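(* There is an absolute constant $C>0$ such that the following holds. For $\mu_0>\mu_1\ge0$, let $\mathrm{CP}[\mu_1,\mu_0]$ be $\gamma$-polarized for some $\gamma\in(0,1]$. Then, given an iterate $z\in\mathcal N^2(\beta)$, $\beta\in(0,1/6]$, with $\overline\mu(z)\in(\mu_1,\mu_0)$, the algorithm SLLS-IPM (with SVD approximation factor $\rho\ge1$) takes at most $$C\,\frac{n^{1.5}}{\beta}\log\Big(\frac{n\rho}{\beta\gamma}\Big)$$ iterations to find $z'\in\overline{\mathcal N}^2(\beta)$ such that $\overline\mu(z')\le\mu_1$.
   Context: **Linear programs.** $A\in\mathbb R^{m\times n}$ has rank $m\le n$, $b\in\mathbb R^m$, $c\in\mathbb R^n$. The primal-dual pair is (LP): $\min\{\langle c,x\rangle: Ax=b,\ x\ge 0\}$ and $\max\{\langle b,y\rangle: A^\top y+s=c,\ s\ge 0\}$, assumed feasible and bounded. $\mathcal P=\{x\in\mathbb R^n: Ax=b,x\ge0\}$, $\mathcal D=\{s\in\mathbb R^n:\exists y,\ A^\top y+s=c,\ s\ge0\}$, and $\mathcal P_{++},\mathcal D_{++}$ are the subsets of coordinatewise strictly positive points, assumed nonempty. $W=\ker A$, $W^\perp=\operatorname{im}A^\top$. Products, quotients, square roots and inverses of vectors are coordinatewise; for a vector $x$ and subspace $V$, $xV=\{xv:v\in V\}$; $\|\cdot\|$ is the Euclidean norm and $\mathbf 1$ the all-ones vector. For $z=(x,s)$, $\overline\mu(z)=\langle x,s\rangle/n$. $\mathcal N^2(\beta)=\{z=(x,s)\in\mathcal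 P_{++}\times\mathcal D_{++}:\|xs/\overline\mu(z)-\mathbf 1\|\le\beta\}$, with closure $\overline{\mathcal N}^2(\beta)$. **Central path and polarization.** For $\mu>0$, $z^{\mathrm{cp}}(\mu)=(x^{\mathrm{cp}}(\mu),s^{\mathrm{cp}}(\mu))$ is the unique $(x,s)\in\mathcal P_{++}\times\mathcal D_{++}$ with $xs=\mu\mathbf 1$; $z^{\mathrm{cp}}(0)$ is the limit as $\mu\searrow0$; $\mathrm{CP}[\mu_1,\mu_0]=\{z^{\mathrm{cp}}(\mu):\mu_1\le\mu\le\mu_0\}$. $\mathrm{CP}[\mu_1,\mu_0]$ is $\gamma$-polarized if there is a partition $B\cup N=[n]$ such that for all $\mu\in[\mu_1,\mu_0]$: $x^{\mathrm{cp}}_i(\mu)\ge\gamma x^{\mathrm{cp}}_i(\mu_0)$ for $i\in B$ and $s^{\mathrm{cp}}_i(\mu)\ge\gamma s^{\mathrm{cp}}_i(\mu_0)$ for $i\in N$. **$\rho$-SVD problem** ($\rho\ge1$). Input: a real $p\times q$ matrix $M$. Output: a matrix $C\in\mathbb R^{q\times q}$ whose columns are nonzero and pairwise orthogonal, and a non-increasing $t\in\mathbb R^q_+$, such that $\|Mu\|\le t_i\|u\|$ for all $u$ in the span of columns $i,\dots,q$ of $C$ and all $i\in[q]$, and $\rho^{-1}t\le\sigma(M)\le t$, where $\sigma(M)\in\mathbb R^q$ lists the singular values of $M$ in non-increasing order, padded by zeros. **Algorithm SLLS-IPM.** Parameters: $\beta\in(0,1/6]$ and $\rho\ge1$, with a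 $\rho$-SVD solver as subroutine. From the current iterate $(x,s)\in\mathcal N^2(\beta)$ repeat the following iteration while $\overline\mu(x,s)$ is larger than the target $\mu_1$. 1. (Corrector) Let $(\Delta x^c,\Delta s^c)\in W\times W^\perp$ be the unique solution of $s\Delta x+x\Delta s=\overline\mu(x,s)\mathbf 1-xs$; set $(x,s)\leftarrow(x+\Delta x^c,s+\Delta s^c)$. Let $\mu=\overline\mu(x,s)$. 2. (Affine scaling) Let $(\Delta x^a,\Delta s^a)\in W\times W^\perp$ be the unique solution of $s\Delta x+x\Delta s=-xs$, and choose $\alpha^a\in(0,1]$ with $\max\{\frac{\beta}{3\sqrt n},1-\frac{3\|\Delta x^a\Delta s^a\|}{\beta\mu}\}\le\alpha^a\le\max\{\frac{\beta}{2\sqrt n},1-\frac{2\|\Delta x^a\Delta s^a\|}{\beta\mu}\}$. 3. (Partition) $B=\{i:|\Delta x^a_i/x_i|<|\Delta s^a_i/s_i|\}$, $N=[n]\setminus B$. 4. (Cheap lift subspaces $V\subseteq W$, $U\subseteq W^\perp$) If $B=\emptyset$: $V=W$, $U=\{0\}$. If $N=\emptyset$: $V=\{0\}$, $U=W^\perp$. Otherwise let $P$ and $P^\perp=I-P$ be the orthogonal projection matrices onto $x^{-1}W$ and $xW^\perp$; let $\bar L=P_{\cdot,N}(P_{N,N})^+$, $\bar L^\perp=P^\perp_{\cdot,B}(P^\perp_{B,B})^+$ ($^+$ is the Moore–Penrose pseudoinverse), $\bar\ell=\bar L_{B,\cdot}$, $\bar\ell^\perp=\bar L^\perp_{N,\cdot}$.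 Let $(C,t)$, $(C',t')$ be $\rho$-SVD outputs for $\bar\ell\in\mathbb R^{B\times N}$ and $\bar\ell^\perp\in\mathbb R^{N\times B}$, $p=|\{i:t_i\le1\}|$, $q=|\{i:t'_i\le1\}|$. Set $V=x\,\bar L(\text{span of the last }p\text{ columns of }C)$ and $U=x^{-1}\bar L^\perp(\text{span of the last }q\text{ columns of }C')$. 5. (Subspace layered least squares) With $\hat x=\sqrt{x\mu/s}$, $\hat s=\sqrt{s\mu/x}$, let $\Delta x^\ell=\arg\min_{\delta\in V}\|(x_N+\delta_N)/\hat x_N\|$ and $\Delta s^\ell=\arg\min_{\delta\in U}\|(s_B+\delta_B)/\hat s_B\|$ (minimizers are unique). Let $\epsilon=\|(x+\Delta x^\ell)(s+\Delta s^\ell)\|/\mu$. If $\max\{\|\Delta x^\ell\Delta s^\ell\|/\mu,\epsilon\}\le\beta/9$ choose $\alpha^\ell\in[1-\frac{9\epsilon}{\beta},1-\frac{8\epsilon}{\beta}]$, otherwise $\alpha^\ell=0$. 6. Replace $(x,s)$ by whichever of $(x+\alpha^a\Delta x^a,s+\alpha^a\Delta s^a)$ and $(x+\alpha^\ell\Delta x^\ell,s+\alpha^\ell\Delta s^\ell)$ has smaller $\overline\mu$ (the second one in case of a tie). *)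

theory Defs
  imports
    "Jordan_Normal_Form.Matrix_Kernel"
    "Jordan_Normal_Form.Char_Poly"
    "Jordan_Normal_Form.Gram_Schmidt"
    "Jordan_Normal_Form.DL_Rank"
    "Jordan_Normal_Form.DL_Submatrix"
    "HOL-Computational_Algebra.Computational_Algebra"
begin

text \<open>
  The constant in the main statement must not depend on the dimensions, so vectors and matrices
  are those of Jordan_Normal_Form, whose dimensions are natural numbers.  Coordinates are
  numbered from 0, and the index set of the coordinates of an n-dimensional vector is
  \<open>{..<n}\<close>.
\<close>

section \<open>Coordinatewise operations, norms, subspaces\<close>

definition vtimes :: "real vec \<Rightarrow> real vec \<Rightarrow> real vec" (infixl \<open>\<odot>\<^sub>v\<close> 70) where
  "x \<odot>\<^sub>v v = vec (dim_vec x) (\<lambda>i. x $ i * v $ i)"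

definition vdivide :: "real vec \<Rightarrow> real vec \<Rightarrow> real vec" (infixl \<open>\<oslash>\<^sub>v\<close> 70) where
  "x \<oslash>\<^sub>v v = vec (dim_vec x) (\<lambda>i. x $ i / v $ i)"

definition ones :: "nat \<Rightarrow> real vec" where
  "ones n = vec n (\<lambda>_. 1)"

definition vnorm :: "real vec \<Rightarrow> real" where
  "vnorm v = sqrt (v \<bullet> v)"

text \<open>The coordinates of a vector in the index set \<open>I\<close>, in increasing order of the indices;
  this matches the ordering used by \<open>submatrix\<close>.\<close>

definition subvec :: "real vec \<Rightarrow> nat set \<Rightarrow> real vec" where
  "subvec v I = vec (card {i. i < dim_vec v \<and> i \<in> I}) (\<lambda>k. v $ pick I k)"

definition vscale :: "real vec \<Rightarrow> real vec set \<Rightarrow> real vec set" where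
  "vscale x V = (\<lambda>v. x \<odot>\<^sub>v v) ` V"

abbreviation vspan :: "nat \<Rightarrow> real vec set \<Rightarrow> real vec set" where
  "vspan n S \<equiv> LinearCombinations.module.span class_ring (module_vec TYPE(real) n) S"

abbreviation primal_space :: "real mat \<Rightarrow> real vec set" where
  "primal_space A \<equiv> mat_kernel A"

definition dual_space :: "real mat \<Rightarrow> real vec set" where
  "dual_space A = (\<lambda>y. A\<^sup>T *\<^sub>v y) ` carrier_vec (dim_row A)"

section \<open>Linear programs and the central path\<close>

definition primal_feasible :: "real mat \<Rightarrow> real vec \<Rightarrow> real vec set" where
  "primal_feasible A b =
     {x \<in> carrier_vec (dim_col A). A *\<^sub>v x = b \<and> (\<forall>i<dim_col A. 0 \<le> x $ i)}"

definition dual_feasible :: "real mat \<Rightarrow> real vec \<Rightarrow> real vec set" where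
  "dual_feasible A c =
     {s \<in> carrier_vec (dim_col A).
        (\<exists>y \<in> carrier_vec (dim_row A). A\<^sup>T *\<^sub>v y + s = c) \<and> (\<forall>i<dim_col A. 0 \<le> s $ i)}"

definition primal_interior :: "real mat \<Rightarrow> real vec \<Rightarrow> real vec set" where
  "primal_interior A b = {x \<in> primal_feasible A b. \<forall>i<dim_col A. 0 < x $ i}"

definition dual_interior :: "real mat \<Rightarrow> real vec \<Rightarrow> real vec set" where
  "dual_interior A c = {s \<in> dual_feasible A c. \<forall>i<dim_col A. 0 < s $ i}"

definition lp_instance ::
  "nat \<Rightarrow> nat \<Rightarrow> real mat \<Rightarrow> real vec \<Rightarrow> real vec \<Rightarrow> bool" where
  "lp_instance m n A b c \<longleftrightarrow>
     A \<in> carrier_mat m n \<and> m \<le> n \<and> vec_space.rank m A = m \<and>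
     b \<in> carrier_vec m \<and> c \<in> carrier_vec n \<and>
     primal_feasible A b \<noteq> {} \<and> dual_feasible A c \<noteq> {} \<and>
     bdd_below ((\<lambda>x. c \<bullet> x) ` primal_feasible A b) \<and>
     bdd_above ((\<lambda>y. b \<bullet> y) `
       {y \<in> carrier_vec m. \<exists>s \<in> carrier_vec n. A\<^sup>T *\<^sub>v y + s = c \<and> (\<forall>i<n. 0 \<le> s $ i)}) \<and>
     primal_interior A b \<noteq> {} \<and> dual_interior A c \<noteq> {}"

definition mubar :: "real vec \<times> real vec \<Rightarrow> real" where
  "mubar z = (fst z \<bullet> snd z) / real (dim_vec (fst z))"

definition nbhd :: "real mat \<Rightarrow> real vec \<Rightarrow> real vec \<Rightarrow> real \<Rightarrow> (real vec \<times> real vec) set" where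
  "nbhd A b c \<beta> =
     {(x, s). x \<in> primal_interior A b \<and> s \<in> dual_interior A c \<and>
        vnorm ((1 / mubar (x, s)) \<cdot>\<^sub>v (x \<odot>\<^sub>v s) - ones (dim_col A)) \<le> \<beta>}"

text \<open>The type \<open>real vec\<close> carries no topology; the closure in
  \<open>\<real>\<^sup>n \<times> \<real>\<^sup>n\<close> is the set of limits of coordinatewise convergent sequences.\<close>

definition nbhd_closure ::
  "real mat \<Rightarrow> real vec \<Rightarrow> real vec \<Rightarrow> real \<Rightarrow> (real vec \<times> real vec) set" where
  "nbhd_closure A b c \<beta> =
     {(x, s). x \<in> carrier_vec (dim_col A) \<and> s \<in> carrier_vec (dim_col A) \<and>
        (\<exists>X S. (\<forall>k::nat. (X k, S k) \<in> nbhd A b c \<beta>) \<and>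
           (\<forall>i<dim_col A. (\<lambda>k. X k $ i) \<longlonglongrightarrow> x $ i \<and> (\<lambda>k. S k $ i) \<longlonglongrightarrow> s $ i))}"

definition central_point_pos ::
  "real mat \<Rightarrow> real vec \<Rightarrow> real vec \<Rightarrow> real \<Rightarrow> real vec \<times> real vec" where
  "central_point_pos A b c \<mu> =
     (THE z. fst z \<in> primal_interior A b \<and> snd z \<in> dual_interior A c \<and>
        fst z \<odot>\<^sub>v snd z = \<mu> \<cdot>\<^sub>v ones (dim_col A))"

definition central_point ::
  "real mat \<Rightarrow> real vec \<Rightarrow> real vec \<Rightarrow> real \<Rightarrow> real vec \<times> real vec" where
  "central_point A b c \<mu> =
     (if \<mu> > 0 then central_point_pos A b c \<mu>
      else (vec (dim_col A) (\<lambda>i. Lim (at_right 0) (\<lambda>\<nu>. fst (central_point_pos A b c \<nu>) $ i)),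
            vec (dim_col A) (\<lambda>i. Lim (at_right 0) (\<lambda>\<nu>. snd (central_point_pos A b c \<nu>) $ i))))"

definition polarized ::
  "real mat \<Rightarrow> real vec \<Rightarrow> real vec \<Rightarrow> real \<Rightarrow> real \<Rightarrow> real \<Rightarrow> bool" where
  "polarized A b c \<mu>1 \<mu>0 \<gamma> \<longleftrightarrow>
     (\<exists>B N. B \<union> N = {..<dim_col A} \<and> B \<inter> N = {} \<and>
        (\<forall>\<mu> \<in> {\<mu>1..\<mu>0}.
           (\<forall>i\<in>B. fst (central_point A b c \<mu>) $ i \<ge> \<gamma> * fst (central_point A b c \<mu>0) $ i) \<and>
           (\<forall>i\<in>N. snd (central_point A b c \<mu>) $ i \<ge> \<gamma> * snd (central_point A b c \<mu>0) $ i)))"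

section \<open>Approximate singular value decomposition\<close>

text \<open>For a \<open>p \<times> q\<close> matrix these are the square roots of the \<open>q\<close> eigenvalues of
  \<open>M\<^sup>T M\<close> with multiplicity: the singular values, padded by zeros to length \<open>q\<close>.\<close>

definition singular_values :: "real mat \<Rightarrow> real list" where
  "singular_values M =
     rev (sorted_list_of_multiset (image_mset sqrt (proots (char_poly (M\<^sup>T * M)))))"

definition rho_svd :: "real \<Rightarrow> real mat \<Rightarrow> real mat \<Rightarrow> real vec \<Rightarrow> bool" where
  "rho_svd \<rho> M C t \<longleftrightarrow>
     (let q = dim_col M in
        C \<in> carrier_mat q q \<and> corthogonal (cols C) \<and>
        t \<in> carrier_vec q \<and> (\<forall>i<q. 0 \<le> t $ i) \<and> (\<forall>i<q. \<forall>j<q. i \<le> j \<longrightarrow> t $ j \<le> t $ i) \<and>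
        (\<forall>i<q. \<forall>u \<in> vspan q (set (drop i (cols C))). vnorm (M *\<^sub>v u) \<le> t $ i * vnorm u) \<and>
        (\<forall>i<q. t $ i / \<rho> \<le> singular_values M ! i \<and> singular_values M ! i \<le> t $ i))"

text \<open>A solver is a set-valued map, so that it may return different outputs when it is called
  repeatedly on the same matrix; deterministic solvers are the singleton-valued ones.\<close>

definition rho_svd_solver :: "real \<Rightarrow> (real mat \<Rightarrow> (real mat \<times> real vec) set) \<Rightarrow> bool" where
  "rho_svd_solver \<rho> svd \<longleftrightarrow> (\<forall>M. svd M \<noteq> {} \<and> (\<forall>(C, t) \<in> svd M. rho_svd \<rho> M C t))"

section \<open>The algorithm\<close>

definition pinv :: "real mat \<Rightarrow> real mat" where
  "pinv M = (THE X. X \<in> carrier_mat (dim_col M) (dim_row M) \<and>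
     M * X * M = M \<and> X * M * X = X \<and> (M * X)\<^sup>T = M * X \<and> (X * M)\<^sup>T = X * M)"

definition orth_proj :: "nat \<Rightarrow> real vec set \<Rightarrow> real mat" where
  "orth_proj n S = (THE P. P \<in> carrier_mat n n \<and>
     (\<forall>v \<in> carrier_vec n. P *\<^sub>v v \<in> S \<and> (\<forall>w\<in>S. (v - P *\<^sub>v v) \<bullet> w = 0)))"

definition lift_mat :: "real mat \<Rightarrow> nat set \<Rightarrow> real mat" where
  "lift_mat P I = submatrix P UNIV I * pinv (submatrix P I I)"

definition cheap_span :: "real mat \<Rightarrow> real vec \<Rightarrow> real vec set" where
  "cheap_span C t =
     (let q = dim_col C; p = card {i. i < q \<and> t $ i \<le> 1}
      in vspan q (set (drop (q - p) (cols C))))"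

definition cheap_lift_spaces ::
  "real mat \<Rightarrow> (real mat \<Rightarrow> (real mat \<times> real vec) set) \<Rightarrow> real vec \<Rightarrow> nat set \<Rightarrow> nat set \<Rightarrow>
   real vec set \<Rightarrow> real vec set \<Rightarrow> bool" where
  "cheap_lift_spaces A svd x B N V U \<longleftrightarrow>
     (if B = {} then V = primal_space A \<and> U = {0\<^sub>v (dim_col A)}
      else if N = {} then V = {0\<^sub>v (dim_col A)} \<and> U = dual_space A
      else
        (let n = dim_col A;
             xinv = map_vec inverse x;
             P = orth_proj n (vscale xinv (primal_space A));
             L = lift_mat P N;
             L' = lift_mat (1\<^sub>m n - P) B
         in \<exists>(C, t) \<in> svd (submatrix L B UNIV). \<exists>(C', t') \<in> svd (submatrix L' N UNIV).
              V = vscale x ((\<lambda>w. L *\<^sub>v w) ` cheap_span C t) \<and>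
              U = vscale xinv ((\<lambda>w. L' *\<^sub>v w) ` cheap_span C' t')))"

definition newton_direction ::
  "real mat \<Rightarrow> real vec \<Rightarrow> real vec \<Rightarrow> real vec \<Rightarrow> real vec \<Rightarrow> real vec \<Rightarrow> bool" where
  "newton_direction A x s r dx ds \<longleftrightarrow>
     dx \<in> primal_space A \<and> ds \<in> dual_space A \<and> s \<odot>\<^sub>v dx + x \<odot>\<^sub>v ds = r"

text \<open>One iteration, from \<open>(x0, s0)\<close> to \<open>z'\<close>.  It is a relation because the step lengths
  and the outputs of the solver are not determined.\<close>

inductive slls_step ::
  "real mat \<Rightarrow> real \<Rightarrow> (real mat \<Rightarrow> (real mat \<times> real vec) set) \<Rightarrow>
   real vec \<times> real vec \<Rightarrow> real vec \<times> real vec \<Rightarrow> bool"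
  for A \<beta> svd where
  "\<lbrakk> n = dim_col A;
     newton_direction A x0 s0 (mubar (x0, s0) \<cdot>\<^sub>v ones n - x0 \<odot>\<^sub>v s0) dxc dsc;
     x = x0 + dxc; s = s0 + dsc; \<mu> = mubar (x, s);
     newton_direction A x s (- (x \<odot>\<^sub>v s)) dxa dsa;
     0 < \<alpha>a; \<alpha>a \<le> 1;
     max (\<beta> / (3 * sqrt n)) (1 - 3 * vnorm (dxa \<odot>\<^sub>v dsa) / (\<beta> * \<mu>)) \<le> \<alpha>a;
     \<alpha>a \<le> max (\<beta> / (2 * sqrt n)) (1 - 2 * vnorm (dxa \<odot>\<^sub>v dsa) / (\<beta> * \<mu>));
     B = {i. i < n \<and> \<bar>dxa $ i / x $ i\<bar> < \<bar>dsa $ i / s $ i\<bar>};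
     N = {..<n} - B;
     cheap_lift_spaces A svd x B N V U;
     xhat = map_vec sqrt ((\<mu> \<cdot>\<^sub>v x) \<oslash>\<^sub>v s);
     shat = map_vec sqrt ((\<mu> \<cdot>\<^sub>v s) \<oslash>\<^sub>v x);
     is_arg_min (\<lambda>\<delta>. vnorm (subvec (x + \<delta>) N \<oslash>\<^sub>v subvec xhat N)) (\<lambda>\<delta>. \<delta> \<in> V) dxl;
     is_arg_min (\<lambda>\<delta>. vnorm (subvec (s + \<delta>) B \<oslash>\<^sub>v subvec shat B)) (\<lambda>\<delta>. \<delta> \<in> U) dsl;
     \<epsilon> = vnorm ((x + dxl) \<odot>\<^sub>v (s + dsl)) / \<mu>;
     if max (vnorm (dxl \<odot>\<^sub>v dsl) / \<mu>) \<epsilon> \<le> \<beta> / 9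
       then \<alpha>l \<in> {1 - 9 * \<epsilon> / \<beta> .. 1 - 8 * \<epsilon> / \<beta>} else \<alpha>l = 0;
     za = (x + \<alpha>a \<cdot>\<^sub>v dxa, s + \<alpha>a \<cdot>\<^sub>v dsa);
     zl = (x + \<alpha>l \<cdot>\<^sub>v dxl, s + \<alpha>l \<cdot>\<^sub>v dsl);
     z' = (if mubar zl \<le> mubar za then zl else za) \<rbrakk>
   \<Longrightarrow> slls_step A \<beta> svd (x0, s0) z'"

definition slls_iteration ::
  "real mat \<Rightarrow> real \<Rightarrow> (real mat \<Rightarrow> (real mat \<times> real vec) set) \<Rightarrow> real \<Rightarrow>
   real vec \<times> real vec \<Rightarrow> real vec \<times> real vec \<Rightarrow> bool" where
  "slls_iteration A \<beta> svd \<mu>1 z z' \<longleftrightarrow> mubar z > \<mu>1 \<and> slls_step A \<beta> svd z z'"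

end

theory Submission
  imports Defs
begin

text \<open>
  Fix the polarizing partition \<open>(B, N)\<close> and let \<open>\<Phi>(\<mu>)\<close> be the number of singular values \<open>\<ge> 1\<close>
  of the lift \<open>\<ell>\<close> and of its dual \<open>\<ell>\<^sup>\<bottom>\<close> at the central path point with parameter \<open>\<mu>\<close>, so that
  \<open>\<Phi> \<le> 2n\<close>.  Moving along the path from \<open>\<mu>\<close> to \<open>\<mu>' < \<mu>\<close> changes the coordinates in \<open>B\<close> only by
  factors polynomial in \<open>n / \<gamma>\<close>, and shrinks those in \<open>N\<close> by \<open>\<mu>' / \<mu>\<close> up to such factors; hence the
  singular values shrink by that ratio, up to polynomial factors, and \<open>\<Phi>\<close> is nearly monotone.

  Let \<open>Q\<close> be a large power of \<open>n \<rho> / (\<beta> \<gamma>)\<close> and suppose that one iteration leads from \<open>\<mu>\<close> to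
  \<open>\<mu>\<^sup>+\<close> without \<open>\<Phi>(\<mu>\<^sup>+ / Q) < \<Phi>(\<mu> Q)\<close>.  Then no singular value of the lifts at the iterate lies in a
  polynomially wide interval around 1.  Below this gap the cheap subspaces contain exactly the
  directions whose lift costs almost nothing, above it they miss only directions that are
  negligible in every vector of bounded size, in particular in the displacement to the central path
  point with parameter \<open>\<mu>\<^sup>+ / Q\<close>.  So the affine scaling direction recovers the partition
  \<open>(B, N)\<close>, and the layered step gets below \<open>\<mu>\<^sup>+\<close>, a contradiction.

  Every iteration reduces \<open>\<mu>\<close> by a factor \<open>1 - \<beta> / (3 \<surd>n)\<close>.  Apart from the iterations in which
  \<open>\<mu>\<close> is within a factor \<open>Q\<close> of \<open>\<mu>\<^sub>0\<close> or of \<open>\<mu>\<^sub>1\<close>, any stretch that reduces \<open>\<mu>\<close> by the factor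
  \<open>Q\<^sup>3\<close> lowers \<open>\<Phi>\<close>, and there are at most \<open>2n\<close> such drops.
\<close>

text \<open>The obstacle is that the accuracy demanded of the layered step depends on its own
  outcome: the comparison point has parameter \<mu>' = \<mu>^+ / Q, and \<mu>^+ is what the
  iteration produces. With R = \<mu> / \<mu>' \<ge> Q, the error of the layered step is at most a
  polynomial factor divided by R. The step therefore reaches a polynomial multiple of \<mu> / R =
  \<mu>', which is below Q \<mu>' = \<mu>^+.

  Singular vectors at different points are never compared. A count of singular values is the largest
  dimension of a subspace on which the lift expands, and lifts are minimum-norm extensions, so
  coordinatewise inequalities between two points suffice. These inequalities come from the
  orthogonality of W and W^perp, which bounds each x'_i s_i by x . s + x' . s'.

  The principal block of the projection may be singular, so that a lift changes the very coordinates
  it is meant to extend. This is harmless only because the kernel of the lift matrix lies inside the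
  cheap span.\<close>

no_notation fps_nth (infixl \<open>$\<close> 75)

section \<open>Real vectors\<close>

lemma scalar_prod_eq_sum:
  fixes v w :: "real vec"
  assumes "w \<in> carrier_vec n"
  shows "v \<bullet> w = (\<Sum>i<n. v $ i * w $ i)"
  using assms by (auto simp: scalar_prod_def lessThan_atLeast0)

lemma scalar_prod_self_ge_0: "0 \<le> v \<bullet> (v :: real vec)"
  by (auto simp: scalar_prod_def intro!: sum_nonneg)

lemma vnorm_ge_0 [simp]: "0 \<le> vnorm v"
  by (simp add: vnorm_def scalar_prod_self_ge_0)

lemma vnorm_power2: "(vnorm v)\<^sup>2 = v \<bullet> v"
  by (simp add: vnorm_def scalar_prod_self_ge_0)

lemma vnorm_power2_sum:
  assumes "v \<in> carrier_vec n"
  shows "(vnorm v)\<^sup>2 = (\<Sum>i<n. (v $ i)\<^sup>2)"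
  using scalar_prod_eq_sum[OF assms, of v] by (simp add: vnorm_power2) (simp add: power2_eq_square)

lemma vnorm_le_iff: "0 \<le> c \<Longrightarrow> vnorm v \<le> c \<longleftrightarrow> v \<bullet> v \<le> c\<^sup>2"
  by (metis abs_le_square_iff abs_of_nonneg vnorm_ge_0 vnorm_power2)

lemma vnorm_le_vnorm_iff: "vnorm v \<le> vnorm w \<longleftrightarrow> v \<bullet> v \<le> w \<bullet> w"
  by (simp add: vnorm_def)

lemma vnorm_zero [simp]: "vnorm (0\<^sub>v n) = 0"
  by (simp add: vnorm_def)

lemma vnorm_eq_0_iff:
  assumes "v \<in> carrier_vec n"
  shows "vnorm v = 0 \<longleftrightarrow> v = 0\<^sub>v n"
proof
  assume "vnorm v = 0"
  hence "(\<Sum>i<n. (v $ i)\<^sup>2) = 0"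
    using vnorm_power2_sum[OF assms] by simp
  hence "\<forall>i<n. v $ i = 0"
    by (subst (asm) sum_nonneg_eq_0_iff) auto
  thus "v = 0\<^sub>v n" using assms by (intro eq_vecI) auto
qed auto

lemma scalar_prod_self_eq_0_iff:
  fixes v :: "real vec"
  assumes "v \<in> carrier_vec n"
  shows "v \<bullet> v = 0 \<longleftrightarrow> v = 0\<^sub>v n"
  using vnorm_eq_0_iff[OF assms] by (simp add: vnorm_def)

lemma vnorm_smult: "vnorm (a \<cdot>\<^sub>v v) = \<bar>a\<bar> * vnorm v"
proof -
  have "(a \<cdot>\<^sub>v v) \<bullet> (a \<cdot>\<^sub>v v) = a\<^sup>2 * (v \<bullet> v)" by (simp add: power2_eq_square)
  thus ?thesis by (simp add: vnorm_def real_sqrt_mult)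
qed

lemma vnorm_uminus: "vnorm (- v) = vnorm v"
  by (simp add: vnorm_def)

lemma scalar_prod_add_self:
  fixes v w :: "real vec"
  assumes "v \<in> carrier_vec n" "w \<in> carrier_vec n"
  shows "(v + w) \<bullet> (v + w) = v \<bullet> v + 2 * (v \<bullet> w) + w \<bullet> w"
  using assms
  by (simp add: scalar_prod_eq_sum[of _ n] algebra_simps sum.distrib sum_distrib_left)

lemma scalar_prod_diff_self:
  fixes v w :: "real vec"
  assumes "v \<in> carrier_vec n" "w \<in> carrier_vec n"
  shows "(v - w) \<bullet> (v - w) = v \<bullet> v - 2 * (v \<bullet> w) + w \<bullet> w"
  using assms
  by (simp add: scalar_prod_eq_sum[of _ n] algebra_simps sum.distrib sum_distrib_left sum_subtractf)

text \<open>Cauchy-Schwarz: the squared norm of (w . w) v - (v . w) w is w . w times the defect of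
  the squared inequality.\<close>

lemma abs_scalar_prod_le:
  assumes "v \<in> carrier_vec n" "w \<in> carrier_vec n"
  shows "\<bar>v \<bullet> w\<bar> \<le> vnorm v * vnorm w"
proof -
  define a b where "a = w \<bullet> w" and "b = v \<bullet> w"
  have a0: "0 \<le> a" by (simp add: a_def scalar_prod_self_ge_0)
  have "b\<^sup>2 \<le> (v \<bullet> v) * a"
  proof (cases "a = 0")
    case True
    hence "w = 0\<^sub>v n" using scalar_prod_self_eq_0_iff assms by (simp add: a_def)
    thus ?thesis using assms by (simp add: a_def b_def)
  next
    case False
    have "0 \<le> (a \<cdot>\<^sub>v v - b \<cdot>\<^sub>v w) \<bullet> (a \<cdot>\<^sub>v v - b \<cdot>\<^sub>v w)"
      by (rule scalar_prod_self_ge_0)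
    also have "\<dots> = a * (a * (v \<bullet> v) - b\<^sup>2)"
      using assms by (subst scalar_prod_diff_self[of _ n])
        (auto simp: a_def[symmetric] b_def[symmetric] algebra_simps power2_eq_square)
    finally show ?thesis using False a0 by (simp add: zero_le_mult_iff mult.commute)
  qed
  also have "\<dots> = (vnorm v * vnorm w)\<^sup>2"
    by (simp add: power_mult_distrib vnorm_power2 a_def)
  finally have "\<bar>b\<bar> \<le> \<bar>vnorm v * vnorm w\<bar>" unfolding abs_le_square_iff .
  thus ?thesis by (simp add: b_def abs_mult)
qed

lemma vnorm_triangle:
  assumes "v \<in> carrier_vec n" "w \<in> carrier_vec n"
  shows "vnorm (v + w) \<le> vnorm v + vnorm w"
proof -
  have "(v + w) \<bullet> (v + w) \<le> (vnorm v + vnorm w)\<^sup>2"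
    using abs_scalar_prod_le[OF assms] scalar_prod_add_self[OF assms]
    by (simp add: power2_sum vnorm_power2)
  thus ?thesis by (subst vnorm_le_iff) auto
qed

lemma vnorm_triangle_diff:
  assumes "v \<in> carrier_vec n" "w \<in> carrier_vec n"
  shows "vnorm (v - w) \<le> vnorm v + vnorm w"
proof -
  have "vnorm (v + - w) \<le> vnorm v + vnorm (- w)"
    using assms by (intro vnorm_triangle) auto
  moreover have "v - w = v + - w" using assms by auto
  ultimately show ?thesis by (simp add: vnorm_uminus)
qed

lemma vnorm_add_ge:
  assumes "v \<in> carrier_vec n" "w \<in> carrier_vec n"
  shows "vnorm v - vnorm w \<le> vnorm (v + w)"
proof -
  have "v = (v + w) - w" using assms by auto
  hence "vnorm v \<le> vnorm (v + w) + vnorm w"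
    using vnorm_triangle_diff[of "v + w" n w] assms by auto
  thus ?thesis by simp
qed

lemma abs_index_le_vnorm:
  assumes "v \<in> carrier_vec n" "i < n"
  shows "\<bar>v $ i\<bar> \<le> vnorm v"
proof -
  have "(v $ i)\<^sup>2 \<le> (\<Sum>i<n. (v $ i)\<^sup>2)"
    using assms by (intro member_le_sum) auto
  also have "\<dots> = (vnorm v)\<^sup>2" using assms by (simp add: vnorm_power2_sum)
  finally show ?thesis using abs_le_square_iff[of "v $ i" "vnorm v"] by simp
qed

lemma vnorm_mono:
  fixes v w :: "real vec"
  assumes "v \<in> carrier_vec n" "w \<in> carrier_vec n" "0 \<le> c"
    and "\<And>i. i < n \<Longrightarrow> \<bar>v $ i\<bar> \<le> c * \<bar>w $ i\<bar>"
  shows "vnorm v \<le> c * vnorm w"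
proof -
  have "(vnorm v)\<^sup>2 = (\<Sum>i<n. \<bar>v $ i\<bar>\<^sup>2)"
    using assms by (simp add: vnorm_power2_sum[of _ n])
  also have "\<dots> \<le> (\<Sum>i<n. (c * \<bar>w $ i\<bar>)\<^sup>2)"
    using assms by (intro sum_mono power_mono) auto
  also have "\<dots> = (c * vnorm w)\<^sup>2"
    using assms by (simp add: vnorm_power2_sum[of _ n] power_mult_distrib sum_distrib_left)
  finally show ?thesis using assms by (simp add: power2_le_iff_abs_le)
qed

lemma vnorm_ones: "vnorm (ones n) = sqrt n"
  by (simp add: vnorm_def ones_def scalar_prod_def)

lemma ones_carrier [simp]: "ones n \<in> carrier_vec n"
  by (simp add: ones_def)

section \<open>Coordinatewise products and quotients\<close>

lemma index_vtimes [simp]: "i < dim_vec v \<Longrightarrow> (v \<odot>\<^sub>v w) $ i = v $ i * w $ i"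
  by (simp add: vtimes_def)

lemma dim_vtimes [simp]: "dim_vec (v \<odot>\<^sub>v w) = dim_vec v"
  by (simp add: vtimes_def)

lemma vtimes_carrier [simp]: "v \<odot>\<^sub>v w \<in> carrier_vec n \<longleftrightarrow> v \<in> carrier_vec n"
  by (simp only: carrier_dim_vec dim_vtimes)



lemma index_vdivide [simp]: "i < dim_vec v \<Longrightarrow> (v \<oslash>\<^sub>v w) $ i = v $ i / w $ i"
  by (simp add: vdivide_def)

lemma dim_vdivide [simp]: "dim_vec (v \<oslash>\<^sub>v w) = dim_vec v"
  by (simp add: vdivide_def)

lemma vdivide_carrier [simp]: "v \<oslash>\<^sub>v w \<in> carrier_vec n \<longleftrightarrow> v \<in> carrier_vec n"
  by (simp only: carrier_dim_vec dim_vdivide)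

lemma vnorm_vtimes_le:
  assumes "v \<in> carrier_vec n" "w \<in> carrier_vec n"
  shows "vnorm (v \<odot>\<^sub>v w) \<le> vnorm v * vnorm w"
  using assms abs_index_le_vnorm[of v n]
  by (intro vnorm_mono[of _ n]) (auto simp: abs_mult intro!: mult_right_mono)

lemma vec_diff_eq_zeroD:
  fixes v w :: "real vec"
  assumes "v \<in> carrier_vec n" "w \<in> carrier_vec n" "v - w = 0\<^sub>v n"
  shows "v = w"
proof (rule eq_vecI)
  fix i assume "i < dim_vec w"
  thus "v $ i = w $ i" using arg_cong[OF assms(3), of "\<lambda>v. v $ i"] assms(1,2) by simp
qed (use assms in auto)

section \<open>Linear systems\<close>

text \<open>Padding with zero rows makes the matrix square. Its last row is then zero, so the
  transpose kills a unit vector and the determinant vanishes.\<close>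

lemma homogeneous_system_nontrivial:
  fixes M :: "real mat"
  assumes M: "M \<in> carrier_mat r k" and "r < k"
  shows "\<exists>c \<in> carrier_vec k. c \<noteq> 0\<^sub>v k \<and> M *\<^sub>v c = 0\<^sub>v r"
proof -
  define M' where "M' = mat k k (\<lambda>(i, j). if i < r then M $$ (i, j) else 0)"
  have M': "M' \<in> carrier_mat k k" by (simp add: M'_def)
  have "M'\<^sup>T *\<^sub>v unit_vec k (k - 1) = 0\<^sub>v k"
  proof (rule eq_vecI)
    fix i assume "i < dim_vec (0\<^sub>v k :: real vec)"
    hence "i < k" by simp
    thus "(M'\<^sup>T *\<^sub>v unit_vec k (k - 1)) $ i = 0\<^sub>v k $ i"
      using \<open>r < k\<close> M' by (simp add: M'_def)
  qed (use M' in auto)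
  moreover have "unit_vec k (k - 1) \<noteq> (0\<^sub>v k :: real vec)"
    using \<open>r < k\<close> by (metis diff_less gr_implies_not_zero less_one neq0_conv unit_vec_nonzero zero_less_one)
  ultimately have "det (M'\<^sup>T) = 0"
    using M' by (subst det_0_iff_vec_prod_zero[of _ k]) (auto intro!: exI[of _ "unit_vec k (k - 1)"])
  hence "det M' = 0" using det_transpose[OF M'] by simp
  then obtain c where c: "c \<in> carrier_vec k" "c \<noteq> 0\<^sub>v k" "M' *\<^sub>v c = 0\<^sub>v k"
    using det_0_iff_vec_prod_zero[OF M'] by blast
  have "M *\<^sub>v c = 0\<^sub>v r"
  proof (rule eq_vecI)
    fix i assume "i < dim_vec (0\<^sub>v r :: real vec)"
    hence i: "i < r" by simp
    have "row M i = row M' i" using i \<open>r < k\<close> M by (intro eq_vecI) (auto simp: M'_def)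
    hence "(M *\<^sub>v c) $ i = (M' *\<^sub>v c) $ i" using i M M' \<open>r < k\<close> by simp
    thus "(M *\<^sub>v c) $ i = 0\<^sub>v r $ i" using c i \<open>r < k\<close> by simp
  qed (use M in auto)
  thus ?thesis using c by blast
qed

lemma square_system_solvable:
  fixes M :: "real mat"
  assumes M: "M \<in> carrier_mat k k"
    and inj: "\<And>c. c \<in> carrier_vec k \<Longrightarrow> M *\<^sub>v c = 0\<^sub>v k \<Longrightarrow> c = 0\<^sub>v k"
    and z: "z \<in> carrier_vec k"
  shows "\<exists>c \<in> carrier_vec k. M *\<^sub>v c = z"
proof -
  have "det M \<noteq> 0" using det_0_iff_vec_prod_zero[OF M] inj by blast
  from det_non_zero_imp_unit[OF M this]
  obtain X where X: "X \<in> carrier_mat k k" "M * X = 1\<^sub>m k"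
    unfolding Units_def by (auto simp: ring_mat_simps)
  have "M *\<^sub>v (X *\<^sub>v z) = z" using M X z by (metis assoc_mult_mat_vec one_mult_mat_vec)
  thus ?thesis using X z by (intro bexI[of _ "X *\<^sub>v z"]) auto
qed

section \<open>Compactness\<close>

text \<open>Bolzano-Weierstrass, one coordinate at a time: every real sequence has a monotone
  subsequence, and passing to it keeps the coordinates already treated convergent.\<close>

lemma bounded_coordinates_convergent_subsequence:
  fixes f :: "nat \<Rightarrow> nat \<Rightarrow> real"
  assumes "\<And>i. i < n \<Longrightarrow> \<exists>C. \<forall>k. \<bar>f k i\<bar> \<le> C"
  shows "\<exists>r. strict_mono r \<and> (\<forall>i<n. convergent (\<lambda>k. f (r k) i))"
  using assms
proof (induction n)
  case 0
  show ?case by (intro exI[of _ id]) (auto simp: strict_mono_def)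
next
  case (Suc n)
  then obtain r where r: "strict_mono r" "\<forall>i<n. convergent (\<lambda>k. f (r k) i)" by force
  obtain C where C: "\<forall>k. \<bar>f k n\<bar> \<le> C" using Suc.prems[of n] by auto
  obtain r' where r': "strict_mono r'" "monoseq (\<lambda>k. f (r (r' k)) n)"
    using seq_monosub[of "\<lambda>k. f (r k) n"] by blast
  have "convergent (\<lambda>k. f (r (r' k)) n)"
    using r'(2) C by (intro Bseq_monoseq_convergent BseqI'[of _ C]) auto
  moreover have "convergent (\<lambda>k. f (r (r' k)) i)" if "i < n" for i
    using r(2) that r'(1) convergent_subseq_convergent[of "\<lambda>k. f (r k) i" r'] by (auto simp: o_def)
  ultimately show ?case
    using r(1) r'(1)
    by (intro exI[of _ "\<lambda>k. r (r' k)"]) (auto simp: less_Suc_eq strict_mono_def)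
qed

text \<open>The extreme value theorem with closedness and continuity phrased by coordinatewise
  limits. It supplies both the maximal Rayleigh quotient and the minimiser of the barrier.\<close>

lemma attains_min_closed_bounded:
  fixes g :: "real vec \<Rightarrow> real"
  assumes ne: "K \<noteq> {}" and carr: "K \<subseteq> carrier_vec n"
    and bdd: "\<And>v i. v \<in> K \<Longrightarrow> i < n \<Longrightarrow> \<bar>v $ i\<bar> \<le> C"
    and closed: "\<And>X x. \<lbrakk>\<And>k::nat. X k \<in> K; x \<in> carrier_vec n; \<And>i. i < n \<Longrightarrow> (\<lambda>k. X k $ i) \<longlonglongrightarrow> x $ i\<rbrakk> \<Longrightarrow> x \<in> K"
    and cont: "\<And>X x. \<lbrakk>\<And>k::nat. X k \<in> K; x \<in> K; \<And>i. i < n \<Longrightarrow> (\<lambda>k. X k $ i) \<longlonglongrightarrow> x $ i\<rbrakk>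
        \<Longrightarrow> (\<lambda>k. g (X k)) \<longlonglongrightarrow> g x"
  shows "\<exists>x\<in>K. \<forall>y\<in>K. g x \<le> g y"
proof -
  have sub: "\<exists>r x. strict_mono r \<and> x \<in> K \<and> (\<lambda>k. g (X (r k))) \<longlonglongrightarrow> g x"
    if X: "\<And>k::nat. X k \<in> K" for X
  proof -
    have "\<exists>C. \<forall>k. \<bar>X k $ i\<bar> \<le> C" if "i < n" for i
      using bdd[OF X that] by (intro exI[of _ C] allI)
    from bounded_coordinates_convergent_subsequence[of n "\<lambda>k i. X k $ i", OF this]
    obtain r where r: "strict_mono r" "\<forall>i<n. convergent (\<lambda>k. X (r k) $ i)" by blast
    define x where "x = vec n (\<lambda>i. lim (\<lambda>k. X (r k) $ i))"
    have lim: "(\<lambda>k. X (r k) $ i) \<longlonglongrightarrow> x $ i" if "i < n" for i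
      using r(2) that by (auto simp: x_def convergent_LIMSEQ_iff)
    have x: "x \<in> carrier_vec n" by (simp add: x_def)
    have "x \<in> K" by (rule closed[of "\<lambda>k. X (r k)", OF X x lim])
    moreover have "(\<lambda>k. g (X (r k))) \<longlonglongrightarrow> g x"
      by (rule cont[of "\<lambda>k. X (r k)", OF X \<open>x \<in> K\<close> lim])
    ultimately show ?thesis using r(1) by (intro exI[of _ r] exI[of _ x] conjI)
  qed
  have bb: "bdd_below (g ` K)"
  proof (rule ccontr)
    assume "\<not> bdd_below (g ` K)"
    hence "\<forall>k::nat. \<exists>v\<in>K. g v < - real k"
      unfolding bdd_below_def by (force simp: not_le)
    then obtain X where X: "\<And>k. X k \<in> K" "\<And>k. g (X k) < - real k" by metis
    obtain r x where r: "strict_mono r" "(\<lambda>k. g (X (r k))) \<longlonglongrightarrow> g x" using sub[of X, OF X(1)] by blast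
    have "Bseq (\<lambda>k. g (X (r k)))" using convergentI[OF r(2)] by (rule convergent_imp_Bseq)
    then obtain C where C: "\<And>k. \<bar>g (X (r k))\<bar> \<le> C" by (auto simp: Bseq_def)
    obtain k where "C < real k" using reals_Archimedean2 by blast
    also have "\<dots> \<le> real (r k)" using seq_suble[OF r(1)] by simp
    finally show False using C[of k] X(2)[of "r k"] by linarith
  qed
  define l where "l = Inf (g ` K)"
  have "\<exists>v\<in>K. g v < l + 1 / real (Suc k)" for k :: nat
    using ne cInf_lessD[of "g ` K" "l + 1 / real (Suc k)"] by (auto simp: l_def)
  then obtain X where X: "\<And>k. X k \<in> K" "\<And>k. g (X k) < l + 1 / real (Suc k)" by metis
  obtain r x where r: "strict_mono r" "x \<in> K" "(\<lambda>k. g (X (r k))) \<longlonglongrightarrow> g x"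
    using sub[of X, OF X(1)] by blast
  have "(\<lambda>k. l + 1 / real (Suc (r k))) \<longlonglongrightarrow> l + 0"
    using LIMSEQ_subseq_LIMSEQ[OF LIMSEQ_inverse_real_of_nat r(1)]
    by (intro tendsto_add tendsto_const) (simp add: o_def inverse_eq_divide)
  hence "g x \<le> l + 0"
    using r(3) X(2) by (intro LIMSEQ_le) (auto intro: less_imp_le)
  hence "g x \<le> l" by simp
  hence "\<forall>y\<in>K. g x \<le> g y" using cInf_lower[OF _ bb] by (force simp: l_def)
  thus ?thesis using r by blast
qed

section \<open>The spectral theorem and singular values\<close>

lemma mult_mat_vec_zero [simp]:
  fixes A :: "real mat"
  assumes "A \<in> carrier_mat nr nc"
  shows "A *\<^sub>v 0\<^sub>v nc = 0\<^sub>v nr"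
  using assms by (intro eq_vecI) auto

lemma adjoint_scalar_prod:
  fixes A :: "real mat"
  assumes "A \<in> carrier_mat nr nc" "x \<in> carrier_vec nc" "y \<in> carrier_vec nr"
  shows "(A *\<^sub>v x) \<bullet> y = x \<bullet> (A\<^sup>T *\<^sub>v y)"
  using transpose_vec_mult_scalar[OF assms] assms
  by (metis comm_scalar_prod mult_mat_vec_carrier transpose_carrier_mat)

text \<open>First-order optimality condition: at t = e a with e small the linear term dominates the
  quadratic one.\<close>

lemma quadratic_nonpos_imp_linear_0:
  fixes a b :: real
  assumes "\<And>t. 2 * t * a + t\<^sup>2 * b \<le> 0"
  shows "a = 0"
proof (rule ccontr)
  assume "a \<noteq> 0"
  define e where "e = 1 / (\<bar>b\<bar> + 1)"
  have e: "0 < e" "e * \<bar>b\<bar> < 1" by (auto simp: e_def field_simps)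
  have "2 * (e * a) * a + (e * a)\<^sup>2 * b \<le> 0" by (rule assms)
  hence "(e * a\<^sup>2) * (2 + e * b) \<le> 0" by (simp add: power2_eq_square algebra_simps)
  moreover have "0 < e * a\<^sup>2" using e \<open>a \<noteq> 0\<close> by simp
  ultimately have "2 + e * b \<le> 0" by (metis mult_pos_pos not_le)
  moreover have "- (e * b) \<le> e * \<bar>b\<bar>" using e by (simp add: abs_if)
  ultimately show False using e by linarith
qed

lemma mult_mat_vec_tendsto:
  fixes A :: "real mat"
  assumes A: "A \<in> carrier_mat nr nc" and "\<And>k. X k \<in> carrier_vec nc" "x \<in> carrier_vec nc"
    and "\<And>i. i < nc \<Longrightarrow> (\<lambda>k::nat. X k $ i) \<longlonglongrightarrow> x $ i" and "i < nr"
  shows "(\<lambda>k. (A *\<^sub>v X k) $ i) \<longlonglongrightarrow> (A *\<^sub>v x) $ i"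
proof -
  have "(A *\<^sub>v y) $ i = (\<Sum>j<nc. A $$ (i, j) * y $ j)" if "y \<in> carrier_vec nc" for y
    using A that \<open>i < nr\<close> by (simp add: scalar_prod_eq_sum[of _ nc])
  thus ?thesis using assms by (auto intro!: tendsto_intros)
qed

lemma scalar_prod_tendsto:
  fixes x y :: "real vec"
  assumes "\<And>k. Y k \<in> carrier_vec n" "y \<in> carrier_vec n"
    and "\<And>i. i < n \<Longrightarrow> (\<lambda>k::nat. X k $ i) \<longlonglongrightarrow> x $ i"
    and "\<And>i. i < n \<Longrightarrow> (\<lambda>k::nat. Y k $ i) \<longlonglongrightarrow> y $ i"
  shows "(\<lambda>k. X k \<bullet> Y k) \<longlonglongrightarrow> x \<bullet> y"
  using assms by (auto simp: scalar_prod_eq_sum[of _ n] intro!: tendsto_intros)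

text \<open>A maximiser of the Rayleigh quotient on the unit vectors orthogonal to the earlier
  eigenvectors. Such unit vectors exist because fewer than n linear conditions are imposed.\<close>

lemma max_rayleigh_eigenvector:
  fixes S :: "real mat"
  assumes S: "S \<in> carrier_mat n n" "S\<^sup>T = S" and "k < n"
    and v: "\<And>i. i < k \<Longrightarrow> v i \<in> carrier_vec n" "\<And>i. i < k \<Longrightarrow> S *\<^sub>v v i = ev i \<cdot>\<^sub>v v i"
  shows "\<exists>u l. u \<in> carrier_vec n \<and> u \<bullet> u = 1 \<and> (\<forall>i<k. u \<bullet> v i = 0) \<and> S *\<^sub>v u = l \<cdot>\<^sub>v u \<and>
    (\<forall>w\<in>carrier_vec n. (\<forall>i<k. w \<bullet> v i = 0) \<longrightarrow> w \<bullet> (S *\<^sub>v w) \<le> l * (w \<bullet> w))"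
proof -
  have Sc: "S *\<^sub>v w \<in> carrier_vec n" if "w \<in> carrier_vec n" for w using S that by auto
  have sym: "(S *\<^sub>v w) \<bullet> u = w \<bullet> (S *\<^sub>v u)" if "w \<in> carrier_vec n" "u \<in> carrier_vec n" for w u
    using adjoint_scalar_prod[OF S(1) that] S(2) by simp
  define K where "K = {u \<in> carrier_vec n. u \<bullet> u = 1 \<and> (\<forall>i<k. u \<bullet> v i = 0)}"
  define M where "M = mat_of_rows n (map v [0..<k])"
  have M: "M \<in> carrier_mat k n" using mat_of_rows_carrier(1)[of n "map v [0..<k]"] by (simp add: M_def)
  obtain c where c: "c \<in> carrier_vec n" "c \<noteq> 0\<^sub>v n" "M *\<^sub>v c = 0\<^sub>v k"
    using homogeneous_system_nontrivial[OF M \<open>k < n\<close>] by blast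
  have cv: "c \<bullet> v i = 0" if "i < k" for i
  proof -
    have "row M i = v i" using that v unfolding M_def by (subst mat_of_rows_row) auto
    hence "(M *\<^sub>v c) $ i = v i \<bullet> c" using M that by simp
    thus ?thesis using c that v comm_scalar_prod[of c n "v i"] by simp
  qed
  have cc: "0 < vnorm c" using vnorm_eq_0_iff[OF c(1)] c(2) vnorm_ge_0[of c] by linarith
  have normalize: "(1 / vnorm w) \<cdot>\<^sub>v w \<in> K"
    if "w \<in> carrier_vec n" "\<And>i. i < k \<Longrightarrow> w \<bullet> v i = 0" "0 < vnorm w" for w
    using that v by (auto simp: K_def vnorm_power2[symmetric] vnorm_smult)
  have "\<exists>u\<in>K. \<forall>y\<in>K. - (u \<bullet> (S *\<^sub>v u)) \<le> - (y \<bullet> (S *\<^sub>v y))"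
  proof (rule attains_min_closed_bounded[where C = 1 and n = n])
    show "K \<noteq> {}" using normalize[OF c(1) cv cc] by auto
    show "K \<subseteq> carrier_vec n" by (auto simp: K_def)
    show "\<bar>u $ i\<bar> \<le> 1" if "u \<in> K" "i < n" for u i
      using that abs_index_le_vnorm[of u n i] by (auto simp: K_def vnorm_def)
    show "x \<in> K" if X: "\<And>k. X k \<in> K" "x \<in> carrier_vec n"
      "\<And>i. i < n \<Longrightarrow> (\<lambda>k::nat. X k $ i) \<longlonglongrightarrow> x $ i" for X x
    proof -
      have Xc: "\<And>k. X k \<in> carrier_vec n" using X(1) by (auto simp: K_def)
      have "(\<lambda>k. X k \<bullet> X k) \<longlonglongrightarrow> x \<bullet> x"
        by (rule scalar_prod_tendsto[of _ n]) (use X Xc in auto)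
      moreover have "(\<lambda>k. X k \<bullet> X k) \<longlonglongrightarrow> 1" using X(1) by (simp add: K_def)
      ultimately have "x \<bullet> x = 1" by (rule LIMSEQ_unique)
      moreover have "x \<bullet> v i = 0" if "i < k" for i
      proof -
        have "(\<lambda>k. X k \<bullet> v i) \<longlonglongrightarrow> x \<bullet> v i"
          by (rule scalar_prod_tendsto[of _ n]) (use X v that in auto)
        moreover have "(\<lambda>k. X k \<bullet> v i) \<longlonglongrightarrow> 0" using X(1) that by (simp add: K_def)
        ultimately show ?thesis by (rule LIMSEQ_unique)
      qed
      ultimately show ?thesis using X by (simp add: K_def)
    qed
    show "(\<lambda>k. - (X k \<bullet> (S *\<^sub>v X k))) \<longlonglongrightarrow> - (x \<bullet> (S *\<^sub>v x))"
      if X: "\<And>k. X k \<in> K" "x \<in> K" "\<And>i. i < n \<Longrightarrow> (\<lambda>k::nat. X k $ i) \<longlonglongrightarrow> x $ i" for X x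
    proof -
      have Xc: "\<And>k. X k \<in> carrier_vec n" "x \<in> carrier_vec n" using X by (auto simp: K_def)
      have "(\<lambda>k. X k \<bullet> (S *\<^sub>v X k)) \<longlonglongrightarrow> x \<bullet> (S *\<^sub>v x)"
        by (rule scalar_prod_tendsto[of _ n])
          (use X Xc Sc mult_mat_vec_tendsto[OF S(1), of X x] in auto)
      thus ?thesis by (rule tendsto_minus)
    qed
  qed
  then obtain u where u: "u \<in> K" "\<And>y. y \<in> K \<Longrightarrow> y \<bullet> (S *\<^sub>v y) \<le> u \<bullet> (S *\<^sub>v u)" by auto
  define l where "l = u \<bullet> (S *\<^sub>v u)"
  have uc: "u \<in> carrier_vec n" and uu: "u \<bullet> u = 1" and uv: "\<And>i. i < k \<Longrightarrow> u \<bullet> v i = 0"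
    using u(1) by (auto simp: K_def)
  have max: "w \<bullet> (S *\<^sub>v w) \<le> l * (w \<bullet> w)"
    if w: "w \<in> carrier_vec n" "\<And>i. i < k \<Longrightarrow> w \<bullet> v i = 0" for w
  proof (cases "w = 0\<^sub>v n")
    case True
    thus ?thesis using S by simp
  next
    case False
    hence pos: "0 < vnorm w" using vnorm_eq_0_iff[OF w(1)] vnorm_ge_0[of w] by linarith
    let ?y = "(1 / vnorm w) \<cdot>\<^sub>v w"
    have "?y \<bullet> (S *\<^sub>v ?y) \<le> l" using u(2)[OF normalize[OF w pos]] by (simp add: l_def)
    moreover have "S *\<^sub>v ?y = (1 / vnorm w) \<cdot>\<^sub>v (S *\<^sub>v w)" using S w by (intro mult_mat_vec) auto
    hence "?y \<bullet> (S *\<^sub>v ?y) = (w \<bullet> (S *\<^sub>v w)) / (vnorm w)\<^sup>2"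
      using w Sc by (simp add: power2_eq_square)
    ultimately show ?thesis using pos by (simp add: vnorm_power2 field_simps scalar_prod_self_ge_0 pos_divide_le_eq flip: vnorm_power2)
  qed
  have "S *\<^sub>v u = l \<cdot>\<^sub>v u"
  proof -
    \<comment> \<open>The residual z is itself orthogonal to the earlier eigenvectors, since S is
      symmetric. Moving u along z is therefore admissible, and the first-order condition reads z . z
      = 0.\<close>
    define z where "z = S *\<^sub>v u - l \<cdot>\<^sub>v u"
    have zc: "z \<in> carrier_vec n" using Sc uc by (simp add: z_def)
    have zv: "z \<bullet> v i = 0" if "i < k" for i
    proof -
      have "z \<bullet> v i = (S *\<^sub>v u) \<bullet> v i - l * (u \<bullet> v i)"
        using Sc uc v that by (simp add: z_def minus_scalar_prod_distrib[of _ n])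
      also have "(S *\<^sub>v u) \<bullet> v i = ev i * (u \<bullet> v i)"
        using sym[OF uc v(1)[OF that]] v that uc by simp
      finally show ?thesis using uv[OF that] by simp
    qed
    have "2 * t * (z \<bullet> z) + t\<^sup>2 * (z \<bullet> (S *\<^sub>v z) - l * (z \<bullet> z)) \<le> 0" for t
    proof -
      let ?w = "u + t \<cdot>\<^sub>v z"
      have "?w \<bullet> v i = 0" if "i < k" for i
        using uc zc v(1)[OF that] uv[OF that] zv[OF that] by (simp add: add_scalar_prod_distrib[of _ n])
      hence le: "?w \<bullet> (S *\<^sub>v ?w) \<le> l * (?w \<bullet> ?w)" using uc zc by (intro max) auto
      have Sw: "S *\<^sub>v ?w = S *\<^sub>v u + t \<cdot>\<^sub>v (S *\<^sub>v z)"
        using S uc zc by (simp add: mult_add_distrib_mat_vec mult_mat_vec)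
      have 1: "?w \<bullet> (S *\<^sub>v ?w) = u \<bullet> (S *\<^sub>v u) + 2 * t * ((S *\<^sub>v u) \<bullet> z) + t\<^sup>2 * (z \<bullet> (S *\<^sub>v z))"
        using uc zc Sc sym[OF uc zc] comm_scalar_prod[of z n "S *\<^sub>v u"]
        unfolding Sw by (simp add: add_scalar_prod_distrib[of _ n] scalar_prod_add_distrib[of _ n] power2_eq_square algebra_simps)
      have 2: "?w \<bullet> ?w = 1 + 2 * t * (u \<bullet> z) + t\<^sup>2 * (z \<bullet> z)"
        using uc zc uu by (simp add: scalar_prod_add_self[of _ n] power2_eq_square algebra_simps)
      have 3: "z \<bullet> z = (S *\<^sub>v u) \<bullet> z - l * (u \<bullet> z)"
        using uc zc Sc by (subst (1) z_def) (simp add: minus_scalar_prod_distrib[of _ n])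
      show ?thesis using le unfolding 1 2 3 l_def[symmetric] by (simp add: algebra_simps)
    qed
    hence "z \<bullet> z = 0" by (rule quadratic_nonpos_imp_linear_0)
    hence z0: "z = 0\<^sub>v n" using scalar_prod_self_eq_0_iff[OF zc] by simp
    show ?thesis
    proof (rule eq_vecI)
      fix i assume "i < dim_vec (l \<cdot>\<^sub>v u)"
      hence "i < n" using uc by simp
      moreover from this have "z $ i = 0" using z0 by simp
      ultimately show "(S *\<^sub>v u) $ i = (l \<cdot>\<^sub>v u) $ i" using uc S by (simp add: z_def)
    qed (use uc S in auto)
  qed
  thus ?thesis using uc uu uv max by blast
qed

text \<open>The extremal property is carried through the induction because it is what later puts the
  eigenvalues in non-increasing order.\<close>

lemma orthonormal_eigenvectors:
  fixes S :: "real mat"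
  assumes S: "S \<in> carrier_mat n n" "S\<^sup>T = S" and "k \<le> n"
  shows "\<exists>v ev. (\<forall>i<k. v i \<in> carrier_vec n \<and> S *\<^sub>v v i = ev i \<cdot>\<^sub>v v i \<and>
      (\<forall>j<k. v i \<bullet> v j = (if i = j then 1 else 0)) \<and>
      (\<forall>w\<in>carrier_vec n. (\<forall>j<i. w \<bullet> v j = 0) \<longrightarrow> w \<bullet> (S *\<^sub>v w) \<le> ev i * (w \<bullet> w)))"
  using \<open>k \<le> n\<close>
proof (induction k)
  case 0
  thus ?case by auto
next
  case (Suc k)
  then obtain v ev where v: "\<And>i. i < k \<Longrightarrow> v i \<in> carrier_vec n" "\<And>i. i < k \<Longrightarrow> S *\<^sub>v v i = ev i \<cdot>\<^sub>v v i"
    and orth: "\<And>i j. i < k \<Longrightarrow> j < k \<Longrightarrow> v i \<bullet> v j = (if i = j then 1 else 0)"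
    and max: "\<And>i w. i < k \<Longrightarrow> w \<in> carrier_vec n \<Longrightarrow> (\<forall>j<i. w \<bullet> v j = 0) \<Longrightarrow> w \<bullet> (S *\<^sub>v w) \<le> ev i * (w \<bullet> w)"
    by (simp add: Suc_le_eq) blast
  have "k < n" using Suc.prems by simp
  from max_rayleigh_eigenvector[OF S this, of v ev, OF v]
  obtain u l where u: "u \<in> carrier_vec n" "u \<bullet> u = 1" "\<And>i. i < k \<Longrightarrow> u \<bullet> v i = 0" "S *\<^sub>v u = l \<cdot>\<^sub>v u"
    "\<And>w. w \<in> carrier_vec n \<Longrightarrow> (\<forall>i<k. w \<bullet> v i = 0) \<Longrightarrow> w \<bullet> (S *\<^sub>v w) \<le> l * (w \<bullet> w)"
    by blast
  have "v i \<bullet> u = 0" if "i < k" for i using u(3)[OF that] comm_scalar_prod[OF u(1) v(1)[OF that]] by simp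
  hence "\<forall>i<Suc k. (v(k := u)) i \<in> carrier_vec n \<and> S *\<^sub>v (v(k := u)) i = (ev(k := l)) i \<cdot>\<^sub>v (v(k := u)) i \<and>
      (\<forall>j<Suc k. (v(k := u)) i \<bullet> (v(k := u)) j = (if i = j then 1 else 0)) \<and>
      (\<forall>w\<in>carrier_vec n. (\<forall>j<i. w \<bullet> (v(k := u)) j = 0) \<longrightarrow> w \<bullet> (S *\<^sub>v w) \<le> (ev(k := l)) i * (w \<bullet> w))"
    using u v orth max by (auto simp: less_Suc_eq)
  thus ?case by blast
qed

theorem real_spectral:
  fixes S :: "real mat"
  assumes S: "S \<in> carrier_mat n n" "S\<^sup>T = S"
  shows "\<exists>V ev. V \<in> carrier_mat n n \<and> V\<^sup>T * V = 1\<^sub>m n \<and> V * V\<^sup>T = 1\<^sub>m n \<and>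
    S = V * mat_diag n ev * V\<^sup>T \<and> (\<forall>i j. i \<le> j \<longrightarrow> j < n \<longrightarrow> ev j \<le> ev i)"
proof -
  from orthonormal_eigenvectors[OF S order_refl]
  obtain v ev where v: "\<And>i. i < n \<Longrightarrow> v i \<in> carrier_vec n" "\<And>i. i < n \<Longrightarrow> S *\<^sub>v v i = ev i \<cdot>\<^sub>v v i"
    and orth: "\<And>i j. i < n \<Longrightarrow> j < n \<Longrightarrow> v i \<bullet> v j = (if i = j then 1 else 0)"
    and max: "\<And>i w. i < n \<Longrightarrow> w \<in> carrier_vec n \<Longrightarrow> (\<forall>j<i. w \<bullet> v j = 0) \<Longrightarrow> w \<bullet> (S *\<^sub>v w) \<le> ev i * (w \<bullet> w)"
    by blast
  define V where "V = mat_of_cols n (map v [0..<n])"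
  have V: "V \<in> carrier_mat n n" using mat_of_cols_carrier(1)[of n "map v [0..<n]"] by (simp add: V_def)
  have colV: "col V i = v i" if "i < n" for i
    using that v unfolding V_def by (subst col_mat_of_cols) auto
  have VV: "V\<^sup>T * V = 1\<^sub>m n"
    using V orth by (intro eq_matI) (auto simp: colV)
  have VV': "V * V\<^sup>T = 1\<^sub>m n"
    using mat_mult_left_right_inverse[OF _ V VV] V by simp
  have "S * V = V * mat_diag n ev"
  proof (rule eq_matI)
    fix j i assume "j < dim_row (V * mat_diag n ev)" "i < dim_col (V * mat_diag n ev)"
    hence i: "i < n" and j: "j < n" using V by (auto simp: mat_diag_mult_right[OF V])
    have "(S * V) $$ (j, i) = (S *\<^sub>v v i) $ j" using S V i j by (simp add: colV)
    also have "\<dots> = ev i * v i $ j" using i j v(2)[OF i] carrier_vecD[OF v(1)[OF i]] by simp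
    also have "v i $ j = V $$ (j, i)" using V i j by (simp add: colV[OF i, symmetric])
    also have "ev i * V $$ (j, i) = V $$ (j, i) * ev i" by simp
    also have "\<dots> = (V * mat_diag n ev) $$ (j, i)" using i j by (simp add: mat_diag_mult_right[OF V])
    finally show "(S * V) $$ (j, i) = (V * mat_diag n ev) $$ (j, i)" .
  qed (use S V in \<open>auto simp: mat_diag_mult_right[OF V]\<close>)
  hence "V * mat_diag n ev * V\<^sup>T = S * V * V\<^sup>T" by (rule arg_cong[OF sym])
  also have "\<dots> = S * (V * V\<^sup>T)" using S V by (intro assoc_mult_mat) auto
  finally have SV: "S = V * mat_diag n ev * V\<^sup>T" using S VV' by simp
  have sorted: "ev j \<le> ev i" if "i \<le> j" "j < n" for i j
  proof -
    have "v j \<bullet> (S *\<^sub>v v j) \<le> ev i * (v j \<bullet> v j)" using that v orth by (intro max) auto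
    thus ?thesis using that v orth by simp
  qed
  show ?thesis using V VV VV' SV sorted by blast
qed

text \<open>Presents the eigenvalues with multiplicity as the multiset of roots, the form in which
  \<open>singular_values\<close> is defined.\<close>

lemma proots_char_poly_diagonalized:
  fixes S :: "real mat"
  assumes V: "V \<in> carrier_mat n n" "V\<^sup>T * V = 1\<^sub>m n" "V * V\<^sup>T = 1\<^sub>m n"
    and S: "S = V * mat_diag n ev * V\<^sup>T"
  shows "proots (char_poly S) = mset (map ev [0..<n])"
proof -
  have "similar_mat S (mat_diag n ev)"
    using V S by (intro similar_matI[of _ _ V "V\<^sup>T" n]) auto
  hence "char_poly S = char_poly (mat_diag n ev)" by (rule char_poly_similar)
  also have "\<dots> = (\<Prod>a\<leftarrow>diag_mat (mat_diag n ev). [:- a, 1:])"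
    by (rule char_poly_upper_triangular[of _ n]) (auto simp: mat_diag_def)
  also have "diag_mat (mat_diag n ev) = map ev [0..<n]"
    by (auto simp: diag_mat_def mat_diag_def)
  also have "(\<Prod>a\<leftarrow>map ev [0..<n]. [:- a, 1:]) = (\<Prod>i\<leftarrow>[0..<n]. [:- ev i, 1:])"
    by (simp add: o_def)
  finally have "proots (char_poly S) = proots (\<Prod>i\<leftarrow>[0..<n]. [:- ev i, 1:])" by simp
  also have "\<dots> = mset (map ev [0..<n])"
  proof (induction n)
    case (Suc n)
    have "(\<Prod>i\<leftarrow>[0..<n]. [:- ev i, 1:]) \<noteq> 0" by (auto simp: prod_list_zero_iff)
    thus ?case using Suc by (simp add: proots_mult del: mult_pCons_right mult_pCons_left)
  qed auto
  finally show ?thesis .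
qed

text \<open>The right half of a singular value decomposition. The norm identity takes the place of
  the left singular vectors.\<close>

definition right_singular_basis :: "nat \<Rightarrow> real mat \<Rightarrow> real mat \<Rightarrow> bool" where
  "right_singular_basis q M V \<longleftrightarrow> V \<in> carrier_mat q q \<and> V * V\<^sup>T = 1\<^sub>m q \<and>
    (\<forall>i<q. 0 \<le> singular_values M ! i) \<and>
    (\<forall>j<q. \<forall>i\<le>j. singular_values M ! j \<le> singular_values M ! i) \<and>
    (\<forall>a\<in>carrier_vec q. (vnorm (M *\<^sub>v (V *\<^sub>v a)))\<^sup>2 = (\<Sum>i<q. (singular_values M ! i * a $ i)\<^sup>2)) \<and>
    (\<forall>a\<in>carrier_vec q. vnorm (V *\<^sub>v a) = vnorm a)"

lemma right_singular_basisD: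
  assumes "right_singular_basis q M V"
  shows "V \<in> carrier_mat q q" and "V * V\<^sup>T = 1\<^sub>m q"
    and "\<And>i. i < q \<Longrightarrow> 0 \<le> singular_values M ! i"
    and "\<And>i j. i \<le> j \<Longrightarrow> j < q \<Longrightarrow> singular_values M ! j \<le> singular_values M ! i"
    and "\<And>a. a \<in> carrier_vec q \<Longrightarrow>
      (vnorm (M *\<^sub>v (V *\<^sub>v a)))\<^sup>2 = (\<Sum>i<q. (singular_values M ! i * a $ i)\<^sup>2)"
    and "\<And>a. a \<in> carrier_vec q \<Longrightarrow> vnorm (V *\<^sub>v a) = vnorm a"
  using assms by (simp_all add: right_singular_basis_def)

theorem exists_right_singular_basis:
  assumes M: "M \<in> carrier_mat p q"
  shows "\<exists>V. right_singular_basis q M V"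
proof -
  have S: "M\<^sup>T * M \<in> carrier_mat q q" "(M\<^sup>T * M)\<^sup>T = M\<^sup>T * M"
    using M by (auto simp: transpose_mult[of _ q p _ q])
  from real_spectral[OF S] obtain V ev where
    V: "V \<in> carrier_mat q q" "V\<^sup>T * V = 1\<^sub>m q" "V * V\<^sup>T = 1\<^sub>m q"
    and SV: "M\<^sup>T * M = V * mat_diag q ev * V\<^sup>T" and sorted: "\<And>i j. i \<le> j \<Longrightarrow> j < q \<Longrightarrow> ev j \<le> ev i"
    by blast
  have D: "mat_diag q ev *\<^sub>v a = vec q (\<lambda>i. ev i * a $ i)" if "a \<in> carrier_vec q" for a
  proof (rule eq_vecI)
    fix i assume "i < dim_vec (vec q (\<lambda>i. ev i * a $ i))"
    hence i: "i < q" by simp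
    have "(mat_diag q ev *\<^sub>v a) $ i = (\<Sum>j<q. (if i = j then ev j else 0) * a $ j)"
      using i that by (simp add: mat_diag_def scalar_prod_eq_sum[of _ q])
    also have "\<dots> = (\<Sum>j<q. if i = j then ev j * a $ j else 0)" by (intro sum.cong) auto
    finally show "(mat_diag q ev *\<^sub>v a) $ i = vec q (\<lambda>i. ev i * a $ i) $ i" using i by simp
  qed (auto simp: mat_diag_def)
  have iso: "(V *\<^sub>v a) \<bullet> (V *\<^sub>v b) = a \<bullet> b" if "a \<in> carrier_vec q" "b \<in> carrier_vec q" for a b
  proof -
    have "(V *\<^sub>v a) \<bullet> (V *\<^sub>v b) = a \<bullet> (V\<^sup>T *\<^sub>v (V *\<^sub>v b))"
      using V that by (intro adjoint_scalar_prod) auto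
    also have "V\<^sup>T *\<^sub>v (V *\<^sub>v b) = (V\<^sup>T * V) *\<^sub>v b" using V that by (intro assoc_mult_mat_vec[symmetric]) auto
    finally show ?thesis using V that by simp
  qed
  have quad: "(vnorm (M *\<^sub>v (V *\<^sub>v a)))\<^sup>2 = (\<Sum>i<q. ev i * (a $ i)\<^sup>2)" if a: "a \<in> carrier_vec q" for a
  proof -
    have Va: "V *\<^sub>v a \<in> carrier_vec q" using V a by auto
    have "(vnorm (M *\<^sub>v (V *\<^sub>v a)))\<^sup>2 = (V *\<^sub>v a) \<bullet> (M\<^sup>T *\<^sub>v (M *\<^sub>v (V *\<^sub>v a)))"
      unfolding vnorm_power2 using M Va by (intro adjoint_scalar_prod) auto
    also have "M\<^sup>T *\<^sub>v (M *\<^sub>v (V *\<^sub>v a)) = (M\<^sup>T * M) *\<^sub>v (V *\<^sub>v a)"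
      using M Va by (intro assoc_mult_mat_vec[symmetric]) auto
    also have "\<dots> = (V * mat_diag q ev) *\<^sub>v (V\<^sup>T *\<^sub>v (V *\<^sub>v a))"
      unfolding SV using V(1) a mult_carrier_mat[OF V(1) mat_diag_dim[of q ev]]
      by (intro assoc_mult_mat_vec[of _ q q _ q]) auto
    also have "V\<^sup>T *\<^sub>v (V *\<^sub>v a) = (V\<^sup>T * V) *\<^sub>v a" using V(1) a by (intro assoc_mult_mat_vec[symmetric]) auto
    also have "\<dots> = a" using V(2) a by simp
    also have "(V * mat_diag q ev) *\<^sub>v a = V *\<^sub>v (mat_diag q ev *\<^sub>v a)"
      using V(1) a mat_diag_dim[of q ev] by (intro assoc_mult_mat_vec) auto
    also have "(V *\<^sub>v a) \<bullet> (V *\<^sub>v (mat_diag q ev *\<^sub>v a)) = a \<bullet> (mat_diag q ev *\<^sub>v a)"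
      using a by (intro iso) (auto simp: D)
    also have "\<dots> = (\<Sum>i<q. ev i * (a $ i)\<^sup>2)"
      by (simp add: D[OF a] scalar_prod_eq_sum[of _ q] power2_eq_square algebra_simps)
    finally show ?thesis .
  qed
  \<comment> \<open>Tested on a unit vector, the quadratic form exhibits each eigenvalue as a
    squared norm.\<close>
  have ev0: "0 \<le> ev i" if "i < q" for i
  proof -
    have "(\<Sum>j<q. ev j * (unit_vec q i $ j)\<^sup>2) = (\<Sum>j<q. if j = i then ev j else 0)"
      by (intro sum.cong) (auto simp: unit_vec_def)
    also have "\<dots> = ev i" using that by simp
    finally have "ev i = (vnorm (M *\<^sub>v (V *\<^sub>v unit_vec q i)))\<^sup>2" by (simp add: quad)
    thus ?thesis by simp
  qed
  define xs where "xs = map (\<lambda>i. sqrt (ev i)) [0..<q]"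
  \<comment> \<open>A sorted list is determined by its multiset. This identifies the list of
    singular values entry by entry with the columns of V.\<close>
  have "sorted (rev xs)"
    using sorted by (auto simp: xs_def sorted_wrt_iff_nth_less rev_nth sorted_iff_nth_mono)
  hence "sorted_list_of_multiset (mset xs) = rev xs"
    by (metis mset_rev sorted_list_of_multiset_mset sorted_sort_id)
  moreover have "image_mset sqrt (proots (char_poly (M\<^sup>T * M))) = mset xs"
    unfolding proots_char_poly_diagonalized[OF V SV] by (simp add: xs_def o_def flip: mset_map)
  ultimately have "singular_values M = xs" by (simp add: singular_values_def)
  hence sv: "length (singular_values M) = q" "\<And>i. i < q \<Longrightarrow> singular_values M ! i = sqrt (ev i)"
    by (auto simp: xs_def)
  have "right_singular_basis q M V"
    unfolding right_singular_basis_def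
  proof (intro conjI ballI allI impI)
    show "0 \<le> singular_values M ! i" if "i < q" for i using sv ev0 that by simp
    show "singular_values M ! j \<le> singular_values M ! i" if "j < q" "i \<le> j" for i j
      using sv sorted that by simp
    show "(vnorm (M *\<^sub>v (V *\<^sub>v a)))\<^sup>2 = (\<Sum>i<q. (singular_values M ! i * a $ i)\<^sup>2)"
      if "a \<in> carrier_vec q" for a
      using quad[OF that] sv ev0 by (simp add: power_mult_distrib)
    show "vnorm (V *\<^sub>v a) = vnorm a" if "a \<in> carrier_vec q" for a
      using iso[OF that that] by (simp add: vnorm_def)
  qed (use V in auto)
  thus ?thesis ..
qed

section \<open>Pseudoinverses, projections and lifts\<close>

lemma eq_mat_mult_vecI:
  fixes A B :: "real mat"
  assumes A: "A \<in> carrier_mat nr nc" and B: "B \<in> carrier_mat nr nc"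
    and eq: "\<And>v. v \<in> carrier_vec nc \<Longrightarrow> A *\<^sub>v v = B *\<^sub>v v"
  shows "A = B"
proof (rule eq_matI)
  fix i j assume "i < dim_row B" "j < dim_col B"
  hence ij: "i < nr" "j < nc" using B by auto
  have "(A *\<^sub>v unit_vec nc j) $ i = (B *\<^sub>v unit_vec nc j) $ i" by (subst eq) auto
  thus "A $$ (i, j) = B $$ (i, j)" using ij A B by simp
qed (use A B in auto)

lemma eq_vec_scalar_prodI:
  fixes v w :: "real vec"
  assumes v: "v \<in> carrier_vec n" "w \<in> carrier_vec n"
    and eq: "\<And>u. u \<in> carrier_vec n \<Longrightarrow> v \<bullet> u = w \<bullet> u"
  shows "v = w"
proof (rule eq_vecI)
  fix i assume "i < dim_vec w"
  thus "v $ i = w $ i" using eq[of "unit_vec n i"] v by simp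
qed (use v in auto)

lemma transpose_mult_mult_vec:
  fixes A :: "real mat"
  assumes "A \<in> carrier_mat nr nc" "v \<in> carrier_vec nc"
  shows "(A\<^sup>T * A) *\<^sub>v v = A\<^sup>T *\<^sub>v (A *\<^sub>v v)"
  using assms by (intro assoc_mult_mat_vec) auto

section \<open>The Moore-Penrose inverse of a symmetric matrix\<close>

lemma moore_penrose_unique:
  fixes M X Y :: "real mat"
  assumes M: "M \<in> carrier_mat r k" and X: "X \<in> carrier_mat k r" and Y: "Y \<in> carrier_mat k r"
    and x: "M * X * M = M" "X * M * X = X" "(M * X)\<^sup>T = M * X" "(X * M)\<^sup>T = X * M"
    and y: "M * Y * M = M" "Y * M * Y = Y" "(M * Y)\<^sup>T = M * Y" "(Y * M)\<^sup>T = Y * M"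
  shows "X = Y"
proof -
  have "M * X = (M * Y * M) * X" using y by simp
  also have "\<dots> = (M * Y) * (M * X)" using M X Y by (intro assoc_mult_mat) auto
  also have "\<dots> = ((M * X) * (M * Y))\<^sup>T"
    using M X Y x(3) y(3) by (subst transpose_mult[of _ r r]) auto
  also have "(M * X) * (M * Y) = (M * X * M) * Y"
    using M X Y by (intro assoc_mult_mat[symmetric]) auto
  finally have MX: "M * X = M * Y" using x y by simp
  have "X * M = X * (M * Y * M)" using y by simp
  also have "\<dots> = X * (M * (Y * M))" using M Y by (subst assoc_mult_mat[of M r k Y r M k]) auto
  also have "\<dots> = (X * M) * (Y * M)" using M X Y by (intro assoc_mult_mat[symmetric]) auto
  also have "\<dots> = ((Y * M) * (X * M))\<^sup>T"
    using M X Y x(4) y(4) by (subst transpose_mult[of _ k k]) auto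
  also have "(Y * M) * (X * M) = Y * (M * (X * M))"
    using M X Y by (intro assoc_mult_mat) auto
  also have "M * (X * M) = M * X * M" using M X by (intro assoc_mult_mat[symmetric]) auto
  finally have XM: "X * M = Y * M" using x y by simp
  have "X = Y * M * X" using x(2) XM by simp
  also have "\<dots> = Y * (M * X)" using M X Y by (intro assoc_mult_mat) auto
  also have "\<dots> = Y * M * Y" unfolding MX using M Y by (intro assoc_mult_mat[symmetric]) auto
  finally show ?thesis using y by simp
qed

text \<open>Resolves the definite description in \<open>pinv\<close>. Symmetric matrices suffice
  here: the lifts invert principal blocks of projections, the other uses invert Gram
  matrices.\<close>

lemma pinv_symmetric:
  fixes S :: "real mat"
  assumes S: "S \<in> carrier_mat n n" "S\<^sup>T = S"
  shows "pinv S \<in> carrier_mat n n \<and> S * pinv S * S = S \<and> pinv S * S * pinv S = pinv S \<and>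
    (S * pinv S)\<^sup>T = S * pinv S \<and> (pinv S * S)\<^sup>T = pinv S * S"
proof -
  obtain V ev where V: "V \<in> carrier_mat n n" "V\<^sup>T * V = 1\<^sub>m n" and SV: "S = V * mat_diag n ev * V\<^sup>T"
    using real_spectral[OF S] by blast
  define C where "C f = V * mat_diag n f * V\<^sup>T" for f
  have CC': "V * D * V\<^sup>T * (V * E * V\<^sup>T) = V * (D * E) * V\<^sup>T"
    if D: "D \<in> carrier_mat n n" and E: "E \<in> carrier_mat n n" for D E
  proof -
    have c: "V * D \<in> carrier_mat n n" "V * E \<in> carrier_mat n n" "E * V\<^sup>T \<in> carrier_mat n n"
      using V D E by auto
    have "V * D * V\<^sup>T * (V * E * V\<^sup>T) = V * D * (V\<^sup>T * (V * E * V\<^sup>T))"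
      using V c by (intro assoc_mult_mat[of _ n n _ n _ n]) auto
    also have "V\<^sup>T * (V * E * V\<^sup>T) = V\<^sup>T * (V * (E * V\<^sup>T))"
      using V E by (subst assoc_mult_mat[of V n n E n "V\<^sup>T" n]) auto
    also have "\<dots> = (V\<^sup>T * V) * (E * V\<^sup>T)" using V c by (intro assoc_mult_mat[symmetric]) auto
    also have "\<dots> = E * V\<^sup>T" unfolding V(2) using c(3) by (rule left_mult_one_mat)
    also have "V * D * (E * V\<^sup>T) = V * D * E * V\<^sup>T" using V c E by (intro assoc_mult_mat[symmetric]) auto
    also have "V * D * E = V * (D * E)" using V D E by (intro assoc_mult_mat) auto
    finally show ?thesis .
  qed
  have C: "C f \<in> carrier_mat n n" for f
    using V(1) by (auto simp: C_def intro!: mult_carrier_mat[of _ n n])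
  have CC: "C f * C g = C (\<lambda>i. f i * g i)" for f g
    unfolding C_def by (subst CC') auto
  have CT: "(C f)\<^sup>T = C f" for f
  proof -
    have d: "mat_diag n f \<in> carrier_mat n n" by simp
    have c: "V * mat_diag n f \<in> carrier_mat n n" using V(1) d by simp
    have "(mat_diag n f)\<^sup>T = mat_diag n f" by (rule eq_matI) (auto simp: mat_diag_def)
    hence "(C f)\<^sup>T = V * (mat_diag n f * V\<^sup>T)"
      unfolding C_def using V c d by (subst transpose_mult[OF c, of _ n]) (auto simp: transpose_mult[OF V(1) d])
    also have "\<dots> = C f" unfolding C_def using V d by (intro assoc_mult_mat[symmetric]) auto
    finally show ?thesis .
  qed
  have S_C: "S = C ev" by (simp add: SV C_def)
  have dims: "dim_row S = n" "dim_col S = n" using S by auto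
  define Pn where "Pn X \<longleftrightarrow> X \<in> carrier_mat (dim_col S) (dim_row S) \<and>
     S * X * S = S \<and> X * S * X = X \<and> (S * X)\<^sup>T = S * X \<and> (X * S)\<^sup>T = X * S" for X
  \<comment> \<open>Since inverse 0 = 0, inverting the eigenvalues pointwise already leaves the
    kernel untouched, as the Moore-Penrose inverse requires.\<close>
  have inv: "a * inverse a * a = a" "inverse a * a * inverse a = inverse a" for a :: real
    by (cases "a = 0"; simp)+
  have "Pn (C (\<lambda>i. inverse (ev i)))"
    using C dims by (simp add: Pn_def S_C CC CT inv del: left_inverse right_inverse)
  moreover have "X = Y" if "Pn X" "Pn Y" for X Y
    using that dims moore_penrose_unique[OF S(1), of X Y] by (simp add: Pn_def)
  ultimately have "Pn (THE X. Pn X)" by (intro theI[of Pn]) auto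
  thus ?thesis using dims by (simp add: Pn_def pinv_def)
qed

text \<open>Consistency of the system is expressed as orthogonality of z to the kernel. The residual
  z - S X z lies in the kernel, so it is orthogonal to z by assumption and to S X z by symmetry,
  hence to itself.\<close>

lemma pinv_solves:
  fixes S :: "real mat"
  assumes S: "S \<in> carrier_mat n n" "S\<^sup>T = S" and z: "z \<in> carrier_vec n"
    and perp: "\<And>a. a \<in> carrier_vec n \<Longrightarrow> S *\<^sub>v a = 0\<^sub>v n \<Longrightarrow> a \<bullet> z = 0"
  shows "S *\<^sub>v (pinv S *\<^sub>v z) = z"
proof -
  let ?X = "pinv S"
  have X: "?X \<in> carrier_mat n n" "S * ?X * S = S" "(S * ?X)\<^sup>T = S * ?X"
    using pinv_symmetric[OF S] by auto
  define y where "y = S *\<^sub>v (?X *\<^sub>v z)"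
  have Xz: "?X *\<^sub>v z \<in> carrier_vec n" using X z by auto
  have yc: "y \<in> carrier_vec n" using S Xz by (simp add: y_def)
  have "S * (S * ?X) = ((S * ?X) * S)\<^sup>T"
    using S X by (subst transpose_mult[of _ n n _ n]) auto
  hence SSX: "S * (S * ?X) = S" using X S by simp
  have y: "y = (S * ?X) *\<^sub>v z" unfolding y_def using S X z by (intro assoc_mult_mat_vec[symmetric]) auto
  have "S *\<^sub>v y = (S * (S * ?X)) *\<^sub>v z"
    unfolding y using S X z by (intro assoc_mult_mat_vec[symmetric]) auto
  hence Sy: "S *\<^sub>v y = S *\<^sub>v z" by (simp add: SSX)
  define w where "w = z - y"
  have wc: "w \<in> carrier_vec n" using z yc by (simp add: w_def)
  have Sw: "S *\<^sub>v w = 0\<^sub>v n"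
    unfolding w_def using S z yc Sy by (subst mult_minus_distrib_mat_vec) auto
  have "w \<bullet> z = 0" using perp[OF wc Sw] .
  moreover have "w \<bullet> y = (S *\<^sub>v w) \<bullet> (?X *\<^sub>v z)"
    unfolding y_def using adjoint_scalar_prod[OF S(1) wc Xz] S(2) by simp
  hence "w \<bullet> y = 0" using Sw Xz by simp
  ultimately have "w \<bullet> w = 0"
    using wc z yc by (subst (2) w_def) (simp add: scalar_prod_minus_distrib[of _ n])
  hence "w = 0\<^sub>v n" using scalar_prod_self_eq_0_iff[OF wc] by simp
  hence "z $ i = y $ i" if "i < n" for i
    using that z yc by (metis index_minus_vec(1) index_zero_vec(1) carrier_vecD w_def right_minus_eq)
  thus ?thesis unfolding y_def[symmetric] using z yc by (intro eq_vecI) auto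
qed

section \<open>Orthogonal projections onto kernels\<close>

lemma mat_mult_transpose_kernel:
  fixes A :: "real mat"
  assumes A: "A \<in> carrier_mat m n" and a: "a \<in> carrier_vec m" "(A * A\<^sup>T) *\<^sub>v a = 0\<^sub>v m"
  shows "A\<^sup>T *\<^sub>v a = 0\<^sub>v n"
proof -
  have c: "A\<^sup>T *\<^sub>v a \<in> carrier_vec n" using A a by auto
  have "(A\<^sup>T *\<^sub>v a) \<bullet> (A\<^sup>T *\<^sub>v a) = a \<bullet> (A *\<^sub>v (A\<^sup>T *\<^sub>v a))"
    using adjoint_scalar_prod[of "A\<^sup>T" n m a "A\<^sup>T *\<^sub>v a"] A a c by simp
  also have "A *\<^sub>v (A\<^sup>T *\<^sub>v a) = 0\<^sub>v m"
    using a A by (subst assoc_mult_mat_vec[symmetric, of _ m n _ m]) auto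
  finally show ?thesis using a scalar_prod_self_eq_0_iff[OF c] by simp
qed

text \<open>The explicit formula for the projection onto the kernel needs no rank assumption, because
  it inverts \<open>A A\<^sup>T\<close> only on the range of \<open>A\<close>.\<close>

lemma kernel_projection:
  fixes A :: "real mat"
  assumes A: "A \<in> carrier_mat m n"
  shows "\<exists>P\<in>carrier_mat n n. \<forall>v\<in>carrier_vec n. A *\<^sub>v (P *\<^sub>v v) = 0\<^sub>v m \<and>
    (\<exists>y\<in>carrier_vec m. v - P *\<^sub>v v = A\<^sup>T *\<^sub>v y)"
proof -
  let ?S = "A * A\<^sup>T"
  have S: "?S \<in> carrier_mat m m" "?S\<^sup>T = ?S" using A by (auto simp: transpose_mult[of _ m n _ m])
  let ?X = "pinv ?S"
  have X: "?X \<in> carrier_mat m m" using pinv_symmetric[OF S] by auto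
  define P where "P = 1\<^sub>m n - A\<^sup>T * (?X * A)"
  have P: "P \<in> carrier_mat n n" using A X by (simp add: P_def minus_carrier_mat)
  show ?thesis
  proof (intro bexI[OF _ P] ballI conjI)
    fix v :: "real vec" assume v: "v \<in> carrier_vec n"
    define y where "y = ?X *\<^sub>v (A *\<^sub>v v)"
    have Av: "A *\<^sub>v v \<in> carrier_vec m" using A v by auto
    have y: "y \<in> carrier_vec m" using X Av by (simp add: y_def)
    have "(A\<^sup>T * (?X * A)) *\<^sub>v v = A\<^sup>T *\<^sub>v ((?X * A) *\<^sub>v v)"
      using A X v by (intro assoc_mult_mat_vec) auto
    also have "(?X * A) *\<^sub>v v = y" unfolding y_def using A X v by (intro assoc_mult_mat_vec) auto
    finally have Pv: "P *\<^sub>v v = v - A\<^sup>T *\<^sub>v y"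
      unfolding P_def using A X v by (subst minus_mult_distrib_mat_vec[of _ n n]) auto
    have "?S *\<^sub>v y = A *\<^sub>v v" unfolding y_def
    proof (rule pinv_solves[OF S Av])
      fix a assume a: "a \<in> carrier_vec m" "?S *\<^sub>v a = 0\<^sub>v m"
      have "a \<bullet> (A *\<^sub>v v) = (A\<^sup>T *\<^sub>v a) \<bullet> v"
        using transpose_vec_mult_scalar[OF A v a(1)] by simp
      thus "a \<bullet> (A *\<^sub>v v) = 0" using mat_mult_transpose_kernel[OF A a] v by simp
    qed
    hence "A *\<^sub>v (A\<^sup>T *\<^sub>v y) = A *\<^sub>v v"
      using A y by (subst assoc_mult_mat_vec[symmetric, of _ m n _ m]) auto
    thus "A *\<^sub>v (P *\<^sub>v v) = 0\<^sub>v m"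
      unfolding Pv using A v y Av by (subst mult_minus_distrib_mat_vec) auto
    show "\<exists>y\<in>carrier_vec m. v - P *\<^sub>v v = A\<^sup>T *\<^sub>v y"
    proof (intro bexI[OF _ y] eq_vecI)
      fix i assume "i < dim_vec (A\<^sup>T *\<^sub>v y)"
      hence "i < n" using A by simp
      thus "(v - P *\<^sub>v v) $ i = (A\<^sup>T *\<^sub>v y) $ i" unfolding Pv using v A by simp
    qed (use v A P in auto)
  qed
qed

text \<open>Symmetric idempotents are closed under P -> 1 - P, so that each statement about lifts
  serves the primal and the dual side at once.\<close>

definition is_orth_proj :: "nat \<Rightarrow> real mat \<Rightarrow> bool" where
  "is_orth_proj n P \<longleftrightarrow> P \<in> carrier_mat n n \<and> P\<^sup>T = P \<and> P * P = P"

lemma is_orth_projD: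
  assumes "is_orth_proj n P"
  shows "P \<in> carrier_mat n n" "P\<^sup>T = P" "P * P = P"
    "\<And>v. v \<in> carrier_vec n \<Longrightarrow> P *\<^sub>v (P *\<^sub>v v) = P *\<^sub>v v"
  using assms assoc_mult_mat_vec[of P n n P n] by (auto simp: is_orth_proj_def)

lemma is_orth_proj_complement:
  assumes "is_orth_proj n P"
  shows "is_orth_proj n (1\<^sub>m n - P)"
proof -
  note P = is_orth_projD[OF assms]
  have c: "1\<^sub>m n - P \<in> carrier_mat n n" using P(1) by (intro minus_carrier_mat)
  have "(1\<^sub>m n - P) * (1\<^sub>m n - P) = 1\<^sub>m n - P"
  proof (rule eq_mat_mult_vecI)
    fix v :: "real vec" assume v: "v \<in> carrier_vec n"
    have Qv: "(1\<^sub>m n - P) *\<^sub>v w = w - P *\<^sub>v w" if "w \<in> carrier_vec n" for w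
      using P(1) that by (subst minus_mult_distrib_mat_vec[of _ n n]) auto
    have Pv: "P *\<^sub>v v \<in> carrier_vec n" using P(1) v by auto
    have "P *\<^sub>v (v - P *\<^sub>v v) = 0\<^sub>v n"
      using P v Pv by (subst mult_minus_distrib_mat_vec[of _ n n]) auto
    hence "(1\<^sub>m n - P) *\<^sub>v ((1\<^sub>m n - P) *\<^sub>v v) = (1\<^sub>m n - P) *\<^sub>v v"
      using v Pv by (simp add: Qv)
    thus "((1\<^sub>m n - P) * (1\<^sub>m n - P)) *\<^sub>v v = (1\<^sub>m n - P) *\<^sub>v v"
      using c v by (subst assoc_mult_mat_vec[of _ n n _ n]) auto
  qed (use c in auto)
  moreover have "(1\<^sub>m n - P)\<^sup>T = 1\<^sub>m n - P"
    using P by (subst transpose_minus[of _ n n]) auto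
  ultimately show ?thesis using c by (simp add: is_orth_proj_def)
qed

text \<open>The space x^{-1} W is the kernel of A diag(x), and its orthogonal complement, the image
  of diag(x) A^T, is x W^perp. One projection thus describes both sides: P recognises scaled primal
  directions and 1 - P scaled dual ones.\<close>

lemma orth_proj_scaled_kernel:
  fixes A :: "real mat"
  assumes A: "A \<in> carrier_mat m n" and x: "x \<in> carrier_vec n" "\<forall>i<n. 0 < x $ i"
  defines "P \<equiv> orth_proj n (vscale (map_vec inverse x) (primal_space A))"
  shows "is_orth_proj n P"
    and "\<And>v. v \<in> carrier_vec n \<Longrightarrow> P *\<^sub>v v = v \<longleftrightarrow> x \<odot>\<^sub>v v \<in> primal_space A"
    and "\<And>u. u \<in> carrier_vec n \<Longrightarrow> (1\<^sub>m n - P) *\<^sub>v u = u \<longleftrightarrow> map_vec inverse x \<odot>\<^sub>v u \<in> dual_space A"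
proof -
  note x = x(1) x(2)[rule_format]
  define A' where "A' = A * mat_diag n (\<lambda>i. x $ i)"
  have A': "A' \<in> carrier_mat m n" using A mat_diag_dim by (simp add: A'_def)
  have D: "mat_diag n (\<lambda>i. x $ i) *\<^sub>v v = x \<odot>\<^sub>v v" if "v \<in> carrier_vec n" for v
  proof (rule eq_vecI)
    fix i assume "i < dim_vec (x \<odot>\<^sub>v v)"
    hence i: "i < n" using x by simp
    have "(mat_diag n (\<lambda>i. x $ i) *\<^sub>v v) $ i = (\<Sum>j<n. (if i = j then x $ j else 0) * v $ j)"
      using i that by (simp add: mat_diag_def scalar_prod_eq_sum[of _ n])
    also have "\<dots> = (\<Sum>j<n. if i = j then x $ j * v $ j else 0)" by (intro sum.cong) auto
    finally show "(mat_diag n (\<lambda>i. x $ i) *\<^sub>v v) $ i = (x \<odot>\<^sub>v v) $ i" using i x by simp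
  qed (use x in \<open>auto simp: mat_diag_def\<close>)
  have A'v: "A' *\<^sub>v v = A *\<^sub>v (x \<odot>\<^sub>v v)" if "v \<in> carrier_vec n" for v
    unfolding A'_def using A that mat_diag_dim by (subst assoc_mult_mat_vec[of _ m n _ n]) (auto simp: D)
  have DT: "(mat_diag n (\<lambda>i. x $ i))\<^sup>T = mat_diag n (\<lambda>i. x $ i)" by (rule eq_matI) (auto simp: mat_diag_def)
  have A'T: "A'\<^sup>T *\<^sub>v y = x \<odot>\<^sub>v (A\<^sup>T *\<^sub>v y)" if "y \<in> carrier_vec m" for y
  proof -
    have "A'\<^sup>T = mat_diag n (\<lambda>i. x $ i) * A\<^sup>T"
      unfolding A'_def using A by (subst transpose_mult[OF A mat_diag_dim]) (simp add: DT)
    hence "A'\<^sup>T *\<^sub>v y = mat_diag n (\<lambda>i. x $ i) *\<^sub>v (A\<^sup>T *\<^sub>v y)"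
      using A that mat_diag_dim by (simp add: assoc_mult_mat_vec[of _ n n _ m])
    thus ?thesis using A that by (simp add: D)
  qed
  define S where "S = vscale (map_vec inverse x) (primal_space A)"
  have S: "S = {v \<in> carrier_vec n. A' *\<^sub>v v = 0\<^sub>v m}"
  proof (intro equalityI subsetI)
    fix v assume "v \<in> S"
    then obtain w where w: "w \<in> carrier_vec n" "A *\<^sub>v w = 0\<^sub>v m" "v = map_vec inverse x \<odot>\<^sub>v w"
      using A by (auto simp: S_def vscale_def mat_kernel_def)
    have v: "v \<in> carrier_vec n" using w x by simp
    have "x \<odot>\<^sub>v v = w"
    proof (rule eq_vecI)
      fix i assume "i < dim_vec w"
      thus "(x \<odot>\<^sub>v v) $ i = w $ i" using w(1) x(1) x(2)[of i] by (simp add: w(3))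
    qed (use w x in auto)
    thus "v \<in> {v \<in> carrier_vec n. A' *\<^sub>v v = 0\<^sub>v m}" using v w by (simp add: A'v)
  next
    fix v assume "v \<in> {v \<in> carrier_vec n. A' *\<^sub>v v = 0\<^sub>v m}"
    hence v: "v \<in> carrier_vec n" "A *\<^sub>v (x \<odot>\<^sub>v v) = 0\<^sub>v m" by (auto simp: A'v)
    have "v = map_vec inverse x \<odot>\<^sub>v (x \<odot>\<^sub>v v)"
    proof (rule eq_vecI)
      fix i assume "i < dim_vec (map_vec inverse x \<odot>\<^sub>v (x \<odot>\<^sub>v v))"
      thus "v $ i = (map_vec inverse x \<odot>\<^sub>v (x \<odot>\<^sub>v v)) $ i" using x(1) x(2)[of i] by simp
    qed (use v x in auto)
    moreover have "x \<odot>\<^sub>v v \<in> primal_space A" using v x A by (simp add: mat_kernel_def)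
    ultimately show "v \<in> S" by (simp add: S_def vscale_def)
  qed
  obtain Q where Q: "Q \<in> carrier_mat n n" "\<And>v. v \<in> carrier_vec n \<Longrightarrow> A' *\<^sub>v (Q *\<^sub>v v) = 0\<^sub>v m"
    "\<And>v. v \<in> carrier_vec n \<Longrightarrow> \<exists>y\<in>carrier_vec m. v - Q *\<^sub>v v = A'\<^sup>T *\<^sub>v y"
    using kernel_projection[OF A'] by blast
  have Qc: "Q *\<^sub>v v \<in> carrier_vec n" if "v \<in> carrier_vec n" for v using Q(1) that by auto
  have QS: "Q *\<^sub>v v \<in> S" if "v \<in> carrier_vec n" for v using Q(2) Qc that by (simp add: S)
  have imperp: "(A'\<^sup>T *\<^sub>v y) \<bullet> w = 0" if "w \<in> S" "y \<in> carrier_vec m" for w y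
    using that transpose_vec_mult_scalar[OF A', of w y] by (simp add: S)
  have Qperp: "(v - Q *\<^sub>v v) \<bullet> w = 0" if v: "v \<in> carrier_vec n" and "w \<in> S" for v w
    using Q(3)[OF v] imperp that by auto
  have unique: "a = b" if "v \<in> carrier_vec n" "a \<in> S" "b \<in> S" "\<And>w. w \<in> S \<Longrightarrow> (v - a) \<bullet> w = 0"
    "\<And>w. w \<in> S \<Longrightarrow> (v - b) \<bullet> w = 0" for v a b
  proof -
    have ab: "a \<in> carrier_vec n" "b \<in> carrier_vec n" using that by (auto simp: S)
    have d: "a - b \<in> S" using that(2,3) A' by (auto simp: S mult_minus_distrib_mat_vec[OF A'])
    have "(a - b) \<bullet> (a - b) = (v - b) \<bullet> (a - b) - (v - a) \<bullet> (a - b)"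
      using that(1) ab by (simp add: minus_scalar_prod_distrib[of _ n])
    hence "(a - b) \<bullet> (a - b) = 0" using that d by simp
    hence "a - b = 0\<^sub>v n" using ab scalar_prod_self_eq_0_iff[of "a - b" n] by simp
    hence "a $ i = b $ i" if "i < n" for i
      using that ab by (metis index_minus_vec(1) index_zero_vec(1) carrier_vecD right_minus_eq)
    thus ?thesis using ab by (intro eq_vecI) auto
  qed
  define isP where "isP R \<longleftrightarrow> R \<in> carrier_mat n n \<and>
     (\<forall>v \<in> carrier_vec n. R *\<^sub>v v \<in> S \<and> (\<forall>w\<in>S. (v - R *\<^sub>v v) \<bullet> w = 0))" for R
  have "isP Q" using Q(1) QS Qperp by (simp add: isP_def)
  moreover have "R = Q" if "isP R" for R
  proof (rule eq_mat_mult_vecI[OF _ Q(1)])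
    show "R \<in> carrier_mat n n" using that by (simp add: isP_def)
    show "R *\<^sub>v v = Q *\<^sub>v v" if "v \<in> carrier_vec n" for v
      using \<open>isP R\<close> that QS Qperp by (intro unique[of v]) (auto simp: isP_def)
  qed
  ultimately have "(THE R. isP R) = Q" by (intro the_equality)
  hence PQ: "P = Q" by (simp add: P_def orth_proj_def isP_def S_def)
  have QQ: "Q *\<^sub>v v = v" if "v \<in> S" for v
    using that QS Qperp by (intro unique[of v]) (auto simp: S)
  have "Q * Q = Q"
  proof (rule eq_mat_mult_vecI)
    fix v :: "real vec" assume "v \<in> carrier_vec n"
    thus "(Q * Q) *\<^sub>v v = Q *\<^sub>v v" using Q(1) QQ[OF QS] by (subst assoc_mult_mat_vec[of _ n n _ n]) auto
  qed (use Q in auto)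
  moreover have "Q\<^sup>T = Q"
  proof (rule eq_mat_mult_vecI)
    fix v :: "real vec" assume v: "v \<in> carrier_vec n"
    show "Q\<^sup>T *\<^sub>v v = Q *\<^sub>v v"
    proof (rule eq_vec_scalar_prodI[of _ n])
      fix u :: "real vec" assume u: "u \<in> carrier_vec n"
      have "(Q\<^sup>T *\<^sub>v v) \<bullet> u = v \<bullet> (Q *\<^sub>v u)" using transpose_vec_mult_scalar[OF Q(1) u v] .
      also have "\<dots> = (Q *\<^sub>v v) \<bullet> (Q *\<^sub>v u) + (v - Q *\<^sub>v v) \<bullet> (Q *\<^sub>v u)"
        using u v Qc by (simp add: minus_scalar_prod_distrib[of _ n])
      also have "\<dots> = (Q *\<^sub>v v) \<bullet> (Q *\<^sub>v u)" using Qperp[OF v QS[OF u]] by simp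
      also have "\<dots> = (Q *\<^sub>v u) \<bullet> (Q *\<^sub>v v) + (u - Q *\<^sub>v u) \<bullet> (Q *\<^sub>v v)"
        using Qperp[OF u QS[OF v]] comm_scalar_prod[OF Qc[OF v] Qc[OF u]] by simp
      also have "\<dots> = u \<bullet> (Q *\<^sub>v v)" using u v Qc by (simp add: minus_scalar_prod_distrib[of _ n])
      also have "\<dots> = (Q *\<^sub>v v) \<bullet> u" using u v Qc by (intro comm_scalar_prod) auto
      finally show "(Q\<^sup>T *\<^sub>v v) \<bullet> u = (Q *\<^sub>v v) \<bullet> u" .
    qed (use Q v in auto)
  qed (use Q in auto)
  ultimately show "is_orth_proj n P" using Q(1) by (simp add: is_orth_proj_def PQ)
  show "P *\<^sub>v v = v \<longleftrightarrow> x \<odot>\<^sub>v v \<in> primal_space A" if v: "v \<in> carrier_vec n" for v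
  proof -
    have "x \<odot>\<^sub>v v \<in> primal_space A \<longleftrightarrow> v \<in> S" using v x A by (simp add: mat_kernel_def S A'v)
    thus ?thesis using QQ QS[OF v] unfolding PQ by metis
  qed
  show "(1\<^sub>m n - P) *\<^sub>v u = u \<longleftrightarrow> map_vec inverse x \<odot>\<^sub>v u \<in> dual_space A" if u: "u \<in> carrier_vec n" for u
  proof -
    have 1: "(1\<^sub>m n - P) *\<^sub>v u = u - Q *\<^sub>v u"
      unfolding PQ using Q(1) u by (subst minus_mult_distrib_mat_vec[of _ n n]) auto
    have scal: "map_vec inverse x \<odot>\<^sub>v u = w \<longleftrightarrow> u = x \<odot>\<^sub>v w" if "w \<in> carrier_vec n" for w
    proof -
      have "inverse (x $ i) * u $ i = w $ i \<longleftrightarrow> u $ i = x $ i * w $ i" if "i < n" for i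
        using x(2)[OF that] by (simp add: field_simps)
      thus ?thesis using x(1) u that by (auto simp: vec_eq_iff)
    qed
    have "map_vec inverse x \<odot>\<^sub>v u \<in> dual_space A \<longleftrightarrow> (\<exists>y\<in>carrier_vec m. map_vec inverse x \<odot>\<^sub>v u = A\<^sup>T *\<^sub>v y)"
      using A by (auto simp: dual_space_def)
    also have "\<dots> \<longleftrightarrow> (\<exists>y\<in>carrier_vec m. u = A'\<^sup>T *\<^sub>v y)"
      using A by (intro bex_cong refl) (simp add: scal A'T)
    finally have 2: "map_vec inverse x \<odot>\<^sub>v u \<in> dual_space A \<longleftrightarrow> (\<exists>y\<in>carrier_vec m. u = A'\<^sup>T *\<^sub>v y)" .
    show ?thesis
    proof
      assume "(1\<^sub>m n - P) *\<^sub>v u = u"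
      thus "map_vec inverse x \<odot>\<^sub>v u \<in> dual_space A" unfolding 2 1 using Q(3)[OF u] by auto
    next
      assume "map_vec inverse x \<odot>\<^sub>v u \<in> dual_space A"
      then obtain y where y: "y \<in> carrier_vec m" "u = A'\<^sup>T *\<^sub>v y" unfolding 2 by blast
      have 0: "0\<^sub>v n \<in> S" using A' by (simp add: S)
      have "Q *\<^sub>v u = 0\<^sub>v n"
        using u 0 QS[OF u] Qperp[OF u] imperp[OF _ y(1)] y(2)
        by (intro unique[of u]) auto
      thus "(1\<^sub>m n - P) *\<^sub>v u = u" unfolding 1 using u by simp
    qed
  qed
qed

section \<open>Subvectors and selected rows or columns\<close>

lemma bij_betw_pick:
  assumes "finite J"
  shows "bij_betw (pick J) {..<card J} J"
proof (rule bij_betw_imageI)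
  show inj: "inj_on (pick J) {..<card J}"
    by (rule inj_onI) (metis lessThan_iff nat_neq_iff order_less_irrefl pick_mono)
  have "pick J ` {..<card J} \<subseteq> J" by (auto intro: pick_in_set)
  moreover have "card (pick J ` {..<card J}) = card J" using inj by (simp add: card_image)
  ultimately show "pick J ` {..<card J} = J" using assms by (simp add: card_subset_eq)
qed

lemma subvec_card:
  assumes "J \<subseteq> {..<n}"
  shows "card {i. i < n \<and> i \<in> J} = card J"
  using assms by (intro arg_cong[of _ _ card]) auto

lemma subvec_carrier:
  assumes "v \<in> carrier_vec n" "J \<subseteq> {..<n}"
  shows "subvec v J \<in> carrier_vec (card J)"
  using assms subvec_card[OF assms(2)] by (auto simp: subvec_def)

lemma pick_less:
  assumes "J \<subseteq> {..<n}" "k < card J"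
  shows "pick J k < n" "pick J k \<in> J"
  using assms pick_in_set[of k J] by auto

lemma index_subvec:
  assumes "v \<in> carrier_vec n" "J \<subseteq> {..<n}" "k < card J"
  shows "subvec v J $ k = v $ pick J k"
  using assms subvec_card[OF assms(2)] by (auto simp: subvec_def)

lemma scalar_prod_subvec:
  assumes "v \<in> carrier_vec n" "w \<in> carrier_vec n" "J \<subseteq> {..<n}"
  shows "subvec v J \<bullet> subvec w J = (\<Sum>i\<in>J. v $ i * w $ i)"
proof -
  have "subvec v J \<bullet> subvec w J = (\<Sum>k<card J. v $ pick J k * w $ pick J k)"
    using assms
    by (simp add: scalar_prod_eq_sum[OF subvec_carrier[of w n]] index_subvec[of _ n])
  also have "\<dots> = (\<Sum>i\<in>J. v $ i * w $ i)"
    using bij_betw_pick[OF finite_subset[OF assms(3)]]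
    by (intro sum.reindex_bij_betw[of "pick J" _ J "\<lambda>i. v $ i * w $ i"]) auto
  finally show ?thesis .
qed

lemma vnorm_subvec:
  assumes "v \<in> carrier_vec n" "J \<subseteq> {..<n}"
  shows "(vnorm (subvec v J))\<^sup>2 = (\<Sum>i\<in>J. (v $ i)\<^sup>2)"
  using scalar_prod_subvec[OF assms(1,1,2)] by (simp add: vnorm_power2) (simp add: power2_eq_square)

lemma vnorm_partition:
  assumes "v \<in> carrier_vec n" "I \<union> J = {..<n}" "I \<inter> J = {}"
  shows "(vnorm v)\<^sup>2 = (vnorm (subvec v I))\<^sup>2 + (vnorm (subvec v J))\<^sup>2"
proof -
  have "finite I" "finite J" using assms(2) by (metis finite_Un finite_lessThan)+
  hence "(\<Sum>i<n. (v $ i)\<^sup>2) = (\<Sum>i\<in>I. (v $ i)\<^sup>2) + (\<Sum>i\<in>J. (v $ i)\<^sup>2)"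
    using assms(2,3) by (simp add: sum.union_disjoint flip: assms(2))
  thus ?thesis using assms by (subst (1 2) vnorm_subvec[of _ n]) (auto simp: vnorm_power2_sum[of _ n])
qed

lemma vnorm_subvec_le:
  assumes "v \<in> carrier_vec n" "J \<subseteq> {..<n}"
  shows "vnorm (subvec v J) \<le> vnorm v"
proof -
  have "(vnorm (subvec v J))\<^sup>2 \<le> (vnorm v)\<^sup>2"
  proof -
    have "({..<n} - J) \<union> J = {..<n}" "({..<n} - J) \<inter> J = {}" using assms by auto
    from vnorm_partition[OF assms(1) this] show ?thesis by simp
  qed
  thus ?thesis by (simp add: power2_le_iff_abs_le)
qed

lemma abs_index_le_vnorm_subvec:
  assumes "v \<in> carrier_vec n" "J \<subseteq> {..<n}" "i \<in> J"
  shows "\<bar>v $ i\<bar> \<le> vnorm (subvec v J)"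
proof -
  have "(v $ i)\<^sup>2 \<le> (\<Sum>i\<in>J. (v $ i)\<^sup>2)"
    using assms by (intro member_le_sum) (auto intro: finite_subset)
  also have "\<dots> = (vnorm (subvec v J))\<^sup>2" using assms by (simp add: vnorm_subvec[of _ n])
  finally show ?thesis using abs_le_square_iff[of "v $ i" "vnorm (subvec v J)"] by simp
qed

lemma vnorm_subvec_mono:
  assumes "v \<in> carrier_vec n" "w \<in> carrier_vec n" "J \<subseteq> {..<n}" "0 \<le> c"
    and "\<And>i. i \<in> J \<Longrightarrow> \<bar>v $ i\<bar> \<le> c * \<bar>w $ i\<bar>"
  shows "vnorm (subvec v J) \<le> c * vnorm (subvec w J)"
  using assms subvec_carrier[OF _ assms(3)] pick_less[OF assms(3)]
  by (intro vnorm_mono[of _ "card J"]) (auto simp: index_subvec[of _ n])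

lemma subvec_add:
  assumes "v \<in> carrier_vec n" "w \<in> carrier_vec n" "J \<subseteq> {..<n}"
  shows "subvec (v + w) J = subvec v J + subvec w J"
  using assms pick_less[OF assms(3)] subvec_carrier[OF _ assms(3), of "v + w"]
    subvec_carrier[OF assms(1,3)] subvec_carrier[OF assms(2,3)]
  by (intro eq_vecI) (auto simp: index_subvec[of _ n])

lemma submatrix_rows_carrier:
  assumes "M \<in> carrier_mat n k" "I \<subseteq> {..<n}"
  shows "submatrix M I UNIV \<in> carrier_mat (card I) k"
  using assms subvec_card[OF assms(2)] by (auto simp: submatrix_def)

lemma submatrix_rows_mult_vec:
  fixes M :: "real mat"
  assumes M: "M \<in> carrier_mat n k" and I: "I \<subseteq> {..<n}" and v: "v \<in> carrier_vec k"
  shows "submatrix M I UNIV *\<^sub>v v = subvec (M *\<^sub>v v) I"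
proof (rule eq_vecI)
  have Mv: "M *\<^sub>v v \<in> carrier_vec n" using M v by auto
  note c = submatrix_rows_carrier[OF M I]
  show "dim_vec (submatrix M I UNIV *\<^sub>v v) = dim_vec (subvec (M *\<^sub>v v) I)"
    using c subvec_carrier[OF Mv I] by simp
  fix i assume "i < dim_vec (subvec (M *\<^sub>v v) I)"
  hence i: "i < card I" using subvec_carrier[OF Mv I] by simp
  have p: "pick I i < n" using pick_less[OF I i] by simp
  have "submatrix M I UNIV $$ (i, j) = M $$ (pick I i, j)" if "j < k" for j
    using M i that subvec_card[OF I] by (subst submatrix_index) (auto simp: pick_UNIV)
  hence "row (submatrix M I UNIV) i = row M (pick I i)"
    using c M i p by (intro eq_vecI) auto
  thus "(submatrix M I UNIV *\<^sub>v v) $ i = subvec (M *\<^sub>v v) I $ i"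
    using c M i p by (simp add: index_subvec[OF Mv I])
qed

lemma submatrix_cols_transpose:
  fixes M :: "real mat"
  assumes M: "M \<in> carrier_mat k n" and J: "J \<subseteq> {..<n}"
  shows "submatrix M UNIV J \<in> carrier_mat k (card J)"
    and "(submatrix M UNIV J)\<^sup>T = submatrix (M\<^sup>T) J UNIV"
proof -
  show c: "submatrix M UNIV J \<in> carrier_mat k (card J)"
    using M subvec_card[OF J] by (auto simp: submatrix_def)
  have c': "submatrix (M\<^sup>T) J UNIV \<in> carrier_mat (card J) k"
    using submatrix_rows_carrier[of "M\<^sup>T" n k J] M J by simp
  show "(submatrix M UNIV J)\<^sup>T = submatrix (M\<^sup>T) J UNIV"
  proof (rule eq_matI)
    fix i j assume "i < dim_row (submatrix (M\<^sup>T) J UNIV)" "j < dim_col (submatrix (M\<^sup>T) J UNIV)"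
    hence ij: "i < card J" "j < k" using c' by auto
    thus "(submatrix M UNIV J)\<^sup>T $$ (i, j) = submatrix (M\<^sup>T) J UNIV $$ (i, j)"
      using M c c' pick_less[OF J ij(1)] subvec_card[OF J]
      by (simp add: submatrix_def pick_UNIV)
  qed (use c c' in auto)
qed

text \<open>With G the columns J of P, the principal block is S = G^T G and the lift is L = G S^+.
  For v in the range of P, the vector L v_J is the element of least norm in that range with the same
  J-coordinates. For general u the J-coordinates of L u are S S^+ u, an orthogonal projection of u,
  which explains the contraction and the fact that lifting them again changes nothing.\<close>

lemma lift_mat_properties:
  assumes P: "is_orth_proj n P" and J: "J \<subseteq> {..<n}"
  defines "L \<equiv> lift_mat P J"
  shows "L \<in> carrier_mat n (card J)"
    and "\<And>u. u \<in> carrier_vec (card J) \<Longrightarrow> P *\<^sub>v (L *\<^sub>v u) = L *\<^sub>v u"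
    and "\<And>v. v \<in> carrier_vec n \<Longrightarrow> P *\<^sub>v v = v \<Longrightarrow> subvec (L *\<^sub>v subvec v J) J = subvec v J"
    and "\<And>v. v \<in> carrier_vec n \<Longrightarrow> P *\<^sub>v v = v \<Longrightarrow> vnorm (L *\<^sub>v subvec v J) \<le> vnorm v"
    and "\<And>u. u \<in> carrier_vec (card J) \<Longrightarrow> L *\<^sub>v subvec (L *\<^sub>v u) J = L *\<^sub>v u"
    and "\<And>u. u \<in> carrier_vec (card J) \<Longrightarrow> vnorm (subvec (L *\<^sub>v u) J) \<le> vnorm u"
proof -
  note PD = is_orth_projD[OF P]
  define k where "k = card J"
  define G where "G = submatrix P UNIV J"
  have G: "G \<in> carrier_mat n k"
    using submatrix_cols_transpose(1)[OF PD(1) J] by (simp add: G_def k_def)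
  have GT: "G\<^sup>T *\<^sub>v v = subvec (P *\<^sub>v v) J" if "v \<in> carrier_vec n" for v
    using submatrix_cols_transpose(2)[OF PD(1) J] submatrix_rows_mult_vec[OF PD(1) J that] PD(2)
    by (simp add: G_def)
  have Gc: "G *\<^sub>v a \<in> carrier_vec n" if "a \<in> carrier_vec k" for a using G that by auto
  have GTc: "G\<^sup>T *\<^sub>v a \<in> carrier_vec k" if "a \<in> carrier_vec n" for a using G that by auto
  have PG: "P *\<^sub>v (G *\<^sub>v a) = G *\<^sub>v a" if a: "a \<in> carrier_vec k" for a
  proof (rule eq_vec_scalar_prodI[of _ n])
    fix u :: "real vec" assume u: "u \<in> carrier_vec n"
    have Pu: "P *\<^sub>v u \<in> carrier_vec n" using PD(1) u by auto
    have "(P *\<^sub>v (G *\<^sub>v a)) \<bullet> u = (G *\<^sub>v a) \<bullet> (P *\<^sub>v u)"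
      using adjoint_scalar_prod[OF PD(1) Gc[OF a] u] PD(2) by simp
    also have "\<dots> = a \<bullet> (G\<^sup>T *\<^sub>v (P *\<^sub>v u))" by (rule adjoint_scalar_prod[OF G a Pu])
    also have "G\<^sup>T *\<^sub>v (P *\<^sub>v u) = G\<^sup>T *\<^sub>v u" using u Pu by (simp add: GT PD(4))
    also have "a \<bullet> (G\<^sup>T *\<^sub>v u) = (G *\<^sub>v a) \<bullet> u" by (rule adjoint_scalar_prod[OF G a u, symmetric])
    finally show "(P *\<^sub>v (G *\<^sub>v a)) \<bullet> u = (G *\<^sub>v a) \<bullet> u" .
  qed (use Gc PD(1) a in auto)
  define S where "S = submatrix P J J"
  have S_rows: "S = submatrix G J UNIV" unfolding S_def G_def by (rule submatrix_split)
  have Sc: "S \<in> carrier_mat k k" using submatrix_rows_carrier[OF G J] by (simp add: S_rows k_def)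
  have SG: "S = G\<^sup>T * G"
  proof (rule eq_mat_mult_vecI[of _ k k])
    fix a :: "real vec" assume a: "a \<in> carrier_vec k"
    have "S *\<^sub>v a = subvec (G *\<^sub>v a) J" unfolding S_rows using submatrix_rows_mult_vec[OF G J a] .
    also have "\<dots> = G\<^sup>T *\<^sub>v (G *\<^sub>v a)" using GT[OF Gc[OF a]] PG[OF a] by simp
    finally show "S *\<^sub>v a = (G\<^sup>T * G) *\<^sub>v a" using transpose_mult_mult_vec[OF G a] by simp
  qed (use Sc G in auto)
  have ST: "S\<^sup>T = S" unfolding SG using G by (simp add: transpose_mult[of _ k n _ k])
  note X = pinv_symmetric[OF Sc ST]
  define X where "X = pinv S"
  have Xc: "X \<in> carrier_mat k k" "X * S * X = X" "(S * X)\<^sup>T = S * X" "S * X * S = S"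
    using X by (auto simp: X_def)
  have L: "L = G * X" by (simp add: L_def lift_mat_def G_def S_def X_def)
  show Lc: "L \<in> carrier_mat n (card J)" using G Xc by (simp add: L flip: k_def)
  have Xu: "X *\<^sub>v u \<in> carrier_vec k" if "u \<in> carrier_vec k" for u using Xc that by auto
  have Lu: "L *\<^sub>v u = G *\<^sub>v (X *\<^sub>v u)" if "u \<in> carrier_vec k" for u
    unfolding L using G Xc that by (intro assoc_mult_mat_vec) auto
  have subG: "subvec (G *\<^sub>v a) J = S *\<^sub>v a" if "a \<in> carrier_vec k" for a
    unfolding S_rows using submatrix_rows_mult_vec[OF G J that] by simp
  have subv: "subvec v J = G\<^sup>T *\<^sub>v v" if "v \<in> carrier_vec n" "P *\<^sub>v v = v" for v
    using GT[OF that(1)] that(2) by simp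
  show "P *\<^sub>v (L *\<^sub>v u) = L *\<^sub>v u" if "u \<in> carrier_vec (card J)" for u
    using that Xu by (simp add: Lu PG k_def)
  show 3: "subvec (L *\<^sub>v subvec v J) J = subvec v J" if v: "v \<in> carrier_vec n" "P *\<^sub>v v = v" for v
  proof -
    have sv: "subvec v J \<in> carrier_vec k" using subvec_carrier[OF v(1) J] by (simp add: k_def)
    \<comment> \<open>S may be singular, but the right-hand side G^T v is orthogonal to ker S,
      because ker S = ker G.\<close>
    have "S *\<^sub>v (X *\<^sub>v subvec v J) = subvec v J"
      unfolding X_def
    proof (rule pinv_solves[OF Sc ST sv])
      fix a assume a: "a \<in> carrier_vec k" "S *\<^sub>v a = 0\<^sub>v k"
      have GG: "(G *\<^sub>v a) \<bullet> (G *\<^sub>v a) = a \<bullet> (S *\<^sub>v a)"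
        using adjoint_scalar_prod[OF G a(1) Gc[OF a(1)]] transpose_mult_mult_vec[OF G a(1)] by (simp add: SG)
      hence "G *\<^sub>v a = 0\<^sub>v n" using a scalar_prod_self_eq_0_iff[OF Gc[OF a(1)]] by simp
      thus "a \<bullet> subvec v J = 0"
        using adjoint_scalar_prod[OF G a(1) v(1)] v by (simp add: subv[OF v])
    qed
    thus ?thesis using sv Xu by (simp add: Lu subG)
  qed
  show "vnorm (L *\<^sub>v subvec v J) \<le> vnorm v" if v: "v \<in> carrier_vec n" "P *\<^sub>v v = v" for v
  proof -
    have sv: "subvec v J \<in> carrier_vec k" using subvec_carrier[OF v(1) J] by (simp add: k_def)
    define b where "b = X *\<^sub>v subvec v J"
    define w where "w = L *\<^sub>v subvec v J"
    have b: "b \<in> carrier_vec k" using Xu[OF sv] by (simp add: b_def)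
    have w: "w = G *\<^sub>v b" using Lu[OF sv] by (simp add: w_def b_def)
    have wc: "w \<in> carrier_vec n" using Gc[OF b] by (simp add: w)
    have Pw: "P *\<^sub>v w = w" using PG[OF b] by (simp add: w)
    have "G\<^sup>T *\<^sub>v v = G\<^sup>T *\<^sub>v w"
      using 3[OF v, folded w_def] subv[OF v] subv[OF wc Pw] by (simp only:)
    hence "G\<^sup>T *\<^sub>v v - G\<^sup>T *\<^sub>v w = 0\<^sub>v k" using GTc[OF wc] by simp
    hence "G\<^sup>T *\<^sub>v (v - w) = 0\<^sub>v k"
      using G v wc by (simp add: mult_minus_distrib_mat_vec[of "G\<^sup>T" k n])
    \<comment> \<open>The lift w lies in the range of G, and v - w is killed by G^T. Pythagoras then
      compares the norms.\<close>
    hence "w \<bullet> (v - w) = 0"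
      using adjoint_scalar_prod[OF G b, of "v - w"] v wc b by (simp add: w)
    hence "w \<bullet> v = w \<bullet> w" using v wc by (simp add: scalar_prod_minus_distrib[of _ n])
    hence "0 \<le> v \<bullet> v - w \<bullet> w"
      using scalar_prod_diff_self[OF v(1) wc] scalar_prod_self_ge_0[of "v - w"] comm_scalar_prod[OF v(1) wc]
      by simp
    thus ?thesis unfolding w_def[symmetric] vnorm_le_vnorm_iff by simp
  qed
  have Pi: "subvec (L *\<^sub>v u) J = (S * X) *\<^sub>v u" if "u \<in> carrier_vec k" for u
    using that Xu Sc Xc by (simp add: Lu subG)
  show "L *\<^sub>v subvec (L *\<^sub>v u) J = L *\<^sub>v u" if "u \<in> carrier_vec (card J)" for u
  proof -
    have u: "u \<in> carrier_vec k" using that by (simp add: k_def)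
    have SXu: "S *\<^sub>v (X *\<^sub>v u) \<in> carrier_vec k" using Sc Xu[OF u] by auto
    have "(X * S * X) *\<^sub>v u = (X * S) *\<^sub>v (X *\<^sub>v u)"
      using Xc(1) Sc u by (intro assoc_mult_mat_vec) auto
    also have "\<dots> = X *\<^sub>v (S *\<^sub>v (X *\<^sub>v u))"
      using Xc(1) Sc Xu[OF u] by (intro assoc_mult_mat_vec) auto
    finally have "X *\<^sub>v (S *\<^sub>v (X *\<^sub>v u)) = (X * S * X) *\<^sub>v u" ..
    thus ?thesis using u SXu Xc by (simp add: Lu subG Xu)
  qed
  show "vnorm (subvec (L *\<^sub>v u) J) \<le> vnorm u" if "u \<in> carrier_vec (card J)" for u
  proof -
    have u: "u \<in> carrier_vec k" using that by (simp add: k_def)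
    define w where "w = (S * X) *\<^sub>v u"
    have c: "S * X \<in> carrier_mat k k" using Sc Xc by simp
    have w: "w \<in> carrier_vec k" using c u by (auto simp: w_def)
    have "(S * X) *\<^sub>v w = ((S * X) * (S * X)) *\<^sub>v u"
      unfolding w_def using c u by (intro assoc_mult_mat_vec[symmetric]) auto
    also have "(S * X) * (S * X) = (S * X * S) * X" using Sc Xc c by (intro assoc_mult_mat[symmetric]) auto
    finally have idem: "(S * X) *\<^sub>v w = w" using Xc by (simp add: w_def)
    have "w \<bullet> w = u \<bullet> w"
      using adjoint_scalar_prod[OF c u w] Xc(3) idem by (simp add: w_def)
    also have "\<dots> \<le> vnorm u * vnorm w" using abs_scalar_prod_le[OF u w] by simp
    finally have "vnorm w * vnorm w \<le> vnorm u * vnorm w"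
      by (simp add: vnorm_power2[symmetric] power2_eq_square)
    hence "vnorm w \<le> vnorm u"
      using vnorm_ge_0[of w] vnorm_ge_0[of u] by (metis mult_le_cancel_right order_le_less)
    thus ?thesis by (simp add: Pi[OF u] w_def)
  qed
qed

text \<open>The lift and v agree on J, so by Pythagoras the comparison of the full norms is a
  comparison of the parts on I.\<close>

lemma lift_mat_minimal:
  assumes P: "is_orth_proj n P" and part: "I \<union> J = {..<n}" "I \<inter> J = {}"
    and v: "v \<in> carrier_vec n" "P *\<^sub>v v = v"
  shows "vnorm (submatrix (lift_mat P J) I UNIV *\<^sub>v subvec v J) \<le> vnorm (subvec v I)"
proof -
  have J: "J \<subseteq> {..<n}" and I: "I \<subseteq> {..<n}" using part by auto
  note L = lift_mat_properties[OF P J]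
  define w where "w = lift_mat P J *\<^sub>v subvec v J"
  have sv: "subvec v J \<in> carrier_vec (card J)" by (rule subvec_carrier[OF v(1) J])
  have w: "w \<in> carrier_vec n" unfolding w_def using L(1) sv by auto
  have "(vnorm w)\<^sup>2 \<le> (vnorm v)\<^sup>2" using L(4)[OF v] by (simp add: w_def power_mono)
  hence "(vnorm (subvec w I))\<^sup>2 \<le> (vnorm (subvec v I))\<^sup>2"
    using vnorm_partition[OF v(1) part] vnorm_partition[OF w part] L(3)[OF v] by (simp add: w_def)
  hence "vnorm (subvec w I) \<le> vnorm (subvec v I)" by (simp add: power2_le_iff_abs_le)
  thus ?thesis using submatrix_rows_mult_vec[OF L(1) I sv] by (simp add: w_def)
qed

section \<open>Approximate singular value decompositions\<close>

definition num_sv_ge :: "real \<Rightarrow> real mat \<Rightarrow> nat" where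
  "num_sv_ge \<tau> M = card {i. i < dim_col M \<and> \<tau> \<le> singular_values M ! i}"

lemma initial_segment_eq_lessThan_card:
  fixes q :: nat
  assumes "\<And>i j. i \<le> j \<Longrightarrow> j < q \<Longrightarrow> Q j \<Longrightarrow> Q i"
  shows "{i. i < q \<and> Q i} = {..<card {i. i < q \<and> Q i}}"
proof -
  define A where "A = {i. i < q \<and> Q i}"
  define m where "m = (LEAST m. m \<notin> A)"
  have fin: "finite A" by (simp add: A_def)
  have "q \<notin> A" by (simp add: A_def)
  hence "m \<notin> A" unfolding m_def by (rule LeastI)
  have "A = {..<m}"
  proof (intro equalityI subsetI)
    fix i assume "i \<in> A"
    show "i \<in> {..<m}"
    proof (rule ccontr)
      assume "i \<notin> {..<m}"
      hence "m \<le> i" by simp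
      hence "m \<in> A" using \<open>i \<in> A\<close> assms[of m i] by (auto simp: A_def)
      thus False using \<open>m \<notin> A\<close> by simp
    qed
  next
    fix i assume "i \<in> {..<m}"
    thus "i \<in> A" using not_less_Least[of i "\<lambda>m. m \<notin> A"] by (auto simp: m_def)
  qed
  thus ?thesis by (simp add: A_def)
qed

lemma num_sv_ge_segment:
  assumes "M \<in> carrier_mat p q"
  shows "{i. i < q \<and> \<tau> \<le> singular_values M ! i} = {..<num_sv_ge \<tau> M}" "num_sv_ge \<tau> M \<le> q"
proof -
  obtain V where "right_singular_basis q M V" using exists_right_singular_basis[OF assms] ..
  note sorted = right_singular_basisD(4)[OF this]
  have "{i. i < q \<and> \<tau> \<le> singular_values M ! i} = {..<card {i. i < q \<and> \<tau> \<le> singular_values M ! i}}"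
    by (rule initial_segment_eq_lessThan_card) (use sorted in \<open>force intro: order_trans\<close>)
  thus "{i. i < q \<and> \<tau> \<le> singular_values M ! i} = {..<num_sv_ge \<tau> M}"
    using assms by (simp add: num_sv_ge_def)
  have "card {i. i < q \<and> \<tau> \<le> singular_values M ! i} \<le> card {..<q}"
    by (intro card_mono) auto
  thus "num_sv_ge \<tau> M \<le> q" using assms by (simp add: num_sv_ge_def)
qed

lemma less_num_sv_ge_iff:
  assumes "M \<in> carrier_mat p q" "i < q"
  shows "i < num_sv_ge \<tau> M \<longleftrightarrow> \<tau> \<le> singular_values M ! i"
  using num_sv_ge_segment(1)[OF assms(1), of \<tau>] assms(2) by blast

text \<open>One half of a Courant-Fischer description of the count: the leading right singular
  vectors span a subspace on which M expands by \<tau>. Subspaces are represented by injective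
  matrices, here the leading columns of V.\<close>

lemma exists_expanding_isometry:
  assumes M: "M \<in> carrier_mat p q" and "0 \<le> \<tau>"
  shows "\<exists>W\<in>carrier_mat q (num_sv_ge \<tau> M). \<forall>a\<in>carrier_vec (num_sv_ge \<tau> M).
    vnorm (W *\<^sub>v a) = vnorm a \<and> \<tau> * vnorm a \<le> vnorm (M *\<^sub>v (W *\<^sub>v a))"
proof -
  define k where "k = num_sv_ge \<tau> M"
  have kq: "k \<le> q" using num_sv_ge_segment(2)[OF M] by (simp add: k_def)
  obtain V where "right_singular_basis q M V" using exists_right_singular_basis[OF M] ..
  note VD = right_singular_basisD[OF this]
  note V = VD(1,2) and nonneg = VD(3) and MV = VD(5) and iso = VD(6)
  define Z :: "real mat" where "Z = mat q k (\<lambda>(i, j). if i = j then 1 else 0)"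
  have Z: "Z \<in> carrier_mat q k" by (simp add: Z_def)
  have Za: "Z *\<^sub>v a = vec q (\<lambda>i. if i < k then a $ i else 0)" if "a \<in> carrier_vec k" for a
  proof (rule eq_vecI)
    fix i assume "i < dim_vec (vec q (\<lambda>i. if i < k then a $ i else 0))"
    hence i: "i < q" by simp
    have "(Z *\<^sub>v a) $ i = (\<Sum>j<k. (if i = j then 1 else 0) * a $ j)"
      using i that by (simp add: Z_def scalar_prod_eq_sum[of _ k])
    also have "\<dots> = (\<Sum>j<k. if i = j then a $ j else 0)" by (intro sum.cong) auto
    finally show "(Z *\<^sub>v a) $ i = vec q (\<lambda>i. if i < k then a $ i else 0) $ i" using i by simp
  qed (simp add: Z_def)
  have sumk: "(\<Sum>i<q. if i < k then f i else 0) = (\<Sum>i<k. f i)" for f :: "nat \<Rightarrow> real"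
  proof -
    have "(\<Sum>i<q. if i < k then f i else 0) = (\<Sum>i\<in>{..<q} \<inter> {i. i < k}. f i)"
      by (subst sum.inter_restrict) auto
    also have "{..<q} \<inter> {i. i < k} = {..<k}" using kq by auto
    finally show ?thesis .
  qed
  show ?thesis
  proof (intro bexI[of _ "V * Z"] ballI)
    show "V * Z \<in> carrier_mat q (num_sv_ge \<tau> M)" using V Z by (simp add: k_def)
    fix a :: "real vec" assume "a \<in> carrier_vec (num_sv_ge \<tau> M)"
    hence a: "a \<in> carrier_vec k" by (simp add: k_def)
    define b where "b = Z *\<^sub>v a"
    have b: "b \<in> carrier_vec q" using Z a by (auto simp: b_def)
    have bi: "b $ i = (if i < k then a $ i else 0)" if "i < q" for i using that by (simp add: b_def Za[OF a])
    have VZ: "(V * Z) *\<^sub>v a = V *\<^sub>v b" unfolding b_def using V Z a by (intro assoc_mult_mat_vec) auto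
    have "(vnorm b)\<^sup>2 = (\<Sum>i<q. if i < k then (a $ i)\<^sup>2 else 0)"
      unfolding vnorm_power2_sum[OF b] by (intro sum.cong) (auto simp: bi)
    also have "\<dots> = (vnorm a)\<^sup>2" using vnorm_power2_sum[OF a] sumk by simp
    finally have nb: "vnorm b = vnorm a" by simp
    have "(\<tau> * vnorm a)\<^sup>2 = (\<Sum>i<k. (\<tau> * a $ i)\<^sup>2)"
      by (simp add: power_mult_distrib vnorm_power2_sum[OF a] sum_distrib_left)
    also have "\<dots> \<le> (\<Sum>i<k. (singular_values M ! i * a $ i)\<^sup>2)"
    proof (rule sum_mono)
      fix i assume "i \<in> {..<k}"
      hence "\<tau> \<le> singular_values M ! i" using less_num_sv_ge_iff[OF M, of i \<tau>] kq by (simp add: k_def)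
      thus "(\<tau> * a $ i)\<^sup>2 \<le> (singular_values M ! i * a $ i)\<^sup>2"
        using \<open>0 \<le> \<tau>\<close> by (simp add: power_mult_distrib mult_right_mono power_mono)
    qed
    also have "\<dots> = (\<Sum>i<q. if i < k then (singular_values M ! i * a $ i)\<^sup>2 else 0)" by (rule sumk[symmetric])
    also have "\<dots> = (vnorm (M *\<^sub>v (V *\<^sub>v b)))\<^sup>2"
      unfolding MV[OF b] by (intro sum.cong) (auto simp: bi)
    finally have "\<tau> * vnorm a \<le> vnorm (M *\<^sub>v (V *\<^sub>v b))"
      by (rule power2_le_imp_le) simp
    thus "vnorm ((V * Z) *\<^sub>v a) = vnorm a \<and> \<tau> * vnorm a \<le> vnorm (M *\<^sub>v ((V * Z) *\<^sub>v a))"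
      unfolding VZ using iso[OF b] nb by simp
  qed
qed

text \<open>The other half: with fewer than k singular values \<ge> \<tau>, the image of W would
  contain a nonzero vector orthogonal to all the corresponding singular vectors, and there M expands
  by strictly less than \<tau>. W is only injective, so that images of singular subspaces under
  rescalings qualify.\<close>

lemma expanding_injection_le_num_sv_ge:
  assumes M: "M \<in> carrier_mat p q" and W: "W \<in> carrier_mat q k" and \<tau>: "0 < \<tau>"
    and inj: "\<And>a. a \<in> carrier_vec k \<Longrightarrow> W *\<^sub>v a = 0\<^sub>v q \<Longrightarrow> a = 0\<^sub>v k"
    and exp: "\<And>a. a \<in> carrier_vec k \<Longrightarrow> \<tau> * vnorm (W *\<^sub>v a) \<le> vnorm (M *\<^sub>v (W *\<^sub>v a))"
  shows "k \<le> num_sv_ge \<tau> M"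
proof (rule ccontr)
  assume "\<not> k \<le> num_sv_ge \<tau> M"
  define c where "c = num_sv_ge \<tau> M"
  have ck: "c < k" using \<open>\<not> k \<le> num_sv_ge \<tau> M\<close> by (simp add: c_def)
  have cq: "c \<le> q" using num_sv_ge_segment(2)[OF M] by (simp add: c_def)
  obtain V where "right_singular_basis q M V" using exists_right_singular_basis[OF M] ..
  note VD = right_singular_basisD[OF this]
  note V = VD(1,2) and nonneg = VD(3) and MV = VD(5) and iso = VD(6)
  define N where "N = mat c k (\<lambda>(i, j). (V\<^sup>T * W) $$ (i, j))"
  have N: "N \<in> carrier_mat c k" by (simp add: N_def)
  obtain a where a: "a \<in> carrier_vec k" "a \<noteq> 0\<^sub>v k" "N *\<^sub>v a = 0\<^sub>v c"
    using homogeneous_system_nontrivial[OF N ck] by blast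
  define b where "b = V\<^sup>T *\<^sub>v (W *\<^sub>v a)"
  have Wa: "W *\<^sub>v a \<in> carrier_vec q" using W a by auto
  have b: "b \<in> carrier_vec q" using V Wa by (auto simp: b_def)
  have bVW: "b = (V\<^sup>T * W) *\<^sub>v a" unfolding b_def using V W a by (intro assoc_mult_mat_vec[symmetric]) auto
  have b0: "b $ i = 0" if "i < c" for i
  proof -
    have "row N i = row (V\<^sup>T * W) i" using that cq V W N by (intro eq_vecI) (auto simp: N_def)
    hence "(N *\<^sub>v a) $ i = b $ i" using that cq V W N by (simp add: bVW)
    thus ?thesis using a that by simp
  qed
  have "V *\<^sub>v b = (V * V\<^sup>T) *\<^sub>v (W *\<^sub>v a)"
    unfolding b_def using V(1) Wa by (intro assoc_mult_mat_vec[symmetric]) auto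
  hence Vb: "V *\<^sub>v b = W *\<^sub>v a" using V Wa by simp
  have "W *\<^sub>v a \<noteq> 0\<^sub>v q" using inj[OF a(1)] a(2) by blast
  hence "b \<noteq> 0\<^sub>v q" using V Vb by auto
  then obtain j where j: "j < q" "b $ j \<noteq> 0" using b by (auto simp: vec_eq_iff)
  have small: "singular_values M ! i < \<tau>" if "i < q" "c \<le> i" for i
    using less_num_sv_ge_iff[OF M that(1), of \<tau>] that by (simp add: c_def)
  have le: "(singular_values M ! i * b $ i)\<^sup>2 \<le> (\<tau> * b $ i)\<^sup>2" if "i < q" for i
  proof (cases "i < c")
    case False
    thus ?thesis using small[of i] nonneg[OF that] that
      by (simp add: power_mult_distrib mult_right_mono power_mono)
  qed (simp add: b0)
  have "c \<le> j" using b0 j by (metis not_le)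
  hence strict: "(singular_values M ! j * b $ j)\<^sup>2 < (\<tau> * b $ j)\<^sup>2"
    using small[OF j(1)] nonneg[OF j(1)] j(2)
    by (simp add: power_mult_distrib mult_strict_right_mono power_strict_mono)
  have "(vnorm (M *\<^sub>v (V *\<^sub>v b)))\<^sup>2 < (\<Sum>i<q. (\<tau> * b $ i)\<^sup>2)"
    unfolding MV[OF b] using le strict j(1) by (intro sum_strict_mono_ex1) auto
  also have "\<dots> = (\<tau> * vnorm b)\<^sup>2"
    by (simp add: power_mult_distrib vnorm_power2_sum[OF b] sum_distrib_left)
  finally have "vnorm (M *\<^sub>v (V *\<^sub>v b)) < \<tau> * vnorm b"
    by (rule power2_less_imp_less) (use \<tau> in simp)
  thus False using exp[OF a(1)] iso[OF b] Vb by simp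
qed

section \<open>Orthogonal columns and approximate decompositions\<close>

lemma orthogonal_columns_coordinates:
  fixes C :: "real mat"
  assumes C: "C \<in> carrier_mat q q" and orth: "corthogonal (cols C)" and z: "z \<in> carrier_vec q"
  shows "\<exists>b\<in>carrier_vec q. z = C *\<^sub>v b \<and> (\<forall>j<q. (z \<bullet> col C j = 0) = (b $ j = 0))"
proof -
  \<comment> \<open>The case i = j of \<open>corthogonal\<close> says that the columns are
    nonzero.\<close>
  have o: "col C i \<bullet> col C j = 0 \<longleftrightarrow> i \<noteq> j" if "i < q" "j < q" for i j
    using corthogonalD[OF orth, of i j] that C by simp
  have Cb: "(C *\<^sub>v b) \<bullet> col C j = b $ j * (col C j \<bullet> col C j)" if "b \<in> carrier_vec q" "j < q" for b j
  proof -
    have c: "col C j \<in> carrier_vec q" using C that by auto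
    have "(C *\<^sub>v b) \<bullet> col C j = b \<bullet> (C\<^sup>T *\<^sub>v col C j)" by (rule adjoint_scalar_prod[OF C that(1) c])
    also have "\<dots> = (C\<^sup>T *\<^sub>v col C j) \<bullet> b" using C c that by (intro comm_scalar_prod[of _ q]) auto
    also have "\<dots> = (\<Sum>i<q. (col C i \<bullet> col C j) * b $ i)"
      using C that by (simp add: scalar_prod_eq_sum[OF that(1)])
    also have "\<dots> = (\<Sum>i<q. if i = j then (col C j \<bullet> col C j) * b $ j else 0)"
      using o that by (intro sum.cong) auto
    finally show ?thesis using that by simp
  qed
  have "\<exists>b\<in>carrier_vec q. C *\<^sub>v b = z"
  proof (rule square_system_solvable[OF C _ z])
    fix b assume b: "b \<in> carrier_vec q" "C *\<^sub>v b = 0\<^sub>v q"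
    have "b $ j = 0" if "j < q" for j
      using Cb[OF b(1) that] o[OF that that] b(2) C that by simp
    thus "b = 0\<^sub>v q" using b by (intro eq_vecI) auto
  qed
  then obtain b where b: "b \<in> carrier_vec q" "z = C *\<^sub>v b" by auto
  moreover have "\<forall>j<q. (z \<bullet> col C j = 0) = (b $ j = 0)"
    using Cb[OF b(1)] o by (auto simp: b(2))
  ultimately show ?thesis by blast
qed

text \<open>Turns the span in the module sense into linear equations, which are easy to check and
  visibly closed under differences.\<close>

lemma vspan_drop_cols:
  fixes C :: "real mat"
  assumes C: "C \<in> carrier_mat q q" and orth: "corthogonal (cols C)"
  shows "vspan q (set (drop k (cols C))) = {z \<in> carrier_vec q. \<forall>j<q. j < k \<longrightarrow> z \<bullet> col C j = 0}"
proof -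
  interpret vec_space "TYPE(real)" q .
  define D where "D = set (drop k (cols C))"
  have Dc: "D \<subseteq> carrier_vec q"
    using C cols_dim[of C] by (auto simp: D_def dest!: in_set_dropD)
  have D: "col C i \<in> D" if "k \<le> i" "i < q" for i
  proof -
    have "drop k (cols C) ! (i - k) = col C i" using that C by simp
    moreover have "i - k < length (drop k (cols C))" using that C by simp
    ultimately show ?thesis unfolding D_def by (metis nth_mem)
  qed
  have zD: "0\<^sub>v q \<in> span D"
    by (rule in_spanI[of _ "\<lambda>_. 0" "{}"]) (auto simp: lincomb_def)
  have o: "col C i \<bullet> col C j = 0 \<longleftrightarrow> i \<noteq> j" if "i < q" "j < q" for i j
    using corthogonalD[OF orth, of i j] that C by simp
  have D': "\<exists>i. k \<le> i \<and> i < q \<and> d = col C i" if d: "d \<in> D" for d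
  proof -
    obtain l where "l < length (drop k (cols C))" "d = drop k (cols C) ! l"
      using d unfolding D_def by (metis in_set_conv_nth)
    thus ?thesis using C by (intro exI[of _ "k + l"]) auto
  qed
  show ?thesis unfolding D_def[symmetric]
  proof (intro equalityI subsetI)
    fix z assume z: "z \<in> span D"
    have zc: "z \<in> carrier_vec q" using z Dc span_closed[of D z] by simp
    have "z \<bullet> col C j = 0" if j: "j < q" "j < k" for j
    proof -
      have c: "col C j \<in> carrier_vec q" using C j by auto
      have "\<forall>d\<in>D. col C j \<bullet> d = 0" using D' o j by fastforce
      hence "col C j \<in> orthogonal_complement D" using c by (simp add: orthogonal_complement_def)
      hence "col C j \<in> orthogonal_complement (span D)" using in_orthogonal_complement_span[OF Dc] by simp
      hence "col C j \<bullet> z = 0" using z by (simp add: orthogonal_complement_def)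
      thus ?thesis using comm_scalar_prod[OF zc c] by simp
    qed
    thus "z \<in> {z \<in> carrier_vec q. \<forall>j<q. j < k \<longrightarrow> z \<bullet> col C j = 0}" using zc by simp
  next
    fix z assume "z \<in> {z \<in> carrier_vec q. \<forall>j<q. j < k \<longrightarrow> z \<bullet> col C j = 0}"
    hence z: "z \<in> carrier_vec q" "\<And>j. j < q \<Longrightarrow> j < k \<Longrightarrow> z \<bullet> col C j = 0" by auto
    obtain b where b: "b \<in> carrier_vec q" "z = C *\<^sub>v b" "\<And>j. j < q \<Longrightarrow> (z \<bullet> col C j = 0) = (b $ j = 0)"
      using orthogonal_columns_coordinates[OF C orth z(1)] by blast
    define s where "s m = C *\<^sub>v vec q (\<lambda>i. if i < m then b $ i else 0)" for m
    have "s m \<in> span D" if "m \<le> q" for m using that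
    proof (induction m)
      case 0
      have "vec q (\<lambda>i. if i < 0 then b $ i else 0) = 0\<^sub>v q" by auto
      hence "s 0 = 0\<^sub>v q" using C by (simp add: s_def)
      thus ?case using zD by simp
    next
      case (Suc m)
      hence m: "m < q" by simp
      have mem: "b $ m \<cdot>\<^sub>v col C m \<in> span D"
      proof (cases "m < k")
        case True
        have "b $ m = 0" using z(2)[OF m True] b(3)[OF m] by simp
        hence "b $ m \<cdot>\<^sub>v col C m = 0\<^sub>v q" using C m by auto
        thus ?thesis using zD by simp
      next
        case False
        thus ?thesis using D[of m] m Dc by (intro smult_in_span span_mem) auto
      qed
      have "vec q (\<lambda>i. if i < Suc m then b $ i else 0) = vec q (\<lambda>i. if i < m then b $ i else 0) + b $ m \<cdot>\<^sub>v unit_vec q m"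
        using m by (intro eq_vecI) (auto simp: unit_vec_def less_Suc_eq)
      hence "s (Suc m) = s m + b $ m \<cdot>\<^sub>v (C *\<^sub>v unit_vec q m)"
        using C by (simp add: s_def mult_add_distrib_mat_vec[OF C] mult_mat_vec[OF C])
      also have "C *\<^sub>v unit_vec q m = col C m" using C m by (intro eq_vecI) auto
      finally have "s (Suc m) = s m + b $ m \<cdot>\<^sub>v col C m" .
      thus ?case using span_add1[OF _ Suc.IH mem] Suc.prems Dc by (simp add: module_vec_simps)
    qed
    moreover have "vec q (\<lambda>i. if i < q then b $ i else 0) = b" using b(1) by (intro eq_vecI) auto
    hence "s q = z" by (simp add: s_def b(2))
    ultimately show "z \<in> span D" by (metis order_refl)
  qed
qed

lemma orthogonal_columns_decomposition:
  fixes C :: "real mat"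
  assumes C: "C \<in> carrier_mat q q" and orth: "corthogonal (cols C)" and z: "z \<in> carrier_vec q"
  shows "\<exists>y w. y \<in> carrier_vec q \<and> w \<in> carrier_vec q \<and> z = y + w \<and> y \<bullet> w = 0 \<and>
    (\<forall>j<q. j < k \<longrightarrow> w \<bullet> col C j = 0) \<and> (\<forall>j<q. k \<le> j \<longrightarrow> y \<bullet> col C j = 0)"
proof -
  have o: "col C i \<bullet> col C j = 0 \<longleftrightarrow> i \<noteq> j" if "i < q" "j < q" for i j
    using corthogonalD[OF orth, of i j] that C by simp
  have Cb: "(C *\<^sub>v b) \<bullet> v = (\<Sum>i<q. b $ i * (col C i \<bullet> v))"
    if "b \<in> carrier_vec q" "v \<in> carrier_vec q" for b v
  proof -
    have "(C *\<^sub>v b) \<bullet> v = b \<bullet> (C\<^sup>T *\<^sub>v v)" by (rule adjoint_scalar_prod[OF C that])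
    thus ?thesis using C that by (simp add: scalar_prod_eq_sum[of "C\<^sup>T *\<^sub>v v" q])
  qed
  obtain b where b: "b \<in> carrier_vec q" "z = C *\<^sub>v b"
    using orthogonal_columns_coordinates[OF C orth z] by blast
  define b1 where "b1 = vec q (\<lambda>i. if i < k then b $ i else 0)"
  define b2 where "b2 = vec q (\<lambda>i. if i < k then 0 else b $ i)"
  have b12: "b1 \<in> carrier_vec q" "b2 \<in> carrier_vec q" by (auto simp: b1_def b2_def)
  have Cc: "C *\<^sub>v v \<in> carrier_vec q" if "v \<in> carrier_vec q" for v using C that by auto
  have cc: "col C j \<in> carrier_vec q" if "j < q" for j using C that by auto
  have "b = b1 + b2" using b by (intro eq_vecI) (auto simp: b1_def b2_def)
  hence sum: "z = C *\<^sub>v b1 + C *\<^sub>v b2" using b b12 C by (simp add: mult_add_distrib_mat_vec[OF C])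
  have w: "(C *\<^sub>v b2) \<bullet> col C j = 0" if "j < q" "j < k" for j
    unfolding Cb[OF b12(2) cc[OF that(1)]] using o that by (intro sum.neutral) (auto simp: b2_def)
  have y: "(C *\<^sub>v b1) \<bullet> col C j = 0" if "j < q" "k \<le> j" for j
    unfolding Cb[OF b12(1) cc[OF that(1)]] using o that by (intro sum.neutral) (auto simp: b1_def)
  have "b1 $ i * (col C i \<bullet> (C *\<^sub>v b2)) = 0" if "i < q" for i
    using w[OF that] comm_scalar_prod[OF Cc[OF b12(2)] cc[OF that]] that by (auto simp: b1_def)
  hence "(C *\<^sub>v b1) \<bullet> (C *\<^sub>v b2) = 0" unfolding Cb[OF b12(1) Cc[OF b12(2)]] by (intro sum.neutral) auto
  thus ?thesis using sum w y Cc b12 by (intro exI[of _ "C *\<^sub>v b1"] exI[of _ "C *\<^sub>v b2"]) auto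
qed

text \<open>The leading columns of C need not be singular vectors, yet M expands on their span.
  Choose l in the range of W with the same inner products as y with the leading columns; this square
  system is solvable because M expands by \<sigma> on one space and by at most t < \<sigma> on the
  other. Then w = y - l lies where M is small and is orthogonal to y, so that neither y nor w is
  longer than l, and M y = M l + M w is at least (\<sigma> - t) times the norm of y.\<close>

lemma orthogonal_complement_expansion:
  fixes M C W :: "real mat"
  assumes M: "M \<in> carrier_mat p q" and C: "C \<in> carrier_mat q q" and orth: "corthogonal (cols C)"
    and k: "k \<le> q" and W: "W \<in> carrier_mat q k"
    and iso: "\<And>a. a \<in> carrier_vec k \<Longrightarrow> vnorm (W *\<^sub>v a) = vnorm a"
    and exp: "\<And>a. a \<in> carrier_vec k \<Longrightarrow> \<sigma> * vnorm a \<le> vnorm (M *\<^sub>v (W *\<^sub>v a))"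
    and small: "\<And>w. w \<in> carrier_vec q \<Longrightarrow> (\<And>j. j < k \<Longrightarrow> w \<bullet> col C j = 0) \<Longrightarrow> vnorm (M *\<^sub>v w) \<le> t * vnorm w"
    and t: "0 \<le> t" "t < \<sigma>"
    and y: "y \<in> carrier_vec q" "\<And>j. k \<le> j \<Longrightarrow> j < q \<Longrightarrow> y \<bullet> col C j = 0"
  shows "(\<sigma> - t) * vnorm y \<le> vnorm (M *\<^sub>v y)"
proof -
  have cc: "col C j \<in> carrier_vec q" if "j < q" for j using C that by auto
  define Ck where "Ck = mat_of_rows q (map (\<lambda>j. col C j) [0..<k])"
  have Ck: "Ck \<in> carrier_mat k q"
    using mat_of_rows_carrier(1)[of q "map (\<lambda>j. col C j) [0..<k]"] by (simp add: Ck_def)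
  have Ckv: "(Ck *\<^sub>v v) $ j = v \<bullet> col C j" if "v \<in> carrier_vec q" "j < k" for v j
  proof -
    have "row Ck j = col C j" using that k cc unfolding Ck_def by (subst mat_of_rows_row) auto
    thus ?thesis using Ck that k comm_scalar_prod[OF that(1) cc[of j]] by simp
  qed
  have Wa: "W *\<^sub>v a \<in> carrier_vec q" if "a \<in> carrier_vec k" for a using W that by auto
  have CW: "Ck * W \<in> carrier_mat k k" using Ck W by simp
  have CWa: "(Ck * W) *\<^sub>v a = Ck *\<^sub>v (W *\<^sub>v a)" if "a \<in> carrier_vec k" for a
    using Ck W that by (intro assoc_mult_mat_vec) auto
  have "\<exists>a\<in>carrier_vec k. (Ck * W) *\<^sub>v a = Ck *\<^sub>v y"
  proof (rule square_system_solvable[OF CW])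
    fix a assume a: "a \<in> carrier_vec k" "(Ck * W) *\<^sub>v a = 0\<^sub>v k"
    have "(W *\<^sub>v a) \<bullet> col C j = 0" if "j < k" for j
      using a that Ckv[OF Wa[OF a(1)] that] by (simp add: CWa)
    hence "vnorm (M *\<^sub>v (W *\<^sub>v a)) \<le> t * vnorm a" using small[OF Wa[OF a(1)]] iso[OF a(1)] by simp
    hence "(\<sigma> - t) * vnorm a \<le> 0" using exp[OF a(1)] by (simp add: algebra_simps)
    hence "vnorm a \<le> 0" using t by (simp add: mult_le_0_iff)
    hence "vnorm a = 0" using vnorm_ge_0[of a] by linarith
    thus "a = 0\<^sub>v k" using vnorm_eq_0_iff[OF a(1)] by simp
  qed (use Ck y in auto)
  then obtain a where a: "a \<in> carrier_vec k" "Ck *\<^sub>v (W *\<^sub>v a) = Ck *\<^sub>v y" using CWa by auto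
  define l where "l = W *\<^sub>v a"
  define w where "w = y - l"
  have l: "l \<in> carrier_vec q" using Wa[OF a(1)] by (simp add: l_def)
  have w: "w \<in> carrier_vec q" using y l by (simp add: w_def)
  have wC: "w \<bullet> col C j = 0" if "j < k" for j
  proof -
    have "w \<bullet> col C j = y \<bullet> col C j - l \<bullet> col C j"
      unfolding w_def using y l cc that k by (intro minus_scalar_prod_distrib) auto
    also have "\<dots> = (Ck *\<^sub>v y) $ j - (Ck *\<^sub>v l) $ j" using that y l by (simp add: Ckv)
    finally show ?thesis using a(2) by (simp add: l_def)
  qed
  have "y \<bullet> w = 0"
  proof -
    obtain b where b: "b \<in> carrier_vec q" "w = C *\<^sub>v b" "\<And>j. j < q \<Longrightarrow> (w \<bullet> col C j = 0) = (b $ j = 0)"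
      using orthogonal_columns_coordinates[OF C orth w] by blast
    have "w \<bullet> y = b \<bullet> (C\<^sup>T *\<^sub>v y)" unfolding b(2) by (rule adjoint_scalar_prod[OF C b(1) y(1)])
    also have "\<dots> = (\<Sum>i<q. b $ i * (col C i \<bullet> y))"
      using C y by (simp add: scalar_prod_eq_sum[of "C\<^sup>T *\<^sub>v y" q])
    also have "\<dots> = 0"
    proof (rule sum.neutral, rule ballI)
      fix i assume "i \<in> {..<q}"
      thus "b $ i * (col C i \<bullet> y) = 0"
        using b(3)[of i] wC[of i] y(2)[of i] comm_scalar_prod[OF y(1) cc[of i]] by (cases "i < k") auto
    qed
    finally show ?thesis using comm_scalar_prod[OF y(1) w] by simp
  qed
  have yl: "y = l + w" using y l by (auto simp: w_def)
  have "y \<bullet> y = y \<bullet> l + y \<bullet> w" using y l w by (subst (2) yl) (simp add: scalar_prod_add_distrib[of _ q])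
  hence "vnorm y * vnorm y \<le> vnorm y * vnorm l"
    using abs_scalar_prod_le[OF y(1) l] \<open>y \<bullet> w = 0\<close> by (simp add: vnorm_power2[symmetric] power2_eq_square)
  hence nyl: "vnorm y \<le> vnorm l"
    using vnorm_ge_0[of y] vnorm_ge_0[of l] by (metis mult_le_cancel_left order_le_less)
  have "w \<bullet> y = w \<bullet> l + w \<bullet> w" using y l w by (subst yl) (simp add: scalar_prod_add_distrib[of _ q])
  hence "w \<bullet> w = - (w \<bullet> l)" using \<open>y \<bullet> w = 0\<close> comm_scalar_prod[OF y(1) w] by simp
  hence "vnorm w * vnorm w \<le> vnorm w * vnorm l"
    using abs_scalar_prod_le[OF w l] by (simp add: vnorm_power2[symmetric] power2_eq_square)
  hence nwl: "vnorm w \<le> vnorm l"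
    using vnorm_ge_0[of w] vnorm_ge_0[of l] by (metis mult_le_cancel_left order_le_less)
  have Mc: "M *\<^sub>v l \<in> carrier_vec p" "M *\<^sub>v w \<in> carrier_vec p" using M l w by auto
  have nl: "vnorm l = vnorm a" using iso[OF a(1)] by (simp add: l_def)
  have "(\<sigma> - t) * vnorm y \<le> (\<sigma> - t) * vnorm l" using nyl t by (intro mult_left_mono) auto
  also have "\<dots> = \<sigma> * vnorm a - t * vnorm l" by (simp add: nl algebra_simps)
  also have "\<dots> \<le> vnorm (M *\<^sub>v l) - vnorm (M *\<^sub>v w)"
    using exp[OF a(1)] small[OF w wC] mult_left_mono[OF nwl t(1)] by (simp add: l_def)
  also have "\<dots> \<le> vnorm (M *\<^sub>v l + M *\<^sub>v w)" by (rule vnorm_add_ge[OF Mc])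
  also have "M *\<^sub>v l + M *\<^sub>v w = M *\<^sub>v y" using M l w by (simp add: yl mult_add_distrib_mat_vec[OF M])
  finally show ?thesis .
qed

lemma cheap_span_eq:
  assumes "C \<in> carrier_mat q q" "corthogonal (cols C)"
  shows "cheap_span C t = {z \<in> carrier_vec q.
    \<forall>j<q. j < q - card {i. i < q \<and> t $ i \<le> 1} \<longrightarrow> z \<bullet> col C j = 0}"
  using vspan_drop_cols[OF assms] assms(1) by (simp add: cheap_span_def Let_def)

text \<open>The multiplicative accuracy of the singular value estimates forces the zero estimates to
  be exact, so the kernel is spanned exactly by columns of \<open>C\<close>.\<close>

lemma rho_svd_gap:
  fixes M C :: "real mat"
  assumes M: "M \<in> carrier_mat p q" and svd: "rho_svd \<rho> M C t" and \<rho>: "1 \<le> \<rho>"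
    and \<tau>: "0 < \<tau>" "\<rho> * \<tau> \<le> 1" and \<sigma>: "1 < \<sigma>" and gap: "num_sv_ge \<tau> M \<le> num_sv_ge \<sigma> M"
  defines "S \<equiv> cheap_span C t"
  shows "\<And>w. w \<in> S \<Longrightarrow> vnorm (M *\<^sub>v w) \<le> \<rho> * \<tau> * vnorm w"
    and "\<And>z. z \<in> carrier_vec q \<Longrightarrow> M *\<^sub>v z = 0\<^sub>v p \<Longrightarrow> z \<in> S"
    and "\<And>z. z \<in> carrier_vec q \<Longrightarrow> \<exists>y w. y \<in> carrier_vec q \<and> w \<in> S \<and> z = y + w \<and> y \<bullet> w = 0 \<and>
      (\<sigma> - \<rho> * \<tau>) * vnorm y \<le> vnorm (M *\<^sub>v y)"
proof -
  have C: "C \<in> carrier_mat q q" and orth: "corthogonal (cols C)"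
    and t0: "\<And>i. i < q \<Longrightarrow> 0 \<le> t $ i"
    and t_mono: "\<And>i j. i \<le> j \<Longrightarrow> j < q \<Longrightarrow> t $ j \<le> t $ i"
    and t_bound: "\<And>i u. i < q \<Longrightarrow> u \<in> vspan q (set (drop i (cols C))) \<Longrightarrow> vnorm (M *\<^sub>v u) \<le> t $ i * vnorm u"
    and t_le: "\<And>i. i < q \<Longrightarrow> t $ i / \<rho> \<le> singular_values M ! i"
    and t_ge: "\<And>i. i < q \<Longrightarrow> singular_values M ! i \<le> t $ i"
    using svd M by (auto simp: rho_svd_def Let_def)
  obtain V where "right_singular_basis q M V" using exists_right_singular_basis[OF M] ..
  note sv0 = right_singular_basisD(3)[OF this] and sv_mono = right_singular_basisD(4)[OF this]
  define k where "k = q - card {i. i < q \<and> t $ i \<le> 1}"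
  define c where "c = card {i. i < q \<and> 1 < t $ i}"
  have seg: "{i. i < q \<and> 1 < t $ i} = {..<c}"
    unfolding c_def by (rule initial_segment_eq_lessThan_card) (use t_mono in force)
  have "{i. i < q \<and> t $ i \<le> 1} = {..<q} - {i. i < q \<and> 1 < t $ i}" by auto
  moreover have cq: "c \<le> q" using card_mono[of "{..<q}" "{i. i < q \<and> 1 < t $ i}"] by (auto simp: c_def)
  ultimately have "card {i. i < q \<and> t $ i \<le> 1} = q - c"
    by (metis (no_types, lifting) c_def card_Diff_subset card_lessThan finite_lessThan finite_subset mem_Collect_eq subsetI lessThan_iff)
  hence kc: "k = c" using cq by (simp add: k_def)
  have large_iff: "1 < t $ i \<longleftrightarrow> i < k" if "i < q" for i using seg that unfolding kc by blast
  have kq: "k \<le> q" using cq by (simp add: kc)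
  have card_le: "a \<le> b" if "{..<a} \<subseteq> {..<b}" for a b :: nat using card_mono[OF _ that] by simp
  have "num_sv_ge \<sigma> M \<le> k"
  proof (rule card_le, rule subsetI)
    fix i assume i: "i \<in> {..<num_sv_ge \<sigma> M}"
    hence iq: "i < q" using num_sv_ge_segment(2)[OF M, of \<sigma>] by simp
    have "\<sigma> \<le> singular_values M ! i" using i less_num_sv_ge_iff[OF M iq] by simp
    hence "1 < t $ i" using t_ge[OF iq] \<sigma> by linarith
    thus "i \<in> {..<k}" using large_iff[OF iq] by simp
  qed
  moreover have "k \<le> num_sv_ge \<tau> M"
  proof (rule card_le, rule subsetI)
    fix i assume i: "i \<in> {..<k}"
    hence iq: "i < q" using kq by simp
    have "1 < t $ i" using i large_iff[OF iq] by simp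
    hence "\<rho> * \<tau> \<le> t $ i" using \<tau> by linarith
    hence "\<tau> \<le> t $ i / \<rho>" using \<rho> by (simp add: field_simps)
    hence "\<tau> \<le> singular_values M ! i" using t_le[OF iq] by linarith
    thus "i \<in> {..<num_sv_ge \<tau> M}" using less_num_sv_ge_iff[OF M iq] by simp
  qed
  \<comment> \<open>The number of estimates above 1 is squeezed between the counts at \<sigma> and
    at \<tau>, which the gap hypothesis makes equal. The cut of the algorithm at 1 thus falls
    exactly into the gap.\<close>
  ultimately have k\<sigma>: "num_sv_ge \<sigma> M = k" and k\<tau>: "num_sv_ge \<tau> M = k" using gap by auto
  have t_small: "t $ i \<le> \<rho> * \<tau>" if "i < q" "k \<le> i" for i
  proof -
    have "singular_values M ! i < \<tau>" using less_num_sv_ge_iff[OF M that(1), of \<tau>] that by (simp add: k\<tau>)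
    hence "t $ i / \<rho> \<le> \<tau>" using t_le[OF that(1)] by linarith
    thus ?thesis using \<rho> by (simp add: field_simps)
  qed
  have S: "S = {z \<in> carrier_vec q. \<forall>j<q. j < k \<longrightarrow> z \<bullet> col C j = 0}"
    using cheap_span_eq[OF C orth, of t] by (simp add: S_def k_def)
  have zero: "w = 0\<^sub>v q" if "w \<in> carrier_vec q" "\<And>j. j < q \<Longrightarrow> w \<bullet> col C j = 0" for w
  proof -
    obtain b where b: "b \<in> carrier_vec q" "w = C *\<^sub>v b" "\<forall>j<q. (w \<bullet> col C j = 0) = (b $ j = 0)"
      using orthogonal_columns_coordinates[OF C orth \<open>w \<in> carrier_vec q\<close>] by blast
    have "b = 0\<^sub>v q" using b that by (intro eq_vecI) auto
    thus ?thesis using C by (simp add: b(2))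
  qed
  have bound: "vnorm (M *\<^sub>v w) \<le> T * vnorm w"
    if w: "w \<in> carrier_vec q" "\<And>j. j < l \<Longrightarrow> j < q \<Longrightarrow> w \<bullet> col C j = 0" and l: "l < q \<Longrightarrow> t $ l \<le> T" and "0 \<le> T"
    for w l T
  proof (cases "l < q")
    case True
    have "w \<in> vspan q (set (drop l (cols C)))"
      unfolding vspan_drop_cols[OF C orth] using w by auto
    hence "vnorm (M *\<^sub>v w) \<le> t $ l * vnorm w" by (rule t_bound[OF True])
    also have "\<dots> \<le> T * vnorm w" using l[OF True] by (intro mult_right_mono) auto
    finally show ?thesis .
  next
    case False
    hence "w = 0\<^sub>v q" using w by (intro zero) auto
    thus ?thesis using M by simp
  qed
  have \<rho>\<tau>: "0 \<le> \<rho> * \<tau>" using \<rho> \<tau> by simp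
  show cheap: "vnorm (M *\<^sub>v w) \<le> \<rho> * \<tau> * vnorm w" if "w \<in> S" for w
    using that t_small by (intro bound[of w k]) (auto simp: S \<rho>\<tau>)
  \<comment> \<open>Stated for an arbitrary threshold because it is applied twice: at the gap, and
    at the smallest positive singular value.\<close>
  have expand: "(\<sigma>' - T) * vnorm y \<le> vnorm (M *\<^sub>v y)"
    if l: "num_sv_ge \<sigma>' M = l" and T: "0 \<le> T" "T < \<sigma>'" "l < q \<Longrightarrow> t $ l \<le> T"
      and y: "y \<in> carrier_vec q" "\<And>j. l \<le> j \<Longrightarrow> j < q \<Longrightarrow> y \<bullet> col C j = 0" for \<sigma>' T l y
  proof -
    have \<sigma>'0: "0 \<le> \<sigma>'" using T by simp
    obtain W where W: "W \<in> carrier_mat q l" "\<And>a. a \<in> carrier_vec l \<Longrightarrow> vnorm (W *\<^sub>v a) = vnorm a"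
      "\<And>a. a \<in> carrier_vec l \<Longrightarrow> \<sigma>' * vnorm a \<le> vnorm (M *\<^sub>v (W *\<^sub>v a))"
      using exists_expanding_isometry[OF M \<sigma>'0] unfolding l by blast
    have lq: "l \<le> q" using num_sv_ge_segment(2)[OF M, of \<sigma>'] by (simp add: l)
    have "vnorm (M *\<^sub>v w) \<le> T * vnorm w"
      if "w \<in> carrier_vec q" "\<And>j. j < l \<Longrightarrow> w \<bullet> col C j = 0" for w
      using that T by (intro bound[of w l]) auto
    from orthogonal_complement_expansion[OF M C orth lq W this T(1,2) y]
    show ?thesis by blast
  qed
  show "\<exists>y w. y \<in> carrier_vec q \<and> w \<in> S \<and> z = y + w \<and> y \<bullet> w = 0 \<and>
      (\<sigma> - \<rho> * \<tau>) * vnorm y \<le> vnorm (M *\<^sub>v y)" if z: "z \<in> carrier_vec q" for z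
  proof -
    obtain y w where yw: "y \<in> carrier_vec q" "w \<in> carrier_vec q" "z = y + w" "y \<bullet> w = 0"
      "\<forall>j<q. j < k \<longrightarrow> w \<bullet> col C j = 0" "\<forall>j<q. k \<le> j \<longrightarrow> y \<bullet> col C j = 0"
      using orthogonal_columns_decomposition[OF C orth z, of k] by blast
    have "(\<sigma> - \<rho> * \<tau>) * vnorm y \<le> vnorm (M *\<^sub>v y)"
      using yw \<rho>\<tau> \<tau> \<sigma> t_small by (intro expand[OF k\<sigma>]) auto
    thus ?thesis using yw by (auto simp: S)
  qed
  show "z \<in> S" if z: "z \<in> carrier_vec q" "M *\<^sub>v z = 0\<^sub>v p" for z
  proof (cases "k = 0")
    case True
    thus ?thesis using z by (simp add: S)
  next
    case False
    \<comment> \<open>r is the rank of M and s below its smallest positive singular value. Splitting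
      z at r, instead of at the gap, isolates the kernel.\<close>
    define Z where "Z = {i. i < q \<and> 0 < singular_values M ! i}"
    define r where "r = card Z"
    have Z: "Z = {..<r}"
      unfolding Z_def r_def by (rule initial_segment_eq_lessThan_card) (use sv_mono in \<open>force intro: less_le_trans\<close>)
    have rq: "r \<le> q" using card_mono[of "{..<q}" Z] by (auto simp: r_def Z_def)
    have kr: "k \<le> r"
    proof (rule card_le, rule subsetI)
      fix i assume "i \<in> {..<k}"
      hence "i < q" "\<tau> \<le> singular_values M ! i" using kq less_num_sv_ge_iff[OF M, of i \<tau>] by (auto simp: k\<tau>)
      thus "i \<in> {..<r}" using \<tau> unfolding Z[symmetric] by (simp add: Z_def)
    qed
    define s where "s = singular_values M ! (r - 1)"
    have r1: "r - 1 \<in> Z" using kr False unfolding Z by simp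
    have s: "0 < s" using r1 by (simp add: s_def Z_def)
    have iff: "s \<le> singular_values M ! i \<longleftrightarrow> i < r" if "i < q" for i
    proof
      assume "s \<le> singular_values M ! i"
      hence "i \<in> Z" using s that by (simp add: Z_def)
      thus "i < r" by (simp add: Z)
    next
      assume "i < r"
      thus "s \<le> singular_values M ! i" unfolding s_def using rq by (intro sv_mono) auto
    qed
    have "{i. i < q \<and> s \<le> singular_values M ! i} = {..<r}" using iff rq by auto
    hence nr: "num_sv_ge s M = r" using M by (simp add: num_sv_ge_def)
    \<comment> \<open>Multiplicative accuracy at a zero singular value: t / \<rho> \<le> 0. M
      therefore vanishes on the columns of C from r on.\<close>
    have tr: "t $ r \<le> 0" if "r < q"
    proof -
      have "r \<notin> Z" by (simp add: Z)
      hence "singular_values M ! r \<le> 0" using that by (simp add: Z_def)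
      hence "t $ r / \<rho> \<le> 0" using t_le[OF that] by linarith
      thus ?thesis using \<rho> by (simp add: divide_le_0_iff)
    qed
    obtain y w where yw: "y \<in> carrier_vec q" "w \<in> carrier_vec q" "z = y + w"
      "\<forall>j<q. j < r \<longrightarrow> w \<bullet> col C j = 0" "\<forall>j<q. r \<le> j \<longrightarrow> y \<bullet> col C j = 0"
      using orthogonal_columns_decomposition[OF C orth z(1), of r] by blast
    have "vnorm (M *\<^sub>v w) \<le> 0 * vnorm w" using yw tr by (intro bound[of w r]) auto
    hence "vnorm (M *\<^sub>v w) = 0" using vnorm_ge_0[of "M *\<^sub>v w"] by linarith
    hence Mw: "M *\<^sub>v w = 0\<^sub>v p" using vnorm_eq_0_iff[of "M *\<^sub>v w" p] M yw by auto
    have "M *\<^sub>v z = M *\<^sub>v y + M *\<^sub>v w" unfolding yw(3) using M yw by (intro mult_add_distrib_mat_vec) auto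
    hence "M *\<^sub>v y = 0\<^sub>v p" using z(2) Mw M yw by simp
    moreover have "(s - 0) * vnorm y \<le> vnorm (M *\<^sub>v y)"
      using yw tr s by (intro expand[OF nr]) auto
    ultimately have "s * vnorm y \<le> 0" by simp
    hence "vnorm y \<le> 0" using s by (simp add: mult_le_0_iff)
    hence "vnorm y = 0" using vnorm_ge_0[of y] by linarith
    hence "y = 0\<^sub>v q" using vnorm_eq_0_iff[OF yw(1)] by simp
    hence "z = w" using yw by simp
    thus ?thesis using yw kr by (auto simp: S)
  qed
qed

text \<open>For the second claim the expensive component y of v_J is discarded. Its lift costs at
  most that of v_J plus that of w, the lift of v_J costs at most v_I by minimality, and M expands y
  by \<sigma> - \<rho> \<tau>, so y is short.\<close>

lemma cheap_lift_gap:
  fixes P C :: "real mat"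
  assumes P: "is_orth_proj n P" and part: "I \<union> J = {..<n}" "I \<inter> J = {}"
    and svd: "rho_svd \<rho> (submatrix (lift_mat P J) I UNIV) C t" and \<rho>: "1 \<le> \<rho>"
    and \<tau>: "0 < \<tau>" "\<rho> * \<tau> \<le> 1" and \<sigma>: "1 < \<sigma>"
    and gap: "num_sv_ge \<tau> (submatrix (lift_mat P J) I UNIV) \<le> num_sv_ge \<sigma> (submatrix (lift_mat P J) I UNIV)"
  defines "L \<equiv> lift_mat P J" and "S \<equiv> cheap_span C t"
  shows "\<And>w. w \<in> S \<Longrightarrow> vnorm (subvec (L *\<^sub>v w) I) \<le> \<rho> * \<tau> * vnorm (subvec (L *\<^sub>v w) J)"
    and "\<And>v. v \<in> carrier_vec n \<Longrightarrow> P *\<^sub>v v = v \<Longrightarrow> \<exists>w\<in>S. (\<sigma> - \<rho> * \<tau>) *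
      vnorm (subvec v J - subvec (L *\<^sub>v w) J) \<le> vnorm (subvec v I) + \<rho> * \<tau> * vnorm (subvec v J)"
proof -
  have I: "I \<subseteq> {..<n}" and J: "J \<subseteq> {..<n}" using part by auto
  note LD = lift_mat_properties[OF P J, folded L_def]
  define M where "M = submatrix L I UNIV"
  define q where "q = card J"
  have Lc: "L \<in> carrier_mat n q" using LD(1) by (simp add: q_def)
  have M: "M \<in> carrier_mat (card I) q" unfolding M_def by (rule submatrix_rows_carrier[OF Lc I])
  have Mv: "M *\<^sub>v v = subvec (L *\<^sub>v v) I" if "v \<in> carrier_vec q" for v
    unfolding M_def by (rule submatrix_rows_mult_vec[OF Lc I that])
  note G = rho_svd_gap[OF M svd[folded L_def, folded M_def] \<rho> \<tau> \<sigma> gap[folded L_def, folded M_def], folded S_def]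
  have C: "C \<in> carrier_mat q q" "corthogonal (cols C)"
    using svd M by (auto simp: rho_svd_def Let_def simp flip: L_def M_def)
  obtain k where S: "S = {z \<in> carrier_vec q. \<forall>j<q. j < k \<longrightarrow> z \<bullet> col C j = 0}"
    using cheap_span_eq[OF C] by (simp add: S_def)
  have Sc: "w \<in> carrier_vec q" if "w \<in> S" for w using that by (simp add: S)
  have Sdiff: "w - w' \<in> S" if "w \<in> S" "w' \<in> S" for w w'
  proof -
    have "(w - w') \<bullet> col C j = 0" if "j < q" "j < k" for j
    proof -
      have "col C j \<in> carrier_vec q" using C that by auto
      hence "(w - w') \<bullet> col C j = w \<bullet> col C j - w' \<bullet> col C j"
        using \<open>w \<in> S\<close> \<open>w' \<in> S\<close> by (intro minus_scalar_prod_distrib[of _ q]) (auto simp: S)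
      thus ?thesis using \<open>w \<in> S\<close> \<open>w' \<in> S\<close> that by (simp add: S)
    qed
    thus ?thesis using that by (auto simp: S)
  qed
  have Lv: "L *\<^sub>v v \<in> carrier_vec n" if "v \<in> carrier_vec q" for v using Lc that by auto
  have sub: "subvec (L *\<^sub>v v) J \<in> carrier_vec q" if "v \<in> carrier_vec q" for v
    using subvec_carrier[OF Lv[OF that] J] by (simp add: q_def)
  show "vnorm (subvec (L *\<^sub>v w) I) \<le> \<rho> * \<tau> * vnorm (subvec (L *\<^sub>v w) J)" if w: "w \<in> S" for w
  proof -
    \<comment> \<open>The bound is wanted relative to the J-part w' of the lift, which can be
      shorter than w. Both have the same lift, so w - w' is in the kernel of M and hence in S, and
      the cheapness estimate applies to w' itself.\<close>
    define w' where "w' = subvec (L *\<^sub>v w) J"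
    have w': "w' \<in> carrier_vec q" using sub[OF Sc[OF w]] by (simp add: w'_def)
    have Lw': "L *\<^sub>v w' = L *\<^sub>v w" using LD(5)[of w] Sc[OF w] by (simp add: w'_def q_def)
    have "M *\<^sub>v (w - w') = M *\<^sub>v w - M *\<^sub>v w'"
      using M Sc[OF w] w' by (intro mult_minus_distrib_mat_vec) auto
    also have "\<dots> = 0\<^sub>v (card I)" using Sc[OF w] w' M by (simp add: Mv Lw' subvec_carrier[OF Lv I])
    finally have "w - w' \<in> S" using Sc[OF w] w' by (intro G(2)) auto
    hence "w - (w - w') \<in> S" by (rule Sdiff[OF w])
    moreover have "w - (w - w') = w'" using Sc[OF w] w' by (intro eq_vecI) auto
    ultimately have "w' \<in> S" by simp
    hence "vnorm (M *\<^sub>v w') \<le> \<rho> * \<tau> * vnorm w'" by (rule G(1))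
    thus ?thesis using w' by (simp add: Mv Lw' flip: w'_def)
  qed
  show "\<exists>w\<in>S. (\<sigma> - \<rho> * \<tau>) * vnorm (subvec v J - subvec (L *\<^sub>v w) J) \<le>
      vnorm (subvec v I) + \<rho> * \<tau> * vnorm (subvec v J)" if v: "v \<in> carrier_vec n" "P *\<^sub>v v = v" for v
  proof -
    define z where "z = subvec v J"
    have z: "z \<in> carrier_vec q" using subvec_carrier[OF v(1) J] by (simp add: z_def q_def)
    obtain y w where yw: "y \<in> carrier_vec q" "w \<in> S" "z = y + w" "y \<bullet> w = 0"
      "(\<sigma> - \<rho> * \<tau>) * vnorm y \<le> vnorm (M *\<^sub>v y)" using G(3)[OF z] by blast
    have w: "w \<in> carrier_vec q" using Sc[OF yw(2)] .
    have "z = subvec (L *\<^sub>v z) J" using LD(3)[OF v] by (simp add: z_def)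
    also have "L *\<^sub>v z = L *\<^sub>v y + L *\<^sub>v w"
      unfolding yw(3) using Lc yw w by (intro mult_add_distrib_mat_vec) auto
    also have "subvec \<dots> J = subvec (L *\<^sub>v y) J + subvec (L *\<^sub>v w) J"
      using Lv yw w J by (intro subvec_add) auto
    finally have "z - subvec (L *\<^sub>v w) J = subvec (L *\<^sub>v y) J"
      using sub[OF yw(1)] sub[OF w] by auto
    hence le1: "vnorm (z - subvec (L *\<^sub>v w) J) \<le> vnorm y" using LD(6)[of y] yw by (simp add: q_def)
    have wz: "vnorm w \<le> vnorm z"
    proof -
      have "z \<bullet> z = y \<bullet> y + w \<bullet> w" unfolding yw(3) using scalar_prod_add_self[OF yw(1) w] yw(4) by simp
      thus ?thesis using scalar_prod_self_ge_0[of y] by (simp add: vnorm_le_vnorm_iff)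
    qed
    have y: "y = z - w" using yw w by auto
    have My: "M *\<^sub>v y = M *\<^sub>v z - M *\<^sub>v w"
      unfolding y using M z w by (intro mult_minus_distrib_mat_vec) auto
    have Mc: "M *\<^sub>v z \<in> carrier_vec (card I)" "M *\<^sub>v w \<in> carrier_vec (card I)" using M z w by auto
    have \<rho>\<tau>: "0 \<le> \<rho> * \<tau>" using \<rho> \<tau> by simp
    have "(\<sigma> - \<rho> * \<tau>) * vnorm (z - subvec (L *\<^sub>v w) J) \<le> (\<sigma> - \<rho> * \<tau>) * vnorm y"
      using le1 \<tau> \<sigma> by (intro mult_left_mono) auto
    also have "\<dots> \<le> vnorm (M *\<^sub>v y)" by (rule yw(5))
    also have "\<dots> \<le> vnorm (M *\<^sub>v z) + vnorm (M *\<^sub>v w)" unfolding My by (rule vnorm_triangle_diff[OF Mc])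
    also have "vnorm (M *\<^sub>v z) \<le> vnorm (subvec v I)"
      using lift_mat_minimal[OF P part v] by (simp add: M_def L_def z_def)
    also have "vnorm (M *\<^sub>v w) \<le> \<rho> * \<tau> * vnorm w" by (rule G(1)[OF yw(2)])
    also have "\<rho> * \<tau> * vnorm w \<le> \<rho> * \<tau> * vnorm z" by (rule mult_left_mono[OF wz \<rho>\<tau>])
    finally show ?thesis using yw(2) by (auto simp: z_def)
  qed
qed

text \<open>Multiplication by r maps the range of P' onto that of P. An expanding subspace for the
  lift of P' is lifted, multiplied by r and restricted to J. The J-part grows by at most b, and the
  I-part of the new minimal lift shrinks by no worse than a, so the result is an expanding subspace
  for the lift of P with threshold a / b times the old one.\<close>

lemma num_sv_ge_lift_rescale:
  fixes P P' :: "real mat"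
  assumes P: "is_orth_proj n P" and P': "is_orth_proj n P'"
    and part: "I \<union> J = {..<n}" "I \<inter> J = {}"
    and r: "r \<in> carrier_vec n" "\<And>i. i < n \<Longrightarrow> 0 < r $ i"
    and maps: "\<And>v. v \<in> carrier_vec n \<Longrightarrow> P' *\<^sub>v v = v \<longleftrightarrow> P *\<^sub>v (r \<odot>\<^sub>v v) = r \<odot>\<^sub>v v"
    and a: "0 < a" "\<And>i. i \<in> I \<Longrightarrow> a \<le> r $ i" and b: "0 < b" "\<And>i. i \<in> J \<Longrightarrow> r $ i \<le> b"
    and \<tau>: "0 < \<tau>"
  shows "num_sv_ge \<tau> (submatrix (lift_mat P' J) I UNIV) \<le>
    num_sv_ge (a / b * \<tau>) (submatrix (lift_mat P J) I UNIV)"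
proof -
  have I: "I \<subseteq> {..<n}" and J: "J \<subseteq> {..<n}" using part by auto
  define q where "q = card J"
  define L where "L = lift_mat P J"
  define L' where "L' = lift_mat P' J"
  define M where "M = submatrix L I UNIV"
  define M' where "M' = submatrix L' I UNIV"
  note LD = lift_mat_properties[OF P J, folded L_def q_def]
  note LD' = lift_mat_properties[OF P' J, folded L'_def q_def]
  have M: "M \<in> carrier_mat (card I) q" unfolding M_def by (rule submatrix_rows_carrier[OF LD(1) I])
  have M': "M' \<in> carrier_mat (card I) q" unfolding M'_def by (rule submatrix_rows_carrier[OF LD'(1) I])
  define k where "k = num_sv_ge \<tau> M'"
  obtain W where W: "W \<in> carrier_mat q k" "\<And>a. a \<in> carrier_vec k \<Longrightarrow> vnorm (W *\<^sub>v a) = vnorm a"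
    "\<And>a. a \<in> carrier_vec k \<Longrightarrow> \<tau> * vnorm a \<le> vnorm (M' *\<^sub>v (W *\<^sub>v a))"
    using exists_expanding_isometry[OF M', of \<tau>] \<tau> unfolding k_def by force
  have M'v: "M' *\<^sub>v v = subvec (L' *\<^sub>v v) I" if "v \<in> carrier_vec q" for v
    unfolding M'_def by (rule submatrix_rows_mult_vec[OF LD'(1) I that])
  have Wa: "W *\<^sub>v c \<in> carrier_vec q" if "c \<in> carrier_vec k" for c using W that by auto
  have L'c: "L' *\<^sub>v v \<in> carrier_vec n" if "v \<in> carrier_vec q" for v using LD'(1) that by auto
  define R where "R = mat n n (\<lambda>(i, j). if i = j then r $ i else 0)"
  have R: "R \<in> carrier_mat n n" by (simp add: R_def)
  have Rv: "R *\<^sub>v v = r \<odot>\<^sub>v v" if "v \<in> carrier_vec n" for v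
  proof (rule eq_vecI)
    fix i assume "i < dim_vec (r \<odot>\<^sub>v v)"
    hence i: "i < n" using r by simp
    have "(R *\<^sub>v v) $ i = (\<Sum>j<n. (if i = j then r $ i else 0) * v $ j)"
      using i that by (simp add: R_def scalar_prod_eq_sum[of _ n])
    also have "\<dots> = (\<Sum>j<n. if i = j then r $ i * v $ j else 0)" by (intro sum.cong) auto
    finally show "(R *\<^sub>v v) $ i = (r \<odot>\<^sub>v v) $ i" using i r by simp
  qed (use r R in auto)
  define F where "F = submatrix (R * (L' * W)) J UNIV"
  have L'W: "L' * W \<in> carrier_mat n k" using LD'(1) W(1) by simp
  have RLW: "R * (L' * W) \<in> carrier_mat n k" using R L'W by simp
  have F: "F \<in> carrier_mat q k" unfolding F_def q_def by (rule submatrix_rows_carrier[OF RLW J])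
  have Fc: "F *\<^sub>v c = subvec (r \<odot>\<^sub>v (L' *\<^sub>v (W *\<^sub>v c))) J" if "c \<in> carrier_vec k" for c
  proof -
    have "F *\<^sub>v c = subvec ((R * (L' * W)) *\<^sub>v c) J"
      unfolding F_def by (rule submatrix_rows_mult_vec[OF RLW J that])
    also have "(R * (L' * W)) *\<^sub>v c = R *\<^sub>v ((L' * W) *\<^sub>v c)"
      using R L'W that by (intro assoc_mult_mat_vec) auto
    also have "(L' * W) *\<^sub>v c = L' *\<^sub>v (W *\<^sub>v c)"
      using LD'(1) W(1) that by (intro assoc_mult_mat_vec) auto
    finally show ?thesis using Rv[OF L'c[OF Wa[OF that]]] by simp
  qed
  have key: "a / b * \<tau> * vnorm (F *\<^sub>v c) \<le> vnorm (M *\<^sub>v (F *\<^sub>v c)) \<and> (F *\<^sub>v c = 0\<^sub>v q \<longrightarrow> c = 0\<^sub>v k)"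
    if c: "c \<in> carrier_vec k" for c
  proof -
    define u where "u = L' *\<^sub>v (W *\<^sub>v c)"
    have u: "u \<in> carrier_vec n" using L'c[OF Wa[OF c]] by (simp add: u_def)
    have P'u: "P' *\<^sub>v u = u" using LD'(2)[OF Wa[OF c]] by (simp add: u_def)
    define v where "v = r \<odot>\<^sub>v u"
    have v: "v \<in> carrier_vec n" using r by (simp add: v_def)
    have vi: "v $ i = r $ i * u $ i" if "i < n" for i using that r by (simp add: v_def)
    have Pv: "P *\<^sub>v v = v" using maps[OF u] P'u by (simp add: v_def)
    have Fv: "F *\<^sub>v c = subvec v J" by (simp add: Fc[OF c] v_def u_def)
    have svJ: "subvec v J \<in> carrier_vec q" using subvec_carrier[OF v J] by (simp add: q_def)
    have suJ: "vnorm (subvec u J) \<le> vnorm c" using LD'(6)[OF Wa[OF c]] W(2)[OF c] by (simp add: u_def)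
    have uI: "\<tau> * vnorm c \<le> vnorm (subvec u I)" using W(3)[OF c] M'v[OF Wa[OF c]] by (simp add: u_def)
    have vJ: "vnorm (subvec v J) \<le> b * vnorm (subvec u J)"
    proof (rule vnorm_subvec_mono[OF v u J])
      fix i assume "i \<in> J"
      moreover from this have "i < n" using J by auto
      ultimately show "\<bar>v $ i\<bar> \<le> b * \<bar>u $ i\<bar>"
        using r(2)[of i] b(2)[of i] by (simp add: vi abs_mult mult_right_mono)
    qed (use b in simp)
    define w where "w = L *\<^sub>v subvec v J"
    have w: "w \<in> carrier_vec n" using LD(1) svJ by (auto simp: w_def)
    have Pw: "P *\<^sub>v w = w" using LD(2)[OF svJ] by (simp add: w_def)
    have wJ: "subvec w J = subvec v J" using LD(3)[OF v Pv] by (simp add: w_def)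
    \<comment> \<open>Minimality is used in the coordinates of P': the new lift divided by r has the
      same J-part as u, so its I-part cannot be shorter than that of u.\<close>
    define w' where "w' = w \<oslash>\<^sub>v r"
    have w': "w' \<in> carrier_vec n" using w by (simp add: w'_def)
    have w'i: "w' $ i = w $ i / r $ i" if "i < n" for i using that w by (simp add: w'_def)
    have "r \<odot>\<^sub>v w' = w"
    proof (rule eq_vecI)
      fix i assume "i < dim_vec w"
      thus "(r \<odot>\<^sub>v w') $ i = w $ i" using w r(1) r(2)[of i] by (simp add: w'i)
    qed (use w r in auto)
    hence P'w': "P' *\<^sub>v w' = w'" using maps[OF w'] Pw by simp
    have "subvec w' J = subvec u J"
    proof (rule eq_vecI)
      fix i assume "i < dim_vec (subvec u J)"
      hence i: "i < card J" using subvec_carrier[OF u J] by simp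
      have p: "pick J i < n" using pick_less[OF J i] by simp
      have "w $ pick J i = v $ pick J i"
        using arg_cong[OF wJ, of "\<lambda>x. x $ i"] i by (simp add: index_subvec[OF w J] index_subvec[OF v J])
      thus "subvec w' J $ i = subvec u J $ i"
        using i p r(2)[OF p] by (simp add: index_subvec[OF w' J] index_subvec[OF u J] w'i vi)
    qed (use subvec_carrier[OF w' J] subvec_carrier[OF u J] in auto)
    hence "vnorm (M' *\<^sub>v subvec u J) \<le> vnorm (subvec w' I)"
      using lift_mat_minimal[OF P' part w' P'w'] by (simp add: M'_def L'_def)
    moreover have suJc: "subvec u J \<in> carrier_vec q" using subvec_carrier[OF u J] by (simp add: q_def)
    have L'u: "L' *\<^sub>v subvec u J = u" using LD'(5)[OF Wa[OF c]] by (simp add: u_def)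
    ultimately have uI': "vnorm (subvec u I) \<le> vnorm (subvec w' I)" using M'v[OF suJc] by simp
    have "vnorm (subvec w' I) \<le> (1 / a) * vnorm (subvec w I)"
    proof (rule vnorm_subvec_mono[OF w' w I])
      fix i assume i: "i \<in> I"
      hence "i < n" using I by auto
      have "a * \<bar>w' $ i\<bar> \<le> r $ i * \<bar>w' $ i\<bar>" using a(2)[OF i] by (intro mult_right_mono) auto
      also have "\<dots> = \<bar>w $ i\<bar>" using r(2)[OF \<open>i < n\<close>] by (simp add: w'i[OF \<open>i < n\<close>])
      finally show "\<bar>w' $ i\<bar> \<le> 1 / a * \<bar>w $ i\<bar>" using a(1) by (simp add: field_simps)
    qed (use a in simp)
    hence wI: "a * vnorm (subvec u I) \<le> vnorm (subvec w I)"
      using uI' a(1) by (simp add: field_simps) (metis mult.commute mult_le_cancel_left_pos order_trans)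
    have "M *\<^sub>v (F *\<^sub>v c) = subvec w I"
      unfolding Fv M_def w_def by (rule submatrix_rows_mult_vec[OF LD(1) I svJ])
    moreover have "a / b * \<tau> * vnorm (F *\<^sub>v c) \<le> vnorm (subvec w I)"
    proof -
      have "a / b * \<tau> * vnorm (F *\<^sub>v c) \<le> a / b * \<tau> * (b * vnorm (subvec u J))"
        unfolding Fv using vJ a b \<tau> by (intro mult_left_mono) auto
      also have "\<dots> = a * (\<tau> * vnorm (subvec u J))" using b by simp
      also have "\<dots> \<le> a * (\<tau> * vnorm c)" using suJ a \<tau> by (intro mult_left_mono) auto
      also have "\<dots> \<le> a * vnorm (subvec u I)" using uI a by (intro mult_left_mono) auto
      finally show ?thesis using wI by simp
    qed
    moreover have "c = 0\<^sub>v k" if "F *\<^sub>v c = 0\<^sub>v q"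
    proof -
      have "subvec v J = 0\<^sub>v q" using that Fv by simp
      hence "v $ i = 0" if "i \<in> J" for i
        using abs_index_le_vnorm_subvec[OF v J that] by simp
      hence "\<bar>u $ i\<bar> \<le> 0 * \<bar>u $ i\<bar>" if "i \<in> J" for i
        using that J vi[of i] r(2)[of i] by fastforce
      hence "vnorm (subvec u J) \<le> 0 * vnorm (subvec u J)" by (intro vnorm_subvec_mono[OF u u J]) auto
      hence "vnorm (subvec u J) = 0" using vnorm_ge_0[of "subvec u J"] by linarith
      hence "subvec u J = 0\<^sub>v q" using vnorm_eq_0_iff[OF suJc] by simp
      hence "u = 0\<^sub>v n" using L'u LD'(1) by auto
      hence "vnorm (subvec u I) \<le> 0" using vnorm_subvec_le[OF u I] by simp
      hence "\<tau> * vnorm c \<le> 0" using uI by simp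
      hence "vnorm c \<le> 0" using \<tau> by (simp add: mult_le_0_iff)
      hence "vnorm c = 0" using vnorm_ge_0[of c] by linarith
      thus ?thesis using vnorm_eq_0_iff[OF c] by simp
    qed
    ultimately show ?thesis by simp
  qed
  have "k \<le> num_sv_ge (a / b * \<tau>) M"
    using key a b \<tau> by (intro expanding_injection_le_num_sv_ge[OF M F]) auto
  thus ?thesis by (simp add: k_def M_def M'_def L_def L'_def)
qed

section \<open>Feasible directions and the central path\<close>

lemma primal_spaceI:
  assumes "A \<in> carrier_mat m n" "w \<in> carrier_vec n" "A *\<^sub>v w = 0\<^sub>v m"
  shows "w \<in> primal_space A"
  using assms by (simp add: mat_kernel_def)

lemma primal_spaceD:
  assumes "A \<in> carrier_mat m n" "w \<in> primal_space A"
  shows "w \<in> carrier_vec n" "A *\<^sub>v w = 0\<^sub>v m"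
  using assms by (auto simp: mat_kernel_def)

lemma dual_space_carrier:
  assumes "A \<in> carrier_mat m n" "u \<in> dual_space A"
  shows "u \<in> carrier_vec n"
  using assms by (auto simp: dual_space_def)

lemma primal_dual_space_orthogonal:
  assumes A: "A \<in> carrier_mat m n" and w: "w \<in> primal_space A" and u: "u \<in> dual_space A"
  shows "w \<bullet> u = 0"
proof -
  obtain y where y: "y \<in> carrier_vec m" "u = A\<^sup>T *\<^sub>v y" using u A by (auto simp: dual_space_def)
  have "w \<bullet> u = (A *\<^sub>v w) \<bullet> y"
    using adjoint_scalar_prod[OF A primal_spaceD(1)[OF A w] y(1)] y by simp
  thus ?thesis using primal_spaceD[OF A w] y by simp
qed

text \<open>Describes im A^T by orthogonality to W, a condition that passes to coordinatewise
  limits.\<close>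

lemma dual_spaceI_orthogonal:
  assumes A: "A \<in> carrier_mat m n" and v: "v \<in> carrier_vec n"
    and orth: "\<And>w. w \<in> primal_space A \<Longrightarrow> w \<bullet> v = 0"
  shows "v \<in> dual_space A"
proof -
  obtain P where P: "P \<in> carrier_mat n n" "\<And>v. v \<in> carrier_vec n \<Longrightarrow> A *\<^sub>v (P *\<^sub>v v) = 0\<^sub>v m"
    "\<And>v. v \<in> carrier_vec n \<Longrightarrow> \<exists>y\<in>carrier_vec m. v - P *\<^sub>v v = A\<^sup>T *\<^sub>v y"
    using kernel_projection[OF A] by blast
  obtain y where y: "y \<in> carrier_vec m" "v - P *\<^sub>v v = A\<^sup>T *\<^sub>v y" using P(3)[OF v] by blast
  have Pv: "P *\<^sub>v v \<in> carrier_vec n" using P(1) v by auto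
  have mem: "P *\<^sub>v v \<in> primal_space A" by (rule primal_spaceI[OF A Pv P(2)[OF v]])
  have "A\<^sup>T *\<^sub>v y \<in> dual_space A" using y A by (auto simp: dual_space_def)
  hence "(P *\<^sub>v v) \<bullet> (v - P *\<^sub>v v) = 0" using primal_dual_space_orthogonal[OF A mem] y by simp
  hence "(P *\<^sub>v v) \<bullet> (P *\<^sub>v v) = 0"
    using orth[OF mem] Pv v by (simp add: scalar_prod_minus_distrib[of _ n])
  hence "P *\<^sub>v v = 0\<^sub>v n" using scalar_prod_self_eq_0_iff[OF Pv] by simp
  hence "v = A\<^sup>T *\<^sub>v y" using y v by simp
  thus ?thesis using y A by (auto simp: dual_space_def)
qed

lemma dual_space_add:
  assumes A: "A \<in> carrier_mat m n" and "u \<in> dual_space A" "v \<in> dual_space A"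
  shows "u + v \<in> dual_space A"
proof -
  obtain y y' where y: "y \<in> carrier_vec m" "u = A\<^sup>T *\<^sub>v y" "y' \<in> carrier_vec m" "v = A\<^sup>T *\<^sub>v y'"
    using assms by (auto simp: dual_space_def)
  have "u + v = A\<^sup>T *\<^sub>v (y + y')" using y A by (simp add: mult_add_distrib_mat_vec[of _ n m])
  thus ?thesis using y A by (auto simp: dual_space_def)
qed

lemma dual_space_smult:
  assumes A: "A \<in> carrier_mat m n" and "u \<in> dual_space A"
  shows "a \<cdot>\<^sub>v u \<in> dual_space A"
proof -
  obtain y where y: "y \<in> carrier_vec m" "u = A\<^sup>T *\<^sub>v y"
    using assms by (auto simp: dual_space_def)
  have "a \<cdot>\<^sub>v u = A\<^sup>T *\<^sub>v (a \<cdot>\<^sub>v y)" using y A by (simp add: mult_mat_vec[of _ n m])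
  thus ?thesis using y A by (auto simp: dual_space_def)
qed

lemma primal_space_smult:
  assumes A: "A \<in> carrier_mat m n" and "u \<in> primal_space A"
  shows "a \<cdot>\<^sub>v u \<in> primal_space A"
  using primal_spaceD[OF assms] A by (intro primal_spaceI[OF A]) (auto simp: mult_mat_vec[OF A])

lemma primal_space_diff:
  assumes A: "A \<in> carrier_mat m n" and "u \<in> primal_space A" "v \<in> primal_space A"
  shows "u - v \<in> primal_space A"
  using primal_spaceD[OF A assms(2)] primal_spaceD[OF A assms(3)] A
  by (intro primal_spaceI[OF A]) (auto simp: mult_minus_distrib_mat_vec[OF A])

lemma dual_space_diff:
  assumes A: "A \<in> carrier_mat m n" and "u \<in> dual_space A" "v \<in> dual_space A"
  shows "u - v \<in> dual_space A"
proof -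
  have "u - v = u + (- 1) \<cdot>\<^sub>v v"
    using dual_space_carrier[OF A assms(2)] dual_space_carrier[OF A assms(3)] by (intro eq_vecI) auto
  thus ?thesis using dual_space_add[OF A assms(2) dual_space_smult[OF A assms(3)]] by simp
qed

section \<open>Interior points\<close>

lemma primal_interior_iff:
  assumes "A \<in> carrier_mat m n"
  shows "x \<in> primal_interior A b \<longleftrightarrow> x \<in> carrier_vec n \<and> A *\<^sub>v x = b \<and> (\<forall>i<n. 0 < x $ i)"
  using assms by (auto simp: primal_interior_def primal_feasible_def less_imp_le)

lemma dual_interior_iff:
  assumes "A \<in> carrier_mat m n"
  shows "s \<in> dual_interior A c \<longleftrightarrow> s \<in> carrier_vec n \<and>
    (\<exists>y\<in>carrier_vec m. A\<^sup>T *\<^sub>v y + s = c) \<and> (\<forall>i<n. 0 < s $ i)"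
  using assms by (auto simp: dual_interior_def dual_feasible_def less_imp_le)

lemma primal_interior_diff:
  assumes A: "A \<in> carrier_mat m n" and "x \<in> primal_interior A b" "x' \<in> primal_interior A b"
  shows "x' - x \<in> primal_space A"
proof -
  have x: "x \<in> carrier_vec n" "x' \<in> carrier_vec n" "A *\<^sub>v x = b" "A *\<^sub>v x' = b"
    using assms by (auto simp: primal_interior_iff[OF A])
  have "b \<in> carrier_vec m" using A x by auto
  thus ?thesis using x A by (intro primal_spaceI[OF A]) (auto simp: mult_minus_distrib_mat_vec[OF A])
qed

lemma dual_interior_diff:
  assumes A: "A \<in> carrier_mat m n" and "s \<in> dual_interior A c" "s' \<in> dual_interior A c"
  shows "s' - s \<in> dual_space A"
proof -
  obtain y y' where s: "s \<in> carrier_vec n" "s' \<in> carrier_vec n" and y: "y \<in> carrier_vec m" "y' \<in> carrier_vec m"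
    and eq: "A\<^sup>T *\<^sub>v y + s = c" "A\<^sup>T *\<^sub>v y' + s' = c"
    using assms by (auto simp: dual_interior_iff[OF A])
  have "s' - s = A\<^sup>T *\<^sub>v (y - y')"
  proof (rule eq_vecI)
    fix i assume "i < dim_vec (A\<^sup>T *\<^sub>v (y - y'))"
    hence i: "i < n" using A by simp
    have "(A\<^sup>T *\<^sub>v y) $ i + s $ i = (A\<^sup>T *\<^sub>v y') $ i + s' $ i"
      using arg_cong[OF eq(1)[folded eq(2)], of "\<lambda>v. v $ i"] i s A by simp
    moreover have "(A\<^sup>T *\<^sub>v (y - y')) $ i = (A\<^sup>T *\<^sub>v y) $ i - (A\<^sup>T *\<^sub>v y') $ i"
      using i y A by (subst mult_minus_distrib_mat_vec[of _ n m]) auto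
    ultimately show "(s' - s) $ i = (A\<^sup>T *\<^sub>v (y - y')) $ i" using i s by simp
  qed (use s A in auto)
  thus ?thesis using y A by (auto simp: dual_space_def)
qed

lemma primal_interior_add:
  assumes A: "A \<in> carrier_mat m n" and x: "x \<in> primal_interior A b" and w: "w \<in> primal_space A"
    and pos: "\<And>i. i < n \<Longrightarrow> 0 < x $ i + w $ i"
  shows "x + w \<in> primal_interior A b"
proof -
  have xb: "x \<in> carrier_vec n" "A *\<^sub>v x = b" using x by (auto simp: primal_interior_iff[OF A])
  have "b \<in> carrier_vec m" using A xb by auto
  thus ?thesis using xb A primal_spaceD[OF A w] pos
    by (auto simp: primal_interior_iff[OF A] mult_add_distrib_mat_vec[OF A])
qed

lemma dual_interior_add:
  assumes A: "A \<in> carrier_mat m n" and s: "s \<in> dual_interior A c" and u: "u \<in> dual_space A"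
    and pos: "\<And>i. i < n \<Longrightarrow> 0 < s $ i + u $ i"
  shows "s + u \<in> dual_interior A c"
proof -
  obtain y where y: "s \<in> carrier_vec n" "y \<in> carrier_vec m" "A\<^sup>T *\<^sub>v y + s = c"
    using s by (auto simp: dual_interior_iff[OF A])
  obtain y' where y': "y' \<in> carrier_vec m" "u = A\<^sup>T *\<^sub>v y'" using u A by (auto simp: dual_space_def)
  have uc: "u \<in> carrier_vec n" by (rule dual_space_carrier[OF A u])
  have "A\<^sup>T *\<^sub>v (y - y') = A\<^sup>T *\<^sub>v y - u" using y y' A by (simp add: mult_minus_distrib_mat_vec[of _ n m])
  hence "A\<^sup>T *\<^sub>v (y - y') + (s + u) = A\<^sup>T *\<^sub>v y + s" using y uc A by (intro eq_vecI) auto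
  hence "\<exists>y\<in>carrier_vec m. A\<^sup>T *\<^sub>v y + (s + u) = c" using y y' by (intro bexI[of _ "y - y'"]) auto
  thus ?thesis using y uc pos by (auto simp: dual_interior_iff[OF A])
qed

text \<open>With D = sqrt(x / s), dx = D p and ds = q / D, the equation becomes p + q = r / sqrt(x
  s) with p in D^{-1} W and q in its orthogonal complement. The solution is the orthogonal
  decomposition of the right-hand side.\<close>

lemma exists_newton_direction:
  assumes A: "A \<in> carrier_mat m n" and x: "x \<in> carrier_vec n" and s: "s \<in> carrier_vec n"
    and pos: "\<And>i. i < n \<Longrightarrow> 0 < x $ i" "\<And>i. i < n \<Longrightarrow> 0 < s $ i" and r: "r \<in> carrier_vec n"
  shows "\<exists>dx ds. newton_direction A x s r dx ds"
proof -
  define D where "D = vec n (\<lambda>i. sqrt (x $ i / s $ i))"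
  have D: "D \<in> carrier_vec n" "\<forall>i<n. 0 < D $ i" using pos by (auto simp: D_def)
  note PD = orth_proj_scaled_kernel[OF A D]
  define P where "P = orth_proj n (vscale (map_vec inverse D) (primal_space A))"
  note P = is_orth_projD[OF PD(1), folded P_def]
  define r' where "r' = vec n (\<lambda>i. r $ i / sqrt (x $ i * s $ i))"
  have r': "r' \<in> carrier_vec n" by (simp add: r'_def)
  define p where "p = P *\<^sub>v r'"
  define q where "q = (1\<^sub>m n - P) *\<^sub>v r'"
  have p: "p \<in> carrier_vec n" using P(1) r' by (auto simp: p_def)
  have q_eq: "q = r' - p" unfolding q_def p_def using P(1) r' by (subst minus_mult_distrib_mat_vec[of _ n n]) auto
  have q: "q \<in> carrier_vec n" using r' p by (simp add: q_eq)
  have "P *\<^sub>v p = p" using P(4)[OF r'] by (simp add: p_def)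
  hence dx: "D \<odot>\<^sub>v p \<in> primal_space A" using PD(2)[OF p] by (simp add: P_def)
  have "(1\<^sub>m n - P) *\<^sub>v q = q"
    using is_orth_projD(4)[OF is_orth_proj_complement[OF PD(1)] r'] by (simp add: q_def P_def)
  hence ds: "map_vec inverse D \<odot>\<^sub>v q \<in> dual_space A" using PD(3)[OF q] by (simp add: P_def)
  have "s \<odot>\<^sub>v (D \<odot>\<^sub>v p) + x \<odot>\<^sub>v (map_vec inverse D \<odot>\<^sub>v q) = r"
  proof (rule eq_vecI)
    fix i assume "i < dim_vec r"
    hence i: "i < n" using r by simp
    have xs: "0 < x $ i" "0 < s $ i" using pos i by auto
    have 1: "s $ i * sqrt (x $ i / s $ i) = sqrt (x $ i * s $ i)"
      using xs by (simp add: real_sqrt_mult real_sqrt_divide field_simps)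
    have 2: "x $ i * inverse (sqrt (x $ i / s $ i)) = sqrt (x $ i * s $ i)"
      using xs by (simp add: real_sqrt_mult real_sqrt_divide field_simps)
    have "(s \<odot>\<^sub>v (D \<odot>\<^sub>v p) + x \<odot>\<^sub>v (map_vec inverse D \<odot>\<^sub>v q)) $ i =
        (s $ i * sqrt (x $ i / s $ i)) * p $ i + (x $ i * inverse (sqrt (x $ i / s $ i))) * q $ i"
      using i x s p q by (simp add: D_def)
    also have "\<dots> = sqrt (x $ i * s $ i) * r' $ i"
      unfolding 1 2 using i r' p by (simp add: q_eq algebra_simps)
    also have "\<dots> = r $ i" using i xs by (simp add: r'_def)
    finally show "(s \<odot>\<^sub>v (D \<odot>\<^sub>v p) + x \<odot>\<^sub>v (map_vec inverse D \<odot>\<^sub>v q)) $ i = r $ i" .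
  qed (use x s r in auto)
  thus ?thesis using dx ds by (auto simp: newton_direction_def)
qed

section \<open>Uniqueness and existence of the central path\<close>

lemma scalar_prod_cross:
  assumes A: "A \<in> carrier_mat m n" and x: "x \<in> primal_interior A b" "x' \<in> primal_interior A b"
    and s: "s \<in> dual_interior A c" "s' \<in> dual_interior A c"
  shows "x \<bullet> s' + x' \<bullet> s = x \<bullet> s + x' \<bullet> s'"
proof -
  have c: "x \<in> carrier_vec n" "x' \<in> carrier_vec n" "s \<in> carrier_vec n" "s' \<in> carrier_vec n"
    using assms by (auto simp: primal_interior_iff[OF A] dual_interior_iff[OF A])
  have "(x' - x) \<bullet> (s' - s) = 0"
    by (rule primal_dual_space_orthogonal[OF A primal_interior_diff[OF A x] dual_interior_diff[OF A s]])
  thus ?thesis using c by (simp add: minus_scalar_prod_distrib[of _ n] scalar_prod_minus_distrib[of _ n])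
qed

text \<open>All terms of the cross sum x . s' + x' . s are positive, so each is bounded by the
  total. The near monotonicity of coordinates along the path rests on this.\<close>

lemma coordinate_products_le:
  assumes A: "A \<in> carrier_mat m n" and x: "x \<in> primal_interior A b" "x' \<in> primal_interior A b"
    and s: "s \<in> dual_interior A c" "s' \<in> dual_interior A c" and "i < n"
  shows "x' $ i * s $ i \<le> x \<bullet> s + x' \<bullet> s'" "x $ i * s' $ i \<le> x \<bullet> s + x' \<bullet> s'"
proof -
  have c: "s \<in> carrier_vec n" "s' \<in> carrier_vec n"
    and pos: "\<And>i. i < n \<Longrightarrow> 0 < x $ i" "\<And>i. i < n \<Longrightarrow> 0 < x' $ i" "\<And>i. i < n \<Longrightarrow> 0 < s $ i" "\<And>i. i < n \<Longrightarrow> 0 < s' $ i"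
    using assms by (auto simp: primal_interior_iff[OF A] dual_interior_iff[OF A])
  have 1: "x' $ i * s $ i \<le> x' \<bullet> s" "0 \<le> x' \<bullet> s"
    unfolding scalar_prod_eq_sum[OF c(1)] using \<open>i < n\<close> pos
    by (auto intro!: member_le_sum sum_nonneg simp: less_imp_le)
  have 2: "x $ i * s' $ i \<le> x \<bullet> s'" "0 \<le> x \<bullet> s'"
    unfolding scalar_prod_eq_sum[OF c(2)] using \<open>i < n\<close> pos
    by (auto intro!: member_le_sum sum_nonneg simp: less_imp_le)
  show "x' $ i * s $ i \<le> x \<bullet> s + x' \<bullet> s'" "x $ i * s' $ i \<le> x \<bullet> s + x' \<bullet> s'"
    using 1 2 scalar_prod_cross[OF A x s] by auto
qed

lemma central_point_unique:
  assumes A: "A \<in> carrier_mat m n" and x: "x \<in> primal_interior A b" "x' \<in> primal_interior A b"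
    and s: "s \<in> dual_interior A c" "s' \<in> dual_interior A c"
    and \<mu>: "\<And>i. i < n \<Longrightarrow> x $ i * s $ i = \<mu>" "\<And>i. i < n \<Longrightarrow> x' $ i * s' $ i = \<mu>"
  shows "x = x' \<and> s = s'"
proof -
  have c: "x \<in> carrier_vec n" "x' \<in> carrier_vec n" "s \<in> carrier_vec n" "s' \<in> carrier_vec n"
    and pos: "\<And>i. i < n \<Longrightarrow> 0 < x $ i" "\<And>i. i < n \<Longrightarrow> 0 < x' $ i" "\<And>i. i < n \<Longrightarrow> 0 < s $ i" "\<And>i. i < n \<Longrightarrow> 0 < s' $ i"
    using assms by (auto simp: primal_interior_iff[OF A] dual_interior_iff[OF A])
  have eq: "(\<Sum>i<n. x $ i * s' $ i + x' $ i * s $ i - 2 * \<mu>) = 0"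
    using scalar_prod_cross[OF A x s] c \<mu>
    by (simp add: scalar_prod_eq_sum[of _ n] sum.distrib sum_subtractf)
  \<comment> \<open>Substituting x = \<mu> / s and x' = \<mu> / s' exhibits each term of the
    vanishing cross sum as a weighted square.\<close>
  have summand: "x $ i * s' $ i + x' $ i * s $ i - 2 * \<mu> = s $ i * s' $ i / \<mu> * (x $ i - x' $ i)\<^sup>2" if "i < n" for i
  proof -
    have "0 < \<mu>" using \<mu>(1)[OF that] pos(1,3)[OF that] by (metis mult_pos_pos)
    have "s $ i * s' $ i * (x $ i - x' $ i)\<^sup>2 =
      (x $ i * s $ i) * (x $ i * s' $ i) + (x' $ i * s' $ i) * (x' $ i * s $ i) - 2 * ((x $ i * s $ i) * (x' $ i * s' $ i))"
      by (simp add: power2_eq_square algebra_simps)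
    also have "\<dots> = \<mu> * (x $ i * s' $ i + x' $ i * s $ i - 2 * \<mu>)"
      unfolding \<mu>[OF that] by (simp add: algebra_simps)
    finally have E: "s $ i * s' $ i * (x $ i - x' $ i)\<^sup>2 = \<mu> * (x $ i * s' $ i + x' $ i * s $ i - 2 * \<mu>)" .
    have "s $ i * s' $ i / \<mu> * (x $ i - x' $ i)\<^sup>2 = (s $ i * s' $ i * (x $ i - x' $ i)\<^sup>2) / \<mu>" by simp
    also have "\<dots> = x $ i * s' $ i + x' $ i * s $ i - 2 * \<mu>" unfolding E using \<open>0 < \<mu>\<close> by simp
    finally show ?thesis ..
  qed
  have "\<mu> > 0" if "i < n" for i using \<mu>(1)[OF that] pos(1,3)[OF that] by (metis mult_pos_pos)
  hence nonneg: "0 \<le> s $ i * s' $ i / \<mu> * (x $ i - x' $ i)\<^sup>2" if "i < n" for i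
    using pos(3,4)[OF that] that by (simp add: less_imp_le)
  have "(\<Sum>i<n. s $ i * s' $ i / \<mu> * (x $ i - x' $ i)\<^sup>2) = 0" using eq by (simp add: summand)
  hence "s $ i * s' $ i / \<mu> * (x $ i - x' $ i)\<^sup>2 = 0" if "i < n" for i
    using that nonneg by (subst (asm) sum_nonneg_eq_0_iff) auto
  hence xx: "x $ i = x' $ i" if "i < n" for i
    using that pos(3,4)[OF that] \<open>\<And>i. i < n \<Longrightarrow> \<mu> > 0\<close>[OF that] by force
  have "s $ i = s' $ i" if "i < n" for i
    using \<mu>(1)[OF that] \<mu>(2)[OF that] xx[OF that] pos(2)[OF that] by (metis less_irrefl mult_left_cancel)
  thus ?thesis using xx c by (auto intro!: eq_vecI)
qed

text \<open>The tangent of the logarithm at 2 \<mu> / a absorbs half of the linear term. What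
  remains forces t into a compact interval of positive numbers.\<close>

lemma linear_minus_log_bounds:
  fixes a \<mu> t M :: real
  assumes "0 < a" "0 < \<mu>" "0 < t"
  defines "C \<equiv> \<mu> * \<bar>ln (a / (2 * \<mu>))\<bar>"
  shows "- C \<le> a * t - \<mu> * ln t"
    and "a * t - \<mu> * ln t \<le> M \<Longrightarrow> exp (- M / \<mu>) \<le> t \<and> t \<le> 2 * (M + C) / a"
proof -
  have "ln (a * t / (2 * \<mu>)) \<le> a * t / (2 * \<mu>) - 1" using assms by (intro ln_le_minus_one) auto
  moreover have "ln (a * t / (2 * \<mu>)) = ln (a / (2 * \<mu>)) + ln t"
    using assms ln_mult_pos[of "a / (2 * \<mu>)" t] by (simp add: field_simps)
  ultimately have "ln t \<le> a * t / (2 * \<mu>) - ln (a / (2 * \<mu>))" by linarith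
  hence "\<mu> * ln t \<le> \<mu> * (a * t / (2 * \<mu>) - ln (a / (2 * \<mu>)))" using assms by (intro mult_left_mono) auto
  also have "\<dots> = a * t / 2 - \<mu> * ln (a / (2 * \<mu>))" using assms by (simp add: field_simps)
  also have "\<dots> \<le> a * t / 2 + C"
    using assms abs_ge_minus_self[of "ln (a / (2 * \<mu>))"] mult_left_mono[of "- ln (a / (2 * \<mu>))" "\<bar>ln (a / (2 * \<mu>))\<bar>" \<mu>]
    by (simp add: C_def)
  finally have le: "a * t / 2 - C \<le> a * t - \<mu> * ln t" by simp
  have at: "0 < a * t" using assms by simp
  show "- C \<le> a * t - \<mu> * ln t" using le at by linarith
  assume M: "a * t - \<mu> * ln t \<le> M"
  hence "a * t / 2 \<le> M + C" using le by linarith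
  hence "a * t \<le> 2 * (M + C)" by simp
  moreover have "- M \<le> \<mu> * ln t" using M at by linarith
  hence "- M / \<mu> \<le> ln t" using assms(2) by (simp only: pos_divide_le_eq mult.commute)
  hence "exp (- M / \<mu>) \<le> t" using assms by (metis exp_le_cancel_iff exp_ln)
  ultimately show "exp (- M / \<mu>) \<le> t \<and> t \<le> 2 * (M + C) / a" using assms by (simp add: field_simps)
qed

text \<open>The central point minimises the barrier \<open>\<Sum>\<^sub>i (x\<^sub>i s\<^sub>i - \<mu> ln (x\<^sub>i s\<^sub>i))\<close>, whose
  derivative along a Newton direction towards \<open>x s = \<mu>\<close> is
  \<open>- \<Sum>\<^sub>i (x\<^sub>i s\<^sub>i - \<mu>)\<^sup>2 / (x\<^sub>i s\<^sub>i)\<close>.\<close>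

definition barrier :: "nat \<Rightarrow> real \<Rightarrow> real vec \<Rightarrow> real vec \<Rightarrow> real" where
  "barrier n \<mu> x s = (\<Sum>i<n. x $ i * s $ i - \<mu> * ln (x $ i * s $ i))"

text \<open>Sublevel sets of the barrier lie in a box away from 0 and infinity, because the barrier
  dominates a sum of coercive functions of single coordinates.\<close>

lemma barrier_minimizer_exists:
  assumes A: "A \<in> carrier_mat m n" and c: "c \<in> carrier_vec n" and x0: "x0 \<in> primal_interior A b" and s0: "s0 \<in> dual_interior A c"
    and \<mu>: "0 < \<mu>"
  shows "\<exists>x\<in>primal_interior A b. \<exists>s\<in>dual_interior A c.
    \<forall>x'\<in>primal_interior A b. \<forall>s'\<in>dual_interior A c. barrier n \<mu> x s \<le> barrier n \<mu> x' s'"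
proof -
  have x0D: "x0 \<in> carrier_vec n" "A *\<^sub>v x0 = b" "\<And>i. i < n \<Longrightarrow> 0 < x0 $ i"
    using x0 by (auto simp: primal_interior_iff[OF A])
  have s0D: "s0 \<in> carrier_vec n" "\<And>i. i < n \<Longrightarrow> 0 < s0 $ i"
    using s0 by (auto simp: dual_interior_iff[OF A])
  \<comment> \<open>The inserted 1 keeps the minimum over a nonempty set and positive even for n =
    0.\<close>
  define \<delta> where "\<delta> = Min (insert 1 ((\<lambda>i. min (x0 $ i) (s0 $ i)) ` {..<n}))"
  have \<delta>: "0 < \<delta>" unfolding \<delta>_def using x0D s0D by (subst Min_gr_iff) auto
  have \<delta>i: "\<delta> \<le> x0 $ i" "\<delta> \<le> s0 $ i" if "i < n" for i
  proof -
    have "\<delta> \<le> min (x0 $ i) (s0 $ i)" unfolding \<delta>_def using that by (intro Min_le) auto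
    thus "\<delta> \<le> x0 $ i" "\<delta> \<le> s0 $ i" by auto
  qed
  define C where "C = \<mu> * \<bar>ln (\<delta> / (2 * \<mu>))\<bar>"
  have C0: "0 \<le> C" using \<mu> by (simp add: C_def)
  note lb = linear_minus_log_bounds[OF \<delta> \<mu>, folded C_def]
  define g where "g t = \<delta> * t - \<mu> * ln t" for t
  have g: "- C \<le> g t" if "0 < t" for t using lb(1)[OF that] by (simp add: g_def)
  \<comment> \<open>The bilinear term x . s equals x . s0 + x0 . s up to the constant x0 . s0, so
    the barrier separates into functions of single coordinates.\<close>
  have split: "(\<Sum>i<n. g (x $ i) + g (s $ i)) - x0 \<bullet> s0 \<le> barrier n \<mu> x s"
    if x: "x \<in> primal_interior A b" and s: "s \<in> dual_interior A c" for x s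
  proof -
    have xD: "x \<in> carrier_vec n" "\<And>i. i < n \<Longrightarrow> 0 < x $ i"
      using x by (auto simp: primal_interior_iff[OF A])
    have sD: "s \<in> carrier_vec n" "\<And>i. i < n \<Longrightarrow> 0 < s $ i"
      using s by (auto simp: dual_interior_iff[OF A])
    have "(\<Sum>i<n. g (x $ i) + g (s $ i)) \<le>
        (\<Sum>i<n. (x $ i * s0 $ i + x0 $ i * s $ i) - \<mu> * ln (x $ i * s $ i))"
    proof (rule sum_mono)
      fix i assume "i \<in> {..<n}"
      hence i: "i < n" by simp
      have "\<delta> * x $ i \<le> x $ i * s0 $ i" "\<delta> * s $ i \<le> x0 $ i * s $ i"
        using mult_right_mono[OF \<delta>i(2)[OF i], of "x $ i"] mult_right_mono[OF \<delta>i(1)[OF i], of "s $ i"]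
          xD(2)[OF i] sD(2)[OF i] by (simp_all add: mult.commute)
      moreover have "ln (x $ i * s $ i) = ln (x $ i) + ln (s $ i)"
        using xD(2)[OF i] sD(2)[OF i] by (rule ln_mult_pos)
      ultimately show "g (x $ i) + g (s $ i) \<le> (x $ i * s0 $ i + x0 $ i * s $ i) - \<mu> * ln (x $ i * s $ i)"
        by (simp add: g_def algebra_simps)
    qed
    also have "\<dots> = x \<bullet> s0 + x0 \<bullet> s - (\<Sum>i<n. \<mu> * ln (x $ i * s $ i))"
      using xD sD s0D x0D by (simp add: scalar_prod_eq_sum[of _ n] sum.distrib sum_subtractf)
    also have "x \<bullet> s0 + x0 \<bullet> s = x \<bullet> s + x0 \<bullet> s0" by (rule scalar_prod_cross[OF A x x0 s s0])
    also have "x \<bullet> s + x0 \<bullet> s0 - (\<Sum>i<n. \<mu> * ln (x $ i * s $ i)) = barrier n \<mu> x s + x0 \<bullet> s0"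
      using sD by (simp add: barrier_def scalar_prod_eq_sum[of s n] sum_subtractf)
    finally show ?thesis by simp
  qed
  define M where "M = barrier n \<mu> x0 s0 + x0 \<bullet> s0 + (2 * real n) * C"
  define lo where "lo = exp (- M / \<mu>)"
  define hi where "hi = 2 * (M + C) / \<delta>"
  \<comment> \<open>Adding 2 C makes every summand nonnegative, so that one summand is bounded by
    the whole sum.\<close>
  have box: "lo \<le> x $ i \<and> x $ i \<le> hi \<and> lo \<le> s $ i \<and> s $ i \<le> hi"
    if x: "x \<in> primal_interior A b" and s: "s \<in> dual_interior A c"
      and le: "barrier n \<mu> x s \<le> barrier n \<mu> x0 s0" and i: "i < n" for x s i
  proof -
    have xp: "0 < x $ i" if "i < n" for i using x that by (auto simp: primal_interior_iff[OF A])
    have sp: "0 < s $ i" if "i < n" for i using s that by (auto simp: dual_interior_iff[OF A])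
    have "g (x $ i) + g (s $ i) + 2 * C \<le> (\<Sum>i<n. g (x $ i) + g (s $ i) + 2 * C)"
    proof (rule member_le_sum)
      fix j assume "j \<in> {..<n} - {i}"
      thus "0 \<le> g (x $ j) + g (s $ j) + 2 * C" using g[OF xp[of j]] g[OF sp[of j]] by simp
    qed (use i in auto)
    also have "\<dots> = (\<Sum>i<n. g (x $ i) + g (s $ i)) + (2 * real n) * C" by (simp add: sum.distrib)
    also have "\<dots> \<le> M" using split[OF x s] le by (simp add: M_def)
    finally have "g (x $ i) \<le> M" "g (s $ i) \<le> M" using g[OF xp[OF i]] g[OF sp[OF i]] C0 by linarith+
    thus ?thesis
      using lb(2)[OF xp[OF i], of M] lb(2)[OF sp[OF i], of M] by (simp add: g_def lo_def hi_def)
  qed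
  have lo0: "0 < lo" by (simp add: lo_def)
  \<comment> \<open>The pair (x, s) is stored as one vector of length 2 n, to which the extreme
    value theorem applies.\<close>
  define X where "X v = vec n (\<lambda>i. v $ i)" for v :: "real vec"
  define S where "S v = vec n (\<lambda>i. v $ (n + i))" for v :: "real vec"
  define K where "K = {v \<in> carrier_vec (n + n). X v \<in> primal_interior A b \<and> S v \<in> dual_interior A c \<and>
     (\<forall>i<n + n. lo \<le> v $ i \<and> v $ i \<le> hi)}"
  have join: "X (x @\<^sub>v s) = x" "S (x @\<^sub>v s) = s" "x @\<^sub>v s \<in> carrier_vec (n + n)"
    if "x \<in> carrier_vec n" "s \<in> carrier_vec n" for x s
    using that by (auto simp: X_def S_def intro!: eq_vecI)
  have inK: "x @\<^sub>v s \<in> K" if x: "x \<in> primal_interior A b" and s: "s \<in> dual_interior A c"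
      and le: "barrier n \<mu> x s \<le> barrier n \<mu> x0 s0" for x s
  proof -
    have cx: "x \<in> carrier_vec n" "s \<in> carrier_vec n"
      using x s by (auto simp: primal_interior_iff[OF A] dual_interior_iff[OF A])
    have "lo \<le> (x @\<^sub>v s) $ i \<and> (x @\<^sub>v s) $ i \<le> hi" if "i < n + n" for i
      using box[OF x s le, of i] box[OF x s le, of "i - n"] cx that by (cases "i < n") auto
    thus ?thesis using join[OF cx] x s by (simp add: K_def)
  qed
  have "\<exists>v\<in>K. \<forall>w\<in>K. barrier n \<mu> (X v) (S v) \<le> barrier n \<mu> (X w) (S w)"
  proof (rule attains_min_closed_bounded[where n = "n + n" and C = hi])
    show "K \<noteq> {}" using inK[OF x0 s0] by auto
    show "K \<subseteq> carrier_vec (n + n)" by (auto simp: K_def)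
    show "\<bar>v $ i\<bar> \<le> hi" if "v \<in> K" "i < n + n" for v i
    proof -
      have "lo \<le> v $ i" "v $ i \<le> hi" using that by (auto simp: K_def)
      thus ?thesis using lo0 by simp
    qed
    show "v \<in> K" if V: "\<And>k. V k \<in> K" "v \<in> carrier_vec (n + n)"
      "\<And>i. i < n + n \<Longrightarrow> (\<lambda>k::nat. V k $ i) \<longlonglongrightarrow> v $ i" for V v
    proof -
      have bnd: "lo \<le> v $ i \<and> v $ i \<le> hi" if "i < n + n" for i
      proof
        have "lo \<le> V k $ i" "V k $ i \<le> hi" for k using V(1)[of k] that by (auto simp: K_def)
        thus "lo \<le> v $ i" "v $ i \<le> hi"
          by (auto intro: LIMSEQ_le_const[OF V(3)[OF that]] LIMSEQ_le_const2[OF V(3)[OF that]])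
      qed
      have XS: "X v \<in> carrier_vec n" "S v \<in> carrier_vec n" "\<And>k. X (V k) \<in> carrier_vec n" "\<And>k. S (V k) \<in> carrier_vec n"
        by (auto simp: X_def S_def)
      have limX: "(\<lambda>k. X (V k) $ i) \<longlonglongrightarrow> X v $ i" if "i < n" for i using V(3)[of i] that by (simp add: X_def)
      have limS: "(\<lambda>k. S (V k) $ i) \<longlonglongrightarrow> S v $ i" if "i < n" for i using V(3)[of "n + i"] that by (simp add: S_def)
      have bc: "b \<in> carrier_vec m" using A x0D by auto
      have AX: "A *\<^sub>v X v = b"
      proof (rule eq_vecI)
        fix i assume "i < dim_vec b"
        hence i: "i < m" using bc by simp
        have "(\<lambda>k. (A *\<^sub>v X (V k)) $ i) \<longlonglongrightarrow> (A *\<^sub>v X v) $ i"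
          by (rule mult_mat_vec_tendsto[OF A XS(3) XS(1) limX i])
        moreover have "A *\<^sub>v X (V k) = b" for k using V(1)[of k] by (simp add: K_def primal_interior_iff[OF A])
        ultimately have "(\<lambda>k::nat. b $ i) \<longlonglongrightarrow> (A *\<^sub>v X v) $ i" by simp
        thus "(A *\<^sub>v X v) $ i = b $ i" using LIMSEQ_unique tendsto_const by blast
      qed (use A bc in auto)
      have "0 < X v $ i" "0 < S v $ i" if "i < n" for i
        using bnd[of i] bnd[of "n + i"] lo0 that by (auto simp: X_def S_def)
      hence Xv: "X v \<in> primal_interior A b" and Spos: "\<forall>i<n. 0 < S v $ i"
        using AX XS by (auto simp: primal_interior_iff[OF A])
      \<comment> \<open>Dual feasibility involves an unknown multiplier. Orthogonality to W replaces
        it by conditions that survive the limit.\<close>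
      have "S v - s0 \<in> dual_space A"
      proof (rule dual_spaceI_orthogonal[OF A])
        fix w assume w: "w \<in> primal_space A"
        have wc: "w \<in> carrier_vec n" using primal_spaceD[OF A w] by simp
        have "(\<lambda>k. w \<bullet> S (V k)) \<longlonglongrightarrow> w \<bullet> S v"
          by (rule scalar_prod_tendsto[of _ n]) (use XS limS in auto)
        moreover have "w \<bullet> S (V k) = w \<bullet> s0" for k
        proof -
          have "S (V k) \<in> dual_interior A c" using V(1)[of k] by (simp add: K_def)
          from primal_dual_space_orthogonal[OF A w dual_interior_diff[OF A s0 this]]
          show ?thesis using wc XS s0D by (simp add: scalar_prod_minus_distrib[of _ n])
        qed
        ultimately have "(\<lambda>k::nat. w \<bullet> s0) \<longlonglongrightarrow> w \<bullet> S v" by simp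
        hence "w \<bullet> S v = w \<bullet> s0" using LIMSEQ_unique tendsto_const by blast
        thus "w \<bullet> (S v - s0) = 0" using wc XS s0D by (simp add: scalar_prod_minus_distrib[of _ n])
      qed (use XS s0D in simp)
      moreover have "s0 + (S v - s0) = S v" using XS s0D by auto
      ultimately have "S v \<in> dual_interior A c"
        using dual_interior_add[OF A s0, of "S v - s0"] Spos XS s0D by auto
      thus ?thesis using Xv bnd V(2) by (simp add: K_def)
    qed
    show "(\<lambda>k. barrier n \<mu> (X (V k)) (S (V k))) \<longlonglongrightarrow> barrier n \<mu> (X v) (S v)"
      if V: "\<And>k. V k \<in> K" "v \<in> K" "\<And>i. i < n + n \<Longrightarrow> (\<lambda>k::nat. V k $ i) \<longlonglongrightarrow> v $ i" for V v
    proof -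
      have "0 < v $ i" if "i < n + n" for i using V(2) that lo0 by (force simp: K_def)
      hence "v $ i * v $ (n + i) \<noteq> 0" if "i < n" for i using that by (metis add_less_cancel_left mult_eq_0_iff order_less_irrefl trans_less_add1)
      thus ?thesis using V(3)
        unfolding barrier_def X_def S_def by (auto intro!: tendsto_intros)
    qed
  qed
  then obtain v where v: "v \<in> K" "\<And>w. w \<in> K \<Longrightarrow> barrier n \<mu> (X v) (S v) \<le> barrier n \<mu> (X w) (S w)" by blast
  have min: "barrier n \<mu> (X v) (S v) \<le> barrier n \<mu> x s"
    if x: "x \<in> primal_interior A b" and s: "s \<in> dual_interior A c" for x s
  proof (cases "barrier n \<mu> x s \<le> barrier n \<mu> x0 s0")
    case True
    have "x \<in> carrier_vec n" "s \<in> carrier_vec n"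
      using x s by (auto simp: primal_interior_iff[OF A] dual_interior_iff[OF A])
    thus ?thesis using v(2)[OF inK[OF x s True]] by (simp add: join)
  next
    case False
    have "barrier n \<mu> (X v) (S v) \<le> barrier n \<mu> x0 s0"
      using v(2)[OF inK[OF x0 s0 order_refl]] x0D s0D by (simp add: join)
    thus ?thesis using False by simp
  qed
  have "X v \<in> primal_interior A b" "S v \<in> dual_interior A c" using v(1) by (auto simp: K_def)
  thus ?thesis using min by blast
qed

lemma barrier_minimizer_central:
  assumes A: "A \<in> carrier_mat m n" and x: "x \<in> primal_interior A b" and s: "s \<in> dual_interior A c"
    and \<mu>: "0 < \<mu>"
    and min: "\<forall>x'\<in>primal_interior A b. \<forall>s'\<in>dual_interior A c. barrier n \<mu> x s \<le> barrier n \<mu> x' s'"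
    and "i < n"
  shows "x $ i * s $ i = \<mu>"
proof -
  have xc: "x \<in> carrier_vec n" "s \<in> carrier_vec n"
    and pos: "\<And>i. i < n \<Longrightarrow> 0 < x $ i" "\<And>i. i < n \<Longrightarrow> 0 < s $ i"
    using x s by (auto simp: primal_interior_iff[OF A] dual_interior_iff[OF A])
  define r where "r = vec n (\<lambda>i. \<mu> - x $ i * s $ i)"
  obtain dx ds where "newton_direction A x s r dx ds"
    using exists_newton_direction[OF A xc pos, of r] by (auto simp: r_def)
  hence d: "dx \<in> primal_space A" "ds \<in> dual_space A" and eq: "s \<odot>\<^sub>v dx + x \<odot>\<^sub>v ds = r"
    by (auto simp: newton_direction_def)
  have dc: "dx \<in> carrier_vec n" "ds \<in> carrier_vec n"
    using primal_spaceD[OF A d(1)] dual_space_carrier[OF A d(2)] by auto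
  have di: "s $ i * dx $ i + x $ i * ds $ i = \<mu> - x $ i * s $ i" if "i < n" for i
    using arg_cong[OF eq, of "\<lambda>v. v $ i"] that xc dc by (simp add: r_def)
  define h where "h t = (\<Sum>i<n. (x $ i + t * dx $ i) * (s $ i + t * ds $ i)
      - \<mu> * ln ((x $ i + t * dx $ i) * (s $ i + t * ds $ i)))" for t
  have "(h has_real_derivative (\<Sum>i<n. - ((\<mu> - x $ i * s $ i)\<^sup>2 / (x $ i * s $ i)))) (at 0)"
    unfolding h_def
  proof (rule DERIV_sum)
    fix i assume "i \<in> {..<n}"
    hence i: "i < n" by simp
    have p: "0 < x $ i * s $ i" using pos i by simp
    define q where "q = x $ i * s $ i"
    define D where "D = \<mu> - q"
    define F where "F t = (x $ i + t * dx $ i) * (s $ i + t * ds $ i)" for t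
    have F0: "F 0 = q" by (simp add: F_def q_def)
    have FD: "(F has_real_derivative D) (at 0)"
      unfolding F_def using di[OF i] by (auto intro!: derivative_eq_intros simp: D_def q_def algebra_simps)
    have "((\<lambda>t. F t - \<mu> * ln (F t)) has_real_derivative D - \<mu> * (D / q)) (at 0)"
      using p by (auto intro!: derivative_eq_intros FD simp: F0 q_def[symmetric])
    moreover have "D - \<mu> * (D / q) = - (D\<^sup>2 / q)"
    proof -
      have "0 < q" using p by (simp add: q_def)
      have "D * q - \<mu> * D = - D\<^sup>2" by (simp add: D_def power2_eq_square algebra_simps)
      hence "(D * q - \<mu> * D) / q = - D\<^sup>2 / q" by simp
      thus ?thesis using \<open>0 < q\<close> by (simp add: diff_divide_distrib)
    qed
    ultimately show "((\<lambda>t. (x $ i + t * dx $ i) * (s $ i + t * ds $ i)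
      - \<mu> * ln ((x $ i + t * dx $ i) * (s $ i + t * ds $ i))) has_real_derivative
        - ((\<mu> - x $ i * s $ i)\<^sup>2 / (x $ i * s $ i))) (at 0)"
      unfolding F_def by (simp add: D_def q_def)
  qed
  note deriv = this
  have "\<exists>d>0. \<forall>t. \<bar>0 - t\<bar> < d \<longrightarrow> h 0 \<le> h t"
  proof -
    have "\<forall>\<^sub>F t in nhds 0. \<forall>i\<in>{..<n}. 0 < x $ i + t * dx $ i \<and> 0 < s $ i + t * ds $ i"
    proof (rule eventually_ball_finite, simp, rule ballI)
      fix i assume "i \<in> {..<n}"
      hence i: "i < n" by simp
      have "((\<lambda>t. x $ i + t * dx $ i) \<longlongrightarrow> x $ i + 0 * dx $ i) (nhds 0)"
        "((\<lambda>t. s $ i + t * ds $ i) \<longlongrightarrow> s $ i + 0 * ds $ i) (nhds 0)"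
        by (intro tendsto_intros filterlim_ident)+
      hence "\<forall>\<^sub>F t in nhds 0. 0 < x $ i + t * dx $ i" "\<forall>\<^sub>F t in nhds 0. 0 < s $ i + t * ds $ i"
        using pos[OF i] by (auto dest: order_tendstoD(1)[where a = 0])
      thus "\<forall>\<^sub>F t in nhds 0. 0 < x $ i + t * dx $ i \<and> 0 < s $ i + t * ds $ i" by (rule eventually_conj)
    qed
    then obtain d where d0: "0 < d" and dp: "\<And>t i. \<bar>t\<bar> < d \<Longrightarrow> i < n \<Longrightarrow> 0 < x $ i + t * dx $ i \<and> 0 < s $ i + t * ds $ i"
      by (auto simp: eventually_nhds_metric dist_real_def)
    have "h 0 \<le> h t" if t: "\<bar>t\<bar> < d" for t
    proof -
      have "x + t \<cdot>\<^sub>v dx \<in> primal_interior A b"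
        using dp[OF t] dc by (intro primal_interior_add[OF A x primal_space_smult[OF A d(1)]]) auto
      moreover have "s + t \<cdot>\<^sub>v ds \<in> dual_interior A c"
        using dp[OF t] dc by (intro dual_interior_add[OF A s dual_space_smult[OF A d(2)]]) auto
      ultimately have "barrier n \<mu> x s \<le> barrier n \<mu> (x + t \<cdot>\<^sub>v dx) (s + t \<cdot>\<^sub>v ds)" using min by blast
      thus ?thesis using xc dc by (simp add: h_def barrier_def)
    qed
    thus ?thesis using d0 by (intro exI[of _ d]) auto
  qed
  then obtain d where "0 < d" "\<forall>t. \<bar>0 - t\<bar> < d \<longrightarrow> h 0 \<le> h t" by auto
  from DERIV_local_min[OF deriv this]
  have "(\<Sum>i<n. - ((\<mu> - x $ i * s $ i)\<^sup>2 / (x $ i * s $ i))) = 0" .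
  define f where "f i = (\<mu> - x $ i * s $ i)\<^sup>2 / (x $ i * s $ i)" for i
  have "sum f {..<n} = 0"
    using \<open>(\<Sum>i<n. - ((\<mu> - x $ i * s $ i)\<^sup>2 / (x $ i * s $ i))) = 0\<close> by (simp add: f_def sum_negf)
  moreover have "0 \<le> f i" if "i \<in> {..<n}" for i
    using pos[of i] that by (simp add: f_def less_imp_le)
  ultimately have "f i = 0" using \<open>i < n\<close> sum_nonneg_0[of "{..<n}" f i] by simp
  hence "(\<mu> - x $ i * s $ i)\<^sup>2 = 0 \<or> x $ i * s $ i = 0"
    unfolding f_def by (rule divide_eq_0_iff[THEN iffD1])
  thus ?thesis using pos[OF \<open>i < n\<close>] by auto
qed

text \<open>The definite description in \<open>central_point_pos\<close> is justified by the
  minimiser of the barrier and by uniqueness.\<close>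

lemma central_point_props:
  assumes lp: "lp_instance m n A b c" and \<mu>: "0 < \<mu>"
  shows "fst (central_point A b c \<mu>) \<in> primal_interior A b"
    and "snd (central_point A b c \<mu>) \<in> dual_interior A c"
    and "\<And>i. i < n \<Longrightarrow> fst (central_point A b c \<mu>) $ i * snd (central_point A b c \<mu>) $ i = \<mu>"
proof -
  have A: "A \<in> carrier_mat m n" and c: "c \<in> carrier_vec n"
    and ne: "primal_interior A b \<noteq> {}" "dual_interior A c \<noteq> {}"
    using lp by (auto simp: lp_instance_def)
  define Q where "Q z \<longleftrightarrow> fst z \<in> primal_interior A b \<and> snd z \<in> dual_interior A c \<and>
        fst z \<odot>\<^sub>v snd z = \<mu> \<cdot>\<^sub>v ones (dim_col A)" for z
  have Q_iff: "Q z \<longleftrightarrow> fst z \<in> primal_interior A b \<and> snd z \<in> dual_interior A c \<and>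
      (\<forall>i<n. fst z $ i * snd z $ i = \<mu>)" for z
  proof -
    have "fst z \<odot>\<^sub>v snd z = \<mu> \<cdot>\<^sub>v ones n \<longleftrightarrow> (\<forall>i<n. fst z $ i * snd z $ i = \<mu>)"
      if fz: "fst z \<in> carrier_vec n"
    proof
      assume eq: "fst z \<odot>\<^sub>v snd z = \<mu> \<cdot>\<^sub>v ones n"
      show "\<forall>i<n. fst z $ i * snd z $ i = \<mu>"
      proof (intro allI impI)
        fix i assume "i < n"
        thus "fst z $ i * snd z $ i = \<mu>"
          using arg_cong[OF eq, of "\<lambda>v. v $ i"] carrier_vecD[OF fz] by (simp add: ones_def)
      qed
    next
      assume "\<forall>i<n. fst z $ i * snd z $ i = \<mu>"
      thus "fst z \<odot>\<^sub>v snd z = \<mu> \<cdot>\<^sub>v ones n"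
        using fz by (intro eq_vecI) (auto simp: ones_def)
    qed
    thus ?thesis unfolding Q_def using A by (auto simp: primal_interior_iff[OF A])
  qed
  obtain x s where xs: "x \<in> primal_interior A b" "s \<in> dual_interior A c"
    "\<forall>x'\<in>primal_interior A b. \<forall>s'\<in>dual_interior A c. barrier n \<mu> x s \<le> barrier n \<mu> x' s'"
    using barrier_minimizer_exists[OF A c _ _ \<mu>] ne by blast
  have "Q (x, s)" using xs barrier_minimizer_central[OF A xs(1,2) \<mu> xs(3)] by (simp add: Q_iff)
  moreover have "z = w" if "Q z" "Q w" for z w
  proof -
    have "fst z = fst w \<and> snd z = snd w"
      by (rule central_point_unique[OF A, of _ b _ _ c _ \<mu>]) (use that in \<open>simp_all add: Q_iff\<close>)
    thus ?thesis by (simp add: prod_eq_iff)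
  qed
  ultimately have "\<exists>!z. Q z" by blast
  hence "Q (THE z. Q z)" by (rule theI')
  hence "Q (central_point A b c \<mu>)"
    using \<mu> by (simp add: central_point_def central_point_pos_def Q_def)
  thus "fst (central_point A b c \<mu>) \<in> primal_interior A b"
    "snd (central_point A b c \<mu>) \<in> dual_interior A c"
    "\<And>i. i < n \<Longrightarrow> fst (central_point A b c \<mu>) $ i * snd (central_point A b c \<mu>) $ i = \<mu>"
    unfolding Q_iff by blast+
qed

section \<open>Neighbourhoods of the central path\<close>

lemma mubar_eq: "x \<in> carrier_vec n \<Longrightarrow> mubar (x, s) = (x \<bullet> s) / real n"
  by (simp add: mubar_def)

lemma nbhdD:
  assumes A: "A \<in> carrier_mat m n" and n: "0 < n" and z: "(x, s) \<in> nbhd A b c \<beta>"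
  shows "x \<in> primal_interior A b" "s \<in> dual_interior A c" "0 < mubar (x, s)"
    "x \<bullet> s = real n * mubar (x, s)"
    "vnorm (x \<odot>\<^sub>v s - mubar (x, s) \<cdot>\<^sub>v ones n) \<le> \<beta> * mubar (x, s)"
proof -
  show x: "x \<in> primal_interior A b" and s: "s \<in> dual_interior A c"
    using z by (auto simp: nbhd_def)
  have c: "x \<in> carrier_vec n" "s \<in> carrier_vec n"
    and pos: "\<And>i. i < n \<Longrightarrow> 0 < x $ i" "\<And>i. i < n \<Longrightarrow> 0 < s $ i"
    using x s by (auto simp: primal_interior_iff[OF A] dual_interior_iff[OF A])
  have "0 < x \<bullet> s"
    unfolding scalar_prod_eq_sum[OF c(2)] using pos n by (intro sum_pos) auto
  thus \<mu>: "0 < mubar (x, s)" using n c by (simp add: mubar_eq)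
  show "x \<bullet> s = real n * mubar (x, s)" using n c by (simp add: mubar_eq)
  let ?\<mu> = "mubar (x, s)"
  have "x \<odot>\<^sub>v s - ?\<mu> \<cdot>\<^sub>v ones n = ?\<mu> \<cdot>\<^sub>v ((1 / ?\<mu>) \<cdot>\<^sub>v (x \<odot>\<^sub>v s) - ones n)"
    using c \<mu> by (intro eq_vecI) (auto simp: ones_def algebra_simps)
  hence "vnorm (x \<odot>\<^sub>v s - ?\<mu> \<cdot>\<^sub>v ones n) = ?\<mu> * vnorm ((1 / ?\<mu>) \<cdot>\<^sub>v (x \<odot>\<^sub>v s) - ones n)"
    using \<mu> by (simp add: vnorm_smult)
  moreover have "vnorm ((1 / ?\<mu>) \<cdot>\<^sub>v (x \<odot>\<^sub>v s) - ones n) \<le> \<beta>" using z A by (auto simp: nbhd_def)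
  ultimately show "vnorm (x \<odot>\<^sub>v s - ?\<mu> \<cdot>\<^sub>v ones n) \<le> \<beta> * ?\<mu>"
    using \<mu> by (simp add: mult.commute)
qed

lemma nbhdI:
  assumes A: "A \<in> carrier_mat m n" and x: "x \<in> primal_interior A b" and s: "s \<in> dual_interior A c"
    and \<mu>: "0 < mubar (x, s)"
    and le: "vnorm (x \<odot>\<^sub>v s - mubar (x, s) \<cdot>\<^sub>v ones n) \<le> \<beta> * mubar (x, s)"
  shows "(x, s) \<in> nbhd A b c \<beta>"
proof -
  have c: "x \<in> carrier_vec n" "s \<in> carrier_vec n"
    using x s by (auto simp: primal_interior_iff[OF A] dual_interior_iff[OF A])
  let ?\<mu> = "mubar (x, s)"
  have "x \<odot>\<^sub>v s - ?\<mu> \<cdot>\<^sub>v ones n = ?\<mu> \<cdot>\<^sub>v ((1 / ?\<mu>) \<cdot>\<^sub>v (x \<odot>\<^sub>v s) - ones n)"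
    using c \<mu> by (intro eq_vecI) (auto simp: ones_def algebra_simps)
  hence "vnorm (x \<odot>\<^sub>v s - ?\<mu> \<cdot>\<^sub>v ones n) = ?\<mu> * vnorm ((1 / ?\<mu>) \<cdot>\<^sub>v (x \<odot>\<^sub>v s) - ones n)"
    using \<mu> by (simp add: vnorm_smult)
  hence "vnorm ((1 / ?\<mu>) \<cdot>\<^sub>v (x \<odot>\<^sub>v s) - ones n) \<le> \<beta>" using le \<mu> by (simp add: mult.commute)
  thus ?thesis using x s A by (auto simp: nbhd_def)
qed

text \<open>After scaling by sqrt(s / x) and sqrt(x / s) the directions become orthogonal vectors p
  and q with the same coordinatewise product. Their norms then satisfy 2 |p| |q| \<le> |p|^2 + |q|^2
  = |p + q|^2, and p + q is r / sqrt(x s).\<close>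

lemma newton_product_bound:
  assumes A: "A \<in> carrier_mat m n" and x: "x \<in> primal_interior A b" and s: "s \<in> dual_interior A c"
    and d: "newton_direction A x s r dx ds"
  shows "vnorm (dx \<odot>\<^sub>v ds) \<le> (\<Sum>i<n. (r $ i)\<^sup>2 / (x $ i * s $ i)) / 2"
proof -
  have c: "x \<in> carrier_vec n" "s \<in> carrier_vec n"
    and pos: "\<And>i. i < n \<Longrightarrow> 0 < x $ i" "\<And>i. i < n \<Longrightarrow> 0 < s $ i"
    using x s by (auto simp: primal_interior_iff[OF A] dual_interior_iff[OF A])
  have W: "dx \<in> primal_space A" "ds \<in> dual_space A" and eq: "s \<odot>\<^sub>v dx + x \<odot>\<^sub>v ds = r"
    using d by (auto simp: newton_direction_def)
  have dc: "dx \<in> carrier_vec n" "ds \<in> carrier_vec n"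
    using primal_spaceD[OF A W(1)] dual_space_carrier[OF A W(2)] by auto
  have ri: "r $ i = s $ i * dx $ i + x $ i * ds $ i" if "i < n" for i
    using arg_cong[OF eq, of "\<lambda>v. v $ i"] that c dc by simp
  define p where "p = vec n (\<lambda>i. sqrt (s $ i / x $ i) * dx $ i)"
  define q where "q = vec n (\<lambda>i. sqrt (x $ i / s $ i) * ds $ i)"
  have pq: "p \<in> carrier_vec n" "q \<in> carrier_vec n" by (auto simp: p_def q_def)
  have one: "sqrt (s $ i / x $ i) * sqrt (x $ i / s $ i) = 1" if "i < n" for i
    using pos[OF that] by (simp add: real_sqrt_mult[symmetric])
  have pqi: "p $ i * q $ i = dx $ i * ds $ i" if "i < n" for i
  proof -
    have "p $ i * q $ i = (sqrt (s $ i / x $ i) * sqrt (x $ i / s $ i)) * (dx $ i * ds $ i)"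
      using that by (simp add: p_def q_def)
    thus ?thesis using one[OF that] by simp
  qed
  have eq_pq: "dx \<odot>\<^sub>v ds = p \<odot>\<^sub>v q" using dc pq pqi by (intro eq_vecI) auto
  have orth: "p \<bullet> q = 0"
    using primal_dual_space_orthogonal[OF A W] pqi by (simp add: scalar_prod_eq_sum[OF pq(2)] scalar_prod_eq_sum[OF dc(2)])
  have sumsq: "(p + q) \<bullet> (p + q) = (\<Sum>i<n. (r $ i)\<^sup>2 / (x $ i * s $ i))"
  proof -
    have "((p + q) $ i)\<^sup>2 = (r $ i)\<^sup>2 / (x $ i * s $ i)" if i: "i < n" for i
    proof -
      have xs: "0 < x $ i" "0 < s $ i" using pos i by auto
      have "(p $ i)\<^sup>2 = s $ i / x $ i * (dx $ i)\<^sup>2" "(q $ i)\<^sup>2 = x $ i / s $ i * (ds $ i)\<^sup>2"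
        using i xs by (auto simp: p_def q_def power_mult_distrib)
      hence "((p + q) $ i)\<^sup>2 = s $ i / x $ i * (dx $ i)\<^sup>2 + x $ i / s $ i * (ds $ i)\<^sup>2 + 2 * (dx $ i * ds $ i)"
        using i pq pqi[OF i] by (simp add: power2_sum)
      also have "\<dots> = (r $ i)\<^sup>2 / (x $ i * s $ i)"
        unfolding ri[OF i] using xs by (simp add: field_simps power2_eq_square)
      finally show ?thesis .
    qed
    moreover have pqc: "p + q \<in> carrier_vec n" using pq by simp
    ultimately show ?thesis
      unfolding scalar_prod_eq_sum[OF pqc] by (intro sum.cong) (auto simp: power2_eq_square[symmetric])
  qed
  have "0 \<le> (vnorm p - vnorm q)\<^sup>2" by simp
  hence "2 * (vnorm p * vnorm q) \<le> p \<bullet> p + q \<bullet> q" by (simp add: power2_diff vnorm_power2)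
  also have "\<dots> = (p + q) \<bullet> (p + q)" using scalar_prod_add_self[OF pq] orth by simp
  finally have "vnorm p * vnorm q \<le> (\<Sum>i<n. (r $ i)\<^sup>2 / (x $ i * s $ i)) / 2" by (simp add: sumsq)
  thus ?thesis using vnorm_vtimes_le[OF pq] unfolding eq_pq by linarith
qed

section \<open>Steps along a line near the central path\<close>

lemma product_deviation_coordinates:
  assumes x: "x \<in> carrier_vec n" and s: "s \<in> carrier_vec n" and \<mu>: "0 < \<mu>"
    and dev: "vnorm (x \<odot>\<^sub>v s - \<mu> \<cdot>\<^sub>v ones n) \<le> \<kappa> * \<mu>" and i: "i < n"
  shows "(1 - \<kappa>) * \<mu> \<le> x $ i * s $ i" "x $ i * s $ i \<le> (1 + \<kappa>) * \<mu>"
proof -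
  have "\<bar>x $ i * s $ i - \<mu>\<bar> \<le> vnorm (x \<odot>\<^sub>v s - \<mu> \<cdot>\<^sub>v ones n)"
    using abs_index_le_vnorm[of "x \<odot>\<^sub>v s - \<mu> \<cdot>\<^sub>v ones n" n i] x i by (simp add: ones_def)
  hence "\<bar>x $ i * s $ i - \<mu>\<bar> \<le> \<kappa> * \<mu>" using dev by linarith
  thus "(1 - \<kappa>) * \<mu> \<le> x $ i * s $ i" "x $ i * s $ i \<le> (1 + \<kappa>) * \<mu>"
    by (auto simp: algebra_simps abs_le_iff)
qed

text \<open>A positive product at the endpoint would allow two negative factors. Positivity on the
  whole segment excludes this: a factor changing sign would vanish on the way.\<close>

lemma positive_along_segment:
  fixes a b d e \<alpha> :: real
  assumes "0 < a" "0 < b" "0 \<le> \<alpha>" and pos: "\<And>t. 0 \<le> t \<Longrightarrow> t \<le> \<alpha> \<Longrightarrow> 0 < (a + t * d) * (b + t * e)"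
  shows "0 < a + \<alpha> * d" "0 < b + \<alpha> * e"
proof -
  have main: "0 < a + \<alpha> * d" if "0 < a" and nz: "\<And>t. 0 \<le> t \<Longrightarrow> t \<le> \<alpha> \<Longrightarrow> a + t * d \<noteq> 0" for a d
  proof (rule ccontr)
    assume neg: "\<not> 0 < a + \<alpha> * d"
    have "\<alpha> * d < 0" using neg \<open>0 < a\<close> by linarith
    hence d: "d < 0" using \<open>0 \<le> \<alpha>\<close> by (simp add: mult_less_0_iff)
    have "a \<le> \<alpha> * (- d)" using neg by linarith
    hence "a / (- d) \<le> \<alpha>" using d by (simp only: pos_divide_le_eq neg_0_less_iff_less)
    moreover have "0 \<le> a / (- d)" using d \<open>0 < a\<close> by (simp add: divide_nonneg_neg less_imp_le)
    ultimately have "a + a / (- d) * d \<noteq> 0" by (intro nz)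
    thus False using d by simp
  qed
  show "0 < a + \<alpha> * d" using assms(1) pos by (intro main) force+
  show "0 < b + \<alpha> * e" using assms(2) pos by (intro main) force+
qed

text \<open>Replacing the centre by the mean of the coordinates is an orthogonal projection, so it does
  not increase the deviation.\<close>

lemma deviation_from_mean_le:
  assumes p: "p \<in> carrier_vec n" and n: "0 < n"
  shows "vnorm (p - ((\<Sum>i<n. p $ i) / real n) \<cdot>\<^sub>v ones n) \<le> vnorm (p - t \<cdot>\<^sub>v ones n)"
    and "\<bar>(\<Sum>i<n. p $ i) / real n - t\<bar> \<le> vnorm (p - t \<cdot>\<^sub>v ones n)"
proof -
  define \<nu> where "\<nu> = (\<Sum>i<n. p $ i) / real n"
  have sq: "(vnorm (p - a \<cdot>\<^sub>v ones n))\<^sup>2 = (\<Sum>i<n. (p $ i - a)\<^sup>2)" for a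
    using p by (subst vnorm_power2_sum[of _ n]) (auto simp: ones_def)
  have "(\<Sum>i<n. (p $ i - t)\<^sup>2) = (\<Sum>i<n. (p $ i - \<nu>)\<^sup>2 + 2 * (\<nu> - t) * (p $ i - \<nu>) + (\<nu> - t)\<^sup>2)"
    by (intro sum.cong) (auto simp: power2_eq_square algebra_simps)
  also have "\<dots> = (\<Sum>i<n. (p $ i - \<nu>)\<^sup>2) + 2 * (\<nu> - t) * (\<Sum>i<n. p $ i - \<nu>) + real n * (\<nu> - t)\<^sup>2"
    by (simp add: sum.distrib sum_distrib_left)
  also have "(\<Sum>i<n. p $ i - \<nu>) = 0" using n by (simp add: sum_subtractf \<nu>_def)
  finally have eq: "(vnorm (p - t \<cdot>\<^sub>v ones n))\<^sup>2 = (vnorm (p - \<nu> \<cdot>\<^sub>v ones n))\<^sup>2 + real n * (\<nu> - t)\<^sup>2"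
    by (simp add: sq)
  have "(vnorm (p - \<nu> \<cdot>\<^sub>v ones n))\<^sup>2 \<le> (vnorm (p - t \<cdot>\<^sub>v ones n))\<^sup>2" using eq by simp
  thus "vnorm (p - ((\<Sum>i<n. p $ i) / real n) \<cdot>\<^sub>v ones n) \<le> vnorm (p - t \<cdot>\<^sub>v ones n)"
    unfolding \<nu>_def[symmetric] by (rule power2_le_imp_le) simp
  have "(\<nu> - t)\<^sup>2 \<le> real n * (\<nu> - t)\<^sup>2" using n by (simp add: mult_le_cancel_right1)
  hence "(\<nu> - t)\<^sup>2 \<le> (vnorm (p - t \<cdot>\<^sub>v ones n))\<^sup>2"
    using eq zero_le_power2[of "vnorm (p - \<nu> \<cdot>\<^sub>v ones n)"] by linarith
  hence "\<bar>\<nu> - t\<bar>\<^sup>2 \<le> (vnorm (p - t \<cdot>\<^sub>v ones n))\<^sup>2" by simp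
  thus "\<bar>(\<Sum>i<n. p $ i) / real n - t\<bar> \<le> vnorm (p - t \<cdot>\<^sub>v ones n)"
    unfolding \<nu>_def[symmetric] by (rule power2_le_imp_le) simp
qed

text \<open>The deviation is controlled for all t up to \<alpha>, since positivity of the end point
  is inferred from the whole segment. The radius 3/5 \<beta> leaves room for passing from the
  nominal centre (1 - \<alpha>) \<mu> to the actual mean.\<close>

lemma line_step_nbhd:
  assumes A: "A \<in> carrier_mat m n" and n: "0 < n" and x: "x \<in> primal_interior A b" and s: "s \<in> dual_interior A c"
    and d: "dx \<in> primal_space A" "ds \<in> dual_space A" and \<mu>: "0 < \<mu>"
    and \<kappa>: "0 \<le> \<kappa>" "\<kappa> \<le> 3 / 5 * \<beta>" and \<beta>: "\<beta> \<le> 1 / 6" and \<alpha>: "0 \<le> \<alpha>" "\<alpha> < 1"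
    and dev: "\<And>t. 0 \<le> t \<Longrightarrow> t \<le> \<alpha> \<Longrightarrow>
      vnorm ((x + t \<cdot>\<^sub>v dx) \<odot>\<^sub>v (s + t \<cdot>\<^sub>v ds) - ((1 - t) * \<mu>) \<cdot>\<^sub>v ones n) \<le> \<kappa> * ((1 - t) * \<mu>)"
  shows "(x + \<alpha> \<cdot>\<^sub>v dx, s + \<alpha> \<cdot>\<^sub>v ds) \<in> nbhd A b c \<beta>"
proof -
  have c: "x \<in> carrier_vec n" "s \<in> carrier_vec n"
    and pos: "\<And>i. i < n \<Longrightarrow> 0 < x $ i" "\<And>i. i < n \<Longrightarrow> 0 < s $ i"
    using x s by (auto simp: primal_interior_iff[OF A] dual_interior_iff[OF A])
  have dc: "dx \<in> carrier_vec n" "ds \<in> carrier_vec n"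
    using primal_spaceD[OF A d(1)] dual_space_carrier[OF A d(2)] by auto
  have \<kappa>1: "\<kappa> \<le> 1 / 10" using \<kappa> \<beta> by linarith
  have prod_pos: "0 < (x $ i + t * dx $ i) * (s $ i + t * ds $ i)" if "i < n" "0 \<le> t" "t \<le> \<alpha>" for i t
  proof -
    have "0 < (1 - t) * \<mu>" using that \<alpha> \<mu> by simp
    from product_deviation_coordinates(1)[OF _ _ this dev[OF that(2,3)] that(1)]
    have "(1 - \<kappa>) * ((1 - t) * \<mu>) \<le> (x $ i + t * dx $ i) * (s $ i + t * ds $ i)"
      using c dc that by simp
    moreover have "0 < (1 - \<kappa>) * ((1 - t) * \<mu>)" using \<open>0 < (1 - t) * \<mu>\<close> \<kappa>1 by simp
    ultimately show ?thesis by linarith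
  qed
  have "0 < x $ i + \<alpha> * dx $ i" "0 < s $ i + \<alpha> * ds $ i" if "i < n" for i
    using positive_along_segment[OF pos(1)[OF that] pos(2)[OF that] \<alpha>(1), of "dx $ i" "ds $ i"]
      prod_pos[OF that] by blast+
  hence x': "x + \<alpha> \<cdot>\<^sub>v dx \<in> primal_interior A b" and s': "s + \<alpha> \<cdot>\<^sub>v ds \<in> dual_interior A c"
    using primal_interior_add[OF A x primal_space_smult[OF A d(1), of \<alpha>]]
      dual_interior_add[OF A s dual_space_smult[OF A d(2), of \<alpha>]] dc by auto
  define p where "p = (x + \<alpha> \<cdot>\<^sub>v dx) \<odot>\<^sub>v (s + \<alpha> \<cdot>\<^sub>v ds)"
  have p: "p \<in> carrier_vec n" using c dc by (simp add: p_def)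
  define t where "t = (1 - \<alpha>) * \<mu>"
  have t: "0 < t" using \<alpha> \<mu> by (simp add: t_def)
  have dp: "vnorm (p - t \<cdot>\<^sub>v ones n) \<le> \<kappa> * t" using dev[OF \<alpha>(1) order_refl] by (simp add: p_def t_def)
  let ?\<nu> = "mubar (x + \<alpha> \<cdot>\<^sub>v dx, s + \<alpha> \<cdot>\<^sub>v ds)"
  have "(x + \<alpha> \<cdot>\<^sub>v dx) \<bullet> (s + \<alpha> \<cdot>\<^sub>v ds) = (\<Sum>i<n. p $ i)"
    using c dc by (subst scalar_prod_eq_sum[of _ n]) (auto simp: p_def)
  hence \<nu>: "?\<nu> = (\<Sum>i<n. p $ i) / real n" using c dc by (simp add: mubar_eq[of _ n])
  have "\<bar>?\<nu> - t\<bar> \<le> \<kappa> * t" using deviation_from_mean_le(2)[OF p n, of t] dp by (simp add: \<nu>)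
  hence \<nu>t: "(1 - \<kappa>) * t \<le> ?\<nu>" by (simp add: algebra_simps abs_le_iff)
  have "0 < (1 - \<kappa>) * t" using t \<kappa>1 by simp
  hence \<nu>0: "0 < ?\<nu>" using \<nu>t by linarith
  have "vnorm (p - ?\<nu> \<cdot>\<^sub>v ones n) \<le> \<kappa> * t"
    using deviation_from_mean_le(1)[OF p n, of t] dp by (simp add: \<nu>)
  \<comment> \<open>The mean may be as small as (1 - \<kappa>) t. With \<kappa> \<le> 1/10 one has
    \<kappa> \<le> 3/5 \<beta> \<le> 9/10 \<beta> \<le> \<beta> (1 - \<kappa>).\<close>
  also have "\<kappa> * t \<le> (\<beta> * (1 - \<kappa>)) * t"
  proof (rule mult_right_mono)
    have "\<beta> * \<kappa> \<le> \<beta> * (1 / 10)" using \<kappa>1 \<kappa> by (intro mult_left_mono) auto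
    thus "\<kappa> \<le> \<beta> * (1 - \<kappa>)" using \<kappa> by (simp add: algebra_simps)
  qed (use t in simp)
  also have "\<dots> = \<beta> * ((1 - \<kappa>) * t)" by simp
  also have "\<dots> \<le> \<beta> * ?\<nu>" using \<kappa> by (intro mult_left_mono \<nu>t) linarith
  finally show ?thesis unfolding p_def by (rule nbhdI[OF A x' s' \<nu>0])
qed

text \<open>A full step may leave the open neighbourhood, but its end point is the limit of the
  points with t = 1 - 1 / (k + 1).\<close>

lemma line_step_closure:
  assumes A: "A \<in> carrier_mat m n" and c: "x \<in> carrier_vec n" "s \<in> carrier_vec n"
    "dx \<in> carrier_vec n" "ds \<in> carrier_vec n"
    and mem: "\<And>t. 0 \<le> t \<Longrightarrow> t < 1 \<Longrightarrow> (x + t \<cdot>\<^sub>v dx, s + t \<cdot>\<^sub>v ds) \<in> nbhd A b c' \<beta>"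
  shows "(x + 1 \<cdot>\<^sub>v dx, s + 1 \<cdot>\<^sub>v ds) \<in> nbhd_closure A b c' \<beta>"
proof -
  define t where "t k = 1 - inverse (real (Suc k))" for k
  have t: "0 \<le> t k" "t k < 1" for k by (auto simp: t_def field_simps)
  have "t \<longlonglongrightarrow> 1 - 0" unfolding t_def by (intro tendsto_intros LIMSEQ_inverse_real_of_nat)
  hence lim: "t \<longlonglongrightarrow> 1" by simp
  have l: "(\<lambda>k. (v + t k \<cdot>\<^sub>v w) $ i) \<longlonglongrightarrow> (v + 1 \<cdot>\<^sub>v w) $ i"
    if "v \<in> carrier_vec n" "w \<in> carrier_vec n" "i < n" for v w i
  proof -
    have "(\<lambda>k. v $ i + t k * w $ i) \<longlonglongrightarrow> v $ i + 1 * w $ i" by (intro tendsto_intros lim)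
    thus ?thesis using that by simp
  qed
  have "\<exists>X S. (\<forall>k::nat. (X k, S k) \<in> nbhd A b c' \<beta>) \<and> (\<forall>i<dim_col A.
      (\<lambda>k. X k $ i) \<longlonglongrightarrow> (x + 1 \<cdot>\<^sub>v dx) $ i \<and> (\<lambda>k. S k $ i) \<longlonglongrightarrow> (s + 1 \<cdot>\<^sub>v ds) $ i)"
    by (rule exI[of _ "\<lambda>k. x + t k \<cdot>\<^sub>v dx"], rule exI[of _ "\<lambda>k. s + t k \<cdot>\<^sub>v ds"])
      (use c A mem[OF t] l in auto)
  thus ?thesis unfolding nbhd_closure_def using c A by simp
qed

text \<open>The quadratic term in \<alpha> is dx . ds = 0, so \<open>mubar\<close> interpolates
  linearly between the two end points.\<close>

lemma mubar_line:
  assumes A: "A \<in> carrier_mat m n" and n: "0 < n" and c: "x \<in> carrier_vec n" "s \<in> carrier_vec n"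
    and d: "dx \<in> primal_space A" "ds \<in> dual_space A" and \<mu>: "x \<bullet> s = real n * \<mu>"
  shows "mubar (x + \<alpha> \<cdot>\<^sub>v dx, s + \<alpha> \<cdot>\<^sub>v ds) =
    (1 - \<alpha>) * \<mu> + \<alpha> * ((\<Sum>i<n. ((x + dx) \<odot>\<^sub>v (s + ds)) $ i) / real n)"
proof -
  have dc: "dx \<in> carrier_vec n" "ds \<in> carrier_vec n"
    using primal_spaceD[OF A d(1)] dual_space_carrier[OF A d(2)] by auto
  have o: "dx \<bullet> ds = 0" by (rule primal_dual_space_orthogonal[OF A d])
  define e where "e = x \<bullet> ds + dx \<bullet> s"
  have "(\<Sum>i<n. ((x + dx) \<odot>\<^sub>v (s + ds)) $ i) = (x + dx) \<bullet> (s + ds)"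
    using c dc by (subst scalar_prod_eq_sum[of _ n]) auto
  also have "\<dots> = real n * \<mu> + e"
    using c dc o \<mu> by (simp add: add_scalar_prod_distrib[of _ n] scalar_prod_add_distrib[of _ n] e_def)
  finally have 1: "(\<Sum>i<n. ((x + dx) \<odot>\<^sub>v (s + ds)) $ i) = real n * \<mu> + e" .
  have "(x + \<alpha> \<cdot>\<^sub>v dx) \<bullet> (s + \<alpha> \<cdot>\<^sub>v ds) = real n * \<mu> + \<alpha> * e"
    using c dc o \<mu>
    by (simp add: add_scalar_prod_distrib[of _ n] scalar_prod_add_distrib[of _ n] e_def algebra_simps)
  thus ?thesis unfolding 1 using n c dc by (simp add: mubar_eq[of _ n] field_simps)
qed

text \<open>Newton's method converges quadratically: after the step the products are \<mu> + dx ds,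
  and dx ds is of order \<beta>^2 \<mu>. Orthogonality of dx and ds keeps the mean.\<close>

lemma corrector_step:
  assumes A: "A \<in> carrier_mat m n" and n: "0 < n" and z: "(x0, s0) \<in> nbhd A b c \<beta>"
    and \<beta>: "0 < \<beta>" "\<beta> \<le> 1 / 6"
    and d: "newton_direction A x0 s0 (mubar (x0, s0) \<cdot>\<^sub>v ones n - x0 \<odot>\<^sub>v s0) dx ds"
  shows "x0 + dx \<in> primal_interior A b" "s0 + ds \<in> dual_interior A c"
    "mubar (x0 + dx, s0 + ds) = mubar (x0, s0)"
    "vnorm ((x0 + dx) \<odot>\<^sub>v (s0 + ds) - mubar (x0, s0) \<cdot>\<^sub>v ones n) \<le> \<beta> / 10 * mubar (x0, s0)"
proof -
  define \<mu> where "\<mu> = mubar (x0, s0)"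
  note Z = nbhdD[OF A n z, folded \<mu>_def]
  have c: "x0 \<in> carrier_vec n" "s0 \<in> carrier_vec n"
    and pos: "\<And>i. i < n \<Longrightarrow> 0 < x0 $ i" "\<And>i. i < n \<Longrightarrow> 0 < s0 $ i"
    using Z by (auto simp: primal_interior_iff[OF A] dual_interior_iff[OF A])
  have W: "dx \<in> primal_space A" "ds \<in> dual_space A" and eq: "s0 \<odot>\<^sub>v dx + x0 \<odot>\<^sub>v ds = \<mu> \<cdot>\<^sub>v ones n - x0 \<odot>\<^sub>v s0"
    using d by (auto simp: newton_direction_def \<mu>_def)
  have dc: "dx \<in> carrier_vec n" "ds \<in> carrier_vec n"
    using primal_spaceD[OF A W(1)] dual_space_carrier[OF A W(2)] by auto
  have ri: "s0 $ i * dx $ i + x0 $ i * ds $ i = \<mu> - x0 $ i * s0 $ i" if "i < n" for i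
    using arg_cong[OF eq, of "\<lambda>v. v $ i"] that c dc by (simp add: ones_def)
  have lo: "(1 - \<beta>) * \<mu> \<le> x0 $ i * s0 $ i" if "i < n" for i
    by (rule product_deviation_coordinates(1)[OF c Z(3) Z(5) that])
  have \<beta>\<mu>: "0 < (1 - \<beta>) * \<mu>" using \<beta> Z(3) by simp
  have "vnorm (dx \<odot>\<^sub>v ds) \<le> (\<Sum>i<n. ((\<mu> \<cdot>\<^sub>v ones n - x0 \<odot>\<^sub>v s0) $ i)\<^sup>2 / (x0 $ i * s0 $ i)) / 2"
    using newton_product_bound[OF A Z(1,2) d] by (simp add: \<mu>_def)
  also have "\<dots> \<le> (\<Sum>i<n. ((x0 \<odot>\<^sub>v s0 - \<mu> \<cdot>\<^sub>v ones n) $ i)\<^sup>2 / ((1 - \<beta>) * \<mu>)) / 2"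
  proof (intro divide_right_mono sum_mono)
    fix i assume "i \<in> {..<n}"
    hence i: "i < n" by simp
    have "((\<mu> \<cdot>\<^sub>v ones n - x0 \<odot>\<^sub>v s0) $ i)\<^sup>2 = ((x0 \<odot>\<^sub>v s0 - \<mu> \<cdot>\<^sub>v ones n) $ i)\<^sup>2"
      using i c by (simp add: ones_def power2_commute)
    thus "((\<mu> \<cdot>\<^sub>v ones n - x0 \<odot>\<^sub>v s0) $ i)\<^sup>2 / (x0 $ i * s0 $ i) \<le>
      ((x0 \<odot>\<^sub>v s0 - \<mu> \<cdot>\<^sub>v ones n) $ i)\<^sup>2 / ((1 - \<beta>) * \<mu>)"
      using lo[OF i] \<beta>\<mu> by (simp add: frac_le)
  qed simp
  also have "\<dots> = (vnorm (x0 \<odot>\<^sub>v s0 - \<mu> \<cdot>\<^sub>v ones n))\<^sup>2 / ((1 - \<beta>) * \<mu>) / 2"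
    using c by (subst vnorm_power2_sum[of _ n]) (auto simp: sum_divide_distrib)
  also have "\<dots> \<le> (\<beta> * \<mu>)\<^sup>2 / ((1 - \<beta>) * \<mu>) / 2"
    using Z(5) \<beta>\<mu> by (intro divide_right_mono power_mono) auto
  also have "\<dots> = (\<beta> * \<beta> / (2 * (1 - \<beta>))) * \<mu>" using Z(3) \<beta> by (simp add: power2_eq_square field_simps)
  \<comment> \<open>\<beta>^2 / (2 (1 - \<beta>)) \<le> \<beta> / 10 holds up to \<beta> = 1/6, with
    equality there.\<close>
  also have "\<dots> \<le> (\<beta> / 10) * \<mu>"
  proof (rule mult_right_mono)
    have "\<beta> * \<beta> \<le> \<beta> * (1 / 6)" using \<beta> by (intro mult_left_mono) auto
    thus "\<beta> * \<beta> / (2 * (1 - \<beta>)) \<le> \<beta> / 10" using \<beta> by (simp add: field_simps)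
  qed (use Z in simp)
  finally have D: "vnorm (dx \<odot>\<^sub>v ds) \<le> \<beta> / 10 * \<mu>" .
  have Di: "\<bar>dx $ i * ds $ i\<bar> \<le> \<beta> / 10 * \<mu>" if "i < n" for i
    using abs_index_le_vnorm[of "dx \<odot>\<^sub>v ds" n i] that dc D by simp
  have prod_pos: "0 < (x0 $ i + t * dx $ i) * (s0 $ i + t * ds $ i)" if i: "i < n" and t: "0 \<le> t" "t \<le> 1" for i t
  proof -
    have "(x0 $ i + t * dx $ i) * (s0 $ i + t * ds $ i) =
      x0 $ i * s0 $ i + t * (s0 $ i * dx $ i + x0 $ i * ds $ i) + t\<^sup>2 * (dx $ i * ds $ i)"
      by (simp add: power2_eq_square algebra_simps)
    also have "\<dots> = (1 - t) * (x0 $ i * s0 $ i) + t * \<mu> + t\<^sup>2 * (dx $ i * ds $ i)"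
      unfolding ri[OF i] by (simp add: algebra_simps)
    also have "\<dots> \<ge> (1 - t) * ((1 - \<beta>) * \<mu>) + t * ((1 - \<beta>) * \<mu>) - \<beta> / 10 * \<mu>"
    proof -
      have "(1 - t) * ((1 - \<beta>) * \<mu>) \<le> (1 - t) * (x0 $ i * s0 $ i)" using lo[OF i] t by (intro mult_left_mono) auto
      moreover have "t * ((1 - \<beta>) * \<mu>) \<le> t * \<mu>" using t \<beta> Z(3) by (intro mult_left_mono) auto
      moreover have "\<bar>t\<^sup>2 * (dx $ i * ds $ i)\<bar> \<le> 1 * (\<beta> / 10 * \<mu>)"
        unfolding abs_mult[of "t\<^sup>2"] using Di[OF i] t by (intro mult_mono) (auto simp: power_le_one)
      ultimately show ?thesis by linarith
    qed
    also have "(1 - t) * ((1 - \<beta>) * \<mu>) + t * ((1 - \<beta>) * \<mu>) - \<beta> / 10 * \<mu> = (1 - \<beta> - \<beta> / 10) * \<mu>"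
      by (simp add: algebra_simps)
    finally have "(1 - \<beta> - \<beta> / 10) * \<mu> \<le> (x0 $ i + t * dx $ i) * (s0 $ i + t * ds $ i)" .
    moreover have "0 < (1 - \<beta> - \<beta> / 10) * \<mu>" using \<beta> Z(3) by simp
    ultimately show ?thesis by linarith
  qed
  have "0 < x0 $ i + 1 * dx $ i" "0 < s0 $ i + 1 * ds $ i" if "i < n" for i
    using positive_along_segment[OF pos(1)[OF that] pos(2)[OF that], of 1 "dx $ i" "ds $ i"]
      prod_pos[OF that] by auto
  thus x: "x0 + dx \<in> primal_interior A b" and s: "s0 + ds \<in> dual_interior A c"
    using primal_interior_add[OF A Z(1) W(1)] dual_interior_add[OF A Z(2) W(2)] by auto
  have prod: "(x0 + dx) \<odot>\<^sub>v (s0 + ds) - \<mu> \<cdot>\<^sub>v ones n = dx \<odot>\<^sub>v ds"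
  proof (rule eq_vecI)
    fix i assume "i < dim_vec (dx \<odot>\<^sub>v ds)"
    hence i: "i < n" using dc by simp
    have "((x0 + dx) \<odot>\<^sub>v (s0 + ds) - \<mu> \<cdot>\<^sub>v ones n) $ i =
      x0 $ i * s0 $ i + (s0 $ i * dx $ i + x0 $ i * ds $ i) + dx $ i * ds $ i - \<mu>"
      using i c dc by (simp add: ones_def algebra_simps)
    thus "((x0 + dx) \<odot>\<^sub>v (s0 + ds) - \<mu> \<cdot>\<^sub>v ones n) $ i = (dx \<odot>\<^sub>v ds) $ i"
      unfolding ri[OF i] using i dc by simp
  qed (use c dc in auto)
  show "vnorm ((x0 + dx) \<odot>\<^sub>v (s0 + ds) - mubar (x0, s0) \<cdot>\<^sub>v ones n) \<le> \<beta> / 10 * mubar (x0, s0)"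
    unfolding \<mu>_def[symmetric] prod by (rule D)
  have "(x0 + dx) \<bullet> (s0 + ds) = (\<Sum>i<n. \<mu> + dx $ i * ds $ i)"
  proof -
    have "((x0 + dx) \<odot>\<^sub>v (s0 + ds)) $ i = \<mu> + dx $ i * ds $ i" if "i < n" for i
      using arg_cong[OF prod, of "\<lambda>v. v $ i"] that c dc by (simp add: ones_def)
    thus ?thesis using c dc by (subst scalar_prod_eq_sum[of _ n]) auto
  qed
  also have "\<dots> = real n * \<mu> + dx \<bullet> ds" by (simp add: sum.distrib scalar_prod_eq_sum[OF dc(2)])
  also have "dx \<bullet> ds = 0" by (rule primal_dual_space_orthogonal[OF A W])
  finally show "mubar (x0 + dx, s0 + ds) = mubar (x0, s0)"
    using n c dc by (simp add: mubar_eq[of "x0 + dx" n] \<mu>_def)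
qed

section \<open>Cheap lift subspaces\<close>

text \<open>Solves the normal equations with the pseudoinverse of F^T F. They are consistent because
  the kernel of F^T F is that of F.\<close>

lemma least_squares_exists:
  fixes F :: "real mat"
  assumes F: "F \<in> carrier_mat r k" and g: "g \<in> carrier_vec r"
  shows "\<exists>a\<in>carrier_vec k. \<forall>a'\<in>carrier_vec k. vnorm (g + F *\<^sub>v a) \<le> vnorm (g + F *\<^sub>v a')"
proof -
  let ?S = "F\<^sup>T * F"
  have S: "?S \<in> carrier_mat k k" "?S\<^sup>T = ?S" using F by (auto simp: transpose_mult[of _ k r _ k])
  have Fg: "F\<^sup>T *\<^sub>v g \<in> carrier_vec k" using F g by auto
  define a where "a = - (pinv ?S *\<^sub>v (F\<^sup>T *\<^sub>v g))"
  have pc: "pinv ?S *\<^sub>v (F\<^sup>T *\<^sub>v g) \<in> carrier_vec k" using pinv_symmetric[OF S] Fg by auto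
  have a: "a \<in> carrier_vec k" using pc by (simp add: a_def)
  have "?S *\<^sub>v (pinv ?S *\<^sub>v (F\<^sup>T *\<^sub>v g)) = F\<^sup>T *\<^sub>v g"
  proof (rule pinv_solves[OF S Fg])
    fix b assume b: "b \<in> carrier_vec k" "?S *\<^sub>v b = 0\<^sub>v k"
    have Fb: "F *\<^sub>v b \<in> carrier_vec r" using F b by auto
    have "(F *\<^sub>v b) \<bullet> (F *\<^sub>v b) = b \<bullet> (?S *\<^sub>v b)"
      using adjoint_scalar_prod[OF F b(1) Fb] transpose_mult_mult_vec[OF F b(1)] by simp
    hence "F *\<^sub>v b = 0\<^sub>v r" using b scalar_prod_self_eq_0_iff[OF Fb] by simp
    thus "b \<bullet> (F\<^sup>T *\<^sub>v g) = 0" using adjoint_scalar_prod[OF F b(1) g] g by simp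
  qed
  hence "F\<^sup>T *\<^sub>v (F *\<^sub>v (pinv ?S *\<^sub>v (F\<^sup>T *\<^sub>v g))) = F\<^sup>T *\<^sub>v g"
    using transpose_mult_mult_vec[OF F pc] by simp
  moreover have "F *\<^sub>v a = - (F *\<^sub>v (pinv ?S *\<^sub>v (F\<^sup>T *\<^sub>v g)))"
  proof -
    have "a = (- 1) \<cdot>\<^sub>v (pinv ?S *\<^sub>v (F\<^sup>T *\<^sub>v g))" using pc by (auto simp: a_def)
    hence "F *\<^sub>v a = (- 1) \<cdot>\<^sub>v (F *\<^sub>v (pinv ?S *\<^sub>v (F\<^sup>T *\<^sub>v g)))" using mult_mat_vec[OF F pc] by simp
    thus ?thesis by auto
  qed
  moreover define y where "y = F *\<^sub>v (pinv ?S *\<^sub>v (F\<^sup>T *\<^sub>v g))"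
  have y: "y \<in> carrier_vec r" using F pc by (auto simp: y_def)
  ultimately have Fa: "F *\<^sub>v a = - y" and FTy: "F\<^sup>T *\<^sub>v y = F\<^sup>T *\<^sub>v g" by (auto simp: y_def)
  have res: "g + F *\<^sub>v a = g - y" using g y unfolding Fa by auto
  have "vnorm (g - y) \<le> vnorm (g + F *\<^sub>v a')" if a': "a' \<in> carrier_vec k" for a'
  proof -
    have FTres: "F\<^sup>T *\<^sub>v (g - y) = 0\<^sub>v k"
      using F g y FTy by (simp add: mult_minus_distrib_mat_vec[of "F\<^sup>T" k r])
    have Fa': "F *\<^sub>v (a' - a) \<in> carrier_vec r" using F a a' by auto
    have "(F *\<^sub>v (a' - a)) \<bullet> (g - y) = (a' - a) \<bullet> (F\<^sup>T *\<^sub>v (g - y))"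
      using g y a a' by (intro adjoint_scalar_prod[OF F]) auto
    hence o: "(g - y) \<bullet> (F *\<^sub>v (a' - a)) = 0"
      using comm_scalar_prod[OF Fa', of "g - y"] g y a a' by (simp add: FTres)
    have "F *\<^sub>v (a' - a) = F *\<^sub>v a' - F *\<^sub>v a" using F a a' by (intro mult_minus_distrib_mat_vec) auto
    hence "g + F *\<^sub>v a' = (g - y) + F *\<^sub>v (a' - a)"
      using g y F a a' unfolding Fa by (intro eq_vecI) auto
    hence "(g + F *\<^sub>v a') \<bullet> (g + F *\<^sub>v a') = (g - y) \<bullet> (g - y) + (F *\<^sub>v (a' - a)) \<bullet> (F *\<^sub>v (a' - a))"
      using scalar_prod_add_self[of "g - y" r "F *\<^sub>v (a' - a)"] g y Fa' o by simp
    thus ?thesis using scalar_prod_self_ge_0[of "F *\<^sub>v (a' - a)"] by (simp add: vnorm_le_vnorm_iff)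
  qed
  thus ?thesis using a unfolding res[symmetric] by blast
qed

lemma subvec_vdivide:
  assumes "v \<in> carrier_vec n" "y \<in> carrier_vec n" "J \<subseteq> {..<n}"
  shows "subvec v J \<oslash>\<^sub>v subvec y J = subvec (v \<oslash>\<^sub>v y) J"
proof (rule eq_vecI)
  have c: "v \<oslash>\<^sub>v y \<in> carrier_vec n" using assms by simp
  note dims = subvec_carrier[OF assms(1,3)] subvec_carrier[OF assms(2,3)] subvec_carrier[OF c assms(3)]
  show "dim_vec (subvec v J \<oslash>\<^sub>v subvec y J) = dim_vec (subvec (v \<oslash>\<^sub>v y) J)" using dims by simp
  fix i assume "i < dim_vec (subvec (v \<oslash>\<^sub>v y) J)"
  hence i: "i < card J" using dims by simp
  have "pick J i < n" using pick_less[OF assms(3) i] by simp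
  thus "(subvec v J \<oslash>\<^sub>v subvec y J) $ i = subvec (v \<oslash>\<^sub>v y) J $ i"
    using i dims assms c by (simp add: index_subvec[of _ n])
qed

text \<open>Rows outside J are replaced by zero, which turns the norm of a subvector into that of a
  full vector and the problem into ordinary least squares.\<close>

lemma exists_subvec_minimizer:
  fixes T :: "real mat"
  assumes T: "T \<in> carrier_mat n k" and x: "x \<in> carrier_vec n" and y: "y \<in> carrier_vec n" and J: "J \<subseteq> {..<n}"
  shows "\<exists>\<delta>. is_arg_min (\<lambda>\<delta>. vnorm (subvec (x + \<delta>) J \<oslash>\<^sub>v subvec y J)) (\<lambda>\<delta>. \<delta> \<in> (*\<^sub>v) T ` carrier_vec k) \<delta>"
proof -
  define F where "F = mat n k (\<lambda>(i, j). if i \<in> J then T $$ (i, j) / y $ i else 0)"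
  define g where "g = vec n (\<lambda>i. if i \<in> J then x $ i / y $ i else 0)"
  have F: "F \<in> carrier_mat n k" and g: "g \<in> carrier_vec n" by (auto simp: F_def g_def)
  have eq: "vnorm (subvec (x + T *\<^sub>v a) J \<oslash>\<^sub>v subvec y J) = vnorm (g + F *\<^sub>v a)" if a: "a \<in> carrier_vec k" for a
  proof -
    have Ta: "T *\<^sub>v a \<in> carrier_vec n" and Fa: "F *\<^sub>v a \<in> carrier_vec n" using T F a by auto
    have Fi: "(F *\<^sub>v a) $ i = (if i \<in> J then (T *\<^sub>v a) $ i / y $ i else 0)" if "i < n" for i
      using that a T F by (auto simp: F_def scalar_prod_eq_sum[OF a] sum_divide_distrib)
    have gF: "(g + F *\<^sub>v a) $ i = (if i \<in> J then (x $ i + (T *\<^sub>v a) $ i) / y $ i else 0)" if "i < n" for i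
      using that F Fi[OF that] by (simp add: g_def add_divide_distrib del: index_mult_mat_vec)
    have "(vnorm (g + F *\<^sub>v a))\<^sup>2 = (\<Sum>i<n. ((g + F *\<^sub>v a) $ i)\<^sup>2)"
      using g Fa by (intro vnorm_power2_sum) auto
    also have "\<dots> = (\<Sum>i<n. if i \<in> J then ((x $ i + (T *\<^sub>v a) $ i) / y $ i)\<^sup>2 else 0)"
      by (intro sum.cong) (auto simp: gF)
    also have "\<dots> = (\<Sum>i\<in>{..<n} \<inter> J. ((x $ i + (T *\<^sub>v a) $ i) / y $ i)\<^sup>2)"
      by (subst sum.inter_restrict) auto
    also have "{..<n} \<inter> J = J" using J by auto
    also have "(\<Sum>i\<in>J. ((x $ i + (T *\<^sub>v a) $ i) / y $ i)\<^sup>2) = (\<Sum>i\<in>J. (((x + T *\<^sub>v a) \<oslash>\<^sub>v y) $ i)\<^sup>2)"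
      using J x T by (intro sum.cong) (auto simp: subset_eq simp del: index_mult_mat_vec)
    also have "\<dots> = (vnorm (subvec ((x + T *\<^sub>v a) \<oslash>\<^sub>v y) J))\<^sup>2"
      using x Ta J by (intro vnorm_subvec[symmetric]) auto
    also have "subvec ((x + T *\<^sub>v a) \<oslash>\<^sub>v y) J = subvec (x + T *\<^sub>v a) J \<oslash>\<^sub>v subvec y J"
      using x Ta y J by (intro subvec_vdivide[symmetric]) auto
    finally show ?thesis by simp
  qed
  obtain a where a: "a \<in> carrier_vec k" "\<And>a'. a' \<in> carrier_vec k \<Longrightarrow> vnorm (g + F *\<^sub>v a) \<le> vnorm (g + F *\<^sub>v a')"
    using least_squares_exists[OF F g] by blast
  show ?thesis
    using a eq by (intro exI[of _ "T *\<^sub>v a"]) (auto simp: is_arg_min_def not_less)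
qed

text \<open>The subspaces of the algorithm in the coordinates \<open>\<delta> / x\<close> (primal) and \<open>x \<delta>\<close> (dual); in these
  coordinates the two sides are exchanged by \<open>P \<leftrightarrow> 1 - P\<close>, \<open>B \<leftrightarrow> N\<close>.\<close>

definition lift_profile ::
  "(real mat \<Rightarrow> (real mat \<times> real vec) set) \<Rightarrow> nat \<Rightarrow> real mat \<Rightarrow> nat set \<Rightarrow> nat set \<Rightarrow> real vec set \<Rightarrow> bool" where
  "lift_profile svd n P I J X \<longleftrightarrow>
     (if J = {} then X = {0\<^sub>v n}
      else if I = {} then X = {p \<in> carrier_vec n. P *\<^sub>v p = p}
      else \<exists>(C, t)\<in>svd (submatrix (lift_mat P J) I UNIV). X = (\<lambda>w. lift_mat P J *\<^sub>v w) ` cheap_span C t)"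

lemma lift_profile_exists:
  assumes "rho_svd_solver \<rho> svd"
  shows "\<exists>X. lift_profile svd n P I J X"
proof -
  have "svd (submatrix (lift_mat P J) I UNIV) \<noteq> {}" using assms by (auto simp: rho_svd_solver_def)
  then obtain C t where "(C, t) \<in> svd (submatrix (lift_mat P J) I UNIV)" by (metis ex_in_conv surj_pair)
  thus ?thesis unfolding lift_profile_def by (cases "J = {}"; cases "I = {}") auto
qed

text \<open>Least squares needs the feasible set parametrised by a matrix. The set is a kernel, and
  the kernel projection has it as its range.\<close>

lemma orthogonality_set_is_image:
  fixes C :: "real mat"
  assumes C: "C \<in> carrier_mat q q"
  shows "\<exists>Q\<in>carrier_mat q q. {z \<in> carrier_vec q. \<forall>j<q. j < k \<longrightarrow> z \<bullet> col C j = 0} = (*\<^sub>v) Q ` carrier_vec q"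
proof -
  define R where "R = mat q q (\<lambda>(i, j). if i < k then C $$ (j, i) else 0)"
  have R: "R \<in> carrier_mat q q" by (simp add: R_def)
  have Rv: "(R *\<^sub>v v) $ j = (if j < k then v \<bullet> col C j else 0)" if "v \<in> carrier_vec q" "j < q" for v j
  proof -
    have c: "col C j \<in> carrier_vec q" using C that by auto
    have "(R *\<^sub>v v) $ j = (\<Sum>i<q. R $$ (j, i) * v $ i)"
      using R that by (simp add: scalar_prod_eq_sum[OF that(1)])
    also have "\<dots> = (if j < k then (\<Sum>i<q. v $ i * col C j $ i) else 0)"
      using that C by (auto simp: R_def intro!: sum.cong)
    finally show ?thesis by (simp add: scalar_prod_eq_sum[OF c])
  qed
  have set_eq: "{z \<in> carrier_vec q. \<forall>j<q. j < k \<longrightarrow> z \<bullet> col C j = 0} = {z \<in> carrier_vec q. R *\<^sub>v z = 0\<^sub>v q}"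
  proof (intro Collect_cong conj_cong refl iffI)
    fix z assume z: "z \<in> carrier_vec q" "\<forall>j<q. j < k \<longrightarrow> z \<bullet> col C j = 0"
    thus "R *\<^sub>v z = 0\<^sub>v q" using R by (intro eq_vecI) (auto simp: Rv simp del: index_mult_mat_vec)
  next
    fix z assume z: "z \<in> carrier_vec q" "R *\<^sub>v z = 0\<^sub>v q"
    show "\<forall>j<q. j < k \<longrightarrow> z \<bullet> col C j = 0"
    proof (intro allI impI)
      fix j assume "j < q" "j < k"
      thus "z \<bullet> col C j = 0" using Rv[OF z(1), of j] z(2) by simp
    qed
  qed
  obtain Q where Q: "Q \<in> carrier_mat q q" "\<And>v. v \<in> carrier_vec q \<Longrightarrow> R *\<^sub>v (Q *\<^sub>v v) = 0\<^sub>v q"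
    "\<And>v. v \<in> carrier_vec q \<Longrightarrow> \<exists>y\<in>carrier_vec q. v - Q *\<^sub>v v = R\<^sup>T *\<^sub>v y"
    using kernel_projection[OF R] by blast
  have "z = Q *\<^sub>v z" if z: "z \<in> carrier_vec q" "R *\<^sub>v z = 0\<^sub>v q" for z
  proof -
    have Qz: "Q *\<^sub>v z \<in> carrier_vec q" using Q z by auto
    define d where "d = z - Q *\<^sub>v z"
    have d: "d \<in> carrier_vec q" using z Qz by (simp add: d_def)
    obtain y where y: "y \<in> carrier_vec q" "d = R\<^sup>T *\<^sub>v y" using Q(3)[OF z(1)] by (auto simp: d_def)
    have "R *\<^sub>v d = 0\<^sub>v q"
      using R z Qz Q(2)[OF z(1)] by (simp add: d_def mult_minus_distrib_mat_vec[OF R])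
    hence "d \<bullet> d = 0" using adjoint_scalar_prod[OF R d y(1)] y by simp
    hence d0: "d = 0\<^sub>v q" using scalar_prod_self_eq_0_iff[OF d] by simp
    show ?thesis by (rule vec_diff_eq_zeroD[OF z(1) Qz d0[unfolded d_def]])
  qed
  hence "{z \<in> carrier_vec q. R *\<^sub>v z = 0\<^sub>v q} = (*\<^sub>v) Q ` carrier_vec q"
    using Q(1,2) by (auto intro: image_eqI)
  thus ?thesis using Q(1) unfolding set_eq by blast
qed

text \<open>The first half lets the least squares problem of the algorithm have a solution. The
  second half makes its solutions feasible directions.\<close>

lemma lift_profile_image:
  assumes P: "is_orth_proj n P" and part: "I \<union> J = {..<n}" "I \<inter> J = {}"
    and solver: "rho_svd_solver \<rho> svd" and X: "lift_profile svd n P I J X"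
  shows "(\<exists>k. \<exists>T\<in>carrier_mat n k. X = (*\<^sub>v) T ` carrier_vec k) \<and> (\<forall>p\<in>X. p \<in> carrier_vec n \<and> P *\<^sub>v p = p)"
proof -
  note PD = is_orth_projD[OF P]
  have I: "I \<subseteq> {..<n}" and J: "J \<subseteq> {..<n}" using part by auto
  consider "J = {}" | "J \<noteq> {}" "I = {}" | "J \<noteq> {}" "I \<noteq> {}" by blast
  thus ?thesis
  proof cases
    case 1
    hence X0: "X = {0\<^sub>v n}" using X by (simp add: lift_profile_def)
    have zero: "0\<^sub>m n n *\<^sub>v v = 0\<^sub>v n" if "v \<in> carrier_vec n" for v :: "real vec"
      using that by (intro eq_vecI) auto
    have "X = (*\<^sub>v) (0\<^sub>m n n) ` carrier_vec n"
    proof (intro equalityI subsetI)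
      fix p assume "p \<in> X"
      thus "p \<in> (*\<^sub>v) (0\<^sub>m n n) ` carrier_vec n"
        using zero[of "0\<^sub>v n"] unfolding X0 by (intro image_eqI[of _ _ "0\<^sub>v n"]) auto
    next
      fix p :: "real vec" assume "p \<in> (*\<^sub>v) (0\<^sub>m n n) ` carrier_vec n"
      then obtain a where "a \<in> carrier_vec n" "p = 0\<^sub>m n n *\<^sub>v a" by (rule imageE)
      thus "p \<in> X" using zero unfolding X0 by simp
    qed
    hence "\<exists>k. \<exists>T\<in>carrier_mat n k. X = (*\<^sub>v) T ` carrier_vec k"
      by (intro exI[of _ n] bexI[of _ "0\<^sub>m n n"] zero_carrier_mat)
    moreover have "P *\<^sub>v 0\<^sub>v n = 0\<^sub>v n" by (rule mult_mat_vec_zero[OF PD(1)])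
    hence "\<forall>p\<in>X. p \<in> carrier_vec n \<and> P *\<^sub>v p = p" unfolding X0 by simp
    ultimately show ?thesis ..
  next
    case 2
    hence X: "X = {p \<in> carrier_vec n. P *\<^sub>v p = p}" using X by (simp add: lift_profile_def)
    have "X = (*\<^sub>v) P ` carrier_vec n"
    proof (intro equalityI subsetI)
      fix p assume "p \<in> X"
      thus "p \<in> (*\<^sub>v) P ` carrier_vec n" unfolding X by (metis (mono_tags, lifting) imageI mem_Collect_eq)
    next
      fix p assume "p \<in> (*\<^sub>v) P ` carrier_vec n"
      thus "p \<in> X" unfolding X using PD by auto
    qed
    thus ?thesis using PD(1) X by blast
  next
    case 3
    then obtain C t where Ct: "(C, t) \<in> svd (submatrix (lift_mat P J) I UNIV)"
      and X: "X = (\<lambda>w. lift_mat P J *\<^sub>v w) ` cheap_span C t" using X by (auto simp: lift_profile_def)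
    note L = lift_mat_properties(1,2)[OF P J]
    have "rho_svd \<rho> (submatrix (lift_mat P J) I UNIV) C t"
      using solver Ct by (auto simp: rho_svd_solver_def)
    moreover have "dim_col (submatrix (lift_mat P J) I UNIV) = card J"
      using submatrix_rows_carrier[OF L(1) I] by simp
    ultimately have C: "C \<in> carrier_mat (card J) (card J)" "corthogonal (cols C)"
      by (auto simp: rho_svd_def Let_def)
    obtain Q where Q1: "Q \<in> carrier_mat (card J) (card J)"
      and Q2: "{z \<in> carrier_vec (card J). \<forall>j<card J.
        j < card J - card {i. i < card J \<and> t $ i \<le> 1} \<longrightarrow> z \<bullet> col C j = 0} = (*\<^sub>v) Q ` carrier_vec (card J)"
      using orthogonality_set_is_image[OF C(1)] by (rule bexE)
    have "cheap_span C t = (*\<^sub>v) Q ` carrier_vec (card J)" unfolding cheap_span_eq[OF C] by (rule Q2)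
    note Q = Q1 this
    have "X = (*\<^sub>v) (lift_mat P J * Q) ` carrier_vec (card J)"
      unfolding X Q(2) image_image using L(1) Q(1) by (intro image_cong refl) (simp add: assoc_mult_mat_vec[of _ n "card J" _ "card J"])
    moreover have "lift_mat P J * Q \<in> carrier_mat n (card J)" using L(1) Q(1) by simp
    moreover have "p \<in> carrier_vec n \<and> P *\<^sub>v p = p" if "p \<in> X" for p
    proof -
      obtain a where "a \<in> carrier_vec (card J)" "p = lift_mat P J *\<^sub>v (Q *\<^sub>v a)"
        using \<open>p \<in> X\<close> unfolding X Q(2) by auto
      moreover from this have "Q *\<^sub>v a \<in> carrier_vec (card J)" using Q(1) by auto
      ultimately show ?thesis using L(2)[of "Q *\<^sub>v a"] L(1) by auto
    qed
    ultimately show ?thesis by blast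
  qed
qed

text \<open>The shift g adapts the approximation to the affine objective of the least squares step:
  if some v in the range of P nearly cancels g on J, so does an element of X, up to the size of v
  divided by \<sigma>.\<close>

lemma lift_profile_gap:
  assumes P: "is_orth_proj n P" and part: "I \<union> J = {..<n}" "I \<inter> J = {}"
    and solver: "rho_svd_solver \<rho> svd" and X: "lift_profile svd n P I J X"
    and \<rho>: "1 \<le> \<rho>" and \<tau>: "0 < \<tau>" "\<rho> * \<tau> \<le> 1" and \<sigma>: "2 \<le> \<sigma>"
    and gap: "num_sv_ge \<tau> (submatrix (lift_mat P J) I UNIV) \<le> num_sv_ge \<sigma> (submatrix (lift_mat P J) I UNIV)"
  shows "\<And>p. p \<in> X \<Longrightarrow> vnorm (subvec p I) \<le> \<rho> * \<tau> * vnorm (subvec p J)"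
    and "\<And>v g. v \<in> carrier_vec n \<Longrightarrow> P *\<^sub>v v = v \<Longrightarrow> g \<in> carrier_vec n \<Longrightarrow> \<exists>p\<in>X. vnorm (subvec (g + p) J) \<le>
      vnorm (subvec (g + v) J) + 2 * (vnorm (subvec v I) + vnorm (subvec v J)) / \<sigma>"
proof -
  have I: "I \<subseteq> {..<n}" and J: "J \<subseteq> {..<n}" using part by auto
  have \<rho>\<tau>: "0 \<le> \<rho> * \<tau>" using \<rho> \<tau> by simp
  have empty: "vnorm (subvec v {}) = 0" for v by (simp add: subvec_def vnorm_def scalar_prod_def)
  consider (J) "J = {}" | (I) "J \<noteq> {}" "I = {}" | (IJ) "J \<noteq> {}" "I \<noteq> {}" by blast
  hence "(\<forall>p\<in>X. vnorm (subvec p I) \<le> \<rho> * \<tau> * vnorm (subvec p J)) \<and>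
    (\<forall>v\<in>carrier_vec n. \<forall>g\<in>carrier_vec n. P *\<^sub>v v = v \<longrightarrow> (\<exists>p\<in>X. vnorm (subvec (g + p) J) \<le>
      vnorm (subvec (g + v) J) + 2 * (vnorm (subvec v I) + vnorm (subvec v J)) / \<sigma>))"
  proof cases
    case J
    hence X0: "X = {0\<^sub>v n}" using X by (simp add: lift_profile_def)
    have "vnorm (subvec (0\<^sub>v n) I) \<le> vnorm (0\<^sub>v n)" by (intro vnorm_subvec_le[of _ n] I) auto
    thus ?thesis using \<sigma> J by (auto simp: X0 empty)
  next
    case I
    hence X0: "X = {p \<in> carrier_vec n. P *\<^sub>v p = p}" using X by (simp add: lift_profile_def)
    have "0 \<le> \<rho> * \<tau> * vnorm (subvec p J)" for p by (rule mult_nonneg_nonneg[OF \<rho>\<tau> vnorm_ge_0])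
    moreover have "0 \<le> 2 * (vnorm (subvec v I) + vnorm (subvec v J)) / \<sigma>" for v using \<sigma> by simp
    ultimately show ?thesis using \<open>I = {}\<close> unfolding X0 by (force simp: empty)
  next
    case IJ
    then obtain C t where Ct: "(C, t) \<in> svd (submatrix (lift_mat P J) I UNIV)"
      and X: "X = (\<lambda>w. lift_mat P J *\<^sub>v w) ` cheap_span C t" using X by (auto simp: lift_profile_def)
    have svd: "rho_svd \<rho> (submatrix (lift_mat P J) I UNIV) C t"
      using solver Ct by (auto simp: rho_svd_solver_def)
    have "1 < \<sigma>" using \<sigma> by simp
    note G = cheap_lift_gap[OF P part svd \<rho> \<tau> this gap]
    have "\<exists>p\<in>X. vnorm (subvec (g + p) J) \<le>
      vnorm (subvec (g + v) J) + 2 * (vnorm (subvec v I) + vnorm (subvec v J)) / \<sigma>"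
      if v: "v \<in> carrier_vec n" "P *\<^sub>v v = v" and g: "g \<in> carrier_vec n" for v g
    proof -
      obtain w where w: "w \<in> cheap_span C t" "(\<sigma> - \<rho> * \<tau>) * vnorm (subvec v J - subvec (lift_mat P J *\<^sub>v w) J) \<le>
          vnorm (subvec v I) + \<rho> * \<tau> * vnorm (subvec v J)" using G(2)[OF v] by blast
      define p where "p = lift_mat P J *\<^sub>v w"
      have pX: "p \<in> X" using w(1) by (auto simp: X p_def)
      have p: "p \<in> carrier_vec n"
        using lift_profile_image[OF P part solver \<open>lift_profile svd n P I J X\<close>] pX by blast
      define d where "d = vnorm (subvec v J - subvec p J)"
      have d: "0 \<le> d" by (simp add: d_def)
      \<comment> \<open>Here \<rho> \<tau> \<le> 1 \<le> \<sigma> / 2.\<close>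
      have "\<sigma> / 2 * d \<le> (\<sigma> - \<rho> * \<tau>) * d" using \<sigma> \<tau> d by (intro mult_right_mono) auto
      also have "\<dots> \<le> vnorm (subvec v I) + \<rho> * \<tau> * vnorm (subvec v J)" using w(2) by (simp add: d_def p_def)
      also have "\<dots> \<le> vnorm (subvec v I) + 1 * vnorm (subvec v J)"
        using \<tau> by (intro add_left_mono mult_right_mono) auto
      finally have "d \<le> 2 * (vnorm (subvec v I) + vnorm (subvec v J)) / \<sigma>" using \<sigma> by (simp add: field_simps)
      moreover have "vnorm (subvec (g + p) J) \<le> vnorm (subvec (g + v) J) + d"
      proof -
        note c = subvec_carrier[OF v(1) J] subvec_carrier[OF p J] subvec_carrier[OF g J]
        have "subvec (g + p) J = subvec (g + v) J - (subvec v J - subvec p J)"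
          using c unfolding subvec_add[OF g p J] subvec_add[OF g v(1) J] by (intro eq_vecI) auto
        moreover have "subvec (g + v) J \<in> carrier_vec (card J)" using g v by (intro subvec_carrier[OF _ J]) auto
        ultimately show ?thesis
          unfolding d_def using vnorm_triangle_diff[of "subvec (g + v) J" "card J" "subvec v J - subvec p J"] c by simp
      qed
      ultimately show ?thesis using pX by (intro bexI[of _ p]) linarith+
    qed
    thus ?thesis using G(1) by (auto simp: X)
  qed
  thus "\<And>p. p \<in> X \<Longrightarrow> vnorm (subvec p I) \<le> \<rho> * \<tau> * vnorm (subvec p J)"
    "\<And>v g. v \<in> carrier_vec n \<Longrightarrow> P *\<^sub>v v = v \<Longrightarrow> g \<in> carrier_vec n \<Longrightarrow> \<exists>p\<in>X. vnorm (subvec (g + p) J) \<le>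
      vnorm (subvec (g + v) J) + 2 * (vnorm (subvec v I) + vnorm (subvec v J)) / \<sigma>"
    by blast+
qed

lemma vscale_image:
  fixes T :: "real mat"
  assumes T: "T \<in> carrier_mat n k" and x: "x \<in> carrier_vec n"
  shows "\<exists>T'\<in>carrier_mat n k. vscale x ((*\<^sub>v) T ` carrier_vec k) = (*\<^sub>v) T' ` carrier_vec k"
proof -
  define T' where "T' = mat n k (\<lambda>(i, j). x $ i * T $$ (i, j))"
  have T': "T' \<in> carrier_mat n k" by (simp add: T'_def)
  have "x \<odot>\<^sub>v (T *\<^sub>v a) = T' *\<^sub>v a" if a: "a \<in> carrier_vec k" for a
  proof (rule eq_vecI)
    fix i assume "i < dim_vec (T' *\<^sub>v a)"
    hence "i < n" using T' by simp
    thus "(x \<odot>\<^sub>v (T *\<^sub>v a)) $ i = (T' *\<^sub>v a) $ i"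
      using a T x by (simp add: T'_def scalar_prod_eq_sum[OF a] sum_distrib_left mult.assoc)
  qed (use x T' in auto)
  thus ?thesis using T' by (intro bexI[of _ T']) (auto simp: vscale_def image_image)
qed

definition lift_proj :: "real mat \<Rightarrow> real vec \<Rightarrow> real mat" where
  "lift_proj A x = orth_proj (dim_col A) (vscale (map_vec inverse x) (primal_space A))"

lemma lift_proj:
  assumes "A \<in> carrier_mat m n" "x \<in> carrier_vec n" "\<forall>i<n. 0 < x $ i"
  shows "is_orth_proj n (lift_proj A x)" "is_orth_proj n (1\<^sub>m n - lift_proj A x)"
    and "\<And>v. v \<in> carrier_vec n \<Longrightarrow> lift_proj A x *\<^sub>v v = v \<longleftrightarrow> x \<odot>\<^sub>v v \<in> primal_space A"
    and "\<And>u. u \<in> carrier_vec n \<Longrightarrow> (1\<^sub>m n - lift_proj A x) *\<^sub>v u = u \<longleftrightarrow> map_vec inverse x \<odot>\<^sub>v u \<in> dual_space A"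
proof -
  have eq: "lift_proj A x = orth_proj n (vscale (map_vec inverse x) (primal_space A))"
    using assms(1) by (simp add: lift_proj_def)
  note O = orth_proj_scaled_kernel[OF assms, folded eq]
  show "is_orth_proj n (lift_proj A x)" "is_orth_proj n (1\<^sub>m n - lift_proj A x)"
    using O(1) is_orth_proj_complement[OF O(1)] by auto
  show "\<And>v. v \<in> carrier_vec n \<Longrightarrow> lift_proj A x *\<^sub>v v = v \<longleftrightarrow> x \<odot>\<^sub>v v \<in> primal_space A"
    "\<And>u. u \<in> carrier_vec n \<Longrightarrow> (1\<^sub>m n - lift_proj A x) *\<^sub>v u = u \<longleftrightarrow> map_vec inverse x \<odot>\<^sub>v u \<in> dual_space A"
    by (rule O(2), assumption) (rule O(3), assumption)
qed

text \<open>The algorithm treats an empty B before an empty N, the two profiles each treat an empty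
  J first. The conventions agree because n > 0 rules out that both are empty.\<close>

lemma cheap_lift_spaces_iff_profiles:
  assumes A: "A \<in> carrier_mat m n" and n: "0 < n" and x: "x \<in> carrier_vec n" "\<forall>i<n. 0 < x $ i"
    and part: "B \<union> N = {..<n}" "B \<inter> N = {}"
  shows "cheap_lift_spaces A svd x B N V U \<longleftrightarrow>
    (\<exists>X Y. lift_profile svd n (lift_proj A x) B N X \<and> lift_profile svd n (1\<^sub>m n - lift_proj A x) N B Y \<and>
      V = vscale x X \<and> U = vscale (map_vec inverse x) Y)"
proof -
  note L = lift_proj[OF A x]
  have dc: "dim_col A = n" using A by simp
  have ne: "\<not> (B = {} \<and> N = {})" using n part by auto
  have inv: "x \<odot>\<^sub>v (map_vec inverse x \<odot>\<^sub>v w) = w" "map_vec inverse x \<odot>\<^sub>v (x \<odot>\<^sub>v w) = w" if "w \<in> carrier_vec n" for w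
  proof -
    have "x $ i * (inverse (x $ i) * w $ i) = w $ i" "inverse (x $ i) * (x $ i * w $ i) = w $ i" if "i < n" for i
      using x(2) that by (auto simp: field_simps)
    thus "x \<odot>\<^sub>v (map_vec inverse x \<odot>\<^sub>v w) = w" "map_vec inverse x \<odot>\<^sub>v (x \<odot>\<^sub>v w) = w"
      using x(1) that by (auto intro!: eq_vecI)
  qed
  have W: "vscale x {p \<in> carrier_vec n. lift_proj A x *\<^sub>v p = p} = primal_space A"
  proof (intro equalityI subsetI)
    fix w assume "w \<in> vscale x {p \<in> carrier_vec n. lift_proj A x *\<^sub>v p = p}"
    thus "w \<in> primal_space A" using L(3) by (auto simp: vscale_def)
  next
    fix w assume w: "w \<in> primal_space A"
    have wc: "w \<in> carrier_vec n" using primal_spaceD[OF A w] by simp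
    have "map_vec inverse x \<odot>\<^sub>v w \<in> {p \<in> carrier_vec n. lift_proj A x *\<^sub>v p = p}"
      using L(3)[of "map_vec inverse x \<odot>\<^sub>v w"] wc w x by (simp add: inv)
    thus "w \<in> vscale x {p \<in> carrier_vec n. lift_proj A x *\<^sub>v p = p}"
      unfolding vscale_def by (rule rev_image_eqI) (simp add: inv wc)
  qed
  have Wp: "vscale (map_vec inverse x) {u \<in> carrier_vec n. (1\<^sub>m n - lift_proj A x) *\<^sub>v u = u} = dual_space A"
  proof (intro equalityI subsetI)
    fix w assume "w \<in> vscale (map_vec inverse x) {u \<in> carrier_vec n. (1\<^sub>m n - lift_proj A x) *\<^sub>v u = u}"
    thus "w \<in> dual_space A" using L(4) by (auto simp: vscale_def)
  next
    fix w assume w: "w \<in> dual_space A"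
    have wc: "w \<in> carrier_vec n" by (rule dual_space_carrier[OF A w])
    have "x \<odot>\<^sub>v w \<in> {u \<in> carrier_vec n. (1\<^sub>m n - lift_proj A x) *\<^sub>v u = u}"
      using L(4)[of "x \<odot>\<^sub>v w"] wc w x by (simp add: inv)
    thus "w \<in> vscale (map_vec inverse x) {u \<in> carrier_vec n. (1\<^sub>m n - lift_proj A x) *\<^sub>v u = u}"
      unfolding vscale_def by (rule rev_image_eqI) (simp add: inv wc)
  qed
  have zero: "vscale x {0\<^sub>v n} = {0\<^sub>v n}" "vscale (map_vec inverse x) {0\<^sub>v n} = {0\<^sub>v n}"
    using x(1) by (auto simp: vscale_def intro!: eq_vecI)
  show ?thesis
  proof (cases "B = {}")
    case True
    thus ?thesis using ne by (auto simp: cheap_lift_spaces_def lift_profile_def W zero dc)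
  next
    case False
    show ?thesis
    proof (cases "N = {}")
      case True
      thus ?thesis using False by (auto simp: cheap_lift_spaces_def lift_profile_def Wp zero dc)
    next
      case N: False
      have eq: "orth_proj n (vscale (map_vec inverse x) (primal_space A)) = lift_proj A x"
        by (simp add: lift_proj_def dc)
      show ?thesis
        using False N unfolding cheap_lift_spaces_def lift_profile_def Let_def dc eq by auto
    qed
  qed
qed

section \<open>Steps between two scales without intermediate singular values\<close>

lemma num_sv_ge_antimono:
  assumes "\<tau> \<le> \<tau>'"
  shows "num_sv_ge \<tau>' M \<le> num_sv_ge \<tau> M"
  unfolding num_sv_ge_def using assms by (intro card_mono) auto

definition primal_sv :: "real \<Rightarrow> real mat \<Rightarrow> nat set \<Rightarrow> nat set \<Rightarrow> real vec \<Rightarrow> nat" where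
  "primal_sv \<tau> A B N x = num_sv_ge \<tau> (submatrix (lift_mat (lift_proj A x) N) B UNIV)"

definition dual_sv :: "real \<Rightarrow> real mat \<Rightarrow> nat set \<Rightarrow> nat set \<Rightarrow> real vec \<Rightarrow> nat" where
  "dual_sv \<tau> A B N x = num_sv_ge \<tau> (submatrix (lift_mat (1\<^sub>m (dim_col A) - lift_proj A x) B) N UNIV)"

text \<open>On the dual side the ratio is inverted and B and N change places, so the bounds become 1
  / b and 1 / a and the threshold is again multiplied by a / b. One domination therefore controls
  both counts.\<close>

lemma sv_rescale:
  assumes A: "A \<in> carrier_mat m n" and x: "x \<in> carrier_vec n" "\<forall>i<n. 0 < x $ i"
    and x': "x' \<in> carrier_vec n" "\<forall>i<n. 0 < x' $ i"
    and part: "B \<union> N = {..<n}" "B \<inter> N = {}" and ab: "0 < a" "0 < b" and \<tau>: "0 < \<tau>"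
    and dom: "\<forall>i\<in>B. a * x $ i \<le> x' $ i" "\<forall>i\<in>N. x' $ i \<le> b * x $ i"
  shows "primal_sv \<tau> A B N x' \<le> primal_sv (a / b * \<tau>) A B N x"
    and "dual_sv \<tau> A B N x' \<le> dual_sv (a / b * \<tau>) A B N x"
proof -
  note L = lift_proj[OF A x] and L' = lift_proj[OF A x']
  have pos: "0 < x $ i" "0 < x' $ i" if "i < n" for i using x x' that by auto
  have sub: "i < n" if "i \<in> B \<or> i \<in> N" for i using that part by auto
  define r where "r = x' \<oslash>\<^sub>v x"
  have r: "r \<in> carrier_vec n" "\<And>i. i < n \<Longrightarrow> r $ i = x' $ i / x $ i" using x' by (auto simp: r_def)
  have "num_sv_ge \<tau> (submatrix (lift_mat (lift_proj A x') N) B UNIV) \<le>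
    num_sv_ge (a / b * \<tau>) (submatrix (lift_mat (lift_proj A x) N) B UNIV)"
  proof (rule num_sv_ge_lift_rescale[OF L(1) L'(1) part r(1)])
    show "0 < r $ i" if "i < n" for i using pos[OF that] r(2)[OF that] by simp
    show "a \<le> r $ i" if "i \<in> B" for i
    proof -
      have i: "i < n" using sub that by blast
      show ?thesis unfolding r(2)[OF i] pos_le_divide_eq[OF pos(1)[OF i]] by (rule bspec[OF dom(1) that])
    qed
    show "r $ i \<le> b" if "i \<in> N" for i
    proof -
      have i: "i < n" using sub that by blast
      show ?thesis unfolding r(2)[OF i] pos_divide_le_eq[OF pos(1)[OF i]] by (rule bspec[OF dom(2) that])
    qed
    fix v :: "real vec" assume v: "v \<in> carrier_vec n"
    have "x \<odot>\<^sub>v (r \<odot>\<^sub>v v) = x' \<odot>\<^sub>v v"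
    proof (rule eq_vecI)
      fix i assume "i < dim_vec (x' \<odot>\<^sub>v v)"
      hence i: "i < n" using x' by simp
      have "x $ i * (x' $ i / x $ i * v $ i) = x' $ i * v $ i" using pos(1)[OF i] by simp
      thus "(x \<odot>\<^sub>v (r \<odot>\<^sub>v v)) $ i = (x' \<odot>\<^sub>v v) $ i" using i x(1) x'(1) r by simp
    qed (use x x' in auto)
    thus "(lift_proj A x' *\<^sub>v v = v) = (lift_proj A x *\<^sub>v (r \<odot>\<^sub>v v) = r \<odot>\<^sub>v v)"
      using L(3)[of "r \<odot>\<^sub>v v"] L'(3)[OF v] r by simp
  qed (use ab \<tau> in auto)
  thus "primal_sv \<tau> A B N x' \<le> primal_sv (a / b * \<tau>) A B N x" by (simp add: primal_sv_def)
  define q where "q = x \<oslash>\<^sub>v x'"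
  have q: "q \<in> carrier_vec n" "\<And>i. i < n \<Longrightarrow> q $ i = x $ i / x' $ i" using x by (auto simp: q_def)
  have part': "N \<union> B = {..<n}" "N \<inter> B = {}" using part by auto
  have "num_sv_ge \<tau> (submatrix (lift_mat (1\<^sub>m n - lift_proj A x') B) N UNIV) \<le>
    num_sv_ge ((1 / b) / (1 / a) * \<tau>) (submatrix (lift_mat (1\<^sub>m n - lift_proj A x) B) N UNIV)"
  proof (rule num_sv_ge_lift_rescale[OF L(2) L'(2) part' q(1)])
    show "0 < q $ i" if "i < n" for i using pos[OF that] q(2)[OF that] by simp
    show "1 / b \<le> q $ i" if "i \<in> N" for i
    proof -
      have i: "i < n" using sub that by blast
      have "x' $ i / b \<le> x $ i" using bspec[OF dom(2) that] ab by (simp add: pos_divide_le_eq mult.commute)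
      thus ?thesis unfolding q(2)[OF i] pos_le_divide_eq[OF pos(2)[OF i]] by simp
    qed
    show "q $ i \<le> 1 / a" if "i \<in> B" for i
    proof -
      have i: "i < n" using sub that by blast
      have "x $ i \<le> x' $ i / a" using bspec[OF dom(1) that] ab by (simp add: pos_le_divide_eq mult.commute)
      thus ?thesis unfolding q(2)[OF i] pos_divide_le_eq[OF pos(2)[OF i]] by simp
    qed
    fix v :: "real vec" assume v: "v \<in> carrier_vec n"
    have "map_vec inverse x \<odot>\<^sub>v (q \<odot>\<^sub>v v) = map_vec inverse x' \<odot>\<^sub>v v"
    proof (rule eq_vecI)
      fix i assume "i < dim_vec (map_vec inverse x' \<odot>\<^sub>v v)"
      hence i: "i < n" using x' by simp
      have "inverse (x $ i) * (x $ i / x' $ i * v $ i) = inverse (x' $ i) * v $ i"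
        using pos(1)[OF i] by (simp add: divide_inverse)
      thus "(map_vec inverse x \<odot>\<^sub>v (q \<odot>\<^sub>v v)) $ i = (map_vec inverse x' \<odot>\<^sub>v v) $ i"
        using i x(1) x'(1) q by simp
    qed (use x x' in auto)
    thus "((1\<^sub>m n - lift_proj A x') *\<^sub>v v = v) = ((1\<^sub>m n - lift_proj A x) *\<^sub>v (q \<odot>\<^sub>v v) = q \<odot>\<^sub>v v)"
      using L(4)[of "q \<odot>\<^sub>v v"] L'(4)[OF v] q by simp
  qed (use ab \<tau> in auto)
  thus "dual_sv \<tau> A B N x' \<le> dual_sv (a / b * \<tau>) A B N x"
    using A by (simp add: dual_sv_def)
qed

lemma vnorm_le_parts:
  assumes "v \<in> carrier_vec n" "I \<union> J = {..<n}" "I \<inter> J = {}"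
  shows "vnorm v \<le> vnorm (subvec v I) + vnorm (subvec v J)"
proof -
  have "(vnorm v)\<^sup>2 \<le> (vnorm (subvec v I) + vnorm (subvec v J))\<^sup>2"
    unfolding vnorm_partition[OF assms] power2_sum by simp
  thus ?thesis by (rule power2_le_imp_le) simp
qed

text \<open>The lifts at the iterate \<open>(x, s)\<close> have no singular values in \<open>[\<tau>, \<sigma>)\<close>.  The pair
  \<open>(x', s')\<close>, a central path point with a much smaller parameter, certifies that some cheap lift
  direction nearly annihilates \<open>x\<^sub>N\<close> and \<open>s\<^sub>B\<close>.\<close>

locale layered_iterate =
  fixes m n :: nat and A :: "real mat" and b c x s x' s' :: "real vec" and \<mu> :: real
    and B N :: "nat set" and \<rho> \<tau> \<sigma> K \<eta> :: real and svd :: "real mat \<Rightarrow> (real mat \<times> real vec) set"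
  assumes A: "A \<in> carrier_mat m n" and n: "0 < n"
    and x: "x \<in> primal_interior A b" and s: "s \<in> dual_interior A c"
    and x': "x' \<in> primal_interior A b" and s': "s' \<in> dual_interior A c"
    and \<mu>: "0 < \<mu>" and dev: "vnorm (x \<odot>\<^sub>v s - \<mu> \<cdot>\<^sub>v ones n) \<le> 1 / 60 * \<mu>"
    and part: "B \<union> N = {..<n}" "B \<inter> N = {}"
    and K: "1 \<le> K" "\<And>i. i < n \<Longrightarrow> x' $ i \<le> K * x $ i" "\<And>i. i < n \<Longrightarrow> s' $ i \<le> K * s $ i"
    and \<eta>: "0 \<le> \<eta>" "\<And>i. i \<in> N \<Longrightarrow> x' $ i \<le> \<eta> * x $ i" "\<And>i. i \<in> B \<Longrightarrow> s' $ i \<le> \<eta> * s $ i"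
    and solver: "rho_svd_solver \<rho> svd" and \<rho>: "1 \<le> \<rho>" and \<tau>: "0 < \<tau>" "\<rho> * \<tau> \<le> 1" and \<sigma>: "2 \<le> \<sigma>"
    and gap: "primal_sv \<tau> A B N x \<le> primal_sv \<sigma> A B N x" "dual_sv \<tau> A B N x \<le> dual_sv \<sigma> A B N x"
begin

text \<open>The common bound of the two profiles: 2 \<eta> sqrt n is what the comparison point
  leaves over, 8 K sqrt n / \<sigma> is what the cheap subspace misses of the displacement to it.
  The dual side attains both terms, the primal side half of them.\<close>

definition err :: real where "err = 2 * sqrt n * (\<eta> + 4 * K / \<sigma>)"

text \<open>The slack s in the scaled dual coordinates x s / \<mu>. It plays the part that the
  all-ones vector plays for x, and it equals that vector exactly on the central path.\<close>

definition d :: "real vec" where "d = (1 / \<mu>) \<cdot>\<^sub>v (x \<odot>\<^sub>v s)"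

lemma carriers: "x \<in> carrier_vec n" "s \<in> carrier_vec n" "x' \<in> carrier_vec n" "s' \<in> carrier_vec n" "d \<in> carrier_vec n"
  using x s x' s' by (auto simp: primal_interior_iff[OF A] dual_interior_iff[OF A] d_def)

lemma pos: "i < n \<Longrightarrow> 0 < x $ i" "i < n \<Longrightarrow> 0 < s $ i" "i < n \<Longrightarrow> 0 < x' $ i" "i < n \<Longrightarrow> 0 < s' $ i"
  using x s x' s' by (auto simp: primal_interior_iff[OF A] dual_interior_iff[OF A])

lemma sub: "B \<subseteq> {..<n}" "N \<subseteq> {..<n}" "i \<in> B \<Longrightarrow> i < n" "i \<in> N \<Longrightarrow> i < n"
  using part by auto

lemma d_index: "i < n \<Longrightarrow> d $ i = x $ i * s $ i / \<mu>"
  using carriers by (simp add: d_def)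

lemma d_bounds:
  assumes "i < n"
  shows "59 / 60 \<le> d $ i" "d $ i \<le> 61 / 60"
proof -
  have "(1 - 1 / 60) * \<mu> \<le> x $ i * s $ i" "x $ i * s $ i \<le> (1 + 1 / 60) * \<mu>"
    using product_deviation_coordinates[OF carriers(1,2) \<mu> dev assms] by auto
  thus "59 / 60 \<le> d $ i" "d $ i \<le> 61 / 60" using \<mu> by (simp_all add: d_index[OF assms] field_simps)
qed

lemma x_pos: "\<forall>i<n. 0 < x $ i" using pos by simp

lemmas P = lift_proj[OF A carriers(1) x_pos]

lemma sqrt_n: "1 \<le> sqrt n" using n by simp

lemma err_nonneg: "0 \<le> err"
  using \<eta> K \<sigma> by (simp add: err_def)

lemma vnorm_ones_sub: "J \<subseteq> {..<n} \<Longrightarrow> vnorm (subvec (ones n) J) \<le> sqrt n"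
  using vnorm_subvec_le[of "ones n" n J] by (simp add: vnorm_ones)

lemma vnorm_bounded_sub:
  assumes "v \<in> carrier_vec n" "J \<subseteq> {..<n}" "0 \<le> C" "\<And>i. i \<in> J \<Longrightarrow> \<bar>v $ i\<bar> \<le> C"
  shows "vnorm (subvec v J) \<le> C * sqrt n"
proof -
  have "vnorm (subvec v J) \<le> C * vnorm (subvec (ones n) J)"
    using assms by (intro vnorm_subvec_mono[of _ n]) (auto simp: ones_def subset_eq)
  also have "\<dots> \<le> C * sqrt n" using assms vnorm_ones_sub by (intro mult_left_mono) auto
  finally show ?thesis .
qed

text \<open>The element v to be approximated is the relative displacement x' / x - 1. Added to the
  all-ones vector it leaves x' / x, which is at most \<eta> on N, while v itself is bounded by
  K.\<close>

lemma primal_profile: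
  assumes X: "lift_profile svd n (lift_proj A x) B N X"
  shows "\<And>p. p \<in> X \<Longrightarrow> vnorm (subvec p B) \<le> \<rho> * \<tau> * vnorm (subvec p N)"
    and "\<exists>p\<in>X. vnorm (subvec (ones n + p) N) \<le> err"
proof -
  note G = lift_profile_gap[OF P(1) part solver X \<rho> \<tau> \<sigma> gap(1)[unfolded primal_sv_def]]
  show "vnorm (subvec p B) \<le> \<rho> * \<tau> * vnorm (subvec p N)" if "p \<in> X" for p by (rule G(1)[OF that])
  define v where "v = vec n (\<lambda>i. x' $ i / x $ i - 1)"
  have v: "v \<in> carrier_vec n" by (simp add: v_def)
  have "x \<odot>\<^sub>v v = x' - x"
  proof (rule eq_vecI)
    fix i assume "i < dim_vec (x' - x)"
    hence i: "i < n" using carriers by simp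
    thus "(x \<odot>\<^sub>v v) $ i = (x' - x) $ i" using pos(1)[OF i] carriers by (simp add: v_def field_simps)
  qed (use carriers in auto)
  hence Pv: "lift_proj A x *\<^sub>v v = v" using P(3)[OF v] primal_interior_diff[OF A x x'] by simp
  have ratio: "x' $ i / x $ i \<le> K" "0 \<le> x' $ i / x $ i" if "i < n" for i
    using K(2)[OF that] pos(1,3)[OF that] by (auto simp: field_simps)
  have "\<bar>v $ i\<bar> \<le> K" if "i < n" for i using ratio[OF that] K(1) that by (simp add: v_def abs_le_iff)
  hence "vnorm (subvec v B) \<le> K * sqrt n" "vnorm (subvec v N) \<le> K * sqrt n"
    using K(1) v sub by (intro vnorm_bounded_sub; force)+
  hence "2 * (vnorm (subvec v B) + vnorm (subvec v N)) / \<sigma> \<le> 2 * (K * sqrt n + K * sqrt n) / \<sigma>"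
    using \<sigma> by (intro divide_right_mono) auto
  moreover have "vnorm (subvec (ones n + v) N) \<le> \<eta> * sqrt n"
  proof (rule vnorm_bounded_sub)
    fix i assume i: "i \<in> N"
    hence "i < n" by (rule sub(4))
    thus "\<bar>(ones n + v) $ i\<bar> \<le> \<eta>"
      using \<eta>(2)[OF i] ratio(2)[OF \<open>i < n\<close>] pos(1)[OF \<open>i < n\<close>] by (simp add: ones_def v_def field_simps)
  qed (use \<eta> v sub in auto)
  moreover obtain p where "p \<in> X" "vnorm (subvec (ones n + p) N) \<le>
      vnorm (subvec (ones n + v) N) + 2 * (vnorm (subvec v B) + vnorm (subvec v N)) / \<sigma>"
    using G(2)[OF v Pv ones_carrier] by blast
  moreover have "\<eta> * sqrt n + 2 * (K * sqrt n + K * sqrt n) / \<sigma> \<le> err"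
    using \<eta>(1) K(1) \<sigma> by (simp add: err_def field_simps)
  ultimately show "\<exists>p\<in>X. vnorm (subvec (ones n + p) N) \<le> err" by (intro bexI[of _ p]) linarith+
qed

text \<open>Here v is the displacement x (s' - s) / \<mu>, so that d + v = d s' / s. The bounds
  double because d is estimated by 2.\<close>

lemma dual_profile:
  assumes Y: "lift_profile svd n (1\<^sub>m n - lift_proj A x) N B Y"
  shows "\<And>u. u \<in> Y \<Longrightarrow> vnorm (subvec u N) \<le> \<rho> * \<tau> * vnorm (subvec u B)"
    and "\<exists>u\<in>Y. vnorm (subvec (d + u) B) \<le> err"
proof -
  have part': "N \<union> B = {..<n}" "N \<inter> B = {}" using part by auto
  have gap': "num_sv_ge \<tau> (submatrix (lift_mat (1\<^sub>m n - lift_proj A x) B) N UNIV) \<le>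
    num_sv_ge \<sigma> (submatrix (lift_mat (1\<^sub>m n - lift_proj A x) B) N UNIV)"
    using gap(2) A by (simp add: dual_sv_def)
  note G = lift_profile_gap[OF P(2) part' solver Y \<rho> \<tau> \<sigma> gap']
  show "vnorm (subvec u N) \<le> \<rho> * \<tau> * vnorm (subvec u B)" if "u \<in> Y" for u by (rule G(1)[OF that])
  define v where "v = vec n (\<lambda>i. x $ i * (s' $ i - s $ i) / \<mu>)"
  have v: "v \<in> carrier_vec n" by (simp add: v_def)
  have "map_vec inverse x \<odot>\<^sub>v v = (1 / \<mu>) \<cdot>\<^sub>v (s' - s)"
  proof (rule eq_vecI)
    fix i assume "i < dim_vec ((1 / \<mu>) \<cdot>\<^sub>v (s' - s))"
    hence i: "i < n" using carriers by simp
    have "inverse (x $ i) * (x $ i * (s' $ i - s $ i) / \<mu>) = (s' $ i - s $ i) / \<mu>"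
      using pos(1)[OF i] by simp
    thus "(map_vec inverse x \<odot>\<^sub>v v) $ i = ((1 / \<mu>) \<cdot>\<^sub>v (s' - s)) $ i"
      using i carriers by (simp add: v_def)
  qed (use carriers in auto)
  hence Pv: "(1\<^sub>m n - lift_proj A x) *\<^sub>v v = v"
    using P(4)[OF v] dual_space_smult[OF A dual_interior_diff[OF A s s'], of "1 / \<mu>"] by simp
  have dv: "d $ i + v $ i = d $ i * (s' $ i / s $ i)" "v $ i = d $ i * (s' $ i / s $ i - 1)" if "i < n" for i
    using that pos(2)[OF that] \<mu> by (auto simp: v_def d_index field_simps)
  have ratio: "s' $ i / s $ i \<le> K" "0 \<le> s' $ i / s $ i" if "i < n" for i
    using K(3)[OF that] pos(2,4)[OF that] by (auto simp: field_simps)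
  have "\<bar>v $ i\<bar> \<le> 2 * K" if "i < n" for i
  proof -
    have "\<bar>s' $ i / s $ i - 1\<bar> \<le> K" using ratio[OF that] K(1) by (simp add: abs_le_iff)
    hence "\<bar>d $ i\<bar> * \<bar>s' $ i / s $ i - 1\<bar> \<le> 2 * K"
      using d_bounds[OF that] by (intro mult_mono) auto
    thus ?thesis by (simp add: dv(2)[OF that] abs_mult)
  qed
  hence "vnorm (subvec v N) \<le> 2 * K * sqrt n" "vnorm (subvec v B) \<le> 2 * K * sqrt n"
    using K(1) v sub by (intro vnorm_bounded_sub; force)+
  hence "2 * (vnorm (subvec v N) + vnorm (subvec v B)) / \<sigma> \<le> 2 * (2 * K * sqrt n + 2 * K * sqrt n) / \<sigma>"
    using \<sigma> by (intro divide_right_mono) auto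
  moreover have "vnorm (subvec (d + v) B) \<le> 2 * \<eta> * sqrt n"
  proof (rule vnorm_bounded_sub)
    fix i assume i: "i \<in> B"
    hence "i < n" by (rule sub(3))
    have "s' $ i / s $ i \<le> \<eta>" using \<eta>(3)[OF i] pos(2)[OF \<open>i < n\<close>] by (simp add: field_simps)
    hence "d $ i * (s' $ i / s $ i) \<le> 2 * \<eta>"
      using d_bounds[OF \<open>i < n\<close>] ratio(2)[OF \<open>i < n\<close>] by (intro mult_mono) auto
    moreover have "0 \<le> d $ i * (s' $ i / s $ i)"
      using d_bounds[OF \<open>i < n\<close>] ratio(2)[OF \<open>i < n\<close>] by (intro mult_nonneg_nonneg) auto
    ultimately show "\<bar>(d + v) $ i\<bar> \<le> 2 * \<eta>" using \<open>i < n\<close> v dv(1)[OF \<open>i < n\<close>] by simp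
  qed (use \<eta> v sub carriers in auto)
  moreover obtain p where "p \<in> Y" "vnorm (subvec (d + p) B) \<le>
      vnorm (subvec (d + v) B) + 2 * (vnorm (subvec v N) + vnorm (subvec v B)) / \<sigma>"
    using G(2)[OF v Pv carriers(5)] by blast
  moreover have "2 * \<eta> * sqrt n + 2 * (2 * K * sqrt n + 2 * K * sqrt n) / \<sigma> \<le> err"
    using \<sigma> by (simp add: err_def field_simps)
  ultimately show "\<exists>u\<in>Y. vnorm (subvec (d + u) B) \<le> err" by (intro bexI[of _ p]) linarith+
qed

text \<open>p is close to -1 on N and u close to -d on B, whence the bounds of order sqrt n.
  Cheapness transfers them, multiplied by \<rho> \<tau>, to the complementary coordinates. E is a
  parameter because it will be \<open>err\<close> for the comparison vectors and twice that for the
  minimisers of the algorithm.\<close>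

lemma approximate_split_bounds:
  assumes p: "p \<in> carrier_vec n" and u: "u \<in> carrier_vec n" and E: "0 \<le> E" "E \<le> 1 / 4"
    and pN: "vnorm (subvec (ones n + p) N) \<le> E" and pB: "vnorm (subvec p B) \<le> \<rho> * \<tau> * vnorm (subvec p N)"
    and uB: "vnorm (subvec (d + u) B) \<le> E" and uN: "vnorm (subvec u N) \<le> \<rho> * \<tau> * vnorm (subvec u B)"
  shows "vnorm (subvec p N) \<le> 3 / 2 * sqrt n" "vnorm (subvec p B) \<le> 3 / 2 * (\<rho> * \<tau> * sqrt n)"
    "vnorm (subvec u B) \<le> 3 / 2 * sqrt n" "vnorm (subvec u N) \<le> 3 / 2 * (\<rho> * \<tau> * sqrt n)"
proof -
  have \<rho>\<tau>: "0 \<le> \<rho> * \<tau>" using \<rho> \<tau> by simp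
  note c = subvec_carrier[OF p sub(2)] subvec_carrier[OF ones_carrier sub(2)]
    subvec_carrier[OF u sub(1)] subvec_carrier[OF carriers(5) sub(1)]
  have E4: "E \<le> 1 / 4 * sqrt n" using E sqrt_n by linarith
  have "vnorm (subvec p N) - vnorm (subvec (ones n) N) \<le> vnorm (subvec p N + subvec (ones n) N)"
    by (rule vnorm_add_ge[OF c(1,2)])
  also have "subvec p N + subvec (ones n) N = subvec (ones n + p) N"
    unfolding subvec_add[OF ones_carrier p sub(2)] using c by (intro comm_add_vec) auto
  finally show 1: "vnorm (subvec p N) \<le> 3 / 2 * sqrt n" using pN E4 vnorm_ones_sub[OF sub(2)] sqrt_n by linarith
  have "vnorm (subvec d B) \<le> 61 / 60 * sqrt n"
  proof (rule vnorm_bounded_sub[OF carriers(5) sub(1)])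
    fix i assume "i \<in> B"
    thus "\<bar>d $ i\<bar> \<le> 61 / 60" using d_bounds[OF sub(3)] by fastforce
  qed simp
  moreover have "vnorm (subvec u B) - vnorm (subvec d B) \<le> vnorm (subvec u B + subvec d B)"
    by (rule vnorm_add_ge[OF c(3,4)])
  moreover have "subvec u B + subvec d B = subvec (d + u) B"
    unfolding subvec_add[OF carriers(5) u sub(1)] using c by (intro comm_add_vec) auto
  ultimately show 2: "vnorm (subvec u B) \<le> 3 / 2 * sqrt n" using uB E4 sqrt_n by (simp only:)
  show "vnorm (subvec p B) \<le> 3 / 2 * (\<rho> * \<tau> * sqrt n)" using pB mult_left_mono[OF 1 \<rho>\<tau>] by (simp add: algebra_simps)
  show "vnorm (subvec u N) \<le> 3 / 2 * (\<rho> * \<tau> * sqrt n)" using uN mult_left_mono[OF 2 \<rho>\<tau>] by (simp add: algebra_simps)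
qed

text \<open>The elements \<open>p\<close> and \<open>u\<close> of the two lift profiles that nearly annihilate \<open>x\<^sub>N\<close> and \<open>s\<^sub>B\<close> solve
  the scaled Newton equation \<open>d p + u = - d\<close> up to a small error, hence the affine scaling direction
  is close to \<open>(x p, \<mu> u / x)\<close>.\<close>

lemma affine_direction_partition:
  assumes newton: "newton_direction A x s (- (x \<odot>\<^sub>v s)) dx ds"
    and small: "err \<le> 1 / 90" "\<rho> * \<tau> * sqrt n \<le> 1 / 400"
  shows "{i. i < n \<and> \<bar>dx $ i / x $ i\<bar> < \<bar>ds $ i / s $ i\<bar>} = B"
proof -
  obtain X where X: "lift_profile svd n (lift_proj A x) B N X" using lift_profile_exists[OF solver] by blast
  obtain Y where Y: "lift_profile svd n (1\<^sub>m n - lift_proj A x) N B Y" using lift_profile_exists[OF solver] by blast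
  have part': "N \<union> B = {..<n}" "N \<inter> B = {}" using part by auto
  obtain p where p: "p \<in> X" "vnorm (subvec (ones n + p) N) \<le> err" using primal_profile(2)[OF X] by blast
  obtain u where u: "u \<in> Y" "vnorm (subvec (d + u) B) \<le> err" using dual_profile(2)[OF Y] by blast
  have pc: "p \<in> carrier_vec n" "lift_proj A x *\<^sub>v p = p"
    using lift_profile_image[OF P(1) part solver X] p(1) by auto
  have uc: "u \<in> carrier_vec n" "(1\<^sub>m n - lift_proj A x) *\<^sub>v u = u"
    using lift_profile_image[OF P(2) part' solver Y] u(1) by auto
  have "err \<le> 1 / 4" using small by simp
  note S = approximate_split_bounds[OF pc(1) uc(1) err_nonneg this p(2) primal_profile(1)[OF X p(1)] u(2) dual_profile(1)[OF Y u(1)]]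
  have W: "dx \<in> primal_space A" "ds \<in> dual_space A" and eq: "s \<odot>\<^sub>v dx + x \<odot>\<^sub>v ds = - (x \<odot>\<^sub>v s)"
    using newton by (auto simp: newton_direction_def)
  have dc: "dx \<in> carrier_vec n" "ds \<in> carrier_vec n"
    using primal_spaceD[OF A W(1)] dual_space_carrier[OF A W(2)] by auto
  have eqi: "s $ i * dx $ i + x $ i * ds $ i = - (x $ i * s $ i)" if "i < n" for i
    using arg_cong[OF eq, of "\<lambda>v. v $ i"] that carriers dc by simp
  \<comment> \<open>a and b measure how far the scaled affine direction is from (p, u). They come
    from W and W^perp, hence are orthogonal, and d a + b = -e with e the residual of (p, u).\<close>
  define a where "a = vec n (\<lambda>i. dx $ i / x $ i - p $ i)"
  define b where "b = vec n (\<lambda>i. x $ i * ds $ i / \<mu> - u $ i)"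
  define e where "e = vec n (\<lambda>i. d $ i * p $ i + u $ i + d $ i)"
  have abc: "a \<in> carrier_vec n" "b \<in> carrier_vec n" "e \<in> carrier_vec n" by (auto simp: a_def b_def e_def)
  have dab: "d $ i * a $ i + b $ i = - e $ i" if "i < n" for i
  proof -
    have "d $ i * (dx $ i / x $ i) + x $ i * ds $ i / \<mu> = (s $ i * dx $ i + x $ i * ds $ i) / \<mu>"
      using pos(1)[OF that] by (simp add: d_index[OF that] add_divide_distrib)
    also have "\<dots> = - d $ i" unfolding eqi[OF that] by (simp add: d_index[OF that])
    finally show ?thesis using that by (simp add: a_def b_def e_def algebra_simps)
  qed
  have orth: "(\<Sum>i<n. a $ i * b $ i) = 0"
  proof -
    have xp: "dx - x \<odot>\<^sub>v p \<in> primal_space A"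
      using P(3)[OF pc(1)] pc(2) by (intro primal_space_diff[OF A W(1)]) auto
    have xu: "(1 / \<mu>) \<cdot>\<^sub>v ds - map_vec inverse x \<odot>\<^sub>v u \<in> dual_space A"
      using P(4)[OF uc(1)] uc(2) by (intro dual_space_diff[OF A dual_space_smult[OF A W(2)]]) auto
    have c2: "(1 / \<mu>) \<cdot>\<^sub>v ds - map_vec inverse x \<odot>\<^sub>v u \<in> carrier_vec n" using dc carriers by simp
    have "0 = (\<Sum>i<n. (dx - x \<odot>\<^sub>v p) $ i * ((1 / \<mu>) \<cdot>\<^sub>v ds - map_vec inverse x \<odot>\<^sub>v u) $ i)"
      using primal_dual_space_orthogonal[OF A xp xu] by (simp add: scalar_prod_eq_sum[OF c2])
    also have "\<dots> = (\<Sum>i<n. a $ i * b $ i)"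
    proof (rule sum.cong[OF refl])
      fix i assume "i \<in> {..<n}"
      hence i: "i < n" by simp
      show "(dx - x \<odot>\<^sub>v p) $ i * ((1 / \<mu>) \<cdot>\<^sub>v ds - map_vec inverse x \<odot>\<^sub>v u) $ i = a $ i * b $ i"
        using i pos(1)[OF i] dc carriers by (simp add: a_def b_def field_simps)
    qed
    finally show ?thesis ..
  qed
  have eN: "vnorm (subvec e N) \<le> 61 / 60 * err + 3 / 2 * (\<rho> * \<tau> * sqrt n)"
  proof -
    define w where "w = vec n (\<lambda>i. d $ i * (1 + p $ i))"
    have w: "w \<in> carrier_vec n" by (simp add: w_def)
    have "e = w + u" using uc abc by (intro eq_vecI) (auto simp: e_def w_def algebra_simps)
    hence "vnorm (subvec e N) \<le> vnorm (subvec w N) + vnorm (subvec u N)"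
      using vnorm_triangle[OF subvec_carrier[OF w sub(2)] subvec_carrier[OF uc(1) sub(2)]]
      by (simp add: subvec_add[OF w uc(1) sub(2)])
    moreover have "vnorm (subvec w N) \<le> 61 / 60 * vnorm (subvec (ones n + p) N)"
    proof (rule vnorm_subvec_mono[OF w _ sub(2)])
      fix i assume "i \<in> N"
      hence i: "i < n" by (rule sub(4))
      have "\<bar>d $ i\<bar> * \<bar>1 + p $ i\<bar> \<le> 61 / 60 * \<bar>1 + p $ i\<bar>"
        using d_bounds[OF i] by (intro mult_right_mono) auto
      thus "\<bar>w $ i\<bar> \<le> 61 / 60 * \<bar>(ones n + p) $ i\<bar>" using i pc by (simp add: w_def ones_def abs_mult)
    qed (use pc in auto)
    ultimately show ?thesis using p(2) S(4) by linarith
  qed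
  have eB: "vnorm (subvec e B) \<le> err + 61 / 60 * (3 / 2 * (\<rho> * \<tau> * sqrt n))"
  proof -
    define w where "w = vec n (\<lambda>i. d $ i * p $ i)"
    have w: "w \<in> carrier_vec n" by (simp add: w_def)
    have du: "d + u \<in> carrier_vec n" using uc carriers by simp
    have "e = (d + u) + w" using uc abc carriers by (intro eq_vecI) (auto simp: e_def w_def algebra_simps)
    hence "vnorm (subvec e B) \<le> vnorm (subvec (d + u) B) + vnorm (subvec w B)"
      using vnorm_triangle[OF subvec_carrier[OF du sub(1)] subvec_carrier[OF w sub(1)]]
      by (simp add: subvec_add[OF du w sub(1)])
    moreover have "vnorm (subvec w B) \<le> 61 / 60 * vnorm (subvec p B)"
    proof (rule vnorm_subvec_mono[OF w pc(1) sub(1)])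
      fix i assume "i \<in> B"
      hence i: "i < n" by (rule sub(3))
      have "\<bar>d $ i\<bar> * \<bar>p $ i\<bar> \<le> 61 / 60 * \<bar>p $ i\<bar>"
        using d_bounds[OF i] by (intro mult_right_mono) auto
      thus "\<bar>w $ i\<bar> \<le> 61 / 60 * \<bar>p $ i\<bar>" using i by (simp add: w_def abs_mult)
    qed auto
    ultimately show ?thesis using u(2) S(2) by linarith
  qed
  have e_small: "vnorm e \<le> 1 / 30"
    using vnorm_le_parts[OF abc(3) part] eN eB small by linarith
  \<comment> \<open>Weighted Pythagoras: the cross terms add up to a . b = 0, so a and b are both
    bounded by the residual.\<close>
  have "(\<Sum>i<n. (d $ i * a $ i + b $ i)\<^sup>2 / d $ i) = (\<Sum>i<n. d $ i * (a $ i)\<^sup>2 + (b $ i)\<^sup>2 / d $ i + 2 * (a $ i * b $ i))"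
  proof (rule sum.cong[OF refl])
    fix i assume "i \<in> {..<n}"
    hence "0 < d $ i" using d_bounds[of i] by simp
    thus "(d $ i * a $ i + b $ i)\<^sup>2 / d $ i = d $ i * (a $ i)\<^sup>2 + (b $ i)\<^sup>2 / d $ i + 2 * (a $ i * b $ i)"
      by (simp add: power2_eq_square field_simps)
  qed
  also have "\<dots> = (\<Sum>i<n. d $ i * (a $ i)\<^sup>2 + (b $ i)\<^sup>2 / d $ i)"
    using orth by (simp add: sum.distrib flip: sum_distrib_left)
  finally have energy: "(\<Sum>i<n. d $ i * (a $ i)\<^sup>2 + (b $ i)\<^sup>2 / d $ i) = (\<Sum>i<n. (e $ i)\<^sup>2 / d $ i)"
    using dab by simp
  have "(\<Sum>i<n. (e $ i)\<^sup>2 / d $ i) \<le> (\<Sum>i<n. 2 * (e $ i)\<^sup>2)"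
  proof (rule sum_mono)
    fix i assume "i \<in> {..<n}"
    hence d1: "59 / 60 \<le> d $ i" using d_bounds[of i] by simp
    have "(e $ i)\<^sup>2 * 1 \<le> (e $ i)\<^sup>2 * (2 * d $ i)" using d1 by (intro mult_left_mono) auto
    thus "(e $ i)\<^sup>2 / d $ i \<le> 2 * (e $ i)\<^sup>2" using d1 by (simp add: field_simps)
  qed
  also have "\<dots> = 2 * (vnorm e)\<^sup>2" by (simp add: vnorm_power2_sum[OF abc(3)] sum_distrib_left)
  also have "\<dots> \<le> 2 * (1 / 30)\<^sup>2" using e_small by (intro mult_left_mono power_mono) auto
  finally have total: "(\<Sum>i<n. d $ i * (a $ i)\<^sup>2 + (b $ i)\<^sup>2 / d $ i) \<le> 2 / 900" using energy by (simp add: power2_eq_square)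
  have ab_small: "\<bar>a $ i\<bar> \<le> 1 / 15 \<and> \<bar>b $ i\<bar> \<le> 1 / 15" if i: "i < n" for i
  proof -
    have d0: "0 < d $ j" if "j < n" for j using d_bounds[OF that] by simp
    have "d $ i * (a $ i)\<^sup>2 + (b $ i)\<^sup>2 / d $ i \<le> (\<Sum>i<n. d $ i * (a $ i)\<^sup>2 + (b $ i)\<^sup>2 / d $ i)"
    proof (rule member_le_sum)
      fix j assume "j \<in> {..<n} - {i}"
      thus "0 \<le> d $ j * (a $ j)\<^sup>2 + (b $ j)\<^sup>2 / d $ j" using d0[of j] by simp
    qed (use i in auto)
    hence le: "d $ i * (a $ i)\<^sup>2 + (b $ i)\<^sup>2 / d $ i \<le> 2 / 900" using total by linarith
    have "1 / 2 * (a $ i)\<^sup>2 \<le> d $ i * (a $ i)\<^sup>2" using d_bounds[OF i] by (intro mult_right_mono) auto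
    moreover have "1 / 2 * (b $ i)\<^sup>2 \<le> (b $ i)\<^sup>2 / d $ i"
    proof -
      have "(b $ i)\<^sup>2 * d $ i \<le> (b $ i)\<^sup>2 * 2" using d_bounds[OF i] by (intro mult_left_mono) auto
      thus ?thesis using d0[OF i] by (simp add: field_simps)
    qed
    moreover have "0 \<le> d $ i * (a $ i)\<^sup>2" "0 \<le> (b $ i)\<^sup>2 / d $ i" using d0[OF i] by auto
    ultimately have "(a $ i)\<^sup>2 \<le> 4 / 900" "(b $ i)\<^sup>2 \<le> 4 / 900" using le by linarith+
    moreover have "(1 / 15 :: real)\<^sup>2 = 4 / 900" by (simp add: power2_eq_square)
    ultimately have "(a $ i)\<^sup>2 \<le> (1 / 15)\<^sup>2" "(b $ i)\<^sup>2 \<le> (1 / 15)\<^sup>2" by simp_all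
    thus ?thesis by (simp add: abs_le_square_iff[symmetric])
  qed
  have pa: "dx $ i / x $ i = a $ i + p $ i" if "i < n" for i using that by (simp add: a_def)
  have ub: "ds $ i / s $ i = (b $ i + u $ i) / d $ i" if "i < n" for i
    using that pos[OF that] \<mu> by (simp add: b_def d_index field_simps)
  have sNB: "3 / 2 * (\<rho> * \<tau> * sqrt n) \<le> 1 / 200" using small by simp
  \<comment> \<open>On B the relative change dx / x = a + p is near 0 and ds / s = (b + u) / d is
    near -1; on N it is the other way round. The value 1/2 separates the two.\<close>
  show ?thesis
  proof (intro equalityI subsetI)
    fix i assume i: "i \<in> B"
    hence i': "i < n" by (rule sub(3))
    have d0: "0 < d $ i" using d_bounds[OF i'] by simp
    have "\<bar>p $ i\<bar> \<le> 1 / 200" using abs_index_le_vnorm_subvec[OF pc(1) sub(1) i] S(2) sNB by linarith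
    hence le: "\<bar>dx $ i / x $ i\<bar> \<le> 1 / 2" using ab_small[OF i'] unfolding pa[OF i'] abs_le_iff by linarith
    have "d + u \<in> carrier_vec n" using carriers uc by simp
    hence "\<bar>(d + u) $ i\<bar> \<le> 1 / 90"
      using abs_index_le_vnorm_subvec[OF _ sub(1) i, of "d + u"] u(2) small(1) by linarith
    hence "\<bar>d $ i + u $ i\<bar> \<le> 1 / 90" using i' uc carriers by simp
    hence "1 / 2 * d $ i < - (b $ i + u $ i)" using ab_small[OF i'] d_bounds[OF i'] unfolding abs_le_iff by linarith
    hence "1 / 2 < - (b $ i + u $ i) / d $ i" unfolding pos_less_divide_eq[OF d0] .
    hence "1 / 2 < - ((b $ i + u $ i) / d $ i)" unfolding minus_divide_left .
    hence "1 / 2 < \<bar>ds $ i / s $ i\<bar>" unfolding ub[OF i'] by linarith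
    thus "i \<in> {i. i < n \<and> \<bar>dx $ i / x $ i\<bar> < \<bar>ds $ i / s $ i\<bar>}"
      using le i' by (intro CollectI conjI) linarith+
  next
    fix i assume "i \<in> {i. i < n \<and> \<bar>dx $ i / x $ i\<bar> < \<bar>ds $ i / s $ i\<bar>}"
    hence i': "i < n" and lt: "\<bar>dx $ i / x $ i\<bar> < \<bar>ds $ i / s $ i\<bar>" by auto
    show "i \<in> B"
    proof (rule ccontr)
      assume "i \<notin> B"
      hence i: "i \<in> N" using i' part by auto
      have d0: "0 < d $ i" using d_bounds[OF i'] by simp
      have "ones n + p \<in> carrier_vec n" using pc by simp
      hence "\<bar>(ones n + p) $ i\<bar> \<le> 1 / 90"
        using abs_index_le_vnorm_subvec[OF _ sub(2) i, of "ones n + p"] p(2) small(1) by linarith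
      hence "\<bar>1 + p $ i\<bar> \<le> 1 / 90" using i' pc by (simp add: ones_def)
      hence "1 / 2 \<le> - (a $ i + p $ i)" using ab_small[OF i'] unfolding abs_le_iff by linarith
      hence ge: "1 / 2 \<le> \<bar>dx $ i / x $ i\<bar>" unfolding pa[OF i'] by linarith
      have "\<bar>u $ i\<bar> \<le> 1 / 200" using abs_index_le_vnorm_subvec[OF uc(1) sub(2) i] S(4) sNB by linarith
      hence "\<bar>b $ i + u $ i\<bar> \<le> 1 / 2 * d $ i" using ab_small[OF i'] d_bounds[OF i'] unfolding abs_le_iff by linarith
      hence "\<bar>b $ i + u $ i\<bar> / d $ i \<le> 1 / 2" unfolding pos_divide_le_eq[OF d0] .
      hence "\<bar>ds $ i / s $ i\<bar> \<le> 1 / 2" unfolding ub[OF i'] abs_divide using d0 by simp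
      thus False using lt ge by linarith
    qed
  qed
qed


lemma sqrt_between:
  assumes "i < n"
  shows "4 / 5 \<le> sqrt (d $ i)" "sqrt (d $ i) \<le> 6 / 5"
proof -
  have "sqrt ((4 / 5)\<^sup>2) \<le> sqrt (d $ i)" "sqrt (d $ i) \<le> sqrt ((6 / 5)\<^sup>2)"
    using d_bounds[OF assms] by (auto intro!: real_sqrt_le_mono simp: power2_eq_square)
  thus "4 / 5 \<le> sqrt (d $ i)" "sqrt (d $ i) \<le> 6 / 5" by simp_all
qed

text \<open>The minimisers of the algorithm are compared with the near-annihilating elements of the
  profiles, which are competitors in its least squares problems.\<close>

lemma slls_directions:
  assumes X: "lift_profile svd n (lift_proj A x) B N X"
    and Y: "lift_profile svd n (1\<^sub>m n - lift_proj A x) N B Y"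
    and dx: "is_arg_min (\<lambda>\<delta>. vnorm (subvec (x + \<delta>) N \<oslash>\<^sub>v subvec (map_vec sqrt ((\<mu> \<cdot>\<^sub>v x) \<oslash>\<^sub>v s)) N))
      (\<lambda>\<delta>. \<delta> \<in> vscale x X) dx"
    and ds: "is_arg_min (\<lambda>\<delta>. vnorm (subvec (s + \<delta>) B \<oslash>\<^sub>v subvec (map_vec sqrt ((\<mu> \<cdot>\<^sub>v s) \<oslash>\<^sub>v x)) B))
      (\<lambda>\<delta>. \<delta> \<in> vscale (map_vec inverse x) Y) ds"
    and small: "err \<le> 1 / 90" "\<rho> * \<tau> * sqrt n \<le> 1 / 400"
  shows "vnorm ((x + dx) \<odot>\<^sub>v (s + ds)) \<le> 10 * err * \<mu>"
    and "vnorm (dx \<odot>\<^sub>v ds) \<le> 8 * (real n * (\<rho> * \<tau>)) * \<mu>"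
proof -
  have part': "N \<union> B = {..<n}" "N \<inter> B = {}" using part by auto
  note Xim = lift_profile_image[OF P(1) part solver X] and Yim = lift_profile_image[OF P(2) part' solver Y]
  have Xc: "p \<in> carrier_vec n" if "p \<in> X" for p using Xim that by blast
  have Yc: "u \<in> carrier_vec n" if "u \<in> Y" for u using Yim that by blast
  have Yscale: "a \<cdot>\<^sub>v u \<in> Y" if u: "u \<in> Y" for a u
  proof -
    obtain k T where T: "T \<in> carrier_mat n k" "Y = (*\<^sub>v) T ` carrier_vec k" using Yim by blast
    obtain v where v: "v \<in> carrier_vec k" "u = T *\<^sub>v v" using u T(2) by auto
    have "a \<cdot>\<^sub>v u = T *\<^sub>v (a \<cdot>\<^sub>v v)" using mult_mat_vec[OF T(1) v(1)] v(2) by simp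
    thus ?thesis using v(1) T(2) by auto
  qed
  have d0: "0 < d $ i" if "i < n" for i using d_bounds[OF that] by simp
  obtain p where p: "p \<in> X" "dx = x \<odot>\<^sub>v p" using dx by (auto simp: is_arg_min_def vscale_def)
  obtain u0 where u0: "u0 \<in> Y" "ds = map_vec inverse x \<odot>\<^sub>v u0" using ds by (auto simp: is_arg_min_def vscale_def)
  define u where "u = (1 / \<mu>) \<cdot>\<^sub>v u0"
  have uY: "u \<in> Y" unfolding u_def by (rule Yscale[OF u0(1)])
  have pc: "p \<in> carrier_vec n" and uc: "u \<in> carrier_vec n" and u0c: "u0 \<in> carrier_vec n"
    using Xc[OF p(1)] Yc[OF uY] Yc[OF u0(1)] by auto
  have dxi: "dx $ i = x $ i * p $ i" if "i < n" for i using that carriers p(2) by simp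
  have dsi: "ds $ i = \<mu> * u $ i / x $ i" if "i < n" for i
    using that carriers u0(2) u0c \<mu> by (simp add: u_def divide_inverse)
  have dc: "dx \<in> carrier_vec n" "ds \<in> carrier_vec n" using p(2) u0(2) carriers by auto
  define xhat where "xhat = map_vec sqrt ((\<mu> \<cdot>\<^sub>v x) \<oslash>\<^sub>v s)"
  define shat where "shat = map_vec sqrt ((\<mu> \<cdot>\<^sub>v s) \<oslash>\<^sub>v x)"
  have hats: "xhat \<in> carrier_vec n" "shat \<in> carrier_vec n" using carriers by (auto simp: xhat_def shat_def)
  \<comment> \<open>xhat is x / sqrt d and shat is \<mu> sqrt d / x. The weights of the algorithm
    differ from those of the profile lemmas only by sqrt d, which lies between 4/5 and 6/5.\<close>
  have weight_x: "(x $ i + x $ i * q) / xhat $ i = sqrt (d $ i) * (1 + q)" if "i < n" for i q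
  proof -
    have xh: "xhat $ i = x $ i / sqrt (d $ i)"
    proof -
      have "xhat $ i = sqrt (\<mu> * x $ i / s $ i)" using that carriers by (simp add: xhat_def)
      also have "\<mu> * x $ i / s $ i = (x $ i)\<^sup>2 / d $ i"
        using pos[OF that] \<mu> by (simp add: d_index[OF that] power2_eq_square)
      also have "sqrt \<dots> = x $ i / sqrt (d $ i)" using pos(1)[OF that] by (simp add: real_sqrt_divide)
      finally show ?thesis .
    qed
    have "(a + a * q) / (a / r) = r * (1 + q)" if "0 < a" for a r :: real
    proof -
      have "a + a * q = a * (1 + q)" by (simp add: distrib_left)
      thus ?thesis using that by simp
    qed
    thus ?thesis unfolding xh using pos(1)[OF that] by simp
  qed
  have weight_s: "(s $ i + \<mu> * q / x $ i) / shat $ i = (d $ i + q) / sqrt (d $ i)" if "i < n" for i q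
  proof -
    have sh: "shat $ i = \<mu> * sqrt (d $ i) / x $ i"
    proof -
      have "shat $ i = sqrt (\<mu> * s $ i / x $ i)" using that carriers by (simp add: shat_def)
      also have "\<mu> * s $ i / x $ i = (\<mu> / x $ i)\<^sup>2 * d $ i"
        using pos[OF that] \<mu> by (simp add: d_index[OF that] power2_eq_square)
      also have "sqrt \<dots> = \<mu> / x $ i * sqrt (d $ i)" using pos(1)[OF that] \<mu> by (simp add: real_sqrt_mult)
      finally show ?thesis by simp
    qed
    have "s $ i + \<mu> * q / x $ i = \<mu> * (d $ i + q) / x $ i"
      using pos(1)[OF that] \<mu> by (simp add: d_index[OF that] field_simps)
    thus ?thesis unfolding sh using pos(1)[OF that] \<mu> by simp
  qed
  \<comment> \<open>Changing weights forth and back costs 5/4 * 6/5 = 3/2, rounded up to 2.\<close>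
  have pN: "vnorm (subvec (ones n + p) N) \<le> 2 * err"
  proof -
    obtain q where q: "q \<in> X" "vnorm (subvec (ones n + q) N) \<le> err" using primal_profile(2)[OF X] by blast
    have obj: "vnorm (subvec (x + x \<odot>\<^sub>v r) N \<oslash>\<^sub>v subvec xhat N) = vnorm (subvec ((x + x \<odot>\<^sub>v r) \<oslash>\<^sub>v xhat) N)"
      if "r \<in> carrier_vec n" for r
      using that carriers hats sub by (subst subvec_vdivide[of _ n]) auto
    have val: "((x + x \<odot>\<^sub>v r) \<oslash>\<^sub>v xhat) $ i = sqrt (d $ i) * (1 + r $ i)" if "r \<in> carrier_vec n" "i < n" for r i
      using weight_x[OF that(2), of "r $ i"] that carriers hats by simp
    have wc: "(x + x \<odot>\<^sub>v r) \<oslash>\<^sub>v xhat \<in> carrier_vec n" if "r \<in> carrier_vec n" for r using that carriers by simp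
    have oc: "ones n + r \<in> carrier_vec n" if "r \<in> carrier_vec n" for r using that by simp
    have qc: "q \<in> carrier_vec n" by (rule Xc[OF q(1)])
    have "vnorm (subvec (ones n + p) N) \<le> 5 / 4 * vnorm (subvec ((x + x \<odot>\<^sub>v p) \<oslash>\<^sub>v xhat) N)"
    proof (rule vnorm_subvec_mono[OF oc[OF pc] wc[OF pc] sub(2)])
      fix i assume "i \<in> N"
      hence i: "i < n" by (rule sub(4))
      have "1 * \<bar>1 + p $ i\<bar> \<le> (5 / 4 * sqrt (d $ i)) * \<bar>1 + p $ i\<bar>"
        using sqrt_between(1)[OF i] by (intro mult_right_mono) auto
      thus "\<bar>(ones n + p) $ i\<bar> \<le> 5 / 4 * \<bar>((x + x \<odot>\<^sub>v p) \<oslash>\<^sub>v xhat) $ i\<bar>"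
        unfolding val[OF pc i] using i pc d0[OF i] by (simp add: ones_def abs_mult)
    qed simp
    also have "vnorm (subvec ((x + x \<odot>\<^sub>v p) \<oslash>\<^sub>v xhat) N) \<le> vnorm (subvec ((x + x \<odot>\<^sub>v q) \<oslash>\<^sub>v xhat) N)"
    proof -
      have "x \<odot>\<^sub>v q \<in> vscale x X" using q(1) by (auto simp: vscale_def)
      hence "\<not> vnorm (subvec (x + x \<odot>\<^sub>v q) N \<oslash>\<^sub>v subvec xhat N) < vnorm (subvec (x + dx) N \<oslash>\<^sub>v subvec xhat N)"
        using dx by (auto simp: is_arg_min_def xhat_def)
      thus ?thesis unfolding p(2) obj[OF pc] obj[OF qc] by simp
    qed
    also have "vnorm (subvec ((x + x \<odot>\<^sub>v q) \<oslash>\<^sub>v xhat) N) \<le> 6 / 5 * vnorm (subvec (ones n + q) N)"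
    proof (rule vnorm_subvec_mono[OF wc[OF qc] oc[OF qc] sub(2)])
      fix i assume "i \<in> N"
      hence i: "i < n" by (rule sub(4))
      have "sqrt (d $ i) * \<bar>1 + q $ i\<bar> \<le> 6 / 5 * \<bar>1 + q $ i\<bar>"
        using sqrt_between(2)[OF i] by (intro mult_right_mono) auto
      thus "\<bar>((x + x \<odot>\<^sub>v q) \<oslash>\<^sub>v xhat) $ i\<bar> \<le> 6 / 5 * \<bar>(ones n + q) $ i\<bar>"
        unfolding val[OF qc i] using i qc d0[OF i] by (simp add: ones_def abs_mult)
    qed simp
    finally have "vnorm (subvec (ones n + p) N) \<le> 5 / 4 * (6 / 5 * vnorm (subvec (ones n + q) N))" by simp
    thus ?thesis using q(2) vnorm_ge_0[of "subvec (ones n + q) N"] by linarith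
  qed
  have uB: "vnorm (subvec (d + u) B) \<le> 2 * err"
  proof -
    obtain q where q: "q \<in> Y" "vnorm (subvec (d + q) B) \<le> err" using dual_profile(2)[OF Y] by blast
    define dir where "dir r = map_vec inverse x \<odot>\<^sub>v (\<mu> \<cdot>\<^sub>v r)" for r :: "real vec"
    have dirc: "dir r \<in> carrier_vec n" for r using carriers by (simp add: dir_def)
    have ds_dir: "ds = dir u"
      using u0 u0c carriers \<mu> by (auto simp: dir_def u_def intro!: eq_vecI)
    have obj: "vnorm (subvec (s + dir r) B \<oslash>\<^sub>v subvec shat B) = vnorm (subvec ((s + dir r) \<oslash>\<^sub>v shat) B)" for r
      using dirc carriers hats sub by (subst subvec_vdivide[of _ n]) auto
    have val: "((s + dir r) \<oslash>\<^sub>v shat) $ i = (d $ i + r $ i) / sqrt (d $ i)" if "r \<in> carrier_vec n" "i < n" for r i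
      using weight_s[OF that(2), of "r $ i"] that carriers hats by (simp add: dir_def divide_inverse mult.commute)
    have wc: "(s + dir r) \<oslash>\<^sub>v shat \<in> carrier_vec n" for r using dirc[of r] carriers by simp
    have oc: "d + r \<in> carrier_vec n" if "r \<in> carrier_vec n" for r using that carriers by simp
    have qc: "q \<in> carrier_vec n" by (rule Yc[OF q(1)])
    have "vnorm (subvec (d + u) B) \<le> 6 / 5 * vnorm (subvec ((s + dir u) \<oslash>\<^sub>v shat) B)"
    proof (rule vnorm_subvec_mono[OF oc[OF uc] wc sub(1)])
      fix i assume "i \<in> B"
      hence i: "i < n" by (rule sub(3))
      have sq: "0 < sqrt (d $ i)" using d0[OF i] by simp
      have "\<bar>d $ i + u $ i\<bar> * sqrt (d $ i) \<le> \<bar>d $ i + u $ i\<bar> * (6 / 5)"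
        using sqrt_between(2)[OF i] by (intro mult_left_mono) auto
      hence "\<bar>d $ i + u $ i\<bar> \<le> \<bar>d $ i + u $ i\<bar> * (6 / 5) / sqrt (d $ i)" unfolding pos_le_divide_eq[OF sq] .
      moreover have "\<bar>(d $ i + u $ i) / sqrt (d $ i)\<bar> = \<bar>d $ i + u $ i\<bar> / sqrt (d $ i)"
        unfolding abs_divide abs_of_pos[OF sq] ..
      moreover have "(d + u) $ i = d $ i + u $ i" using i uc carriers by simp
      ultimately show "\<bar>(d + u) $ i\<bar> \<le> 6 / 5 * \<bar>((s + dir u) \<oslash>\<^sub>v shat) $ i\<bar>"
        unfolding val[OF uc i] by (simp only: times_divide_eq_left times_divide_eq_right mult.commute)
    qed simp
    also have "vnorm (subvec ((s + dir u) \<oslash>\<^sub>v shat) B) \<le> vnorm (subvec ((s + dir q) \<oslash>\<^sub>v shat) B)"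
    proof -
      have "dir q \<in> vscale (map_vec inverse x) Y" using Yscale[OF q(1)] by (auto simp: vscale_def dir_def)
      hence "\<not> vnorm (subvec (s + dir q) B \<oslash>\<^sub>v subvec shat B) < vnorm (subvec (s + ds) B \<oslash>\<^sub>v subvec shat B)"
        using ds by (auto simp: is_arg_min_def shat_def)
      thus ?thesis unfolding ds_dir obj by simp
    qed
    also have "vnorm (subvec ((s + dir q) \<oslash>\<^sub>v shat) B) \<le> 5 / 4 * vnorm (subvec (d + q) B)"
    proof (rule vnorm_subvec_mono[OF wc oc[OF qc] sub(1)])
      fix i assume "i \<in> B"
      hence i: "i < n" by (rule sub(3))
      have sq: "0 < sqrt (d $ i)" using d0[OF i] by simp
      have "\<bar>d $ i + q $ i\<bar> * 1 \<le> \<bar>d $ i + q $ i\<bar> * (5 / 4 * sqrt (d $ i))"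
        using sqrt_between(1)[OF i] by (intro mult_left_mono) auto
      hence "\<bar>d $ i + q $ i\<bar> \<le> (5 / 4 * \<bar>d $ i + q $ i\<bar>) * sqrt (d $ i)" by simp
      hence "\<bar>d $ i + q $ i\<bar> / sqrt (d $ i) \<le> 5 / 4 * \<bar>d $ i + q $ i\<bar>" unfolding pos_divide_le_eq[OF sq] .
      moreover have "\<bar>(d $ i + q $ i) / sqrt (d $ i)\<bar> = \<bar>d $ i + q $ i\<bar> / sqrt (d $ i)"
        unfolding abs_divide abs_of_pos[OF sq] ..
      moreover have "(d + q) $ i = d $ i + q $ i" using i qc carriers by simp
      ultimately show "\<bar>((s + dir q) \<oslash>\<^sub>v shat) $ i\<bar> \<le> 5 / 4 * \<bar>(d + q) $ i\<bar>"
        unfolding val[OF qc i] by (simp only:)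
    qed simp
    finally have "vnorm (subvec (d + u) B) \<le> 6 / 5 * (5 / 4 * vnorm (subvec (d + q) B))" by simp
    thus ?thesis using q(2) vnorm_ge_0[of "subvec (d + q) B"] by linarith
  qed
  have E: "0 \<le> 2 * err" "2 * err \<le> 1 / 4" using err_nonneg small by auto
  note S = approximate_split_bounds[OF pc uc E pN primal_profile(1)[OF X p(1)] uB dual_profile(1)[OF Y uY]]
  have r400: "3 / 2 * (\<rho> * \<tau> * sqrt n) \<le> 1 / 200" using small by simp
  \<comment> \<open>The scaled product (1 + p) (d + u) has a small first factor on N and a small
    second factor on B, the other factor being at most 2.\<close>
  define w where "w = vec n (\<lambda>i. (1 + p $ i) * (d $ i + u $ i))"
  have w: "w \<in> carrier_vec n" by (simp add: w_def)
  have xw: "(x + dx) \<odot>\<^sub>v (s + ds) = \<mu> \<cdot>\<^sub>v w"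
  proof (rule eq_vecI)
    fix i assume "i < dim_vec (\<mu> \<cdot>\<^sub>v w)"
    hence i: "i < n" using w by simp
    have "((x + dx) \<odot>\<^sub>v (s + ds)) $ i = (x $ i + x $ i * p $ i) * (s $ i + \<mu> * u $ i / x $ i)"
      using i carriers dc dxi[OF i] dsi[OF i] by simp
    also have "\<dots> = (1 + p $ i) * (x $ i * s $ i + \<mu> * u $ i)" using pos(1)[OF i] by (simp add: field_simps)
    also have "x $ i * s $ i + \<mu> * u $ i = \<mu> * (d $ i + u $ i)" using \<mu> by (simp add: d_index[OF i] field_simps)
    finally show "((x + dx) \<odot>\<^sub>v (s + ds)) $ i = (\<mu> \<cdot>\<^sub>v w) $ i" using i by (simp add: w_def)
  qed (use carriers w dc in auto)
  have "vnorm (subvec w N) \<le> 2 * vnorm (subvec (ones n + p) N)"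
  proof (rule vnorm_subvec_mono[OF w _ sub(2)])
    fix i assume iN: "i \<in> N"
    hence i: "i < n" by (rule sub(4))
    have "\<bar>u $ i\<bar> \<le> 1 / 200" using abs_index_le_vnorm_subvec[OF uc sub(2) iN] S(4) r400 by linarith
    hence "\<bar>d $ i + u $ i\<bar> \<le> 2" using d_bounds[OF i] unfolding abs_le_iff by linarith
    hence "\<bar>1 + p $ i\<bar> * \<bar>d $ i + u $ i\<bar> \<le> \<bar>1 + p $ i\<bar> * 2" by (intro mult_left_mono) auto
    thus "\<bar>w $ i\<bar> \<le> 2 * \<bar>(ones n + p) $ i\<bar>" using i pc by (simp add: w_def ones_def abs_mult)
  qed (use pc in auto)
  moreover have "vnorm (subvec w B) \<le> 2 * vnorm (subvec (d + u) B)"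
  proof (rule vnorm_subvec_mono[OF w _ sub(1)])
    fix i assume iB: "i \<in> B"
    hence i: "i < n" by (rule sub(3))
    have "\<bar>p $ i\<bar> \<le> 1 / 200" using abs_index_le_vnorm_subvec[OF pc sub(1) iB] S(2) r400 by linarith
    hence "\<bar>1 + p $ i\<bar> \<le> 2" unfolding abs_le_iff by linarith
    hence "\<bar>1 + p $ i\<bar> * \<bar>d $ i + u $ i\<bar> \<le> 2 * \<bar>d $ i + u $ i\<bar>" by (intro mult_right_mono) auto
    thus "\<bar>w $ i\<bar> \<le> 2 * \<bar>(d + u) $ i\<bar>" using i uc carriers by (simp add: w_def abs_mult)
  qed (use uc carriers in auto)
  ultimately have "vnorm w \<le> 10 * err"
    using vnorm_le_parts[OF w part] pN uB err_nonneg by linarith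
  hence "\<mu> * vnorm w \<le> \<mu> * (10 * err)" using \<mu> by (intro mult_left_mono) auto
  thus "vnorm ((x + dx) \<odot>\<^sub>v (s + ds)) \<le> 10 * err * \<mu>" unfolding xw vnorm_smult using \<mu> by (simp add: mult.commute)
  \<comment> \<open>In the scaled product p u, cheapness makes p small on B and u small on N. The
    other factor is of order sqrt n, which gives n \<rho> \<tau>.\<close>
  define v where "v = p \<odot>\<^sub>v u"
  have v: "v \<in> carrier_vec n" using pc by (simp add: v_def)
  have dv: "dx \<odot>\<^sub>v ds = \<mu> \<cdot>\<^sub>v v"
  proof (rule eq_vecI)
    fix i assume "i < dim_vec (\<mu> \<cdot>\<^sub>v v)"
    hence i: "i < n" using v by simp
    show "(dx \<odot>\<^sub>v ds) $ i = (\<mu> \<cdot>\<^sub>v v) $ i"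
      using i dc dxi[OF i] dsi[OF i] pc pos(1)[OF i] by (simp add: v_def)
  qed (use v dc in auto)
  have prod_sub: "vnorm (subvec v J) \<le> vnorm (subvec p J) * vnorm (subvec u J)" if J: "J \<subseteq> {..<n}" for J
  proof (rule vnorm_subvec_mono[OF v uc J])
    fix i assume i: "i \<in> J"
    have "\<bar>p $ i\<bar> * \<bar>u $ i\<bar> \<le> vnorm (subvec p J) * \<bar>u $ i\<bar>"
      using abs_index_le_vnorm_subvec[OF pc J i] by (intro mult_right_mono) auto
    thus "\<bar>v $ i\<bar> \<le> vnorm (subvec p J) * \<bar>u $ i\<bar>" using i J pc by (auto simp: v_def abs_mult)
  qed simp
  have regroup: "(3 / 2 * r) * (3 / 2 * (t * r)) = 9 / 4 * (r * r * t)" "(3 / 2 * (t * r)) * (3 / 2 * r) = 9 / 4 * (r * r * t)" for r t :: real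
    by (simp_all add: algebra_simps)
  have \<rho>\<tau>: "0 \<le> \<rho> * \<tau>" using \<rho> \<tau> by simp
  have "vnorm (subvec p N) * vnorm (subvec u N) \<le> (3 / 2 * sqrt n) * (3 / 2 * (\<rho> * \<tau> * sqrt n))"
    using S \<rho>\<tau> by (intro mult_mono) auto
  moreover have "vnorm (subvec p B) * vnorm (subvec u B) \<le> (3 / 2 * (\<rho> * \<tau> * sqrt n)) * (3 / 2 * sqrt n)"
    using S \<rho>\<tau> by (intro mult_mono) auto
  moreover have "(3 / 2 * sqrt n) * (3 / 2 * (\<rho> * \<tau> * sqrt n)) = 9 / 4 * (real n * (\<rho> * \<tau>))"
    "(3 / 2 * (\<rho> * \<tau> * sqrt n)) * (3 / 2 * sqrt n) = 9 / 4 * (real n * (\<rho> * \<tau>))"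
    unfolding regroup by simp_all
  moreover have "0 \<le> real n * (\<rho> * \<tau>)" using \<rho>\<tau> by simp
  ultimately have "vnorm v \<le> 8 * (real n * (\<rho> * \<tau>))"
    using vnorm_le_parts[OF v part] prod_sub[OF sub(1)] prod_sub[OF sub(2)] by linarith
  hence "\<mu> * vnorm v \<le> \<mu> * (8 * (real n * (\<rho> * \<tau>)))" using \<mu> by (intro mult_left_mono) auto
  thus "vnorm (dx \<odot>\<^sub>v ds) \<le> 8 * (real n * (\<rho> * \<tau>)) * \<mu>" unfolding dv vnorm_smult using \<mu> by (simp add: mult.commute)
qed

end

lemma abs_mean_product_le:
  assumes "v \<in> carrier_vec n" "0 < n"
  shows "\<bar>(\<Sum>i<n. v $ i) / real n\<bar> \<le> vnorm v"
proof -
  have "v - 0 \<cdot>\<^sub>v ones n = v" using assms by (intro eq_vecI) (auto simp: ones_def)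
  thus ?thesis using deviation_from_mean_le(2)[OF assms, of 0] by simp
qed

text \<open>The final mean is (1 - \<alpha>) \<mu> plus \<alpha> times the mean product at full
  step. The first part is at most 9 \<epsilon> / \<beta> times \<mu>, the second at most \<epsilon>
  \<mu>, and \<beta> \<le> 1.\<close>

lemma slls_progress:
  assumes A: "A \<in> carrier_mat m n" and n: "0 < n" and c: "x \<in> carrier_vec n" "s \<in> carrier_vec n"
    and d: "dx \<in> primal_space A" "ds \<in> dual_space A" and \<mu>: "x \<bullet> s = real n * \<mu>" "0 < \<mu>"
    and \<beta>: "0 < \<beta>" "\<beta> \<le> 1"
    and \<epsilon>: "\<epsilon> = vnorm ((x + dx) \<odot>\<^sub>v (s + ds)) / \<mu>" "\<epsilon> \<le> \<beta> / 9"
    and \<alpha>: "1 - 9 * \<epsilon> / \<beta> \<le> \<alpha>" "\<alpha> \<le> 1"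
  shows "mubar (x + \<alpha> \<cdot>\<^sub>v dx, s + \<alpha> \<cdot>\<^sub>v ds) \<le> 10 * \<epsilon> / \<beta> * \<mu>"
proof -
  have dc: "dx \<in> carrier_vec n" "ds \<in> carrier_vec n"
    using primal_spaceD[OF A d(1)] dual_space_carrier[OF A d(2)] by auto
  define e where "e = (x + dx) \<odot>\<^sub>v (s + ds)"
  have e: "e \<in> carrier_vec n" using c dc by (simp add: e_def)
  have ne: "vnorm e = \<epsilon> * \<mu>" using \<epsilon>(1) \<mu>(2) by (simp add: e_def)
  have \<epsilon>0: "0 \<le> \<epsilon>" using \<epsilon>(1) \<mu>(2) by simp
  have \<alpha>0: "0 \<le> \<alpha>"
  proof -
    have "9 * \<epsilon> / \<beta> \<le> 1" using \<epsilon>(2) \<beta> by (simp add: pos_divide_le_eq)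
    thus ?thesis using \<alpha> by linarith
  qed
  have "(\<Sum>i<n. e $ i) / real n \<le> \<epsilon> * \<mu>" using abs_mean_product_le[OF e n] ne by linarith
  hence "\<alpha> * ((\<Sum>i<n. e $ i) / real n) \<le> \<alpha> * (\<epsilon> * \<mu>)" using \<alpha>0 by (intro mult_left_mono)
  also have "\<dots> \<le> 1 * (\<epsilon> * \<mu>)" using \<alpha> \<epsilon>0 \<mu>(2) by (intro mult_right_mono) auto
  finally have 1: "\<alpha> * ((\<Sum>i<n. e $ i) / real n) \<le> \<epsilon> * \<mu>" by simp
  have 2: "(1 - \<alpha>) * \<mu> \<le> 9 * \<epsilon> / \<beta> * \<mu>" using \<alpha> \<mu>(2) by (intro mult_right_mono) auto
  have "\<epsilon> * \<beta> \<le> \<epsilon> * 1" using \<beta> \<epsilon>0 by (intro mult_left_mono) auto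
  hence "\<epsilon> \<le> \<epsilon> / \<beta>" using \<beta> by (simp add: pos_le_divide_eq)
  hence 3: "\<epsilon> * \<mu> \<le> \<epsilon> / \<beta> * \<mu>" using \<mu>(2) by (intro mult_right_mono) auto
  have split: "10 * \<epsilon> / \<beta> * \<mu> = 9 * \<epsilon> / \<beta> * \<mu> + \<epsilon> / \<beta> * \<mu>" by (simp add: field_simps)
  show ?thesis
    unfolding mubar_line[OF A n c d \<mu>(1)] e_def[symmetric]
    using 1 2 3 split by linarith
qed

section \<open>One iteration\<close>

text \<open>The state after the corrector: deviation \<beta> / 10 instead of \<beta>, which is the
  slack that the two kinds of step spend.\<close>

locale corrected_iterate =
  fixes m n :: nat and A :: "real mat" and b c x s :: "real vec" and \<mu> \<beta> :: real
  assumes A: "A \<in> carrier_mat m n" and n: "0 < n"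
    and x: "x \<in> primal_interior A b" and s: "s \<in> dual_interior A c"
    and \<mu>: "0 < \<mu>" "x \<bullet> s = real n * \<mu>" and \<beta>: "0 < \<beta>" "\<beta> \<le> 1 / 6"
    and dev: "vnorm (x \<odot>\<^sub>v s - \<mu> \<cdot>\<^sub>v ones n) \<le> \<beta> / 10 * \<mu>"
begin

lemma carriers: "x \<in> carrier_vec n" "s \<in> carrier_vec n"
  using x s by (auto simp: primal_interior_iff[OF A] dual_interior_iff[OF A])

lemma pos: "i < n \<Longrightarrow> 0 < x $ i" "i < n \<Longrightarrow> 0 < s $ i"
  using x s by (auto simp: primal_interior_iff[OF A] dual_interior_iff[OF A])

text \<open>As a quadratic in t the product is (1 - t) x s + t e - t (1 - t) dx ds, where e is the
  product at the full step.\<close>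

lemma line_deviation:
  assumes d: "dx \<in> carrier_vec n" "ds \<in> carrier_vec n" and t: "0 \<le> t" "t \<le> 1"
  shows "vnorm ((x + t \<cdot>\<^sub>v dx) \<odot>\<^sub>v (s + t \<cdot>\<^sub>v ds) - ((1 - t) * \<mu>) \<cdot>\<^sub>v ones n)
    \<le> (1 - t) * (\<beta> / 10 * \<mu>) + t * vnorm ((x + dx) \<odot>\<^sub>v (s + ds)) + t * (1 - t) * vnorm (dx \<odot>\<^sub>v ds)"
proof -
  let ?e = "(x + dx) \<odot>\<^sub>v (s + ds)" and ?p = "dx \<odot>\<^sub>v ds"
  have e: "?e \<in> carrier_vec n" and p: "?p \<in> carrier_vec n" and w: "x \<odot>\<^sub>v s - \<mu> \<cdot>\<^sub>v ones n \<in> carrier_vec n"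
    using carriers d by auto
  have "(x + t \<cdot>\<^sub>v dx) \<odot>\<^sub>v (s + t \<cdot>\<^sub>v ds) - ((1 - t) * \<mu>) \<cdot>\<^sub>v ones n
    = ((1 - t) \<cdot>\<^sub>v (x \<odot>\<^sub>v s - \<mu> \<cdot>\<^sub>v ones n) + t \<cdot>\<^sub>v ?e) + (- (t * (1 - t))) \<cdot>\<^sub>v ?p"
    using carriers d by (intro eq_vecI) (auto simp: ones_def algebra_simps)
  also have "vnorm \<dots> \<le> (vnorm ((1 - t) \<cdot>\<^sub>v (x \<odot>\<^sub>v s - \<mu> \<cdot>\<^sub>v ones n)) + vnorm (t \<cdot>\<^sub>v ?e)) + vnorm ((- (t * (1 - t))) \<cdot>\<^sub>v ?p)"
    using vnorm_triangle[of "(1 - t) \<cdot>\<^sub>v (x \<odot>\<^sub>v s - \<mu> \<cdot>\<^sub>v ones n)" n "t \<cdot>\<^sub>v ?e"]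
      vnorm_triangle[of "(1 - t) \<cdot>\<^sub>v (x \<odot>\<^sub>v s - \<mu> \<cdot>\<^sub>v ones n) + t \<cdot>\<^sub>v ?e" n "(- (t * (1 - t))) \<cdot>\<^sub>v ?p"] e p w
    by fastforce
  also have "\<dots> = (1 - t) * vnorm (x \<odot>\<^sub>v s - \<mu> \<cdot>\<^sub>v ones n) + t * vnorm ?e + t * (1 - t) * vnorm ?p"
    using t by (simp add: vnorm_smult abs_mult)
  also have "\<dots> \<le> (1 - t) * (\<beta> / 10 * \<mu>) + t * vnorm ?e + t * (1 - t) * vnorm ?p"
    using mult_left_mono[OF dev, of "1 - t"] t by simp
  finally show ?thesis .
qed

text \<open>For \<alpha> = 1 the deviation bound forces all products to be 0. The end point is then
  optimal and lies in the closure, which is why the conclusion is a disjunction.\<close>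

lemma line_step:
  assumes d: "dx \<in> primal_space A" "ds \<in> dual_space A" and \<alpha>: "0 \<le> \<alpha>" "\<alpha> \<le> 1"
    and dev': "\<And>t. 0 \<le> t \<Longrightarrow> t \<le> \<alpha> \<Longrightarrow>
      vnorm ((x + t \<cdot>\<^sub>v dx) \<odot>\<^sub>v (s + t \<cdot>\<^sub>v ds) - ((1 - t) * \<mu>) \<cdot>\<^sub>v ones n) \<le> 3 / 5 * \<beta> * ((1 - t) * \<mu>)"
  shows "(x + \<alpha> \<cdot>\<^sub>v dx, s + \<alpha> \<cdot>\<^sub>v ds) \<in> nbhd A b c \<beta> \<or>
    (x + \<alpha> \<cdot>\<^sub>v dx, s + \<alpha> \<cdot>\<^sub>v ds) \<in> nbhd_closure A b c \<beta> \<and> mubar (x + \<alpha> \<cdot>\<^sub>v dx, s + \<alpha> \<cdot>\<^sub>v ds) = 0"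
proof -
  have dc: "dx \<in> carrier_vec n" "ds \<in> carrier_vec n"
    using primal_spaceD[OF A d(1)] dual_space_carrier[OF A d(2)] by auto
  have inside: "(x + t \<cdot>\<^sub>v dx, s + t \<cdot>\<^sub>v ds) \<in> nbhd A b c \<beta>" if "0 \<le> t" "t < 1" "t \<le> \<alpha>" for t
    using that \<beta> dev' by (intro line_step_nbhd[OF A n x s d \<mu>(1), of "3 / 5 * \<beta>"]) auto
  show ?thesis
  proof (cases "\<alpha> < 1")
    case True
    thus ?thesis using inside[of \<alpha>] \<alpha> by simp
  next
    case False
    hence \<alpha>1: "\<alpha> = 1" using \<alpha> by simp
    have "(x + 1 \<cdot>\<^sub>v dx, s + 1 \<cdot>\<^sub>v ds) \<in> nbhd_closure A b c \<beta>"
      using inside \<alpha>1 by (intro line_step_closure[OF A carriers dc]) auto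
    moreover have "vnorm ((x + 1 \<cdot>\<^sub>v dx) \<odot>\<^sub>v (s + 1 \<cdot>\<^sub>v ds) - 0 \<cdot>\<^sub>v ones n) \<le> 0" using dev'[of 1] \<alpha>1 by simp
    hence "\<bar>(\<Sum>i<n. ((x + 1 \<cdot>\<^sub>v dx) \<odot>\<^sub>v (s + 1 \<cdot>\<^sub>v ds)) $ i) / real n - 0\<bar> \<le> 0"
      using deviation_from_mean_le(2)[OF _ n, of "(x + 1 \<cdot>\<^sub>v dx) \<odot>\<^sub>v (s + 1 \<cdot>\<^sub>v ds)" 0] carriers dc by fastforce
    hence mean0: "(\<Sum>i<n. ((x + 1 \<cdot>\<^sub>v dx) \<odot>\<^sub>v (s + 1 \<cdot>\<^sub>v ds)) $ i) / real n = 0"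
      by (simp only: diff_zero abs_le_zero_iff)
    have "mubar (x + 1 \<cdot>\<^sub>v dx, s + 1 \<cdot>\<^sub>v ds) = 0"
      unfolding mubar_line[OF A n carriers d \<mu>(2), of 1] using mean0 by (simp only: one_smult_vec) simp
    ultimately show ?thesis unfolding \<alpha>1 by simp
  qed
qed

lemma affine_product:
  assumes "newton_direction A x s (- (x \<odot>\<^sub>v s)) dx ds"
  shows "(x + dx) \<odot>\<^sub>v (s + ds) = dx \<odot>\<^sub>v ds" "vnorm (dx \<odot>\<^sub>v ds) \<le> real n * \<mu> / 2"
proof -
  have d: "dx \<in> primal_space A" "ds \<in> dual_space A" and eq: "s \<odot>\<^sub>v dx + x \<odot>\<^sub>v ds = - (x \<odot>\<^sub>v s)"
    using assms by (auto simp: newton_direction_def)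
  have dc: "dx \<in> carrier_vec n" "ds \<in> carrier_vec n"
    using primal_spaceD[OF A d(1)] dual_space_carrier[OF A d(2)] by auto
  show "(x + dx) \<odot>\<^sub>v (s + ds) = dx \<odot>\<^sub>v ds"
  proof (rule eq_vecI)
    fix i assume "i < dim_vec (dx \<odot>\<^sub>v ds)"
    hence i: "i < n" using dc by simp
    have "s $ i * dx $ i + x $ i * ds $ i = - (x $ i * s $ i)"
      using arg_cong[OF eq, of "\<lambda>v. v $ i"] i carriers dc by simp
    moreover have "((x + dx) \<odot>\<^sub>v (s + ds)) $ i = (x $ i * s $ i + (s $ i * dx $ i + x $ i * ds $ i)) + dx $ i * ds $ i"
      using i carriers dc by (simp add: algebra_simps)
    ultimately show "((x + dx) \<odot>\<^sub>v (s + ds)) $ i = (dx \<odot>\<^sub>v ds) $ i" using i dc by simp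
  qed (use carriers dc in auto)
  have "vnorm (dx \<odot>\<^sub>v ds) \<le> (\<Sum>i<n. ((- (x \<odot>\<^sub>v s)) $ i)\<^sup>2 / (x $ i * s $ i)) / 2"
    by (rule newton_product_bound[OF A x s assms])
  also have "(\<Sum>i<n. ((- (x \<odot>\<^sub>v s)) $ i)\<^sup>2 / (x $ i * s $ i)) = (\<Sum>i<n. x $ i * s $ i)"
  proof (rule sum.cong[OF refl])
    fix i assume "i \<in> {..<n}"
    thus "((- (x \<odot>\<^sub>v s)) $ i)\<^sup>2 / (x $ i * s $ i) = x $ i * s $ i"
      using carriers pos[of i] by (simp add: power2_eq_square)
  qed
  also have "\<dots> = real n * \<mu>" using \<mu>(2) by (simp add: scalar_prod_eq_sum[OF carriers(2)])
  finally show "vnorm (dx \<odot>\<^sub>v ds) \<le> real n * \<mu> / 2" .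
qed

lemma affine_step:
  assumes newton: "newton_direction A x s (- (x \<odot>\<^sub>v s)) dx ds" and \<alpha>: "0 \<le> \<alpha>" "\<alpha> \<le> 1"
    "\<alpha> \<le> max (\<beta> / (2 * sqrt n)) (1 - 2 * vnorm (dx \<odot>\<^sub>v ds) / (\<beta> * \<mu>))"
  shows "(x + \<alpha> \<cdot>\<^sub>v dx, s + \<alpha> \<cdot>\<^sub>v ds) \<in> nbhd A b c \<beta> \<or>
    (x + \<alpha> \<cdot>\<^sub>v dx, s + \<alpha> \<cdot>\<^sub>v ds) \<in> nbhd_closure A b c \<beta> \<and> mubar (x + \<alpha> \<cdot>\<^sub>v dx, s + \<alpha> \<cdot>\<^sub>v ds) = 0"
    and "mubar (x + \<alpha> \<cdot>\<^sub>v dx, s + \<alpha> \<cdot>\<^sub>v ds) = (1 - \<alpha>) * \<mu>"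
proof -
  have d: "dx \<in> primal_space A" "ds \<in> dual_space A" using newton by (auto simp: newton_direction_def)
  have dc: "dx \<in> carrier_vec n" "ds \<in> carrier_vec n"
    using primal_spaceD[OF A d(1)] dual_space_carrier[OF A d(2)] by auto
  define D where "D = vnorm (dx \<odot>\<^sub>v ds)"
  have D: "0 \<le> D" "D \<le> real n * \<mu> / 2" using affine_product(2)[OF newton] by (auto simp: D_def)
  \<comment> \<open>Two regimes of the step length. A step up to \<beta> / (2 sqrt n) is covered by
    the worst-case bound n \<mu> / 2 on the product; a longer one satisfies 2 D \<le> (1 - t)
    \<beta> \<mu> by its definition. Together with the \<beta> / 10 left by the corrector this makes
    3/5 \<beta>.\<close>
  have product_small: "t * t * D \<le> 1 / 2 * \<beta> * ((1 - t) * \<mu>)" if t: "0 \<le> t" "t \<le> \<alpha>" for t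
  proof (cases "\<alpha> \<le> \<beta> / (2 * sqrt n)")
    case True
    have sq: "1 \<le> sqrt n" "sqrt n * sqrt n = n" using n by auto
    have t': "t \<le> \<beta> / (2 * sqrt n)" using t True by linarith
    hence "t * t * D \<le> (\<beta> / (2 * sqrt n)) * (\<beta> / (2 * sqrt n)) * (real n * \<mu> / 2)"
      using t D \<beta> by (intro mult_mono) auto
    also have "\<dots> = \<beta> * \<beta> * \<mu> / 8 * (real n / (sqrt n * sqrt n))" by simp
    also have "\<dots> = \<beta> * (\<beta> * \<mu>) / 8" unfolding sq(2) using n by simp
    also have "\<dots> \<le> \<beta> * (1 / 6 * \<mu>) / 8" using \<beta> \<mu> by (intro divide_right_mono mult_left_mono mult_right_mono) auto
    finally have 1: "t * t * D \<le> 1 / 2 * \<beta> * (1 / 24 * \<mu>)" by simp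
    have "\<beta> / (2 * sqrt n) \<le> \<beta> / (2 * 1)" using sq \<beta> by (intro divide_left_mono) auto
    hence "1 / 24 \<le> 1 - t" using t' \<beta> by simp
    hence "1 / 2 * \<beta> * (1 / 24 * \<mu>) \<le> 1 / 2 * \<beta> * ((1 - t) * \<mu>)" using \<beta> \<mu>
      by (intro mult_left_mono mult_right_mono) auto
    thus ?thesis using 1 by linarith
  next
    case False
    hence "t \<le> 1 - 2 * D / (\<beta> * \<mu>)" using \<alpha>(3) t by (simp add: D_def)
    hence "2 * D / (\<beta> * \<mu>) \<le> 1 - t" by simp
    hence "2 * D \<le> (1 - t) * (\<beta> * \<mu>)" using \<beta> \<mu> by (simp add: pos_divide_le_eq)
    moreover have "t * t * D \<le> 1 * 1 * D" using t \<alpha> D by (intro mult_mono) auto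
    moreover have "1 / 2 * \<beta> * ((1 - t) * \<mu>) = (1 - t) * (\<beta> * \<mu>) / 2" by simp
    ultimately show ?thesis by linarith
  qed
  show "(x + \<alpha> \<cdot>\<^sub>v dx, s + \<alpha> \<cdot>\<^sub>v ds) \<in> nbhd A b c \<beta> \<or>
    (x + \<alpha> \<cdot>\<^sub>v dx, s + \<alpha> \<cdot>\<^sub>v ds) \<in> nbhd_closure A b c \<beta> \<and> mubar (x + \<alpha> \<cdot>\<^sub>v dx, s + \<alpha> \<cdot>\<^sub>v ds) = 0"
  proof (rule line_step[OF d \<alpha>(1,2)])
    fix t assume t: "0 \<le> t" "t \<le> \<alpha>"
    let ?e = "(x + t \<cdot>\<^sub>v dx) \<odot>\<^sub>v (s + t \<cdot>\<^sub>v ds)"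
    have "?e - ((1 - t) * \<mu>) \<cdot>\<^sub>v ones n = (1 - t) \<cdot>\<^sub>v (x \<odot>\<^sub>v s - \<mu> \<cdot>\<^sub>v ones n) + (t * t) \<cdot>\<^sub>v (dx \<odot>\<^sub>v ds)"
    proof (rule eq_vecI)
      fix i assume "i < dim_vec ((1 - t) \<cdot>\<^sub>v (x \<odot>\<^sub>v s - \<mu> \<cdot>\<^sub>v ones n) + (t * t) \<cdot>\<^sub>v (dx \<odot>\<^sub>v ds))"
      hence i: "i < n" using dc by simp
      have "((x + dx) \<odot>\<^sub>v (s + ds)) $ i = (dx \<odot>\<^sub>v ds) $ i" unfolding affine_product(1)[OF newton] ..
      hence "x $ i * ds $ i + dx $ i * s $ i = - (x $ i * s $ i)" using i carriers dc by (simp add: algebra_simps)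
      moreover have "(x $ i + t * dx $ i) * (s $ i + t * ds $ i) =
        x $ i * s $ i + t * (x $ i * ds $ i + dx $ i * s $ i) + t * t * (dx $ i * ds $ i)"
        by (simp add: algebra_simps)
      ultimately have "(x $ i + t * dx $ i) * (s $ i + t * ds $ i) =
        x $ i * s $ i + t * (- (x $ i * s $ i)) + t * t * (dx $ i * ds $ i)" by simp
      thus "(?e - ((1 - t) * \<mu>) \<cdot>\<^sub>v ones n) $ i = ((1 - t) \<cdot>\<^sub>v (x \<odot>\<^sub>v s - \<mu> \<cdot>\<^sub>v ones n) + (t * t) \<cdot>\<^sub>v (dx \<odot>\<^sub>v ds)) $ i"
        using i carriers dc by (simp add: ones_def algebra_simps)
    qed (use carriers dc in auto)
    hence "vnorm (?e - ((1 - t) * \<mu>) \<cdot>\<^sub>v ones n) \<le> vnorm ((1 - t) \<cdot>\<^sub>v (x \<odot>\<^sub>v s - \<mu> \<cdot>\<^sub>v ones n)) + vnorm ((t * t) \<cdot>\<^sub>v (dx \<odot>\<^sub>v ds))"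
      using vnorm_triangle[of "(1 - t) \<cdot>\<^sub>v (x \<odot>\<^sub>v s - \<mu> \<cdot>\<^sub>v ones n)" n "(t * t) \<cdot>\<^sub>v (dx \<odot>\<^sub>v ds)"] carriers dc by simp
    also have "\<dots> = (1 - t) * vnorm (x \<odot>\<^sub>v s - \<mu> \<cdot>\<^sub>v ones n) + t * t * D"
      using t \<alpha> by (simp add: vnorm_smult abs_mult D_def)
    also have "\<dots> \<le> (1 - t) * (\<beta> / 10 * \<mu>) + 1 / 2 * \<beta> * ((1 - t) * \<mu>)"
      using product_small[OF t] dev t \<alpha> by (intro add_mono mult_left_mono) auto
    also have "\<dots> = 3 / 5 * \<beta> * ((1 - t) * \<mu>)" by (simp add: algebra_simps)
    finally show "vnorm (?e - ((1 - t) * \<mu>) \<cdot>\<^sub>v ones n) \<le> 3 / 5 * \<beta> * ((1 - t) * \<mu>)" .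
  qed
  have "(\<Sum>i<n. ((x + dx) \<odot>\<^sub>v (s + ds)) $ i) = dx \<bullet> ds"
    unfolding affine_product(1)[OF newton] using dc by (simp add: scalar_prod_eq_sum[OF dc(2)])
  thus "mubar (x + \<alpha> \<cdot>\<^sub>v dx, s + \<alpha> \<cdot>\<^sub>v ds) = (1 - \<alpha>) * \<mu>"
    using mubar_line[OF A n carriers d \<mu>(2), of \<alpha>] primal_dual_space_orthogonal[OF A d] by simp
qed

lemma layered_step:
  assumes d: "dx \<in> primal_space A" "ds \<in> dual_space A"
    and \<epsilon>: "\<epsilon> = vnorm ((x + dx) \<odot>\<^sub>v (s + ds)) / \<mu>" "vnorm (dx \<odot>\<^sub>v ds) / \<mu> \<le> \<beta> / 9"
    and \<alpha>: "0 \<le> \<alpha>" "\<alpha> \<le> 1 - 8 * \<epsilon> / \<beta>"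
  shows "(x + \<alpha> \<cdot>\<^sub>v dx, s + \<alpha> \<cdot>\<^sub>v ds) \<in> nbhd A b c \<beta> \<or>
    (x + \<alpha> \<cdot>\<^sub>v dx, s + \<alpha> \<cdot>\<^sub>v ds) \<in> nbhd_closure A b c \<beta> \<and> mubar (x + \<alpha> \<cdot>\<^sub>v dx, s + \<alpha> \<cdot>\<^sub>v ds) = 0"
proof -
  have dc: "dx \<in> carrier_vec n" "ds \<in> carrier_vec n"
    using primal_spaceD[OF A d(1)] dual_space_carrier[OF A d(2)] by auto
  have ne: "vnorm ((x + dx) \<odot>\<^sub>v (s + ds)) = \<epsilon> * \<mu>" and \<epsilon>0: "0 \<le> \<epsilon>" using \<epsilon>(1) \<mu>(1) by auto
  have D: "vnorm (dx \<odot>\<^sub>v ds) \<le> \<beta> / 9 * \<mu>" using \<epsilon>(2) \<mu>(1) by (simp add: pos_divide_le_eq)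
  have "0 \<le> 8 * \<epsilon> / \<beta>" using \<epsilon>0 \<beta> by simp
  hence \<alpha>1: "\<alpha> \<le> 1" using \<alpha> by linarith
  show ?thesis
  proof (rule line_step[OF d \<alpha>(1) \<alpha>1])
    fix t assume t: "0 \<le> t" "t \<le> \<alpha>"
    \<comment> \<open>The budget, relative to (1 - t) \<mu>: \<beta> / 10 from the corrector,
      \<beta> / 8 from the end point (the reason for the bound 1 - 8 \<epsilon> / \<beta>) and
      \<beta> / 9 from dx ds. The sum is below 3/5 \<beta>.\<close>
    have "8 * \<epsilon> / \<beta> \<le> 1 - t" using t \<alpha> by linarith
    hence "\<epsilon> \<le> \<beta> * (1 - t) / 8" using \<beta> by (simp add: pos_divide_le_eq mult.commute)
    hence "\<epsilon> * \<mu> \<le> \<beta> * (1 - t) / 8 * \<mu>" using \<mu> by (intro mult_right_mono) auto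
    moreover have "t * (\<epsilon> * \<mu>) \<le> 1 * (\<epsilon> * \<mu>)" using t \<alpha>1 \<epsilon>0 \<mu> by (intro mult_right_mono) auto
    ultimately have 1: "t * (\<epsilon> * \<mu>) \<le> 1 / 8 * (\<beta> * ((1 - t) * \<mu>))" by simp
    have "t * (1 - t) * vnorm (dx \<odot>\<^sub>v ds) \<le> 1 * (1 - t) * (\<beta> / 9 * \<mu>)"
      using t \<alpha>1 D by (intro mult_mono) auto
    hence 2: "t * (1 - t) * vnorm (dx \<odot>\<^sub>v ds) \<le> 1 / 9 * (\<beta> * ((1 - t) * \<mu>))" by (simp add: ac_simps)
    have 3: "(1 - t) * (\<beta> / 10 * \<mu>) = 1 / 10 * (\<beta> * ((1 - t) * \<mu>))" by simp
    have 4: "0 \<le> \<beta> * ((1 - t) * \<mu>)" using \<beta> t \<alpha>1 \<mu> by simp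
    have 5: "3 / 5 * \<beta> * ((1 - t) * \<mu>) = 3 / 5 * (\<beta> * ((1 - t) * \<mu>))" by simp
    have "t \<le> 1" using t \<alpha>1 by simp
    from line_deviation[OF dc t(1) this]
    show "vnorm ((x + t \<cdot>\<^sub>v dx) \<odot>\<^sub>v (s + t \<cdot>\<^sub>v ds) - ((1 - t) * \<mu>) \<cdot>\<^sub>v ones n) \<le> 3 / 5 * \<beta> * ((1 - t) * \<mu>)"
      unfolding 5 ne using 1 2 3 4 by linarith
  qed
qed

end

section \<open>A complete iteration: form, progress, existence\<close>

lemma nbhd_subset_closure:
  assumes A: "A \<in> carrier_mat m n" and "z \<in> nbhd A b c \<beta>"
  shows "z \<in> nbhd_closure A b c \<beta>"
proof -
  obtain x s where z: "z = (x, s)" by force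
  have "x \<in> carrier_vec (dim_col A)" "s \<in> carrier_vec (dim_col A)"
    using assms(2) z A by (auto simp: nbhd_def primal_interior_iff[OF A] dual_interior_iff[OF A])
  moreover have "\<exists>X S. (\<forall>k::nat. (X k, S k) \<in> nbhd A b c \<beta>) \<and> (\<forall>i<dim_col A.
      (\<lambda>k. X k $ i) \<longlonglongrightarrow> x $ i \<and> (\<lambda>k. S k $ i) \<longlonglongrightarrow> s $ i)"
    using assms(2) unfolding z by (intro exI[of _ "\<lambda>_. x"] exI[of _ "\<lambda>_. s"]) simp
  ultimately show ?thesis unfolding z nbhd_closure_def by simp
qed

text \<open>Inversion of one iteration into the form used below: the corrector is absorbed in the
  locale, the solver outputs are hidden in the profiles X and Y, and feasibility of the layered
  directions is recorded.\<close>

lemma slls_stepE: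
  assumes step: "slls_step A \<beta> svd z z'" and A: "A \<in> carrier_mat m n" and n: "0 < n"
    and z: "z \<in> nbhd A b c \<beta>" and \<beta>: "0 < \<beta>" "\<beta> \<le> 1 / 6" and solver: "rho_svd_solver \<rho> svd"
  obtains x s dxa dsa \<alpha>a B N X Y dxl dsl \<epsilon> \<alpha>l where
    "corrected_iterate m n A b c x s (mubar z) \<beta>"
    "newton_direction A x s (- (x \<odot>\<^sub>v s)) dxa dsa"
    "\<beta> / (3 * sqrt n) \<le> \<alpha>a" "\<alpha>a \<le> 1"
    "\<alpha>a \<le> max (\<beta> / (2 * sqrt n)) (1 - 2 * vnorm (dxa \<odot>\<^sub>v dsa) / (\<beta> * mubar z))"
    "B = {i. i < n \<and> \<bar>dxa $ i / x $ i\<bar> < \<bar>dsa $ i / s $ i\<bar>}" "N = {..<n} - B"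
    "lift_profile svd n (lift_proj A x) B N X" "lift_profile svd n (1\<^sub>m n - lift_proj A x) N B Y"
    "is_arg_min (\<lambda>\<delta>. vnorm (subvec (x + \<delta>) N \<oslash>\<^sub>v subvec (map_vec sqrt ((mubar z \<cdot>\<^sub>v x) \<oslash>\<^sub>v s)) N))
      (\<lambda>\<delta>. \<delta> \<in> vscale x X) dxl"
    "is_arg_min (\<lambda>\<delta>. vnorm (subvec (s + \<delta>) B \<oslash>\<^sub>v subvec (map_vec sqrt ((mubar z \<cdot>\<^sub>v s) \<oslash>\<^sub>v x)) B))
      (\<lambda>\<delta>. \<delta> \<in> vscale (map_vec inverse x) Y) dsl"
    "dxl \<in> primal_space A" "dsl \<in> dual_space A"
    "\<epsilon> = vnorm ((x + dxl) \<odot>\<^sub>v (s + dsl)) / mubar z"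
    "if max (vnorm (dxl \<odot>\<^sub>v dsl) / mubar z) \<epsilon> \<le> \<beta> / 9
      then \<alpha>l \<in> {1 - 9 * \<epsilon> / \<beta> .. 1 - 8 * \<epsilon> / \<beta>} else \<alpha>l = 0"
    "z' = (if mubar (x + \<alpha>l \<cdot>\<^sub>v dxl, s + \<alpha>l \<cdot>\<^sub>v dsl) \<le> mubar (x + \<alpha>a \<cdot>\<^sub>v dxa, s + \<alpha>a \<cdot>\<^sub>v dsa)
      then (x + \<alpha>l \<cdot>\<^sub>v dxl, s + \<alpha>l \<cdot>\<^sub>v dsl) else (x + \<alpha>a \<cdot>\<^sub>v dxa, s + \<alpha>a \<cdot>\<^sub>v dsa))"
proof -
  from step show thesis
  proof (rule slls_step.cases, goal_cases)
    case (1 n' x0 s0 dxc dsc x s \<mu> dxa dsa \<alpha>a B N V U xhat shat dxl dsl \<epsilon> \<alpha>l za zl zz)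
    have n': "n' = n" using 1(3) A by simp
    have z0: "(x0, s0) \<in> nbhd A b c \<beta>" using z 1(1) by simp
    note C = corrector_step[OF A n z0 \<beta> 1(4)[unfolded n'], folded 1(5,6)]
    have \<mu>: "\<mu> = mubar z" unfolding 1(1) 1(7) by (rule C(3))
    have \<mu>0: "0 < mubar z" unfolding 1(1) by (rule nbhdD(3)[OF A n z0])
    have c: "x \<in> carrier_vec n" "s \<in> carrier_vec n" and xp: "\<forall>i<n. 0 < x $ i"
      using C(1,2) by (auto simp: primal_interior_iff[OF A] dual_interior_iff[OF A])
    have it: "corrected_iterate m n A b c x s (mubar z) \<beta>"
    proof
      show "x \<bullet> s = real n * mubar z" using mubar_eq[OF c(1), of s] n by (simp add: \<mu>[symmetric] 1(7))
      show "vnorm (x \<odot>\<^sub>v s - mubar z \<cdot>\<^sub>v ones n) \<le> \<beta> / 10 * mubar z" using C(4) by (simp add: 1(1))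
    qed (fact A n C(1,2) \<mu>0 \<beta>)+
    have BN: "B = {i. i < n \<and> \<bar>dxa $ i / x $ i\<bar> < \<bar>dsa $ i / s $ i\<bar>}" "N = {..<n} - B"
      using 1(13,14) unfolding n' .
    have part: "B \<union> N = {..<n}" "B \<inter> N = {}" unfolding BN by auto
    have part': "N \<union> B = {..<n}" "N \<inter> B = {}" using part by auto
    obtain X Y where XY: "lift_profile svd n (lift_proj A x) B N X" "lift_profile svd n (1\<^sub>m n - lift_proj A x) N B Y"
      "V = vscale x X" "U = vscale (map_vec inverse x) Y"
      using 1(15) unfolding cheap_lift_spaces_iff_profiles[OF A n c(1) xp part] by blast
    note L = lift_proj[OF A c(1) xp]
    have "dxl \<in> V" "dsl \<in> U" using 1(18,19) by (simp_all add: is_arg_min_def)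
    then obtain p u where p: "p \<in> X" "dxl = x \<odot>\<^sub>v p" and u: "u \<in> Y" "dsl = map_vec inverse x \<odot>\<^sub>v u"
      unfolding XY(3,4) vscale_def by blast
    have dxl: "dxl \<in> primal_space A"
      using lift_profile_image[OF L(1) part solver XY(1)] p L(3)[of p] by simp
    have dsl: "dsl \<in> dual_space A"
      using lift_profile_image[OF L(2) part' solver XY(2)] u L(4)[of u] by simp
    show ?thesis
    proof (rule that[OF it 1(8) _ 1(10) _ BN XY(1,2) _ _ dxl dsl])
      show "\<beta> / (3 * sqrt n) \<le> \<alpha>a" using 1(11) unfolding n' by simp
      show "\<alpha>a \<le> max (\<beta> / (2 * sqrt n)) (1 - 2 * vnorm (dxa \<odot>\<^sub>v dsa) / (\<beta> * mubar z))"
        using 1(12) unfolding n' \<mu> .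
      show "is_arg_min (\<lambda>\<delta>. vnorm (subvec (x + \<delta>) N \<oslash>\<^sub>v subvec (map_vec sqrt ((mubar z \<cdot>\<^sub>v x) \<oslash>\<^sub>v s)) N))
        (\<lambda>\<delta>. \<delta> \<in> vscale x X) dxl" using 1(18) unfolding 1(16) \<mu> XY(3) .
      show "is_arg_min (\<lambda>\<delta>. vnorm (subvec (s + \<delta>) B \<oslash>\<^sub>v subvec (map_vec sqrt ((mubar z \<cdot>\<^sub>v s) \<oslash>\<^sub>v x)) B))
        (\<lambda>\<delta>. \<delta> \<in> vscale (map_vec inverse x) Y) dsl" using 1(19) unfolding 1(17) \<mu> XY(4) .
      show "vnorm ((x + dxl) \<odot>\<^sub>v (s + dsl)) / \<mu> = vnorm ((x + dxl) \<odot>\<^sub>v (s + dsl)) / mubar z" unfolding \<mu> ..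
      show "if max (vnorm (dxl \<odot>\<^sub>v dsl) / mubar z) (vnorm ((x + dxl) \<odot>\<^sub>v (s + dsl)) / \<mu>) \<le> \<beta> / 9
        then \<alpha>l \<in> {1 - 9 * (vnorm ((x + dxl) \<odot>\<^sub>v (s + dsl)) / \<mu>) / \<beta> .. 1 - 8 * (vnorm ((x + dxl) \<odot>\<^sub>v (s + dsl)) / \<mu>) / \<beta>}
        else \<alpha>l = 0"
        using 1(21) unfolding 1(20) \<mu> .
      show "z' = (if mubar (x + \<alpha>l \<cdot>\<^sub>v dxl, s + \<alpha>l \<cdot>\<^sub>v dsl) \<le> mubar (x + \<alpha>a \<cdot>\<^sub>v dxa, s + \<alpha>a \<cdot>\<^sub>v dsa)
        then (x + \<alpha>l \<cdot>\<^sub>v dxl, s + \<alpha>l \<cdot>\<^sub>v dsl) else (x + \<alpha>a \<cdot>\<^sub>v dxa, s + \<alpha>a \<cdot>\<^sub>v dsa))"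
        unfolding 1(2) 1(22-24) ..
    qed
  qed
qed

lemma slls_step_nbhd:
  assumes step: "slls_step A \<beta> svd z z'" and A: "A \<in> carrier_mat m n" and n: "0 < n"
    and z: "z \<in> nbhd A b c \<beta>" and \<beta>: "0 < \<beta>" "\<beta> \<le> 1 / 6" and solver: "rho_svd_solver \<rho> svd"
  shows "mubar z' \<le> (1 - \<beta> / (3 * sqrt n)) * mubar z"
    and "z' \<in> nbhd A b c \<beta> \<or> z' \<in> nbhd_closure A b c \<beta> \<and> mubar z' = 0"
proof -
  obtain x s dxa dsa \<alpha>a dxl dsl \<epsilon> \<alpha>l where it: "corrected_iterate m n A b c x s (mubar z) \<beta>"
    and newton: "newton_direction A x s (- (x \<odot>\<^sub>v s)) dxa dsa"
    and \<alpha>a: "\<beta> / (3 * sqrt n) \<le> \<alpha>a" "\<alpha>a \<le> 1"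
    "\<alpha>a \<le> max (\<beta> / (2 * sqrt n)) (1 - 2 * vnorm (dxa \<odot>\<^sub>v dsa) / (\<beta> * mubar z))"
    and d: "dxl \<in> primal_space A" "dsl \<in> dual_space A"
    and \<epsilon>: "\<epsilon> = vnorm ((x + dxl) \<odot>\<^sub>v (s + dsl)) / mubar z"
    and \<alpha>l: "if max (vnorm (dxl \<odot>\<^sub>v dsl) / mubar z) \<epsilon> \<le> \<beta> / 9
      then \<alpha>l \<in> {1 - 9 * \<epsilon> / \<beta> .. 1 - 8 * \<epsilon> / \<beta>} else \<alpha>l = 0"
    and z': "z' = (if mubar (x + \<alpha>l \<cdot>\<^sub>v dxl, s + \<alpha>l \<cdot>\<^sub>v dsl) \<le> mubar (x + \<alpha>a \<cdot>\<^sub>v dxa, s + \<alpha>a \<cdot>\<^sub>v dsa)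
      then (x + \<alpha>l \<cdot>\<^sub>v dxl, s + \<alpha>l \<cdot>\<^sub>v dsl) else (x + \<alpha>a \<cdot>\<^sub>v dxa, s + \<alpha>a \<cdot>\<^sub>v dsa))"
    by (rule slls_stepE[OF step A n z \<beta> solver])
  interpret corrected_iterate m n A b c x s "mubar z" \<beta> by (rule it)
  have sq: "0 < sqrt n" using n by simp
  have "0 < \<beta> / (3 * sqrt n)" using \<beta> sq by simp
  hence \<alpha>a0: "0 \<le> \<alpha>a" "0 < \<alpha>a" using \<alpha>a(1) by linarith+
  note za = affine_step[OF newton \<alpha>a0(1) \<alpha>a(2,3)]
  have "mubar z' \<le> mubar (x + \<alpha>a \<cdot>\<^sub>v dxa, s + \<alpha>a \<cdot>\<^sub>v dsa)" unfolding z' by simp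
  also have "\<dots> = (1 - \<alpha>a) * mubar z" by (rule za(2))
  also have "\<dots> \<le> (1 - \<beta> / (3 * sqrt n)) * mubar z" using \<alpha>a(1) \<mu> by (intro mult_right_mono) auto
  finally show "mubar z' \<le> (1 - \<beta> / (3 * sqrt n)) * mubar z" .
  show "z' \<in> nbhd A b c \<beta> \<or> z' \<in> nbhd_closure A b c \<beta> \<and> mubar z' = 0"
  proof (cases "mubar (x + \<alpha>l \<cdot>\<^sub>v dxl, s + \<alpha>l \<cdot>\<^sub>v dsl) \<le> mubar (x + \<alpha>a \<cdot>\<^sub>v dxa, s + \<alpha>a \<cdot>\<^sub>v dsa)")
    case False
    hence "z' = (x + \<alpha>a \<cdot>\<^sub>v dxa, s + \<alpha>a \<cdot>\<^sub>v dsa)" unfolding z' by (simp only: if_False)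
    thus ?thesis using za(1) by (simp only:)
  next
    case True
    have dc: "dxl \<in> carrier_vec n" "dsl \<in> carrier_vec n"
      using primal_spaceD[OF A d(1)] dual_space_carrier[OF A d(2)] by auto
    \<comment> \<open>If the test fails, \<alpha>l = 0 leaves \<open>mubar\<close> unchanged, while
      the affine step decreases it strictly. The layered point is then not the one selected.\<close>
    have cond: "max (vnorm (dxl \<odot>\<^sub>v dsl) / mubar z) \<epsilon> \<le> \<beta> / 9"
    proof (rule ccontr)
      assume "\<not> ?thesis"
      hence "\<alpha>l = 0" using \<alpha>l by (simp only: if_False)
      hence "mubar (x + \<alpha>l \<cdot>\<^sub>v dxl, s + \<alpha>l \<cdot>\<^sub>v dsl) = mubar z"
        using mubar_line[OF A n carriers d \<mu>(2), of 0] by simp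
      moreover have "(1 - \<alpha>a) * mubar z < 1 * mubar z" using \<alpha>a0 \<mu> by (intro mult_strict_right_mono) auto
      ultimately show False using True unfolding za(2) by linarith
    qed
    hence \<alpha>l': "1 - 9 * \<epsilon> / \<beta> \<le> \<alpha>l" "\<alpha>l \<le> 1 - 8 * \<epsilon> / \<beta>" using \<alpha>l by auto
    have "\<epsilon> \<le> \<beta> / 9" "vnorm (dxl \<odot>\<^sub>v dsl) / mubar z \<le> \<beta> / 9"
      using cond unfolding max.bounded_iff by blast+
    hence "9 * \<epsilon> / \<beta> \<le> 1" using \<beta> by (simp add: pos_divide_le_eq)
    hence \<alpha>l0: "0 \<le> \<alpha>l" using \<alpha>l' by linarith
    have "z' = (x + \<alpha>l \<cdot>\<^sub>v dxl, s + \<alpha>l \<cdot>\<^sub>v dsl)" unfolding z' using True by (simp only: if_True)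
    thus ?thesis using layered_step[OF d \<epsilon> \<open>vnorm (dxl \<odot>\<^sub>v dsl) / mubar z \<le> \<beta> / 9\<close> \<alpha>l0 \<alpha>l'(2)] by (simp only:)
  qed
qed

text \<open>Guarantees that a run can end only by reaching its target, not for lack of a
  successor.\<close>

lemma slls_step_exists:
  assumes A: "A \<in> carrier_mat m n" and n: "0 < n" and z: "z \<in> nbhd A b c \<beta>"
    and \<beta>: "0 < \<beta>" "\<beta> \<le> 1 / 6" and solver: "rho_svd_solver \<rho> svd"
  shows "\<exists>z'. slls_step A \<beta> svd z z'"
proof -
  obtain x0 s0 where z0: "z = (x0, s0)" by force
  note Z = nbhdD[OF A n z[unfolded z0]]
  have c0: "x0 \<in> carrier_vec n" "s0 \<in> carrier_vec n"
    and pos0: "\<And>i. i < n \<Longrightarrow> 0 < x0 $ i" "\<And>i. i < n \<Longrightarrow> 0 < s0 $ i"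
    using Z by (auto simp: primal_interior_iff[OF A] dual_interior_iff[OF A])
  have dimA: "n = dim_col A" using A by simp
  obtain dxc dsc where newton_c: "newton_direction A x0 s0 (mubar (x0, s0) \<cdot>\<^sub>v ones n - x0 \<odot>\<^sub>v s0) dxc dsc"
    using exists_newton_direction[OF A c0 pos0, of "mubar (x0, s0) \<cdot>\<^sub>v ones n - x0 \<odot>\<^sub>v s0"] c0 by auto
  define x where "x = x0 + dxc"
  define s where "s = s0 + dsc"
  define \<mu> where "\<mu> = mubar (x, s)"
  note C = corrector_step[OF A n z[unfolded z0] \<beta> newton_c, folded x_def s_def]
  have c: "x \<in> carrier_vec n" "s \<in> carrier_vec n"
    and pos: "\<And>i. i < n \<Longrightarrow> 0 < x $ i" "\<And>i. i < n \<Longrightarrow> 0 < s $ i"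
    using C(1,2) by (auto simp: primal_interior_iff[OF A] dual_interior_iff[OF A])
  have \<mu>: "0 < \<mu>" using C(3) Z(3) by (simp add: \<mu>_def)
  obtain dxa dsa where newton_a: "newton_direction A x s (- (x \<odot>\<^sub>v s)) dxa dsa"
    using exists_newton_direction[OF A c pos, of "- (x \<odot>\<^sub>v s)"] c by auto
  define D where "D = vnorm (dxa \<odot>\<^sub>v dsa)"
  \<comment> \<open>The upper end of the admissible interval; similarly the layered step length will
    be 1 - 8 \<epsilon> / \<beta>.\<close>
  define \<alpha>a where "\<alpha>a = max (\<beta> / (2 * sqrt n)) (1 - 2 * D / (\<beta> * \<mu>))"
  have D: "0 \<le> D / (\<beta> * \<mu>)" using \<beta> \<mu> by (simp add: D_def)
  have sq: "1 \<le> sqrt n" using n by simp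
  have "\<beta> / (3 * sqrt n) \<le> \<beta> / (2 * sqrt n)" using \<beta> sq by (intro divide_left_mono) auto
  moreover have "\<beta> / (2 * sqrt n) \<le> 1 / (2 * 1)" using \<beta> sq by (intro frac_le) auto
  moreover have "0 < \<beta> / (2 * sqrt n)" using \<beta> sq by simp
  ultimately have \<alpha>a: "0 < \<alpha>a" "\<alpha>a \<le> 1" "max (\<beta> / (3 * sqrt n)) (1 - 3 * D / (\<beta> * \<mu>)) \<le> \<alpha>a"
    using D unfolding \<alpha>a_def times_divide_eq_right[symmetric] by linarith+
  define B where "B = {i. i < n \<and> \<bar>dxa $ i / x $ i\<bar> < \<bar>dsa $ i / s $ i\<bar>}"
  define N where "N = {..<n} - B"
  have part: "B \<union> N = {..<n}" "B \<inter> N = {}" by (auto simp: B_def N_def)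
  have part': "N \<union> B = {..<n}" "N \<inter> B = {}" using part by auto
  have xp: "\<forall>i<n. 0 < x $ i" using pos by simp
  note L = lift_proj[OF A c(1) xp]
  obtain X where X: "lift_profile svd n (lift_proj A x) B N X" using lift_profile_exists[OF solver] by blast
  obtain Y where Y: "lift_profile svd n (1\<^sub>m n - lift_proj A x) N B Y" using lift_profile_exists[OF solver] by blast
  have spaces: "cheap_lift_spaces A svd x B N (vscale x X) (vscale (map_vec inverse x) Y)"
    unfolding cheap_lift_spaces_iff_profiles[OF A n c(1) xp part] using X Y by blast
  have minimizer: "\<exists>\<delta>. is_arg_min (\<lambda>\<delta>. vnorm (subvec (v + \<delta>) J \<oslash>\<^sub>v subvec y J)) (\<lambda>\<delta>. \<delta> \<in> vscale w Z) \<delta>"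
    if v: "v \<in> carrier_vec n" and y: "y \<in> carrier_vec n" and w: "w \<in> carrier_vec n" and J: "J \<subseteq> {..<n}"
      and Z: "\<exists>k. \<exists>T\<in>carrier_mat n k. Z = (*\<^sub>v) T ` carrier_vec k" for v y w J Z
  proof -
    from Z obtain k T where T: "T \<in> carrier_mat n k" "Z = (*\<^sub>v) T ` carrier_vec k" by (elim exE bexE)
    from vscale_image[OF T(1) w] obtain T' where T': "T' \<in> carrier_mat n k" "vscale w Z = (*\<^sub>v) T' ` carrier_vec k"
      unfolding T(2) by (elim bexE)
    show ?thesis unfolding T'(2) by (rule exists_subvec_minimizer[OF T'(1) v y J])
  qed
  define xhat where "xhat = map_vec sqrt ((\<mu> \<cdot>\<^sub>v x) \<oslash>\<^sub>v s)"
  define shat where "shat = map_vec sqrt ((\<mu> \<cdot>\<^sub>v s) \<oslash>\<^sub>v x)"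
  have hats: "xhat \<in> carrier_vec n" "shat \<in> carrier_vec n" using c by (auto simp: xhat_def shat_def)
  have BN: "B \<subseteq> {..<n}" "N \<subseteq> {..<n}" using part by auto
  obtain dxl where dxl: "is_arg_min (\<lambda>\<delta>. vnorm (subvec (x + \<delta>) N \<oslash>\<^sub>v subvec xhat N)) (\<lambda>\<delta>. \<delta> \<in> vscale x X) dxl"
    using minimizer[OF c(1) hats(1) c(1) BN(2) conjunct1[OF lift_profile_image[OF L(1) part solver X]]] by blast
  have ic: "map_vec inverse x \<in> carrier_vec n" using c by simp
  obtain dsl where dsl: "is_arg_min (\<lambda>\<delta>. vnorm (subvec (s + \<delta>) B \<oslash>\<^sub>v subvec shat B))
      (\<lambda>\<delta>. \<delta> \<in> vscale (map_vec inverse x) Y) dsl"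
    using minimizer[OF c(2) hats(2) ic BN(1) conjunct1[OF lift_profile_image[OF L(2) part' solver Y]]] by blast
  define \<epsilon> where "\<epsilon> = vnorm ((x + dxl) \<odot>\<^sub>v (s + dsl)) / \<mu>"
  have \<epsilon>: "0 \<le> \<epsilon> / \<beta>" using \<mu> \<beta> by (simp add: \<epsilon>_def)
  define \<alpha>l where "\<alpha>l = (if max (vnorm (dxl \<odot>\<^sub>v dsl) / \<mu>) \<epsilon> \<le> \<beta> / 9 then 1 - 8 * \<epsilon> / \<beta> else 0)"
  have \<alpha>l: "if max (vnorm (dxl \<odot>\<^sub>v dsl) / \<mu>) \<epsilon> \<le> \<beta> / 9
      then \<alpha>l \<in> {1 - 9 * \<epsilon> / \<beta> .. 1 - 8 * \<epsilon> / \<beta>} else \<alpha>l = 0"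
    using \<epsilon> by (simp add: \<alpha>l_def)
  have "\<alpha>a \<le> max (\<beta> / (2 * sqrt n)) (1 - 2 * vnorm (dxa \<odot>\<^sub>v dsa) / (\<beta> * \<mu>))" by (simp add: \<alpha>a_def D_def)
  from slls_step.intros[OF dimA newton_c x_def s_def \<mu>_def newton_a \<alpha>a(1,2) \<alpha>a(3)[unfolded D_def] this
      B_def N_def spaces xhat_def shat_def dxl dsl \<epsilon>_def \<alpha>l refl refl refl]
  show ?thesis unfolding z0 by (rule exI)
qed

section \<open>The potential along a polarized segment\<close>

locale polarized_lp =
  fixes m n :: nat and A :: "real mat" and b c :: "real vec" and \<mu>0 \<mu>1 \<gamma> :: real and B N :: "nat set"
  assumes lp: "lp_instance m n A b c" and n: "0 < n" and \<mu>1: "0 \<le> \<mu>1" and \<gamma>: "0 < \<gamma>" "\<gamma> \<le> 1"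
    and part: "B \<union> N = {..<n}" "B \<inter> N = {}"
    and polar: "\<And>\<mu> i. \<mu>1 \<le> \<mu> \<Longrightarrow> \<mu> \<le> \<mu>0 \<Longrightarrow> i \<in> B \<Longrightarrow>
        \<gamma> * fst (central_point A b c \<mu>0) $ i \<le> fst (central_point A b c \<mu>) $ i"
      "\<And>\<mu> i. \<mu>1 \<le> \<mu> \<Longrightarrow> \<mu> \<le> \<mu>0 \<Longrightarrow> i \<in> N \<Longrightarrow>
        \<gamma> * snd (central_point A b c \<mu>0) $ i \<le> snd (central_point A b c \<mu>) $ i"
begin

definition xcp :: "real \<Rightarrow> real vec" where "xcp \<mu> = fst (central_point A b c \<mu>)"
definition scp :: "real \<Rightarrow> real vec" where "scp \<mu> = snd (central_point A b c \<mu>)"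

definition \<Phi> :: "real \<Rightarrow> nat" where "\<Phi> \<mu> = primal_sv 1 A B N (xcp \<mu>) + dual_sv 1 A B N (xcp \<mu>)"

lemma A: "A \<in> carrier_mat m n" using lp by (simp add: lp_instance_def)

lemma sub: "i \<in> B \<Longrightarrow> i < n" "i \<in> N \<Longrightarrow> i < n" using part by auto

lemma cp:
  assumes "0 < \<mu>"
  shows "xcp \<mu> \<in> primal_interior A b" "scp \<mu> \<in> dual_interior A c"
    and "\<And>i. i < n \<Longrightarrow> xcp \<mu> $ i * scp \<mu> $ i = \<mu>"
    and "xcp \<mu> \<in> carrier_vec n" "scp \<mu> \<in> carrier_vec n"
    and "\<And>i. i < n \<Longrightarrow> 0 < xcp \<mu> $ i" "\<And>i. i < n \<Longrightarrow> 0 < scp \<mu> $ i"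
    and "xcp \<mu> \<bullet> scp \<mu> = real n * \<mu>"
proof -
  show i: "xcp \<mu> \<in> primal_interior A b" "scp \<mu> \<in> dual_interior A c"
    and p: "\<And>i. i < n \<Longrightarrow> xcp \<mu> $ i * scp \<mu> $ i = \<mu>"
    using central_point_props[OF lp assms] by (auto simp: xcp_def scp_def)
  show "xcp \<mu> \<in> carrier_vec n" and s: "scp \<mu> \<in> carrier_vec n"
    and "\<And>i. i < n \<Longrightarrow> 0 < xcp \<mu> $ i" "\<And>i. i < n \<Longrightarrow> 0 < scp \<mu> $ i"
    using i by (auto simp: primal_interior_iff[OF A] dual_interior_iff[OF A])
  show "xcp \<mu> \<bullet> scp \<mu> = real n * \<mu>" unfolding scalar_prod_eq_sum[OF s] using p by simp
qed

text \<open>The cross bound gives \<open>xcp \<nu> $ i * s $ i\<close> at most n \<mu> + n \<nu>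
  \<le> 2 n \<mu>, and \<mu> is at most x_i s_i / \<delta>. Later \<delta> is 1 on the path and
  59/60 at corrected iterates.\<close>

lemma le_iterate:
  assumes x: "x \<in> primal_interior A b" and s: "s \<in> dual_interior A c" and \<mu>: "0 < \<mu>" "x \<bullet> s = real n * \<mu>"
    and lower: "\<And>i. i < n \<Longrightarrow> \<delta> * \<mu> \<le> x $ i * s $ i" and \<delta>: "0 < \<delta>" and \<nu>: "0 < \<nu>" "\<nu> \<le> \<mu>" and i: "i < n"
  shows "xcp \<nu> $ i \<le> 2 * real n / \<delta> * x $ i" "scp \<nu> $ i \<le> 2 * real n / \<delta> * s $ i"
proof -
  have pos: "0 < x $ i" "0 < s $ i" using x s i by (auto simp: primal_interior_iff[OF A] dual_interior_iff[OF A])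
  have "x \<bullet> s + xcp \<nu> \<bullet> scp \<nu> = real n * \<mu> + real n * \<nu>" by (simp add: \<mu>(2) cp(8)[OF \<nu>(1)])
  also have "\<dots> \<le> real n * \<mu> + real n * \<mu>" using \<nu> by (intro add_left_mono mult_left_mono) auto
  also have "\<dots> = 2 * real n / \<delta> * (\<delta> * \<mu>)" using \<delta> by simp
  also have "\<dots> \<le> 2 * real n / \<delta> * (x $ i * s $ i)" using lower[OF i] \<delta> by (intro mult_left_mono) auto
  finally have *: "x \<bullet> s + xcp \<nu> \<bullet> scp \<nu> \<le> 2 * real n / \<delta> * (x $ i * s $ i)" .
  note P = coordinate_products_le[OF A x cp(1)[OF \<nu>(1)] s cp(2)[OF \<nu>(1)] i]
  have "xcp \<nu> $ i * s $ i \<le> (2 * real n / \<delta> * x $ i) * s $ i" using P(1) * by (simp only: mult.assoc)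
  thus "xcp \<nu> $ i \<le> 2 * real n / \<delta> * x $ i" using pos(2) by (rule mult_right_le_imp_le)
  have "scp \<nu> $ i * x $ i \<le> (2 * real n / \<delta> * s $ i) * x $ i" using P(2) * by (simp only: ac_simps)
  thus "scp \<nu> $ i \<le> 2 * real n / \<delta> * s $ i" using pos(1) by (rule mult_right_le_imp_le)
qed

lemma cp_upper:
  assumes \<nu>: "0 < \<nu>" "\<nu> \<le> \<mu>" and i: "i < n"
  shows "xcp \<nu> $ i \<le> 2 * real n * xcp \<mu> $ i" "scp \<nu> $ i \<le> 2 * real n * scp \<mu> $ i"
proof -
  have \<mu>: "0 < \<mu>" using \<nu> by simp
  show "xcp \<nu> $ i \<le> 2 * real n * xcp \<mu> $ i" "scp \<nu> $ i \<le> 2 * real n * scp \<mu> $ i"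
    using le_iterate[OF cp(1,2)[OF \<mu>] \<mu> cp(8)[OF \<mu>] _ _ \<nu> i, of 1] cp(3)[OF \<mu>] by simp_all
qed

text \<open>The opposite comparison, at equal parameters: the cross bound is divided by the central
  slack, whose product with the central x is exactly \<mu>.\<close>

lemma iterate_le_cp:
  assumes x: "x \<in> primal_interior A b" and s: "s \<in> dual_interior A c" and \<mu>: "0 < \<mu>" "x \<bullet> s = real n * \<mu>"
    and i: "i < n"
  shows "x $ i \<le> 2 * real n * xcp \<mu> $ i"
proof -
  have "x $ i * scp \<mu> $ i \<le> x \<bullet> s + xcp \<mu> \<bullet> scp \<mu>"
    by (rule coordinate_products_le(2)[OF A x cp(1)[OF \<mu>(1)] s cp(2)[OF \<mu>(1)] i])
  also have "\<dots> = 2 * real n * (xcp \<mu> $ i * scp \<mu> $ i)" by (simp add: \<mu>(2) cp(8)[OF \<mu>(1)] cp(3)[OF \<mu>(1) i])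
  finally have "x $ i * scp \<mu> $ i \<le> (2 * real n * xcp \<mu> $ i) * scp \<mu> $ i" by (simp only: mult.assoc)
  thus ?thesis using cp(7)[OF \<mu>(1) i] by (rule mult_right_le_imp_le)
qed

text \<open>Polarization compares only with the point at \<mu>0. Near monotonicity from \<mu> up to
  \<mu>0 turns this into a comparison with an arbitrary \<mu> at the price of 2 n.\<close>

lemma cp_lower:
  assumes \<nu>: "0 < \<nu>" "\<mu>1 \<le> \<nu>" "\<nu> \<le> \<mu>0" and \<mu>: "0 < \<mu>" "\<mu> \<le> \<mu>0"
  shows "i \<in> B \<Longrightarrow> \<gamma> / (2 * real n) * xcp \<mu> $ i \<le> xcp \<nu> $ i"
    and "i \<in> N \<Longrightarrow> \<gamma> / (2 * real n) * scp \<mu> $ i \<le> scp \<nu> $ i"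
proof -
  have scale: "\<gamma> / (2 * real n) * p \<le> q" if "p \<le> 2 * real n * r" "\<gamma> * r \<le> q" for p q r
  proof -
    have "\<gamma> / (2 * real n) * p \<le> \<gamma> / (2 * real n) * (2 * real n * r)"
      using that(1) \<gamma> n by (intro mult_left_mono) auto
    also have "\<dots> = \<gamma> * r" using n by simp
    finally show ?thesis using that(2) by simp
  qed
  show "\<gamma> / (2 * real n) * xcp \<mu> $ i \<le> xcp \<nu> $ i" if "i \<in> B"
    using scale[OF cp_upper(1)[OF \<mu> sub(1)[OF that]]] polar(1)[OF \<nu>(2,3) that] by (simp add: xcp_def)
  show "\<gamma> / (2 * real n) * scp \<mu> $ i \<le> scp \<nu> $ i" if "i \<in> N"
    using scale[OF cp_upper(2)[OF \<mu> sub(2)[OF that]]] polar(2)[OF \<nu>(2,3) that] by (simp add: scp_def)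
qed

text \<open>The coordinate that polarization keeps large forces its partner to shrink, because the
  products are exactly \<nu> and \<mu>.\<close>

lemma cp_small:
  assumes \<nu>: "0 < \<nu>" "\<mu>1 \<le> \<nu>" "\<nu> \<le> \<mu>0" and \<mu>: "0 < \<mu>" "\<mu> \<le> \<mu>0"
  shows "i \<in> N \<Longrightarrow> xcp \<nu> $ i \<le> 2 * real n / \<gamma> * (\<nu> / \<mu>) * xcp \<mu> $ i"
    and "i \<in> B \<Longrightarrow> scp \<nu> $ i \<le> 2 * real n / \<gamma> * (\<nu> / \<mu>) * scp \<mu> $ i"
proof -
  have flip: "p' \<le> 2 * real n / \<gamma> * (\<nu> / \<mu>) * p"
    if "p' * q' = \<nu>" "p * q = \<mu>" "0 < p" "0 < q" "0 < p'" "0 < q'" "\<gamma> / (2 * real n) * q \<le> q'" for p q p' q' :: real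
  proof -
    have "q \<le> 2 * real n / \<gamma> * q'" using that(7) \<gamma> n by (simp add: field_simps)
    hence "q * (p' * p) \<le> 2 * real n / \<gamma> * q' * (p' * p)" using that by (intro mult_right_mono) auto
    also have "\<dots> = 2 * real n / \<gamma> * ((p' * q') * p)" by simp
    finally have "p' * (p * q) \<le> 2 * real n / \<gamma> * (\<nu> * p)" unfolding that(1) by (simp only: ac_simps)
    also have "\<dots> = (2 * real n / \<gamma> * (\<nu> / \<mu>) * p) * \<mu>" using \<mu> by simp
    finally show ?thesis unfolding that(2) using \<mu>(1) by (rule mult_right_le_imp_le)
  qed
  show "xcp \<nu> $ i \<le> 2 * real n / \<gamma> * (\<nu> / \<mu>) * xcp \<mu> $ i" if iN: "i \<in> N"
  proof -
    have i: "i < n" by (rule sub(2)[OF iN])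
    show ?thesis by (rule flip[OF cp(3)[OF \<nu>(1) i] cp(3)[OF \<mu>(1) i] cp(6)[OF \<mu>(1) i] cp(7)[OF \<mu>(1) i]
      cp(6)[OF \<nu>(1) i] cp(7)[OF \<nu>(1) i] cp_lower(2)[OF \<nu> \<mu> iN]])
  qed
  show "scp \<nu> $ i \<le> 2 * real n / \<gamma> * (\<nu> / \<mu>) * scp \<mu> $ i" if iB: "i \<in> B"
  proof -
    have i: "i < n" by (rule sub(1)[OF iB])
    have sym: "scp \<kappa> $ i * xcp \<kappa> $ i = \<kappa>" if "0 < \<kappa>" for \<kappa> using cp(3)[OF that i] by (simp add: mult.commute)
    show ?thesis by (rule flip[OF sym[OF \<nu>(1)] sym[OF \<mu>(1)] cp(7)[OF \<mu>(1) i] cp(6)[OF \<mu>(1) i]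
      cp(7)[OF \<nu>(1) i] cp(6)[OF \<nu>(1) i] cp_lower(1)[OF \<nu> \<mu> iB]])
  qed
qed

lemma \<Phi>_le:
  assumes "0 < \<mu>"
  shows "\<Phi> \<mu> \<le> 2 * n"
proof -
  note x = cp(4)[OF assms] and L = lift_proj[OF A cp(4)[OF assms]]
  have xp: "\<forall>i<n. 0 < xcp \<mu> $ i" using cp(6)[OF assms] by simp
  have dimA: "dim_col A = n" using A by simp
  have card: "card B \<le> n" "card N \<le> n"
    using card_mono[of "{..<n}" B] card_mono[of "{..<n}" N] part by auto
  have BN: "B \<subseteq> {..<n}" "N \<subseteq> {..<n}" using part by auto
  have "primal_sv 1 A B N (xcp \<mu>) \<le> card N"
    unfolding primal_sv_def
    by (rule num_sv_ge_segment(2)[OF submatrix_rows_carrier[OF lift_mat_properties(1)[OF L(1)[OF xp] BN(2)] BN(1)]])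
  moreover have "dual_sv 1 A B N (xcp \<mu>) \<le> card B"
    unfolding dual_sv_def dimA
    by (rule num_sv_ge_segment(2)[OF submatrix_rows_carrier[OF lift_mat_properties(1)[OF L(2)[OF xp] BN(1)] BN(2)]])
  ultimately show ?thesis using card unfolding \<Phi>_def by linarith
qed

text \<open>Rescaling from \<mu> to \<nu> multiplies the threshold by \<gamma>^2 \<mu> / (4 n^2
  \<nu>). The separation Q makes this factor at least 1, and a larger threshold gives a smaller
  count.\<close>

lemma \<Phi>_mono:
  assumes \<nu>: "0 < \<nu>" "\<mu>1 \<le> \<nu>" and \<mu>: "\<mu> \<le> \<mu>0" and Q: "4 * (real n)\<^sup>2 / \<gamma>\<^sup>2 \<le> Q" "\<nu> * Q \<le> \<mu>"
  shows "\<Phi> \<nu> \<le> \<Phi> \<mu>"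
proof -
  have g: "0 < \<gamma> / (2 * real n)" using \<gamma> n by simp
  have Q1: "1 \<le> Q"
  proof -
    have "\<gamma>\<^sup>2 \<le> 1" using \<gamma> by (simp add: power_le_one)
    moreover have "1 \<le> (real n)\<^sup>2" using n by simp
    ultimately have "1 * \<gamma>\<^sup>2 \<le> 4 * (real n)\<^sup>2" by linarith
    hence "1 \<le> 4 * (real n)\<^sup>2 / \<gamma>\<^sup>2" using \<gamma> by (subst pos_le_divide_eq) auto
    thus ?thesis using Q by linarith
  qed
  have "\<nu> * 1 \<le> \<nu> * Q" using \<nu> Q1 by (intro mult_left_mono) auto
  hence \<mu>0': "0 < \<mu>" "\<nu> \<le> \<mu>0" using \<nu> \<mu> Q by linarith+
  let ?a = "\<gamma> / (2 * real n)" and ?b = "2 * real n / \<gamma> * (\<nu> / \<mu>)"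
  have b: "0 < ?b" using n \<gamma> \<nu> \<mu>0' by simp
  have "?b \<le> ?a"
  proof -
    have "4 * (real n)\<^sup>2 / \<gamma>\<^sup>2 * \<nu> \<le> Q * \<nu>" using Q \<nu> by (intro mult_right_mono) auto
    hence "4 * (real n)\<^sup>2 / \<gamma>\<^sup>2 * \<nu> \<le> \<mu>" using Q by (simp add: mult.commute)
    thus ?thesis using n \<gamma> \<mu>0' by (simp add: field_simps power2_eq_square)
  qed
  hence ab: "1 \<le> ?a / ?b * 1" unfolding mult_1_right pos_le_divide_eq[OF b] by (simp only: mult_1_left)
  have xp: "\<forall>i<n. 0 < xcp \<mu> $ i" "\<forall>i<n. 0 < xcp \<nu> $ i" using cp(6)[OF \<mu>0'(1)] cp(6)[OF \<nu>(1)] by auto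
  have dom: "\<forall>i\<in>B. ?a * xcp \<mu> $ i \<le> xcp \<nu> $ i" "\<forall>i\<in>N. xcp \<nu> $ i \<le> ?b * xcp \<mu> $ i"
    using cp_lower(1)[OF \<nu> \<mu>0'(2,1) \<mu>] cp_small(1)[OF \<nu> \<mu>0'(2,1) \<mu>] by blast+
  have one: "(0::real) < 1" by simp
  note R = sv_rescale[OF A cp(4)[OF \<mu>0'(1)] xp(1) cp(4)[OF \<nu>(1)] xp(2) part g b one dom]
  have "primal_sv 1 A B N (xcp \<nu>) \<le> primal_sv 1 A B N (xcp \<mu>)"
    using R(1) unfolding primal_sv_def by (rule order_trans) (rule num_sv_ge_antimono[OF ab])
  moreover have "dual_sv 1 A B N (xcp \<nu>) \<le> dual_sv 1 A B N (xcp \<mu>)"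
    using R(2) unfolding dual_sv_def by (rule order_trans) (rule num_sv_ge_antimono[OF ab])
  ultimately show ?thesis unfolding \<Phi>_def by (rule add_mono)
qed

lemma potential_decrease:
  assumes step: "slls_step A \<beta> svd z z'" and z: "z \<in> nbhd A b c \<beta>" and \<beta>: "0 < \<beta>" "\<beta> \<le> 1 / 6"
    and \<rho>: "1 \<le> \<rho>" and solver: "rho_svd_solver \<rho> svd"
    and Q: "60000 * (real n ^ 6 * \<rho> / (\<gamma>\<^sup>2 * \<beta>)) \<le> Q"
    and upper: "mubar z * Q \<le> \<mu>0" and lower: "Q * \<mu>1 < mubar z'"
  shows "\<Phi> (mubar z' / Q) < \<Phi> (mubar z * Q)"
proof (rule ccontr)
  assume "\<not> ?thesis"
  hence stuck: "\<Phi> (mubar z * Q) \<le> \<Phi> (mubar z' / Q)" by simp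
  \<comment> \<open>w collects the polynomial losses. In \<open>err\<close> the term 4 K / \<sigma>
    is of order n^5 / (\<gamma>^2 R) and sqrt n is rounded up to n, which gives n^6. The solver
    accuracy \<rho> enters through n \<rho> \<tau>, and 1 / \<beta> because both error bounds have
    to be fractions of \<beta>.\<close>
  define w where "w = real n ^ 6 * \<rho> / (\<gamma>\<^sup>2 * \<beta>)"
  define \<mu> where "\<mu> = mubar z"
  \<comment> \<open>The comparison parameter is defined from the result of the iteration, so Q
    \<mu>' is the value that the layered step must undercut.\<close>
  define \<mu>' where "\<mu>' = mubar z' / Q"
  define M where "M = \<mu> * Q"
  have n1: "1 \<le> real n" using n by simp
  have g2: "0 < \<gamma>\<^sup>2" "\<gamma>\<^sup>2 \<le> 1" using \<gamma> by (auto intro: power_le_one)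
  have g3: "\<gamma>\<^sup>2 \<le> \<gamma>" using \<gamma> by (simp add: power2_eq_square mult_left_le)
  \<comment> \<open>The estimates below lead to terms n^k \<rho>' / \<gamma>^2 with k \<le> 6, all
    of which are replaced by \<beta> w.\<close>
  have w_ge: "real n ^ k * \<rho>' / \<gamma>\<^sup>2 \<le> \<beta> * w" if "k \<le> 6" "0 \<le> \<rho>'" "\<rho>' \<le> \<rho>" for k \<rho>'
  proof -
    have "real n ^ k * \<rho>' \<le> real n ^ 6 * \<rho>" using that n1 by (intro mult_mono power_increasing) auto
    hence "real n ^ k * \<rho>' / \<gamma>\<^sup>2 \<le> real n ^ 6 * \<rho> / \<gamma>\<^sup>2" using g2 by (intro divide_right_mono) auto
    also have "\<dots> = \<beta> * w" using \<beta> by (simp add: w_def)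
    finally show ?thesis .
  qed
  have w1: "1 \<le> w"
  proof -
    have "1 * 1 / (1 * 1) \<le> real n ^ 6 * \<rho> / (\<gamma>\<^sup>2 * \<beta>)" using n1 \<rho> g2 \<beta> by (intro frac_le mult_mono) auto
    thus ?thesis by (simp add: w_def)
  qed
  have Qw: "60000 * w \<le> Q" using Q by (simp add: w_def)
  have Q1: "1 \<le> Q" "0 < Q" using Qw w1 by linarith+
  obtain x s dxa dsa Ba Na X Y dxl dsl \<epsilon> \<alpha>l and \<alpha>a :: real where it: "corrected_iterate m n A b c x s (mubar z) \<beta>"
    and newton: "newton_direction A x s (- (x \<odot>\<^sub>v s)) dxa dsa"
    and BN: "Ba = {i. i < n \<and> \<bar>dxa $ i / x $ i\<bar> < \<bar>dsa $ i / s $ i\<bar>}" "Na = {..<n} - Ba"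
    and X: "lift_profile svd n (lift_proj A x) Ba Na X" and Y: "lift_profile svd n (1\<^sub>m n - lift_proj A x) Na Ba Y"
    and dxl: "is_arg_min (\<lambda>\<delta>. vnorm (subvec (x + \<delta>) Na \<oslash>\<^sub>v subvec (map_vec sqrt ((mubar z \<cdot>\<^sub>v x) \<oslash>\<^sub>v s)) Na))
      (\<lambda>\<delta>. \<delta> \<in> vscale x X) dxl"
    and dsl: "is_arg_min (\<lambda>\<delta>. vnorm (subvec (s + \<delta>) Ba \<oslash>\<^sub>v subvec (map_vec sqrt ((mubar z \<cdot>\<^sub>v s) \<oslash>\<^sub>v x)) Ba))
      (\<lambda>\<delta>. \<delta> \<in> vscale (map_vec inverse x) Y) dsl"
    and d: "dxl \<in> primal_space A" "dsl \<in> dual_space A"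
    and \<epsilon>: "\<epsilon> = vnorm ((x + dxl) \<odot>\<^sub>v (s + dsl)) / mubar z"
    and \<alpha>l: "if max (vnorm (dxl \<odot>\<^sub>v dsl) / mubar z) \<epsilon> \<le> \<beta> / 9
      then \<alpha>l \<in> {1 - 9 * \<epsilon> / \<beta> .. 1 - 8 * \<epsilon> / \<beta>} else \<alpha>l = 0"
    and z': "z' = (if mubar (x + \<alpha>l \<cdot>\<^sub>v dxl, s + \<alpha>l \<cdot>\<^sub>v dsl) \<le> mubar (x + \<alpha>a \<cdot>\<^sub>v dxa, s + \<alpha>a \<cdot>\<^sub>v dsa)
      then (x + \<alpha>l \<cdot>\<^sub>v dxl, s + \<alpha>l \<cdot>\<^sub>v dsl) else (x + \<alpha>a \<cdot>\<^sub>v dxa, s + \<alpha>a \<cdot>\<^sub>v dsa))"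
    by (rule slls_stepE[OF step A n z \<beta> solver])
  interpret I: corrected_iterate m n A b c x s \<mu> \<beta> unfolding \<mu>_def by (rule it)
  have sqn: "1 \<le> sqrt n" "sqrt n \<le> n"
  proof -
    show s1: "1 \<le> sqrt n" using n by simp
    have "sqrt n * 1 \<le> sqrt n * sqrt n" using s1 by (intro mult_left_mono) auto
    thus "sqrt n \<le> n" by simp
  qed
  have \<mu>: "0 < \<mu>" by (rule I.\<mu>(1))
  have "0 \<le> \<beta> / (3 * sqrt n) * mubar z" using \<beta> \<mu> by (simp add: \<mu>_def)
  hence mubar_le: "mubar z' \<le> \<mu>"
    using slls_step_nbhd(1)[OF step A n z \<beta> solver] by (simp add: \<mu>_def left_diff_distrib)
  have "0 \<le> Q * \<mu>1" using Q1 \<mu>1 by simp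
  hence z'0: "0 < mubar z'" using lower by linarith
  have \<mu>': "0 < \<mu>'" "\<mu>1 \<le> \<mu>'" "\<mu>' * Q \<le> \<mu>"
    using z'0 Q1 lower mubar_le by (auto simp: \<mu>'_def pos_le_divide_eq mult.commute)
  have "\<mu>' * 1 \<le> \<mu>' * Q" using \<mu>' Q1 by (intro mult_left_mono) auto
  hence \<mu>'_le: "\<mu>' \<le> \<mu>" using \<mu>' by linarith
  have "\<mu> * 1 \<le> \<mu> * Q" using \<mu> Q1 by (intro mult_left_mono) auto
  hence \<mu>M: "\<mu> \<le> M" by (simp add: M_def)
  have "M \<le> \<mu>0" using upper by (simp add: M_def \<mu>_def)
  hence M: "0 < M" "M \<le> \<mu>0" "\<mu> \<le> M" "\<mu> \<le> \<mu>0" "\<mu>' \<le> \<mu>0" "\<mu>1 \<le> \<mu>"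
    using \<mu>M \<mu> \<mu>'_le \<mu>' by linarith+
  define R where "R = \<mu> / \<mu>'"
  have R: "Q \<le> R" "0 < R" using \<mu>' \<mu> by (auto simp: R_def pos_le_divide_eq mult.commute)
  have R60: "60000 * w \<le> R" using R Qw by linarith
  have dev60: "vnorm (x \<odot>\<^sub>v s - \<mu> \<cdot>\<^sub>v ones n) \<le> 1 / 60 * \<mu>"
  proof -
    have "\<beta> / 10 * \<mu> \<le> 1 / 60 * \<mu>" using \<beta> \<mu> by (intro mult_right_mono) auto
    thus ?thesis using I.dev by linarith
  qed
  have prod_lower: "59 / 60 * \<mu> \<le> x $ i * s $ i" if "i < n" for i
    using product_deviation_coordinates(1)[OF I.carriers \<mu> dev60 that] by simp
  have crude: "xcp \<nu> $ i \<le> 3 * real n * x $ i" "scp \<nu> $ i \<le> 3 * real n * s $ i"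
    if \<nu>: "0 < \<nu>" "\<nu> \<le> \<mu>" and i: "i < n" for \<nu> i
  proof -
    have factor: "2 * real n / (59 / 60) * r \<le> 3 * real n * r" if "0 < r" for r
      using that by (intro mult_right_mono) auto
    have "(0::real) < 59 / 60" by simp
    note L = le_iterate[OF I.x I.s I.\<mu> prod_lower this \<nu> i]
    show "xcp \<nu> $ i \<le> 3 * real n * x $ i" using L(1) factor[OF I.pos(1)[OF i]] by linarith
    show "scp \<nu> $ i \<le> 3 * real n * s $ i" using L(2) factor[OF I.pos(2)[OF i]] by linarith
  qed
  define \<eta> where "\<eta> = 6 * (real n)\<^sup>2 / \<gamma> / R"
  have \<eta>0: "0 \<le> \<eta>" using \<gamma> R by (simp add: \<eta>_def)
  have chain: "u \<le> \<eta> * r" if "u \<le> 2 * real n / \<gamma> * (\<mu>' / \<mu>) * v" "v \<le> 3 * real n * r" for u v r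
  proof -
    have "2 * real n / \<gamma> * (\<mu>' / \<mu>) * v \<le> 2 * real n / \<gamma> * (\<mu>' / \<mu>) * (3 * real n * r)"
      using that(2) \<gamma> \<mu> \<mu>' by (intro mult_left_mono) auto
    also have "\<dots> = \<eta> * r" using \<mu> \<mu>' \<gamma> by (simp add: \<eta>_def R_def power2_eq_square)
    finally show ?thesis using that(1) by linarith
  qed
  have small_x: "xcp \<mu>' $ i \<le> \<eta> * x $ i" if iN: "i \<in> N" for i
    by (rule chain[OF cp_small(1)[OF \<mu>'(1,2) M(5) \<mu> M(4) iN] crude(1)[OF \<mu> order_refl sub(2)[OF iN]]])
  have small_s: "scp \<mu>' $ i \<le> \<eta> * s $ i" if iB: "i \<in> B" for i
    by (rule chain[OF cp_small(2)[OF \<mu>'(1,2) M(5) \<mu> M(4) iB] crude(2)[OF \<mu> order_refl sub(1)[OF iB]]])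
  \<comment> \<open>Both comparisons lose the factor G. From M down to the iterate the bounds have
    quotient Q / G, so \<tau> = G / Q corresponds to the threshold 1 at M; from the iterate down to
    \<mu>' the quotient is R / G, which is \<sigma>.\<close>
  define G where "G = 24 * real n ^ 4 / \<gamma>\<^sup>2"
  have G: "0 < G" using n1 g2 by (simp add: G_def)
  define \<tau> where "\<tau> = G / Q"
  define \<sigma> where "\<sigma> = R / G"
  have \<tau>0: "0 < \<tau>" using G Q1 by (simp add: \<tau>_def)
  have xpos: "\<forall>i<n. 0 < x $ i" "\<forall>i<n. 0 < xcp M $ i" "\<forall>i<n. 0 < xcp \<mu>' $ i"
    using I.pos(1) cp(6)[OF M(1)] cp(6)[OF \<mu>'(1)] by auto
  have upper_gap: "primal_sv \<tau> A B N x \<le> primal_sv 1 A B N (xcp M)" "dual_sv \<tau> A B N x \<le> dual_sv 1 A B N (xcp M)"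
  proof -
    define a where "a = \<gamma> / (6 * (real n)\<^sup>2)"
    define bb where "bb = 4 * (real n)\<^sup>2 / \<gamma> / Q"
    have ab: "0 < a" "0 < bb" using \<gamma> n1 Q1 by (auto simp: a_def bb_def)
    have dB: "\<forall>i\<in>B. a * xcp M $ i \<le> x $ i"
    proof
      fix i assume iB: "i \<in> B"
      have "\<gamma> / (2 * real n) * xcp M $ i \<le> 3 * real n * x $ i"
        using cp_lower(1)[OF \<mu> M(6,4) M(1,2) iB] crude(1)[OF \<mu> order_refl sub(1)[OF iB]] by linarith
      hence "1 / (3 * real n) * (\<gamma> / (2 * real n) * xcp M $ i) \<le> 1 / (3 * real n) * (3 * real n * x $ i)"
        by (intro mult_left_mono) auto
      thus "a * xcp M $ i \<le> x $ i" using n1 by (simp add: a_def power2_eq_square)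
    qed
    have dN: "\<forall>i\<in>N. x $ i \<le> bb * xcp M $ i"
    proof
      fix i assume iN: "i \<in> N"
      have "x $ i \<le> 2 * real n * xcp \<mu> $ i" by (rule iterate_le_cp[OF I.x I.s I.\<mu> sub(2)[OF iN]])
      also have "\<dots> \<le> 2 * real n * (2 * real n / \<gamma> * (\<mu> / M) * xcp M $ i)"
        using cp_small(1)[OF \<mu> M(6,4) M(1,2) iN] by (intro mult_left_mono) auto
      also have "\<dots> = bb * xcp M $ i" using \<mu> by (simp add: bb_def M_def power2_eq_square)
      finally show "x $ i \<le> bb * xcp M $ i" .
    qed
    have one: "a / bb * \<tau> = 1"
      using n1 g2 \<gamma> Q1 by (simp add: a_def bb_def \<tau>_def G_def field_simps power2_eq_square power4_eq_xxxx)
    show "primal_sv \<tau> A B N x \<le> primal_sv 1 A B N (xcp M)" "dual_sv \<tau> A B N x \<le> dual_sv 1 A B N (xcp M)"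
      by (fact sv_rescale[OF A cp(4)[OF M(1)] xpos(2) I.carriers(1) xpos(1) part ab \<tau>0 dB dN, unfolded one])+
  qed
  have lower_gap: "primal_sv 1 A B N (xcp \<mu>') \<le> primal_sv \<sigma> A B N x" "dual_sv 1 A B N (xcp \<mu>') \<le> dual_sv \<sigma> A B N x"
  proof -
    define a where "a = \<gamma> / (4 * (real n)\<^sup>2)"
    have ab: "0 < a" "0 < \<eta>" using \<gamma> n1 R by (auto simp: a_def \<eta>_def)
    have dB: "\<forall>i\<in>B. a * x $ i \<le> xcp \<mu>' $ i"
    proof
      fix i assume iB: "i \<in> B"
      have "a * x $ i \<le> a * (2 * real n * xcp \<mu> $ i)"
        using iterate_le_cp[OF I.x I.s I.\<mu> sub(1)[OF iB]] ab by (intro mult_left_mono) auto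
      also have "\<dots> = \<gamma> / (2 * real n) * xcp \<mu> $ i" using n1 by (simp add: a_def power2_eq_square)
      also have "\<dots> \<le> xcp \<mu>' $ i" by (rule cp_lower(1)[OF \<mu>'(1,2) M(5) \<mu> M(4) iB])
      finally show "a * x $ i \<le> xcp \<mu>' $ i" .
    qed
    have dN: "\<forall>i\<in>N. xcp \<mu>' $ i \<le> \<eta> * x $ i" using small_x by blast
    have "a / \<eta> * 1 = \<sigma>"
      using n1 g2 \<gamma> R by (simp add: a_def \<eta>_def \<sigma>_def G_def field_simps power2_eq_square power4_eq_xxxx)
    moreover have "(0::real) < 1" by simp
    note sv_rescale[OF A I.carriers(1) xpos(1) cp(4)[OF \<mu>'(1)] xpos(3) part ab this dB dN]
    ultimately show "primal_sv 1 A B N (xcp \<mu>') \<le> primal_sv \<sigma> A B N x" "dual_sv 1 A B N (xcp \<mu>') \<le> dual_sv \<sigma> A B N x"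
      by simp_all
  qed
  have t_small: "real n * (\<rho> * \<tau>) \<le> \<beta> / 2500"
  proof -
    have "real n * (\<rho> * \<tau>) = 24 * (real n ^ 5 * \<rho> / \<gamma>\<^sup>2) / Q" by (simp add: \<tau>_def G_def eval_nat_numeral)
    also have "\<dots> \<le> 24 * (\<beta> * w) / Q" using w_ge[of 5 \<rho>] \<rho> Q1 by (intro divide_right_mono mult_left_mono) auto
    also have "\<dots> \<le> 24 * (\<beta> * (Q / 60000)) / Q" using Qw Q1 \<beta> by (intro divide_right_mono mult_left_mono) auto
    also have "\<dots> = \<beta> / 2500" using Q1 by simp
    finally show ?thesis .
  qed
  have \<rho>\<tau>: "0 \<le> \<rho> * \<tau>" using \<rho> \<tau>0 by simp
  have "1 * (\<rho> * \<tau>) \<le> real n * (\<rho> * \<tau>)" using \<rho>\<tau> n1 by (intro mult_right_mono) auto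
  hence \<rho>\<tau>1: "\<rho> * \<tau> \<le> 1" using t_small \<beta> by linarith
  have "sqrt n * (\<rho> * \<tau>) \<le> real n * (\<rho> * \<tau>)" using \<rho>\<tau> sqn by (intro mult_right_mono) auto
  hence \<rho>\<tau>2: "\<rho> * \<tau> * sqrt n \<le> 1 / 400" using t_small \<beta> by (simp add: mult.commute)
  define err where "err = 2 * sqrt n * (\<eta> + 4 * (3 * real n) / \<sigma>)"
  have err: "err \<le> 588 * (\<beta> * w) / R"
  proof -
    have "(real n)\<^sup>2 / \<gamma> \<le> real n ^ 5 / \<gamma>\<^sup>2" using n1 g2 g3 by (intro frac_le power_increasing) auto
    hence "6 * ((real n)\<^sup>2 / \<gamma>) / R \<le> 6 * (real n ^ 5 / \<gamma>\<^sup>2) / R" using R by (intro divide_right_mono mult_left_mono) auto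
    note sum1 = this
    have sum2: "4 * (3 * real n) / \<sigma> = 288 * (real n ^ 5 / \<gamma>\<^sup>2) / R"
      by (simp add: \<sigma>_def G_def eval_nat_numeral)
    have sum: "\<eta> + 4 * (3 * real n) / \<sigma> \<le> 294 * (real n ^ 5 / \<gamma>\<^sup>2) / R"
    proof -
      have "6 * (real n)\<^sup>2 / \<gamma> / R = 6 * ((real n)\<^sup>2 / \<gamma>) / R" by simp
      moreover have "6 * r / R + 288 * r / R = 294 * r / R" for r by (simp add: add_divide_distrib[symmetric])
      ultimately show ?thesis unfolding \<eta>_def using sum1 sum2 by (metis add_right_mono)
    qed
    have "err \<le> 2 * real n * (294 * (real n ^ 5 / \<gamma>\<^sup>2) / R)"
      unfolding err_def using sqn sum R \<eta>0 G by (intro mult_mono) (auto simp: \<sigma>_def)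
    also have "\<dots> = 588 * (real n ^ 6 * 1 / \<gamma>\<^sup>2) / R" by (simp add: eval_nat_numeral)
    also have "\<dots> \<le> 588 * (\<beta> * w) / R" using w_ge[of 6 1] \<rho> R by (intro divide_right_mono mult_left_mono) auto
    finally show ?thesis .
  qed
  have err_\<beta>: "err \<le> \<beta> / 100"
  proof -
    have "588 * (\<beta> * w) / R \<le> 588 * (\<beta> * (R / 60000)) / R"
      using R60 R \<beta> by (intro divide_right_mono mult_left_mono) auto
    also have "\<dots> \<le> \<beta> / 100" using R \<beta> by simp
    finally show ?thesis using err by linarith
  qed
  have "G \<le> 24 * w"
  proof -
    have "real n ^ 4 * 1 / \<gamma>\<^sup>2 \<le> \<beta> * w" by (rule w_ge) (use \<rho> in auto)
    moreover have "\<beta> * w \<le> 1 * w" using \<beta> w1 by (intro mult_right_mono) auto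
    ultimately show ?thesis by (simp add: G_def)
  qed
  hence "2 * G \<le> R" using R60 w1 by linarith
  hence \<sigma>2: "2 \<le> \<sigma>" using G by (simp add: \<sigma>_def pos_le_divide_eq)
  have \<tau>\<sigma>: "\<tau> \<le> \<sigma>"
  proof -
    have "\<rho> * \<tau> \<ge> 1 * \<tau>" using \<rho> \<tau>0 by (intro mult_right_mono) auto
    thus ?thesis using \<rho>\<tau>1 \<sigma>2 by linarith
  qed
  \<comment> \<open>Each of the two counts can only drop from \<tau> to \<sigma>. Since their sum
    \<Phi> does not drop across the window, neither of them does.\<close>
  have gap: "primal_sv \<tau> A B N x \<le> primal_sv \<sigma> A B N x" "dual_sv \<tau> A B N x \<le> dual_sv \<sigma> A B N x"
  proof -
    have "primal_sv \<sigma> A B N x \<le> primal_sv \<tau> A B N x" "dual_sv \<sigma> A B N x \<le> dual_sv \<tau> A B N x"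
      unfolding primal_sv_def dual_sv_def by (rule num_sv_ge_antimono[OF \<tau>\<sigma>])+
    thus "primal_sv \<tau> A B N x \<le> primal_sv \<sigma> A B N x" "dual_sv \<tau> A B N x \<le> dual_sv \<sigma> A B N x"
      using upper_gap lower_gap stuck unfolding \<Phi>_def M_def[unfolded \<mu>_def, symmetric] \<mu>'_def[symmetric] by linarith+
  qed
  interpret L: layered_iterate m n A b c x s "xcp \<mu>'" "scp \<mu>'" \<mu> B N \<rho> \<tau> \<sigma> "3 * real n" \<eta> svd
  proof
    show "xcp \<mu>' $ i \<le> 3 * real n * x $ i" "scp \<mu>' $ i \<le> 3 * real n * s $ i" if "i < n" for i
      using crude[OF \<mu>'(1) \<mu>'_le that] by auto
    show "1 \<le> 3 * real n" using n1 by simp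
  qed (fact A n I.x I.s cp(1,2)[OF \<mu>'(1)] \<mu> dev60 part \<eta>0 small_x small_s solver \<rho> \<tau>0 \<rho>\<tau>1 \<sigma>2 gap)+
  have Lerr: "L.err = err" by (simp add: L.err_def err_def)
  have small: "L.err \<le> 1 / 90" using err_\<beta> \<beta> unfolding Lerr by linarith
  \<comment> \<open>The partition computed from the affine direction is the polarizing one, so the
    profiles built by the algorithm are those for which the gap is known.\<close>
  have Ba: "Ba = B" unfolding BN(1) by (rule L.affine_direction_partition[OF newton small \<rho>\<tau>2])
  have Na: "Na = N" unfolding BN(2) Ba using part by auto
  note D = L.slls_directions[OF X[unfolded Ba Na] Y[unfolded Ba Na]
    dxl[folded \<mu>_def, unfolded Na] dsl[folded \<mu>_def, unfolded Ba] small \<rho>\<tau>2, unfolded Lerr]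
  have \<epsilon>10: "\<epsilon> \<le> 10 * err" unfolding \<epsilon> \<mu>_def[symmetric] pos_divide_le_eq[OF \<mu>] by (rule D(1))
  have \<epsilon>9: "\<epsilon> \<le> \<beta> / 9" using \<epsilon>10 err_\<beta> \<beta> by linarith
  have "vnorm (dxl \<odot>\<^sub>v dsl) / \<mu> \<le> 8 * (real n * (\<rho> * \<tau>))" unfolding pos_divide_le_eq[OF \<mu>] by (rule D(2))
  hence "vnorm (dxl \<odot>\<^sub>v dsl) / \<mu> \<le> \<beta> / 9" using t_small \<beta> by linarith
  hence "max (vnorm (dxl \<odot>\<^sub>v dsl) / mubar z) \<epsilon> \<le> \<beta> / 9" using \<epsilon>9 unfolding \<mu>_def by (rule max.boundedI)
  hence \<alpha>l': "1 - 9 * \<epsilon> / \<beta> \<le> \<alpha>l" "\<alpha>l \<le> 1 - 8 * \<epsilon> / \<beta>" using \<alpha>l by auto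
  have "0 \<le> \<epsilon>" unfolding \<epsilon> \<mu>_def[symmetric] using \<mu> by simp
  hence "0 \<le> 8 * \<epsilon> / \<beta>" using \<beta> by simp
  hence \<alpha>l1: "\<alpha>l \<le> 1" using \<alpha>l' by linarith
  have \<beta>1: "\<beta> \<le> 1" using \<beta> by simp
  have "mubar z' \<le> mubar (x + \<alpha>l \<cdot>\<^sub>v dxl, s + \<alpha>l \<cdot>\<^sub>v dsl)" unfolding z' by simp
  also have "\<dots> \<le> 10 * \<epsilon> / \<beta> * \<mu>"
    by (rule slls_progress[OF A n I.carriers d I.\<mu>(2,1) \<beta>(1) \<beta>1 \<epsilon>[folded \<mu>_def] \<epsilon>9 \<alpha>l'(1) \<alpha>l1])
  also have "\<dots> \<le> 10 * (10 * (588 * (\<beta> * w) / R)) / \<beta> * \<mu>"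
    using \<epsilon>10 err \<beta> \<mu> by (intro mult_right_mono divide_right_mono mult_left_mono) auto
  also have "\<dots> = 58800 * w * \<mu>'" using \<beta> \<mu> \<mu>' by (simp add: R_def)
  \<comment> \<open>58800 = 10 * 10 * 588 is below the constant 60000 in the assumption on Q. As Q
    \<mu>' is \<open>mubar z'\<close>, the layered point would be better than the point that the
    iteration returned.\<close>
  also have "\<dots> < Q * \<mu>'" using Qw w1 \<mu>' by (intro mult_strict_right_mono) auto
  also have "\<dots> = mubar z'" using Q1 by (simp add: \<mu>'_def)
  finally show False by simp
qed

end

section \<open>Counting the iterations\<close>

lemma geometric_decay:
  fixes \<mu> :: "nat \<Rightarrow> real"
  assumes \<theta>: "0 \<le> \<theta>" and decay: "\<And>i. i < k \<Longrightarrow> \<mu> (Suc i) \<le> \<theta> * \<mu> i" and "i + j \<le> k"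
  shows "\<mu> (i + j) \<le> \<theta> ^ j * \<mu> i"
  using \<open>i + j \<le> k\<close>
proof (induction j)
  case (Suc j)
  have "\<mu> (i + Suc j) \<le> \<theta> * \<mu> (i + j)" using decay[of "i + j"] Suc.prems by simp
  also have "\<dots> \<le> \<theta> * (\<theta> ^ j * \<mu> i)" using Suc \<theta> by (intro mult_left_mono) auto
  finally show ?case by (simp add: mult.assoc)
qed simp

text \<open>T iterations reduce \<mu> by the factor Q. T of them are spent near \<mu>0 and T near
  \<mu>1; in between the potential, at most L, drops once in every 3 T + 1 iterations.\<close>

lemma potential_count:
  fixes \<mu> :: "nat \<Rightarrow> real" and \<Phi> :: "real \<Rightarrow> nat"
  assumes \<theta>: "0 \<le> \<theta>" "\<theta> \<le> 1" and decay: "\<And>i. i < k \<Longrightarrow> \<mu> (Suc i) \<le> \<theta> * \<mu> i"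
    and above: "\<And>i. i < k \<Longrightarrow> \<mu>1 < \<mu> i" and \<mu>1: "0 \<le> \<mu>1" and start: "\<mu> 0 < \<mu>0"
    and Q: "1 \<le> Q" and T: "\<theta> ^ T * Q \<le> 1"
    and decrease: "\<And>i. i < k \<Longrightarrow> \<mu> i * Q \<le> \<mu>0 \<Longrightarrow> Q * \<mu>1 < \<mu> (Suc i) \<Longrightarrow> \<Phi> (\<mu> (Suc i) / Q) < \<Phi> (\<mu> i * Q)"
    and mono: "\<And>\<nu> \<nu>'. 0 < \<nu> \<Longrightarrow> \<mu>1 \<le> \<nu> \<Longrightarrow> \<nu>' \<le> \<mu>0 \<Longrightarrow> \<nu> * Q \<le> \<nu>' \<Longrightarrow> \<Phi> \<nu> \<le> \<Phi> \<nu>'"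
    and bound: "\<And>\<nu>. 0 < \<nu> \<Longrightarrow> \<Phi> \<nu> \<le> L"
  shows "k \<le> 2 * T + 1 + (L + 1) * (3 * T + 1)"
proof (rule ccontr)
  assume "\<not> ?thesis"
  hence k: "2 * T + 1 + (L + 1) * (3 * T + 1) < k" by simp
  \<comment> \<open>Sampled iterations: after the initial T, one step followed by 3 T further ones.
    The factor Q^3 is needed because the potential is known at \<mu> / Q after the step and is
    wanted at \<mu> Q before the next sample, and the monotonicity lemma itself requires a
    separation Q.\<close>
  define t where "t j = T + j * (3 * T + 1)" for j
  have t_Suc: "t (Suc j) = Suc (t j) + 3 * T" for j by (simp add: t_def)
  note G = geometric_decay[of \<theta> k \<mu>, OF \<theta>(1) decay]
  have anti: "\<mu> (i + j) \<le> \<mu> i" if "i < k" "i + j \<le> k" for i j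
  proof -
    have "\<theta> ^ j * \<mu> i \<le> 1 * \<mu> i" using \<theta> above[OF that(1)] \<mu>1 by (intro mult_right_mono power_le_one) auto
    thus ?thesis using G[OF _ that(2)] by simp
  qed
  have shrink: "\<mu> (i + T * e) * Q ^ e \<le> \<mu> i" if "i < k" "i + T * e \<le> k" for i e
  proof -
    have "\<mu> (i + T * e) * Q ^ e \<le> (\<theta> ^ (T * e) * \<mu> i) * Q ^ e" using G[OF _ that(2)] Q by (intro mult_right_mono) auto
    also have "\<dots> = (\<theta> ^ T * Q) ^ e * \<mu> i" by (simp add: power_mult power_mult_distrib)
    also have "\<dots> \<le> 1 * \<mu> i"
      using T \<theta> Q above[OF that(1)] \<mu>1 by (intro mult_right_mono power_le_one) auto
    finally show ?thesis by simp
  qed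
  \<comment> \<open>Only the last sample is assumed to lie above Q \<mu>1; earlier samples inherit
    this because \<mu> decreases.\<close>
  have descent: "\<Phi> (\<mu> (t j) * Q) + j \<le> L" if "t j < k" "Q * \<mu>1 < \<mu> (Suc (t j))" for j
    using that
  proof (induction j)
    case 0
    have "0 < \<mu> (t 0) * Q" using above[OF 0(1)] \<mu>1 Q by simp
    thus ?case using bound by simp
  next
    case (Suc j)
    have tj: "t j < k" "Suc (t j) < k" using Suc.prems(1) by (auto simp: t_Suc)
    have "\<mu> (Suc (t j) + (3 * T + 1)) \<le> \<mu> (Suc (t j))"
      using Suc.prems(1) by (intro anti tj) (simp add: t_Suc)
    hence large: "Q * \<mu>1 < \<mu> (Suc (t j))" using Suc.prems(2) by (simp add: t_Suc)
    have "\<mu> (j * (3 * T + 1) + T * 1) * Q ^ 1 \<le> \<mu> (j * (3 * T + 1))"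
      using tj by (intro shrink) (auto simp: t_def)
    also have "\<dots> \<le> \<mu> 0" using anti[of 0 "j * (3 * T + 1)"] tj by (auto simp: t_def)
    finally have "\<mu> (t j) * Q \<le> \<mu>0" using start by (simp add: t_def add.commute)
    hence dec: "\<Phi> (\<mu> (Suc (t j)) / Q) < \<Phi> (\<mu> (t j) * Q)" by (rule decrease[OF tj(1) _ large])
    have "\<mu> (Suc (t j) + T * 3) * Q ^ 3 \<le> \<mu> (Suc (t j))"
      using Suc.prems(1) by (intro shrink tj) (simp add: t_Suc)
    hence "\<mu> (t (Suc j)) * (Q * Q * Q) \<le> \<mu> (Suc (t j))" by (simp add: t_Suc power3_eq_cube mult.commute)
    hence far: "\<mu> (t (Suc j)) * Q * Q \<le> \<mu> (Suc (t j)) / Q" using Q by (simp add: pos_le_divide_eq mult.assoc)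
    have pos: "\<mu>1 < \<mu> (t (Suc j))" by (rule above[OF Suc.prems(1)])
    hence pos0: "0 < \<mu> (t (Suc j))" using \<mu>1 by simp
    have "\<mu> (t (Suc j)) * 1 \<le> \<mu> (t (Suc j)) * Q" using pos0 Q by (intro mult_left_mono) auto
    hence ge: "0 < \<mu> (t (Suc j)) * Q" "\<mu>1 \<le> \<mu> (t (Suc j)) * Q" using pos pos0 by linarith+
    have "\<mu> (Suc (t j)) \<le> \<mu> 0" using anti[of 0 "Suc (t j)"] tj by simp
    moreover have "0 \<le> \<mu> (Suc (t j))" using above[OF tj(2)] \<mu>1 by simp
    hence "\<mu> (Suc (t j)) * 1 \<le> \<mu> (Suc (t j)) * Q" using Q by (intro mult_left_mono) auto
    hence "\<mu> (Suc (t j)) / Q \<le> \<mu> (Suc (t j))" using Q by (simp add: pos_divide_le_eq)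
    ultimately have "\<mu> (Suc (t j)) / Q \<le> \<mu>0" using start by linarith
    from mono[OF ge this far] dec Suc.IH[OF tj(1) large] show ?case by linarith
  qed
  \<comment> \<open>At index L + 1 the descent would make the potential negative, so \<mu> is then
    at most Q \<mu>1. After T more iterations it is at most \<mu>1, although the run is still going
    on.\<close>
  have tL: "t (L + 1) < k" "Suc (t (L + 1)) + T < k" using k by (auto simp: t_def)
  have "\<mu> (Suc (t (L + 1))) \<le> Q * \<mu>1" using descent[OF tL(1)] by fastforce
  moreover have "\<mu> (Suc (t (L + 1)) + T * 1) * Q ^ 1 \<le> \<mu> (Suc (t (L + 1)))"
    using tL by (intro shrink) auto
  ultimately have "\<mu> (Suc (t (L + 1)) + T) * Q \<le> \<mu>1 * Q" by (simp add: mult.commute)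
  hence "\<mu> (Suc (t (L + 1)) + T) \<le> \<mu>1" using Q by simp
  thus False using above[OF tL(2)] by linarith
qed

text \<open>T is chosen as 13 ln h / \<delta>, rounded up, because (1 - \<delta>)^T \<le> exp(-
  \<delta> T). The count is at most 15 T n and T is at most twice the unrounded value, which gives
  15 * 2 * 13 * 3 = 1170.\<close>

lemma iteration_bound:
  fixes h :: real
  assumes n: "0 < n" and \<beta>: "0 < \<beta>" "\<beta> \<le> 1 / 6" and h: "6 \<le> h"
  shows "\<exists>T. (1 - \<beta> / (3 * sqrt n)) ^ T * h ^ 13 \<le> 1 \<and>
    real (2 * T + 1 + (2 * n + 1) * (3 * T + 1)) \<le> 1200 * (real n powr (3 / 2) / \<beta>) * ln h"
proof -
  have sq: "1 \<le> sqrt n" using n by simp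
  define \<delta> where "\<delta> = \<beta> / (3 * sqrt n)"
  have "\<beta> / (3 * sqrt n) \<le> \<beta> / (3 * 1)" using sq \<beta> by (intro divide_left_mono) auto
  hence \<delta>: "0 < \<delta>" "\<delta> \<le> 1" using \<beta> sq unfolding \<delta>_def by (simp, linarith)
  have "exp 1 \<le> h" using exp_le h by linarith
  hence lnh: "1 \<le> ln h" using h by (subst ln_ge_iff) auto
  define r where "r = 13 * ln h / \<delta>"
  define T where "T = nat \<lceil>r\<rceil>"
  have "13 * \<delta> \<le> 13 * ln h" using \<delta> lnh by linarith
  hence r1: "1 \<le> r" using \<delta> lnh by (simp add: r_def pos_le_divide_eq)
  have T: "r \<le> T" "T \<le> 2 * r"
    using r1 of_nat_ceiling[of r] unfolding T_def by (auto, linarith)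
  have "\<delta> * r = 13 * ln h" using \<delta> by (simp add: r_def)
  moreover have "\<delta> * r \<le> \<delta> * T" using T \<delta> by (intro mult_left_mono) auto
  ultimately have \<delta>T: "13 * ln h \<le> \<delta> * T" by simp
  have "(1 - \<delta>) ^ T \<le> exp (- \<delta>) ^ T"
    using \<delta> exp_ge_add_one_self[of "- \<delta>"] by (intro power_mono) auto
  also have "\<dots> = exp (- (\<delta> * T))" by (simp add: exp_of_nat_mult[symmetric] mult.commute)
  also have "\<dots> \<le> exp (- (13 * ln h))" using \<delta>T by simp
  finally have "(1 - \<delta>) ^ T * h ^ 13 \<le> exp (- (13 * ln h)) * h ^ 13" using h by (intro mult_right_mono) auto
  moreover have "exp (13 * ln h) = h ^ 13"
    using h exp_of_nat_mult[of 13 "ln h"] by simp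
  hence "exp (- (13 * ln h)) * h ^ 13 = 1" using h by (simp add: exp_minus)
  ultimately have 1: "(1 - \<delta>) ^ T * h ^ 13 \<le> 1" by simp
  have T1: "1 \<le> T" using T(1) r1 by linarith
  have n1: "1 \<le> n" using n by simp
  have "T * 1 \<le> T * n" "1 * 1 \<le> T * n" "1 * n \<le> T * n"
    using T1 n1 by (simp_all only: mult_le_mono order_refl)
  moreover have "2 * T + 1 + (2 * n + 1) * (3 * T + 1) = 5 * T + 2 + 6 * (T * n) + 2 * n" by (simp add: algebra_simps)
  ultimately have "2 * T + 1 + (2 * n + 1) * (3 * T + 1) \<le> 15 * (T * n)" by linarith
  hence "real (2 * T + 1 + (2 * n + 1) * (3 * T + 1)) \<le> real (15 * (T * n))" by (rule of_nat_mono)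
  also have "\<dots> = 15 * (real T * n)" by simp
  also have "\<dots> \<le> 15 * (2 * r * n)" using T by (intro mult_left_mono mult_right_mono) auto
  also have "\<dots> = 1170 * ((real n * sqrt n) / \<beta> * ln h)" using \<beta> sq by (simp add: r_def \<delta>_def)
  also have "real n * sqrt n = real n powr (3 / 2)"
  proof -
    have "real n powr (3 / 2) = real n powr (1 + 1 / 2)" by simp
    also have "\<dots> = real n * sqrt n" unfolding powr_add using n by (simp add: powr_half_sqrt)
    finally show ?thesis ..
  qed
  also have "1170 * (real n powr (3 / 2) / \<beta> * ln h) \<le> 1200 * (real n powr (3 / 2) / \<beta> * ln h)"
    using \<beta> lnh by (intro mult_right_mono) auto
  finally have "real (2 * T + 1 + (2 * n + 1) * (3 * T + 1)) \<le> 1200 * (real n powr (3 / 2) / \<beta>) * ln h"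
    by (simp only: mult.assoc)
  thus ?thesis using 1 unfolding \<delta>_def by blast
qed

text \<open>The exponent is 13 = 6 + 7: the sixth power of h dominates the polynomial w, and the
  seventh dominates the constant, as 6^7 > 60000. The bound \<beta> \<le> 1/6 is what makes h at
  least 6.\<close>

lemma condition_bounds:
  fixes n \<rho> \<beta> \<gamma> :: real
  assumes "1 \<le> n" "1 \<le> \<rho>" "0 < \<beta>" "\<beta> \<le> 1 / 6" "0 < \<gamma>" "\<gamma> \<le> 1"
  defines "h \<equiv> n * \<rho> / (\<beta> * \<gamma>)"
  shows "6 \<le> h" "60000 * (n ^ 6 * \<rho> / (\<gamma>\<^sup>2 * \<beta>)) \<le> h ^ 13" "4 * n\<^sup>2 / \<gamma>\<^sup>2 \<le> h ^ 13"
proof -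
  have "\<beta> * \<gamma> \<le> 1 / 6 * 1" using assms by (intro mult_mono) auto
  hence "1 * 1 / (1 / 6 * 1) \<le> h" unfolding h_def using assms by (intro frac_le mult_mono) auto
  thus h6: "6 \<le> h" by simp
  have "n ^ 6 * \<rho> / (\<gamma>\<^sup>2 * \<beta>) \<le> n ^ 6 * \<rho> ^ 6 / (\<gamma> ^ 6 * \<beta> ^ 6)"
  proof (intro frac_le mult_mono)
    show "\<rho> \<le> \<rho> ^ 6" using assms by (intro self_le_power) auto
    show "\<gamma> ^ 6 \<le> \<gamma>\<^sup>2" using assms by (intro power_decreasing) auto
    show "\<beta> ^ 6 \<le> \<beta>" using power_decreasing[of 1 6 \<beta>] assms by simp
  qed (use assms in auto)
  also have "\<dots> = h ^ 6" by (simp add: h_def power_mult_distrib power_divide mult.commute)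
  finally have w: "n ^ 6 * \<rho> / (\<gamma>\<^sup>2 * \<beta>) \<le> h ^ 6" .
  have "(6::real) ^ 7 \<le> h ^ 7" using h6 by (intro power_mono) auto
  hence "60000 \<le> h ^ 7" by simp
  hence "60000 * h ^ 6 \<le> h ^ 7 * h ^ 6" using h6 by (intro mult_right_mono) auto
  also have "\<dots> = h ^ 13" by (simp flip: power_add)
  finally have h13: "60000 * h ^ 6 \<le> h ^ 13" .
  show "60000 * (n ^ 6 * \<rho> / (\<gamma>\<^sup>2 * \<beta>)) \<le> h ^ 13" using w h13 by linarith
  have "n\<^sup>2 * 1 \<le> n ^ 6 * \<rho>" using assms by (intro mult_mono power_increasing) auto
  moreover have "\<gamma>\<^sup>2 * \<beta> \<le> \<gamma>\<^sup>2 * 1" using assms by (intro mult_left_mono) auto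
  ultimately have "n\<^sup>2 * 1 / (\<gamma>\<^sup>2 * 1) \<le> n ^ 6 * \<rho> / (\<gamma>\<^sup>2 * \<beta>)"
    using assms by (intro frac_le) auto
  hence "4 * n\<^sup>2 / \<gamma>\<^sup>2 \<le> 4 * h ^ 6" using w by simp
  moreover have "0 \<le> h ^ 6" using h6 by simp
  ultimately show "4 * n\<^sup>2 / \<gamma>\<^sup>2 \<le> h ^ 13" using h13 by linarith
qed

theorem theorem7p4:
  shows "\<exists>K::real. K > 0 \<and>
    (\<forall>(m::nat) (n::nat) (A::real mat) (b::real vec) (c::real vec)
       (\<mu>0::real) (\<mu>1::real) (\<gamma>::real) (\<beta>::real) (\<rho>::real)
       (svd :: real mat \<Rightarrow> (real mat \<times> real vec) set) (z :: real vec \<times> real vec).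
       lp_instance m n A b c \<longrightarrow>
       0 \<le> \<mu>1 \<longrightarrow> \<mu>1 < \<mu>0 \<longrightarrow>
       0 < \<gamma> \<longrightarrow> \<gamma> \<le> 1 \<longrightarrow> polarized A b c \<mu>1 \<mu>0 \<gamma> \<longrightarrow>
       0 < \<beta> \<longrightarrow> \<beta> \<le> 1 / 6 \<longrightarrow>
       1 \<le> \<rho> \<longrightarrow> rho_svd_solver \<rho> svd \<longrightarrow>
       z \<in> nbhd A b c \<beta> \<longrightarrow> \<mu>1 < mubar z \<longrightarrow> mubar z < \<mu>0 \<longrightarrow>
       (\<forall>k z'. (slls_iteration A \<beta> svd \<mu>1 ^^ k) z z' \<longrightarrow>
          real k \<le> K * (real n powr (3 / 2) / \<beta>) * ln (real n * \<rho> / (\<beta> * \<gamma>)) \<and>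
          ((\<nexists>z''. slls_iteration A \<beta> svd \<mu>1 z' z'') \<longrightarrow>
             z' \<in> nbhd_closure A b c \<beta> \<and> mubar z' \<le> \<mu>1)))"
proof (intro exI[of _ 1200] conjI allI impI)
  fix m n :: nat and A :: "real mat" and b c :: "real vec" and \<mu>0 \<mu>1 \<gamma> \<beta> \<rho> :: real
    and svd :: "real mat \<Rightarrow> (real mat \<times> real vec) set" and z z' :: "real vec \<times> real vec" and k :: nat
  assume lp: "lp_instance m n A b c" and \<mu>1: "0 \<le> \<mu>1" and "\<mu>1 < \<mu>0" and \<gamma>: "0 < \<gamma>" "\<gamma> \<le> 1"
    and pol: "polarized A b c \<mu>1 \<mu>0 \<gamma>" and \<beta>: "0 < \<beta>" "\<beta> \<le> 1 / 6" and \<rho>: "1 \<le> \<rho>"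
    and solver: "rho_svd_solver \<rho> svd" and z: "z \<in> nbhd A b c \<beta>" "\<mu>1 < mubar z" "mubar z < \<mu>0"
    and iter: "(slls_iteration A \<beta> svd \<mu>1 ^^ k) z z'"
  have A: "A \<in> carrier_mat m n" using lp by (simp add: lp_instance_def)
  \<comment> \<open>For n = 0 the value of \<open>mubar\<close> is 0 by division by zero, against 0
    \<le> \<mu>1 < \<open>mubar z\<close>.\<close>
  have n: "0 < n"
  proof (rule ccontr)
    assume "\<not> 0 < n"
    moreover have "fst z \<in> carrier_vec n" using z(1) by (auto simp: nbhd_def primal_interior_iff[OF A])
    ultimately have "mubar z = 0" by (simp add: mubar_def)
    thus False using z(2) \<mu>1 by simp
  qed
  obtain B N where BN: "B \<union> N = {..<n}" "B \<inter> N = {}"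
    "\<And>\<mu> i. \<mu>1 \<le> \<mu> \<Longrightarrow> \<mu> \<le> \<mu>0 \<Longrightarrow> i \<in> B \<Longrightarrow>
      \<gamma> * fst (central_point A b c \<mu>0) $ i \<le> fst (central_point A b c \<mu>) $ i"
    "\<And>\<mu> i. \<mu>1 \<le> \<mu> \<Longrightarrow> \<mu> \<le> \<mu>0 \<Longrightarrow> i \<in> N \<Longrightarrow>
      \<gamma> * snd (central_point A b c \<mu>0) $ i \<le> snd (central_point A b c \<mu>) $ i"
    using pol A unfolding polarized_def by (metis atLeastAtMost_iff carrier_matD(2))
  interpret P: polarized_lp m n A b c \<mu>0 \<mu>1 \<gamma> B N
    by standard (fact lp n \<mu>1 \<gamma> BN)+
  obtain f where f: "f 0 = z" "f k = z'" "\<And>i. i < k \<Longrightarrow> slls_iteration A \<beta> svd \<mu>1 (f i) (f (Suc i))"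
    using iter unfolding relpowp_fun_conv by blast
  have above: "\<mu>1 < mubar (f i)" and step: "slls_step A \<beta> svd (f i) (f (Suc i))" if "i < k" for i
    using f(3)[OF that] by (auto simp: slls_iteration_def)
  \<comment> \<open>The boundary alternative has \<open>mubar\<close> equal to 0, so it can occur
    only at the last index: earlier iterates exceed \<mu>1 \<ge> 0.\<close>
  have mem: "f i \<in> nbhd A b c \<beta> \<or> f i \<in> nbhd_closure A b c \<beta> \<and> mubar (f i) = 0" if "i \<le> k" for i
    using that
  proof (induction i)
    case 0
    show ?case using z(1) f(1) by simp
  next
    case (Suc i)
    have "f i \<in> nbhd A b c \<beta>" using Suc.IH Suc.prems above[of i] \<mu>1 by simp
    thus ?case using slls_step_nbhd(2)[OF step A n _ \<beta> solver] Suc.prems by simp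
  qed
  have inside: "f i \<in> nbhd A b c \<beta>" if "i < k" for i
    using mem[of i] above[OF that] \<mu>1 that by simp
  define h where "h = real n * \<rho> / (\<beta> * \<gamma>)"
  have n1: "1 \<le> real n" using n by simp
  note H = condition_bounds[OF n1 \<rho> \<beta> \<gamma>, folded h_def]
  obtain T where T: "(1 - \<beta> / (3 * sqrt n)) ^ T * h ^ 13 \<le> 1"
    "real (2 * T + 1 + (2 * n + 1) * (3 * T + 1)) \<le> 1200 * (real n powr (3 / 2) / \<beta>) * ln h"
    using iteration_bound[OF n \<beta> H(1)] by blast
  have "k \<le> 2 * T + 1 + (2 * n + 1) * (3 * T + 1)"
  \<comment> \<open>The separation Q is h^13 and the potential is bounded by 2 n.\<close>
  proof (rule potential_count[of "1 - \<beta> / (3 * sqrt n)" k "\<lambda>i. mubar (f i)" \<mu>1 \<mu>0 "h ^ 13" T P.\<Phi> "2 * n"])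
    have "1 \<le> sqrt n" using n by simp
    hence "\<beta> / (3 * sqrt n) \<le> \<beta> / (3 * 1)" using \<beta> by (intro divide_left_mono) auto
    thus "0 \<le> 1 - \<beta> / (3 * sqrt n)" "1 - \<beta> / (3 * sqrt n) \<le> 1" using \<beta> by (linarith, simp)
    show "mubar (f (Suc i)) \<le> (1 - \<beta> / (3 * sqrt n)) * mubar (f i)" if "i < k" for i
      by (rule slls_step_nbhd(1)[OF step[OF that] A n inside[OF that] \<beta> solver])
    show "1 \<le> h ^ 13" using H(1) by (intro one_le_power) simp
    show "P.\<Phi> (mubar (f (Suc i)) / h ^ 13) < P.\<Phi> (mubar (f i) * h ^ 13)"
      if "i < k" "mubar (f i) * h ^ 13 \<le> \<mu>0" "h ^ 13 * \<mu>1 < mubar (f (Suc i))" for i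
      by (rule P.potential_decrease[OF step[OF that(1)] inside[OF that(1)] \<beta> \<rho> solver H(2) that(2,3)])
    show "P.\<Phi> \<nu> \<le> P.\<Phi> \<nu>'" if "0 < \<nu>" "\<mu>1 \<le> \<nu>" "\<nu>' \<le> \<mu>0" "\<nu> * h ^ 13 \<le> \<nu>'" for \<nu> \<nu>'
      by (rule P.\<Phi>_mono[OF that(1-3) H(3) that(4)])
  qed (use above \<mu>1 z f T P.\<Phi>_le in auto)
  hence "real k \<le> real (2 * T + 1 + (2 * n + 1) * (3 * T + 1))" by (rule of_nat_mono)
  also note T(2)
  finally show "real k \<le> 1200 * (real n powr (3 / 2) / \<beta>) * ln (real n * \<rho> / (\<beta> * \<gamma>))" unfolding h_def .
  assume stop: "\<nexists>z''. slls_iteration A \<beta> svd \<mu>1 z' z''"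
  show "z' \<in> nbhd_closure A b c \<beta>" using mem[of k] nbhd_subset_closure[OF A] unfolding f(2) by blast
  show "mubar z' \<le> \<mu>1"
  proof (rule ccontr)
    assume "\<not> mubar z' \<le> \<mu>1"
    \<comment> \<open>Above the target the iterate lies in the open neighbourhood, where a further
      step always exists; this contradicts the end of the run.\<close>
    hence "\<mu>1 < mubar z'" "z' \<in> nbhd A b c \<beta>" using mem[of k] f(2) \<mu>1 by auto
    thus False using slls_step_exists[OF A n _ \<beta> solver] stop unfolding slls_iteration_def by blast
  qed
qed simp

end
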